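(* Let $M:[0,\infty)\to[0,\infty)$ be continuous, put $\mathscr M(t)=\int_0^t M(\tau)\,d\tau$, and assume: (i) there exists $\theta\in[1,p^*/q)$ such that $tM(t)\le\theta\mathscr M(t)$ for any $t\in[0,\infty)$; (ii) for any $\tau>0$ there exists $\kappa=\kappa(\tau)>0$ such that $M(t)\ge\kappa$ for any $t\ge\tau$. Let $f:\Omega\times\mathbb R\to\mathbb R$ be a Carathéodory function, put $F(x,t)=\int_0^t f(x,\tau)\,d\tau$, and assume (with the $\theta$ of (i)): (iii) there exist an exponent $r\in(p,p^* )$ and $C>0$ such that $|f(x,t)|\le C(1+|t|^{r-1})$ for a.e. $x\in\Omega$ and any $t\in\mathbb R$; (iv) there exist $\sigma\in(q\theta,p^* )$, $c>0$ and $t_0\ge0$ such that $c\le\sigma F(x,t)\le tf(x,t)$ for a.e. $x\in\Omega$ and any $|t|\ge t_0$; (v) $f(x,-t)=-f(x,t)$ for a.e. $x\in\Omega$ and any $t\in\mathbb R$. Then the problem $$-M\left[\int_\Omega\left(\frac{|\nabla u|^p}{p}+a(x)\frac{|\nabla u|^q}{q}\right)dx\right]\mathrm{div}\left(|\nabla u|^{p-2}\nabla u+a(x)|\nabla u|^{q-2}\nabla u\right)=f(x,u)\ \text{in }\Omega,\qquad u=0\ \text{on }\partial\Omega,$$ has infinitely many weak solutions $\{u_j\}_j\subset W^{1,\mathcal H}_0(\Omega)$ with unbounded energy, i.e. such that the sequence of real numbers $\{J(u_j)\}_j$ is unbounded, where $$J(u)=\mathscr M\left[\int_\Omega\left(\frac{|\nabla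 u|^p}{p}+a(x)\frac{|\nabla u|^q}{q}\right)dx\right]-\int_\Omega F(x,u)\,dx.$$
   Context: Standing assumptions: $\Omega\subset\mathbb R^N$ is an open, bounded set with Lipschitz boundary, $N\ge2$, $1<p<q<N$, $\frac qp<1+\frac1N$, and $a:\overline\Omega\to[0,\infty)$ is Lipschitz continuous. $p^*=Np/(N-p)$. Function spaces: $\mathcal H(x,t)=t^p+a(x)t^q$ for $x\in\Omega$, $t\ge0$; $\varrho_{\mathcal H}(u)=\int_\Omega(|u|^p+a(x)|u|^q)\,dx$; $L^{\mathcal H}(\Omega)$ is the space of measurable $u:\Omega\to\mathbb R$ with $\varrho_{\mathcal H}(u)<\infty$, with the Luxemburg norm $\|u\|_{\mathcal H}=\inf\{\lambda>0:\varrho_{\mathcal H}(u/\lambda)\le1\}$. $W^{1,\mathcal H}(\Omega)=\{u\in L^{\mathcal H}(\Omega):|\nabla u|\in L^{\mathcal H}(\Omega)\}$ with norm $\|u\|_{\mathcal H}+\|\,|\nabla u|\,\|_{\mathcal H}$, and $W^{1,\mathcal H}_0(\Omega)$ is the completion (closure) of $C_0^\infty(\Omega)$ in $W^{1,\mathcal H}(\Omega)$, endowed with the equivalent norm $\|u\|=\|\,|\nabla u|\,\|_{\mathcal H}$. Weak solution: $u\in W^{1,\mathcal H}_0(\Omega)$ is a weak solution of the problem if, for any $\varphi\in W^{1,\mathcal H}_0(\Omega)$, $$M\left[\int_\Omega\left(\frac{|\nabla u|^p}{p}+a(x)\frac{|\nabla u|^q}{q}\right)dx\right]\int_\Omega\left(|\nabla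 u|^{p-2}+a(x)|\nabla u|^{q-2}\right)\nabla u\cdot\nabla\varphi\,dx=\int_\Omega f(x,u)\varphi\,dx.$$ The energy of $u$ is the value $J(u)$ of the Euler-Lagrange functional $J:W^{1,\mathcal H}_0(\Omega)\to\mathbb R$ of the problem. *)

theory Defs
  imports "HOL-Analysis.Analysis"
begin

text \<open>
  Functions on \<open>\<Omega>\<close> are represented by total functions on the ambient Euclidean space whose values
  outside \<open>\<Omega>\<close> are irrelevant; no quotient by almost everywhere equality is taken.
  ``Measurable'' means Lebesgue measurable, and all integrals over \<open>\<Omega>\<close> are Lebesgue integrals.
\<close>

definition lipschitz_boundary :: "'a::euclidean_space set \<Rightarrow> bool" where
  \<comment> \<open>Near each boundary point, \<open>\<Omega>\<close> is the strict epigraph, in some direction \<open>e\<close>, of a Lipschitz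
    function \<open>\<gamma>\<close> on the hyperplane orthogonal to \<open>e\<close>.\<close>
  "lipschitz_boundary \<Omega> \<longleftrightarrow>
    (\<forall>x\<in>frontier \<Omega>. \<exists>r>0. \<exists>e \<gamma> L. norm e = 1 \<and> L-lipschitz_on {z. z \<bullet> e = 0} \<gamma> \<and>
      \<Omega> \<inter> ball x r = {y \<in> ball x r. \<gamma> (y - (y \<bullet> e) *\<^sub>R e) < y \<bullet> e})"

definition sobolev_conjugate :: "real \<Rightarrow> real \<Rightarrow> real" where
  "sobolev_conjugate N p = N * p / (N - p)"

primrec Ck :: "nat \<Rightarrow> ('a::euclidean_space \<Rightarrow> real) \<Rightarrow> bool" where
  "Ck 0 \<phi> \<longleftrightarrow> continuous_on UNIV \<phi>"
| "Ck (Suc k) \<phi> \<longleftrightarrow> (\<forall>x. \<phi> differentiable (at x)) \<and>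
     (\<forall>b\<in>Basis. Ck k (\<lambda>x. frechet_derivative \<phi> (at x) b))"

definition test_functions :: "'a::euclidean_space set \<Rightarrow> ('a \<Rightarrow> real) set" where
  "test_functions \<Omega> =
    {\<phi>. (\<forall>k. Ck k \<phi>) \<and> compact (closure {x. \<phi> x \<noteq> 0}) \<and> closure {x. \<phi> x \<noteq> 0} \<subseteq> \<Omega>}"

definition weak_gradient_on ::
  "'a::euclidean_space set \<Rightarrow> ('a \<Rightarrow> real) \<Rightarrow> ('a \<Rightarrow> 'a) \<Rightarrow> bool" where
  "weak_gradient_on \<Omega> u g \<longleftrightarrow>
    (\<forall>K. compact K \<and> K \<subseteq> \<Omega> \<longrightarrow> integrable (lebesgue_on K) u \<and> integrable (lebesgue_on K) g) \<and>
    (\<forall>\<phi>\<in>test_functions \<Omega>. \<forall>b\<in>Basis.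
      (LINT x|lebesgue_on \<Omega>. u x * frechet_derivative \<phi> (at x) b) =
      - (LINT x|lebesgue_on \<Omega>. (g x \<bullet> b) * \<phi> x))"

definition wgrad :: "'a::euclidean_space set \<Rightarrow> ('a \<Rightarrow> real) \<Rightarrow> 'a \<Rightarrow> 'a" where
  \<comment> \<open>A representative of the weak gradient, which is unique up to a null set; meaningful only
    if a weak gradient exists.\<close>
  "wgrad \<Omega> u = (SOME g. weak_gradient_on \<Omega> u g)"

definition modular_H ::
  "'a::euclidean_space set \<Rightarrow> real \<Rightarrow> real \<Rightarrow> ('a \<Rightarrow> real) \<Rightarrow> ('a \<Rightarrow> real) \<Rightarrow> ennreal" where
  "modular_H \<Omega> p q a u =
    (\<integral>\<^sup>+ x. ennreal (\<bar>u x\<bar> powr p + a x * \<bar>u x\<bar> powr q) \<partial>lebesgue_on \<Omega>)"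

definition LH ::
  "'a::euclidean_space set \<Rightarrow> real \<Rightarrow> real \<Rightarrow> ('a \<Rightarrow> real) \<Rightarrow> ('a \<Rightarrow> real) set" where
  "LH \<Omega> p q a = {u \<in> borel_measurable (lebesgue_on \<Omega>). modular_H \<Omega> p q a u < \<infinity>}"

definition norm_H ::
  "'a::euclidean_space set \<Rightarrow> real \<Rightarrow> real \<Rightarrow> ('a \<Rightarrow> real) \<Rightarrow> ('a \<Rightarrow> real) \<Rightarrow> real" where
  "norm_H \<Omega> p q a u = Inf {s. 0 < s \<and> modular_H \<Omega> p q a (\<lambda>x. u x / s) \<le> 1}"

definition W1H ::
  "'a::euclidean_space set \<Rightarrow> real \<Rightarrow> real \<Rightarrow> ('a \<Rightarrow> real) \<Rightarrow> ('a \<Rightarrow> real) set" where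
  "W1H \<Omega> p q a =
    {u \<in> LH \<Omega> p q a. (\<exists>g. weak_gradient_on \<Omega> u g) \<and> (\<lambda>x. norm (wgrad \<Omega> u x)) \<in> LH \<Omega> p q a}"

definition norm_W1H ::
  "'a::euclidean_space set \<Rightarrow> real \<Rightarrow> real \<Rightarrow> ('a \<Rightarrow> real) \<Rightarrow> ('a \<Rightarrow> real) \<Rightarrow> real" where
  "norm_W1H \<Omega> p q a u = norm_H \<Omega> p q a u + norm_H \<Omega> p q a (\<lambda>x. norm (wgrad \<Omega> u x))"

definition W1H0 ::
  "'a::euclidean_space set \<Rightarrow> real \<Rightarrow> real \<Rightarrow> ('a \<Rightarrow> real) \<Rightarrow> ('a \<Rightarrow> real) set" where
  "W1H0 \<Omega> p q a =
    {u \<in> W1H \<Omega> p q a. \<forall>\<epsilon>>0. \<exists>\<phi>\<in>test_functions \<Omega>. norm_W1H \<Omega> p q a (\<lambda>x. u x - \<phi> x) < \<epsilon>}"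

definition caratheodory :: "'a::euclidean_space set \<Rightarrow> ('a \<Rightarrow> real \<Rightarrow> real) \<Rightarrow> bool" where
  "caratheodory \<Omega> f \<longleftrightarrow>
    (\<forall>t. (\<lambda>x. f x t) \<in> borel_measurable (lebesgue_on \<Omega>)) \<and>
    (AE x in lebesgue_on \<Omega>. continuous_on UNIV (f x))"

text \<open>The signed integral \<open>\<integral>\<^sub>0\<^sup>t h(\<tau>) d\<tau>\<close>, for either sign of \<open>t\<close>.\<close>

definition primitive :: "(real \<Rightarrow> real) \<Rightarrow> real \<Rightarrow> real" where
  "primitive h t = (LBINT \<tau>=0..t. h \<tau>)"

definition phi_H ::
  "'a::euclidean_space set \<Rightarrow> real \<Rightarrow> real \<Rightarrow> ('a \<Rightarrow> real) \<Rightarrow> ('a \<Rightarrow> real) \<Rightarrow> real" where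
  "phi_H \<Omega> p q a u =
    (LINT x|lebesgue_on \<Omega>. norm (wgrad \<Omega> u x) powr p / p + a x * (norm (wgrad \<Omega> u x) powr q / q))"

definition weak_solution ::
  "'a::euclidean_space set \<Rightarrow> real \<Rightarrow> real \<Rightarrow> ('a \<Rightarrow> real) \<Rightarrow> (real \<Rightarrow> real) \<Rightarrow>
    ('a \<Rightarrow> real \<Rightarrow> real) \<Rightarrow> ('a \<Rightarrow> real) \<Rightarrow> bool" where
  \<comment> \<open>For \<open>p < 2\<close> the convention \<open>0 powr (p - 2) = 0\<close> makes the field \<open>|\<nabla>u|\<^sup>p\<^sup>-\<^sup>2\<nabla>u\<close> vanish where
    \<open>\<nabla>u = 0\<close>, as usual.\<close>
  "weak_solution \<Omega> p q a M f u \<longleftrightarrow> u \<in> W1H0 \<Omega> p q a \<and>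
    (\<forall>\<phi>\<in>W1H0 \<Omega> p q a.
      M (phi_H \<Omega> p q a u) *
        (LINT x|lebesgue_on \<Omega>.
          (norm (wgrad \<Omega> u x) powr (p - 2) + a x * norm (wgrad \<Omega> u x) powr (q - 2)) *
          (wgrad \<Omega> u x \<bullet> wgrad \<Omega> \<phi> x))
      = (LINT x|lebesgue_on \<Omega>. f x (u x) * \<phi> x))"

definition energy ::
  "'a::euclidean_space set \<Rightarrow> real \<Rightarrow> real \<Rightarrow> ('a \<Rightarrow> real) \<Rightarrow> (real \<Rightarrow> real) \<Rightarrow>
    ('a \<Rightarrow> real \<Rightarrow> real) \<Rightarrow> ('a \<Rightarrow> real) \<Rightarrow> real" where
  "energy \<Omega> p q a M f u =
    primitive M (phi_H \<Omega> p q a u) - (LINT x|lebesgue_on \<Omega>. primitive (f x) (u x))"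

end

theory Submission
  imports Defs "HOL-Analysis.Analysis" "HOL-Library.Z2" "HOL-Library.Diagonal_Subsequence"
begin

text \<open>The test functions contain a countable dense independent family; solutions are limits of critical
 points of the energy on the spans of its first n members. There, minimax values over odd maps give
 critical points at high levels: by a Borsuk theorem, proved by counting antipodal pairs modulo 2
 in cubical chains, every such map meets a sphere on which finitely many averages over dyadic cubes
 vanish, and on it the energy is large. The same averages give subcritical Sobolev and Rellich
 estimates. The Ambrosetti--Rabinowitz condition bounds these critical points uniformly, so a
 subsequence converges in the Lebesgue space of the nonlinearity; testing the equation with differences and uniform
 convexity then make the gradients converge in the double-phase modular. Hence the limit is a weak
 solution and keeps the energy level.\<close>

text \<open>Working on finite spans replaces a Palais-Smale argument in the double-phase space:
  there a critical point is an exact zero of finitely many derivatives, and compactness of the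
  region where the energy is nonnegative suffices for a deformation. The price is that every bound
  must be uniform in the number n of basis functions. This is why the minimax uses odd images of one
  fixed space of dimension d: the number of vanishing averages determines d, and an upper bound of
  the energy on that space bounds the minimax level for every n >= d. The Kirchhoff factor may
  vanish at energy zero, so it can be divided out only if the limit of the energies is positive;
  levels above a positive \<open>Lam\<close> exclude the limit zero. The weight may vanish as well,
  so all embeddings are drawn from the p-part of the energy, with a single subcritical exponent s
  that dominates both q and the growth of f.\<close>

notation (input) LIMSEQ ("((_)/ ----> (_))" [60, 60] 60)

abbreviation (input) Lpow :: "real => ('a::euclidean_space => real) => ennreal" where
 "Lpow s g \<equiv> (\<integral>\<^sup>+x. ennreal (\<bar>g x\<bar> powr s) \<partial>lborel)"

abbreviation (input) Hden :: "('a => real) => real => real => 'a => 'b::real_normed_vector => real" where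
 "Hden a p q x v \<equiv> norm v powr p + a x * norm v powr q"

abbreviation (input) Eden :: "('a => real) => real => real => 'a => 'b::real_normed_vector => real" where
 "Eden a p q x v \<equiv> norm v powr p / p + a x * (norm v powr q / q)"

abbreviation (input) Fden :: "('a => real) => real => real => 'a => 'b::real_normed_vector => real" where
 "Fden a p q x v \<equiv> norm v powr (p - 2) + a x * norm v powr (q - 2)"

declare add_bit_eq_xor [simp del] mult_bit_eq_and [simp del]

lemma bit_double [simp]: "(x::bit) + x = 0"
 by (cases x) auto

lemma bit_double_left [simp]: "(x::bit) + (x + y) = y"
 by (metis add.assoc add_0 bit_double)

lemma bit_add_eq_0_iff: "(x::bit) + y = 0 \<longleftrightarrow> x = y"
 by (cases x; cases y) auto

text \<open>The terms at (i, j) and (j, i) cancel modulo 2. This replaces the signs in the proof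
  that a boundary has no boundary.\<close>

lemma sum_symmetric_offdiag:
 fixes F :: "'i => 'i => bit"
 assumes "finite S" "!!i j. F i j = F j i"
 shows "(\<Sum>i\<in>S. \<Sum>j\<in>S - {i}. F i j) = 0"
 using assms(1)
proof (induction S rule: finite_induct)
 case (insert x S)
 have "(\<Sum>j\<in>insert x S - {i}. F i j) = F i x + (\<Sum>j\<in>S - {i}. F i j)" if "i : S" for i
  using that insert by (subst insert_Diff_if) (auto simp: insert_Diff_if)
 then have "(\<Sum>i\<in>insert x S. \<Sum>j\<in>insert x S - {i}. F i j) =
   (\<Sum>j\<in>S. F x j) + (\<Sum>i\<in>S. F i x + (\<Sum>j\<in>S - {i}. F i j))"
  using insert by simp
 also have "... = (\<Sum>j\<in>S. F x j) + (\<Sum>j\<in>S. F x j)"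
  using insert assms(2) by (simp add: sum.distrib)
 finally show ?case by simp
qed simp

section \<open>A Borsuk theorem and finite-dimensional minimax\<close>

text \<open>A cell of the cubical grid with odd vertices is coded by its centre: an even coordinate stands for an
 interval of length 2, an odd one for a vertex. So the origin is the centre of a cell, and no other cell is fixed
 by the antipodal map.\<close>

type_synonym cell = "nat => int"
type_synonym chain = "cell => bit"

definition antipode :: "cell => cell" where "antipode z = (%i. - z i)"

lemma antipode_antipode [simp]: "antipode (antipode z) = z"
 by (simp add: antipode_def)

definition dimc :: "nat => cell => nat" where "dimc d z = card {i. i < d & even (z i)}"

definition odds :: "nat => cell => nat set" where "odds d z = {i. i < d & odd (z i)}"

definition cells :: "nat => int => cell set" where
 "cells d n = {z. (ALL i>=d. z i = 0) & (ALL i<d. \<bar>z i\<bar> <= n)}"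

text \<open>A boundary coefficient is collected from the cofaces: moving an odd coordinate i of
  \<open>w\<close> by one step gives the two cells of one dimension more that have \<open>w\<close>
  as a face in direction i. So this is the usual cellular boundary, read at the face.\<close>

definition bdry :: "nat => chain => chain" where
 "bdry d K w = (\<Sum>i\<in>odds d w. K (w(i := w i + 1)) + K (w(i := w i - 1)))"

definition kchain :: "nat => int => nat => chain => bool" where
 "kchain d n k K \<longleftrightarrow> (ALL z. K z ~= 0 --> z : cells d n & dimc d z = k)"

definition restr :: "cell set => chain => chain" where
 "restr P K z = (if z : P then K z else 0)"

definition symc :: "chain => bool" where "symc K \<longleftrightarrow> (ALL z. K (antipode z) = K z)"

definition symm :: "chain => chain" where "symm D z = D z + D (antipode z)"

text \<open>A half contains exactly one cell of each antipodal pair. Among the cells of a grid only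
  the one at the origin, its own antipode, is left unconstrained.\<close>

definition halves :: "nat => cell set => bool" where
 "halves d P \<longleftrightarrow> (ALL z. (EX i<d. z i ~= 0) --> (antipode z : P \<longleftrightarrow> z \<notin> P))"

text \<open>Reduced cycles: in dimension zero the boundary is replaced by the parity of the number
  of vertices.\<close>

definition cyc :: "nat => int => nat => chain => bool" where
 "cyc d n k K \<longleftrightarrow> (if k = 0 then sum K (cells d n) = 0 else bdry d K = (%_. 0))"

text \<open>For a symmetric cycle, each step keeps the half in P k and passes to its boundary, which
 is again symmetric; at the end half of the vertices are counted. The value does not depend on P.\<close>

primrec ind :: "nat => int => (nat => cell set) => nat => chain => bit" where
 "ind d n P 0 K = sum (restr (P 0) K) (cells d n)"
| "ind d n P (Suc k) K = ind d n P k (bdry d (restr (P (Suc k)) K))"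

lemma finite_odds [simp]: "finite (odds d z)" by (simp add: odds_def)

lemma finite_cells [simp]: "finite (cells d n)"
proof -
 have "cells d n \<subseteq> (%f. %i. if i < d then f i else 0) ` ({..<d} \<rightarrow>\<^sub>E {-n..n})"
 proof
  fix z assume z: "z : cells d n"
  have "z = (%i. if i < d then restrict z {..<d} i else 0)"
   using z by (auto simp: cells_def)
  moreover have "restrict z {..<d} : {..<d} \<rightarrow>\<^sub>E {-n..n}"
   using z by (auto simp: cells_def PiE_iff extensional_def abs_le_iff minus_le_iff)
  ultimately show "z : (%f. %i. if i < d then f i else 0) ` ({..<d} \<rightarrow>\<^sub>E {-n..n})"
   by blast
 qed
 then show ?thesis
  by (rule finite_subset) (auto intro: finite_PiE)
qed

lemma antipode_cells [simp]: "antipode z : cells d n \<longleftrightarrow> z : cells d n"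
 by (simp add: cells_def antipode_def)

lemma dimc_antipode [simp]: "dimc d (antipode z) = dimc d z"
 by (simp add: dimc_def antipode_def)

lemma bdry_add: "bdry d (%z. K z + L z) = (%z. bdry d K z + bdry d L z)"
 by (rule ext) (simp add: bdry_def sum.distrib algebra_simps)

lemma restr_add: "restr P (%z. K z + L z) = (%z. restr P K z + restr P L z)"
 by (rule ext) (simp add: restr_def)

lemma bdry_antipode: "bdry d K (antipode w) = bdry d (%z. K (antipode z)) w"
proof -
 have "odds d (antipode w) = odds d w" by (simp add: odds_def antipode_def)
 moreover have "(antipode w)(i := antipode w i + 1) = antipode (w(i := w i - 1))"
  "(antipode w)(i := antipode w i - 1) = antipode (w(i := w i + 1))" for i
  by (auto simp: antipode_def)
 ultimately show ?thesis by (simp add: bdry_def add.commute)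
qed

lemma bdry_symm: "bdry d (symm D) = symm (bdry d D)"
 by (rule ext) (simp add: symm_def bdry_antipode bdry_add[unfolded fun_eq_iff, rule_format] symm_def[abs_def])

lemma symc_bdry: "symc K ==> symc (bdry d K)"
 by (simp add: symc_def bdry_antipode)

text \<open>A moved coordinate becomes even, so the second boundary only meets other directions, and
  moves in different directions commute. The double sum is therefore symmetric and cancels.\<close>

lemma bdry_bdry: "bdry d (bdry d K) = (%_. 0)"
proof
 fix w
 define s where "s e i z = z(i := z i + e)" for e :: int and i :: nat and z :: cell
 have odds_s: "odds d (s e i w) = odds d w - {i}" if "odd e" "i : odds d w" for e i
  using that by (auto simp: odds_def s_def)
 have bd: "bdry d K w = (\<Sum>i\<in>odds d w. K (s 1 i w) + K (s (-1) i w))" for K w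
  by (simp add: bdry_def s_def)
 have comm: "s a i (s b j w) = s b j (s a i w)" for a b i j w
  by (auto simp: s_def)
 define F where "F i j = K (s 1 j (s 1 i w)) + K (s (-1) j (s 1 i w)) +
  K (s 1 j (s (-1) i w)) + K (s (-1) j (s (-1) i w))" for i j
 have F_sym: "F i j = F j i" for i j
  unfolding F_def by (simp add: comm[of _ i] algebra_simps)
 have "bdry d (bdry d K) w = (\<Sum>i\<in>odds d w. \<Sum>j\<in>odds d w - {i}. F i j)"
  by (subst bd, intro sum.cong refl, subst (1 2) bd, simp add: odds_s F_def sum.distrib algebra_simps)
 also have "... = 0"
  using F_sym by (intro sum_symmetric_offdiag) auto
 finally show "bdry d (bdry d K) w = 0" .
qed

lemma kchain_restr: "kchain d n k K ==> kchain d n k (restr P K)"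
 by (simp add: kchain_def restr_def)

lemma kchain_symm: "kchain d n k K ==> kchain d n k (symm K)"
 unfolding kchain_def symm_def
 by (metis add_0 antipode_cells dimc_antipode)

lemma kchain_add: "kchain d n k K ==> kchain d n k L ==> kchain d n k (%z. K z + L z)"
 unfolding kchain_def by (metis add_0)

lemma dimc_face:
 assumes "i : odds d w" "odd e"
 shows "dimc d (w(i := w i + e)) = Suc (dimc d w)"
proof -
 have "{j. j < d & even ((w(i := w i + e)) j)} = insert i {j. j < d & even (w j)}"
  using assms by (auto simp: odds_def)
 moreover have "i \<notin> {j. j < d & even (w j)}" using assms by (auto simp: odds_def)
 ultimately show ?thesis by (simp add: dimc_def)
qed

text \<open>This is where n must be odd: after the move the coordinate is even, so it is at most n -
  1 in absolute value, and moving back stays in the grid.\<close>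

lemma cells_face:
 assumes "odd n" "i : odds d w" "odd e" "\<bar>e\<bar> = 1" "w(i := w i + e) : cells d n"
 shows "w : cells d n"
proof -
 have i: "i < d" "odd (w i)" using assms by (auto simp: odds_def)
 have "\<bar>w i + e\<bar> <= n" using assms(5) i by (auto simp: cells_def dest: spec[of _ i])
 moreover have "\<bar>w i + e\<bar> ~= n" using assms(1,3) i(2) by (metis even_abs_add_iff even_add)
 ultimately have "\<bar>w i\<bar> <= n" using assms(4) by linarith
 moreover have "ALL j<d. j ~= i --> \<bar>w j\<bar> <= n" "ALL j>=d. w j = 0"
  using assms(5) i by (auto simp: cells_def dest: spec split: if_splits)
 ultimately show ?thesis by (auto simp: cells_def)
qed

lemma bdry_nonzeroE:
 assumes "bdry d K w ~= 0"
 obtains i e where "i : odds d w" "e = 1 | e = -1" "K (w(i := w i + e)) ~= 0"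
proof -
 obtain i where "i : odds d w" "K (w(i := w i + 1)) + K (w(i := w i - 1)) ~= 0"
  using assms unfolding bdry_def by (meson sum.neutral)
 then show ?thesis
  by (metis add_0 diff_conv_add_uminus that)
qed

lemma kchain_bdry:
 assumes "odd n" "kchain d n (Suc k) K"
 shows "kchain d n k (bdry d K)"
 unfolding kchain_def
proof (intro allI impI)
 fix w assume "bdry d K w ~= 0"
 then obtain i e where *: "i : odds d w" "e = 1 | e = -1" "K (w(i := w i + e)) ~= 0"
  by (rule bdry_nonzeroE)
 then have "w(i := w i + e) : cells d n" "dimc d (w(i := w i + e)) = Suc k"
  using assms(2) by (auto simp: kchain_def)
 then show "w : cells d n & dimc d w = k"
  using * assms(1) dimc_face[of i d w e] cells_face[of n i d w e] by auto
qed

lemma dimc_less_nonzero: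
 assumes "dimc d z < d" shows "EX i<d. z i ~= 0"
proof (rule ccontr)
 assume "~ ?thesis"
 then have "{i. i < d & even (z i)} = {..<d}" by auto
 then show False using assms by (simp add: dimc_def)
qed

lemma halvesD: "halves d P ==> dimc d z < d ==> antipode z : P \<longleftrightarrow> z \<notin> P"
 using dimc_less_nonzero unfolding halves_def by blast

text \<open>Below dimension d no cell is its own antipode, so a symmetric chain is a union of
  antipodal pairs, and the half picks one cell of each.\<close>

lemma symc_decompose:
 assumes "symc S" "kchain d n k S" "k < d" "halves d P"
 shows "S = symm (restr P S)"
proof
 fix z
 show "S z = symm (restr P S) z"
 proof (cases "S z = 0")
  case True
  then show ?thesis using assms(1) by (simp add: symm_def restr_def symc_def)
 next
  case False
  then have "dimc d z < d" using assms(2,3) by (auto simp: kchain_def)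
  then show ?thesis
   using halvesD[OF assms(4)] assms(1) by (auto simp: symm_def restr_def symc_def)
 qed
qed

lemma sum_antipode: "sum (%z. K (antipode z)) (cells d n) = sum K (cells d n)"
 by (rule sum.reindex_bij_witness[of _ antipode antipode]) auto

lemma sum_symm_restr: "sum (symm K) (cells d n) = 0"
 by (simp add: symm_def[abs_def] sum.distrib sum_antipode)

text \<open>An edge has two end points; linearity extends this from a single edge to a chain. It
  links the boundary to the parity that defines cycles in dimension zero.\<close>

lemma sum_bdry_one:
 assumes "odd n" "kchain d n 1 L"
 shows "sum (bdry d L) (cells d n) = 0"
proof -
 have single: "sum (bdry d (%z. of_bool (z = y))) (cells d n) = 0"
  if y: "y : cells d n" "dimc d y = 1" for y
 proof -
  obtain i where i: "{i. i < d & even (y i)} = {i}"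
   using y(2) unfolding dimc_def by (metis card_1_singletonE)
  define a b where "a = y(i := y i + 1)" and "b = y(i := y i - 1)"
  have ev: "even (y i)" "i < d" using i by auto
  have ab: "a ~= b"
  proof
   assume "a = b"
   then have "a i = b i" by simp
   then show False by (simp add: a_def b_def)
  qed
  have nn: "\<bar>y i\<bar> <= n" "\<bar>y i\<bar> ~= n"
   using y ev assms(1) by (auto simp: cells_def)
  have cell: "a : cells d n" "b : cells d n"
   using y(1) ev nn by (auto simp: a_def b_def cells_def)
  have *: "bdry d (%z. of_bool (z = y)) w = of_bool (w = a) + of_bool (w = b)" for w
  proof -
   have odds: "j : odds d w ==> w(j := w j + 1) = y \<longleftrightarrow> j = i & w = b" for j
    using i ev by (fastforce simp: b_def odds_def fun_eq_iff split: if_splits)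
   have odds': "j : odds d w ==> w(j := w j - 1) = y \<longleftrightarrow> j = i & w = a" for j
    using i ev by (fastforce simp: a_def odds_def fun_eq_iff split: if_splits)
   have "i : odds d a" "i : odds d b" using ev by (auto simp: a_def b_def odds_def)
   then have "bdry d (%z. of_bool (z = y)) w =
     (\<Sum>j\<in>odds d w. if j = i then of_bool (w = b) + of_bool (w = a) else 0)"
    unfolding bdry_def by (intro sum.cong refl) (use odds odds' in auto)
   also have "... = (if i : odds d w then of_bool (w = b) + of_bool (w = a) else 0)"
    by simp
   also have "... = of_bool (w = a) + of_bool (w = b)"
    using \<open>i : odds d a\<close> \<open>i : odds d b\<close> by (auto simp: add.commute)
   finally show ?thesis .
  qed
  show ?thesis
   using cell ab unfolding * sum.distrib by (simp add: of_bool_def)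
 qed
 have L: "L = (%z. \<Sum>y\<in>{y\<in>cells d n. L y = 1}. of_bool (z = y))"
 proof
  fix z show "L z = (\<Sum>y\<in>{y\<in>cells d n. L y = 1}. of_bool (z = y))"
   using assms(2) by (cases "L z") (auto simp: kchain_def of_bool_def)
 qed
 have lin: "sum (bdry d (%z. \<Sum>y\<in>Y. of_bool (z = y))) (cells d n) = 0"
  if "finite Y" "Y \<subseteq> {y\<in>cells d n. L y = 1}" for Y
  using that
 proof (induction Y rule: finite_induct)
  case empty
  then show ?case by (simp add: bdry_def)
 next
  case (insert y Y)
  have "dimc d y = 1" using insert.prems assms(2) by (auto simp: kchain_def)
  then show ?case
   using insert single[of y]
   unfolding sum.insert[OF insert.hyps] bdry_add sum.distrib by simp
 qed
 show ?thesis by (subst L) (rule lin, auto)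
qed

lemma cyc_bdry:
 assumes "odd n" "kchain d n (Suc k) L"
 shows "cyc d n k (bdry d L)"
 using assms by (cases k) (auto simp: cyc_def bdry_bdry sum_bdry_one)

lemma ind_add: "ind d n P k (%z. K z + L z) = ind d n P k K + ind d n P k L"
 by (induction k arbitrary: K L) (auto simp: restr_add bdry_add sum.distrib)

text \<open>The half \<open>H\<close> of \<open>symm D\<close> and \<open>D\<close> itself have the
  same symmetrisation, so their sum is symmetric and equals \<open>symm L\<close> for some
  \<open>L\<close>. As \<open>D\<close> is a cycle, the boundary of \<open>H\<close> is
  \<open>symm (bdry d L)\<close>, and the induction continues with the cycle
  \<open>bdry d L\<close>. In dimension zero the half counts each vertex of \<open>D\<close> once,
  and their number is even.\<close>

lemma ind_symm:
 assumes n: "odd n" and P: "!!k. halves d (P k)"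
 shows "k < d ==> kchain d n k D ==> cyc d n k D ==> ind d n P k (symm D) = 0"
proof (induction k arbitrary: D)
 case 0
 have split: "D z = restr (P 0) D z + restr (- P 0) D z" for z
  by (simp add: restr_def)
 have anti: "restr (P 0) (%z. D (antipode z)) z = restr (- P 0) D (antipode z)" for z
 proof (cases "D (antipode z) = 0")
  case False
  then have "dimc d z < d" using 0 by (auto simp: kchain_def)
  then show ?thesis using halvesD[OF P] by (auto simp: restr_def)
 qed (simp add: restr_def)
 have "ind d n P 0 (symm D) = sum (restr (P 0) D) (cells d n) +
   sum (restr (P 0) (%z. D (antipode z))) (cells d n)"
  by (simp add: symm_def[abs_def] restr_add sum.distrib)
 also have "sum (restr (P 0) (%z. D (antipode z))) (cells d n) = sum (restr (- P 0) D) (cells d n)"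
  by (simp add: anti sum_antipode[of "restr (- P 0) D"])
 also have "sum (restr (P 0) D) (cells d n) + sum (restr (- P 0) D) (cells d n) = sum D (cells d n)"
  by (simp add: split[symmetric] flip: sum.distrib)
 finally show ?case using 0 by (simp add: cyc_def)
next
 case (Suc k)
 define H where "H = restr (P (Suc k)) (symm D)"
 define S where "S z = H z + D z" for z
 have kH: "kchain d n (Suc k) H" unfolding H_def using Suc.prems kchain_restr kchain_symm by blast
 have kS: "kchain d n (Suc k) S" unfolding S_def using kH Suc.prems kchain_add by blast
 have "symc (symm D)" by (simp add: symc_def symm_def add.commute)
 then have "symm D = symm H"
  unfolding H_def using Suc.prems P kchain_symm by (intro symc_decompose) auto
 then have e: "D z + D (antipode z) = H z + H (antipode z)" for z
  by (metis symm_def)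
 have "S (antipode z) = S z" for z
 proof -
  have "S (antipode z) + S z = (D z + D (antipode z)) + (H z + H (antipode z))"
   by (simp add: S_def algebra_simps)
  then show ?thesis by (simp add: e bit_add_eq_0_iff)
 qed
 then have "symc S" by (simp add: symc_def)
 define L where "L = restr (P (Suc k)) S"
 have L: "S = symm L" "kchain d n (Suc k) L"
  unfolding L_def using \<open>symc S\<close> kS Suc.prems P kchain_restr by (auto intro: symc_decompose)
 have "H = (%z. S z + D z)" by (simp add: S_def algebra_simps)
 then have "bdry d H = (%z. bdry d S z + bdry d D z)" by (simp add: bdry_add)
 also have "... = symm (bdry d L)"
  using Suc.prems L(1) by (simp add: cyc_def bdry_symm)
 finally have "ind d n P (Suc k) (symm D) = ind d n P k (symm (bdry d L))"
  by (simp add: H_def)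
 then show ?case
  using Suc.IH[of "bdry d L"] L(2) Suc.prems n cyc_bdry kchain_bdry by simp
qed

text \<open>The halves cut out by two choices differ by a symmetric chain, which is
  \<open>symm\<close> of its own half. Their boundaries then differ by \<open>symm D\<close> for a
  cycle \<open>D\<close>, and such a term has index zero by \<open>ind_symm\<close>.\<close>

lemma ind_choice:
 assumes n: "odd n" and P: "!!k. halves d (P k)" and Q: "!!k. halves d (Q k)"
 shows "k < d ==> kchain d n k K ==> symc K ==> (k > 0 ==> bdry d K = (%_. 0)) ==>
  ind d n P k K = ind d n Q k K"
proof (induction k arbitrary: K)
 case 0
 define S where "S z = restr (P 0) K z + restr (Q 0) K z" for z
 have kS: "kchain d n 0 S" unfolding S_def using 0 kchain_restr kchain_add by blast
 have "S (antipode z) = S z" for z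
 proof (cases "K z = 0")
  case False
  then have "dimc d z < d" using 0 by (auto simp: kchain_def)
  then show ?thesis using halvesD[OF P] halvesD[OF Q] 0 by (auto simp: S_def restr_def symc_def)
 qed (use 0 in \<open>auto simp: S_def restr_def symc_def\<close>)
 then have "S = symm (restr (P 0) S)"
  using kS 0 P by (intro symc_decompose) (auto simp: symc_def)
 then have "sum S (cells d n) = 0" by (metis sum_symm_restr)
 then show ?case by (simp add: S_def sum.distrib bit_add_eq_0_iff)
next
 case (Suc k)
 define H H' where "H = restr (P (Suc k)) K" and "H' = restr (Q (Suc k)) K"
 define S where "S z = H z + H' z" for z
 have kH: "kchain d n (Suc k) H" "kchain d n (Suc k) H'"
  unfolding H_def H'_def using Suc.prems kchain_restr by blast+
 have kS: "kchain d n (Suc k) S" unfolding S_def using kH kchain_add by blast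
 have KH: "K = symm H" "K = symm H'"
  unfolding H_def H'_def using Suc.prems P Q by (auto intro: symc_decompose)
 have "S (antipode z) = S z" for z
 proof -
  have "S (antipode z) + S z = symm H z + symm H' z"
   by (simp add: S_def symm_def algebra_simps)
  also have "... = 0" using KH by (metis bit_double)
  finally show ?thesis by (simp add: bit_add_eq_0_iff)
 qed
 then have S: "S = symm (restr (P (Suc k)) S)"
  using kS Suc.prems P by (intro symc_decompose) (auto simp: symc_def)
 define D where "D = bdry d (restr (P (Suc k)) S)"
 have kD: "kchain d n k D" "cyc d n k D"
  unfolding D_def using kS n kchain_restr kchain_bdry cyc_bdry by blast+
 have "bdry d H z = bdry d H' z + symm D z" for z
 proof -
  have "symm D z = bdry d S z" unfolding D_def by (metis S bdry_symm)
  also have "... = bdry d H z + bdry d H' z" by (simp add: S_def[abs_def] bdry_add)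
  finally show ?thesis by (simp add: algebra_simps)
 qed
 then have "ind d n P k (bdry d H) = ind d n P k (%z. bdry d H' z + symm D z)"
  by (metis ext)
 also have "... = ind d n P k (bdry d H')"
  using ind_symm[OF n P _ kD] Suc.prems by (simp add: ind_add)
 also have "... = ind d n Q k (bdry d H')"
 proof (rule Suc.IH)
  have "symm (bdry d H') = (%_. 0)"
   using Suc.prems(4) KH(2) by (metis bdry_symm zero_less_Suc)
  then show "symc (bdry d H')"
   unfolding symc_def symm_def fun_eq_iff by (simp add: bit_add_eq_0_iff)
 qed (use Suc.prems n kH kchain_bdry in \<open>auto simp: bdry_bdry\<close>)
 finally show ?case by (simp add: H_def H'_def)
qed

section \<open>Alternating cells: explicit chains of index one\<close>

text \<open>The nonzero coordinates, read from the highest index down, are b, - b, b and so on;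
  zeros are skipped. Such cells form a descending sequence of symmetric chains around the origin on
  which the index can be computed by hand.\<close>

primrec alt :: "nat => int => cell => bool" where
 "alt 0 b w = True"
| "alt (Suc m) b w = (if w m = 0 then alt m b w else w m = b & alt m (- b) w)"

text \<open>A lexicographic half: the sign of the nonzero coordinate of highest index, which is also
  the leading sign in \<open>alt\<close>.\<close>

primrec pos :: "nat => cell => bool" where
 "pos 0 z = False"
| "pos (Suc m) z = (if z m = 0 then pos m z else z m > 0)"

lemma alt_cong: "(!!i. i < m ==> w i = v i) ==> alt m b w = alt m b v"
 by (induction m arbitrary: b) auto

lemma alt_upd_ge: "m <= i ==> alt m b (w(i := c)) = alt m b w"
 by (rule alt_cong) auto

lemma alt_abs_le: "alt m b w ==> \<bar>b\<bar> = 1 ==> i < m ==> \<bar>w i\<bar> <= 1"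
 by (induction m arbitrary: b) (auto simp: less_Suc_eq split: if_splits)

text \<open>Setting a coordinate to zero deletes one sign. For the result to alternate with leading
  sign b, a word that alternates from b must lose its last sign, and one that alternates from - b
  its first. A word that does not alternate must have one adjacent equal pair, and then either
  member can be deleted, which makes two ways and cancels.\<close>

lemma alt_count:
 assumes "\<bar>b\<bar> = 1"
 shows "(\<Sum>i\<in>{i. i < m & \<bar>w i\<bar> = 1}. of_bool (alt m b (w(i := 0)))) =
  (of_bool (alt m b w) + of_bool (alt m (- b) w) :: bit)"
 using assms
proof (induction m arbitrary: b)
 case (Suc m)
 define I where "I = {i. i < m & \<bar>w i\<bar> = 1}"
 have I: "finite I" "m \<notin> I" by (auto simp: I_def)
 have IH: "(\<Sum>i\<in>I. of_bool (alt m b (w(i := 0)))) = (of_bool (alt m b w) + of_bool (alt m (- b) w) :: bit)"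
  "(\<Sum>i\<in>I. of_bool (alt m (- b) (w(i := 0)))) = (of_bool (alt m (- b) w) + of_bool (alt m b w) :: bit)"
  unfolding I_def using Suc.IH[OF Suc.prems] apply (simp only:)
  using Suc.IH[OF Suc.prems[folded abs_minus_cancel[of b]], unfolded minus_minus] by (simp only:)
 have I': "{i. i < Suc m & \<bar>w i\<bar> = 1} = (if \<bar>w m\<bar> = 1 then insert m I else I)"
  by (auto simp: I_def less_Suc_eq)
 have step: "alt (Suc m) b (w(i := 0)) =
   (if w m = 0 then alt m b (w(i := 0)) else w m = b & alt m (- b) (w(i := 0)))" if "i : I" for i
  using that I(2) by auto
 have top: "alt (Suc m) b (w(m := 0)) = alt m b w" by (simp add: alt_upd_ge)
 have S: "(\<Sum>i\<in>I. of_bool (alt (Suc m) b (w(i := 0)))) =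
  (if w m = 0 then of_bool (alt m b w) + of_bool (alt m (- b) w)
   else if w m = b then of_bool (alt m (- b) w) + of_bool (alt m b w) else (0::bit))"
 proof -
  have "(\<Sum>i\<in>I. of_bool (alt (Suc m) b (w(i := 0)))) =
    (\<Sum>i\<in>I. of_bool (if w m = 0 then alt m b (w(i := 0)) else w m = b & alt m (- b) (w(i := 0))) :: bit)"
   by (intro sum.cong refl) (simp only: step)
  then show ?thesis using IH by (simp del: sum_of_bool_eq alt.simps)
 qed
 have total: "(\<Sum>i\<in>{i. i < Suc m & \<bar>w i\<bar> = 1}. of_bool (alt (Suc m) b (w(i := 0)))) =
   (if \<bar>w m\<bar> = 1 then of_bool (alt m b w) else 0) +
   (\<Sum>i\<in>I. of_bool (alt (Suc m) b (w(i := 0))) :: bit)"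
  unfolding I' using I top by (simp del: alt.simps sum_of_bool_eq)
 consider "w m = 0" | "w m = b" "w m ~= 0" | "w m = - b" "w m ~= 0" "w m ~= b"
  | "w m ~= 0" "w m ~= b" "w m ~= - b" "\<bar>w m\<bar> ~= 1"
  using Suc.prems by linarith
 then have "(if \<bar>w m\<bar> = 1 then of_bool (alt m b w) else 0) +
   (if w m = 0 then of_bool (alt m b w) + of_bool (alt m (- b) w)
    else if w m = b then of_bool (alt m (- b) w) + of_bool (alt m b w) else (0::bit)) =
   of_bool (alt (Suc m) b w) + of_bool (alt (Suc m) (- b) w)"
  using Suc.prems by cases (auto simp: ac_simps)
 with total show ?case unfolding S by (rule trans)
qed simp

lemma pos_antipode: "EX i<m. z i ~= 0 ==> pos m (antipode z) \<longleftrightarrow> ~ pos m z"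
 by (induction m) (auto simp: antipode_def less_Suc_eq)

lemma halves_pos: "halves d {z. pos d z}"
 using pos_antipode by (auto simp: halves_def)

lemma alt_pos: "alt m b z ==> \<bar>b\<bar> = 1 ==> EX i<m. z i ~= 0 ==> pos m z \<longleftrightarrow> b = 1"
 by (induction m) (auto simp: less_Suc_eq split: if_splits)

text \<open>A vertex has no zero coordinate, so for a given leading sign exactly one vertex
  alternates. This single vertex is what the index finally counts.\<close>

lemma alt_all_odd:
 "\<bar>b\<bar> = 1 ==> (alt m b w & (ALL i<m. odd (w i))) \<longleftrightarrow> (ALL i<m. w i = b * (- 1) ^ (m - Suc i))"
proof (induction m arbitrary: b)
 case (Suc m)
 have "(ALL i<m. w i = b * (- 1) ^ (Suc m - Suc i)) \<longleftrightarrow> (ALL i<m. w i = (- b) * (- 1) ^ (m - Suc i))"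
  by (intro all_cong) (auto simp: Suc_diff_Suc[symmetric] simp flip: Suc_diff_Suc)
 moreover have "odd b" using Suc.prems by (auto simp: abs_if split: if_splits)
 ultimately show ?case
  using Suc.IH[of "- b"] Suc.prems by (auto simp: less_Suc_eq)
qed simp

text \<open>Both leading signs are added to make the chain symmetric; for k < d some coordinate is
  nonzero and they exclude each other.\<close>

definition alt_chain :: "nat => int => nat => chain" where
 "alt_chain d n k w =
  (if w : cells d n & dimc d w = k then of_bool (alt d 1 w) + of_bool (alt d (- 1) w) else 0)"

lemma odd_cases: "odd (v::int) ==> v = 1 | v = - 1 | v > 2 | v < - 2"
 by presburger

text \<open>An alternating cell has coordinates of absolute value at most one, so among the cofaces
  of a cell only those that move a coordinate 1 or -1 to zero count. Their number modulo 2 is given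
  by \<open>alt_count\<close>.\<close>

lemma bdry_alt_chain:
 assumes "odd n" "n >= 1" "kchain d n (Suc k) K"
  and K: "!!z. (ALL i>=d. z i = 0) ==> dimc d z = Suc k ==> K z = of_bool (alt d 1 z)"
 shows "bdry d K = alt_chain d n k"
proof
 fix w
 show "bdry d K w = alt_chain d n k w"
 proof (cases "w : cells d n & dimc d w = k")
  case False
  then show ?thesis
   using kchain_bdry[OF assms(1,3)] unfolding kchain_def alt_chain_def by auto
 next
  case True
  have Kz: "K (w(i := w i + e)) = of_bool (alt d 1 (w(i := w i + e)))"
   if "i : odds d w" "odd e" for i e
   using that True dimc_face[OF that] by (intro K) (auto simp: cells_def odds_def)
  have no: "~ alt d 1 (w(i := c))" if "i < d" "\<bar>c\<bar> > 1" for i c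
   using alt_abs_le[of d 1 "w(i := c)" i] that by auto
  have "K (w(i := w i + 1)) + K (w(i := w i - 1)) =
    (if \<bar>w i\<bar> = 1 then of_bool (alt d 1 (w(i := 0))) else 0)" if i: "i : odds d w" for i
  proof -
   have *: "i < d" "odd (w i)" using i by (auto simp: odds_def)
   consider "w i = 1" | "w i = -1" | "w i > 2 | w i < - 2"
    using odd_cases[OF *(2)] by blast
   then show ?thesis
    using Kz[OF i, of 1] Kz[OF i, of "- 1"] no[OF *(1), of "w i + 1"] no[OF *(1), of "w i - 1"]
    by cases auto
  qed
  then have "bdry d K w = (\<Sum>i\<in>odds d w. if \<bar>w i\<bar> = 1 then of_bool (alt d 1 (w(i := 0))) else 0)"
   unfolding bdry_def by (intro sum.cong) auto
  also have "... = (\<Sum>i\<in>{i. i < d & \<bar>w i\<bar> = 1}. of_bool (alt d 1 (w(i := 0))))"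
  proof -
   have "{i : odds d w. \<bar>w i\<bar> = 1} = {i. i < d & \<bar>w i\<bar> = 1}"
    by (auto simp: odds_def abs_if split: if_splits)
   then show ?thesis by (subst sum.inter_filter[symmetric]) (simp_all del: sum_of_bool_eq)
  qed
  also have "... = of_bool (alt d 1 w) + of_bool (alt d (- 1) w)"
   using alt_count[of 1 d w] by simp
  finally show ?thesis using True by (simp add: alt_chain_def)
 qed
qed

lemma kchain_alt_chain: "kchain d n k (alt_chain d n k)"
 by (auto simp: kchain_def alt_chain_def)

lemma restr_alt_chain:
 assumes "n >= 1" "k < d" "ALL i>=d. z i = 0" "dimc d z = k"
 shows "restr {z. pos d z} (alt_chain d n k) z = of_bool (alt d 1 z)"
proof -
 have nz: "EX i<d. z i ~= 0" using assms dimc_less_nonzero by blast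
 have "alt d 1 z ==> z : cells d n"
  using assms alt_abs_le[of d 1 z] by (force simp: cells_def)
 moreover have "alt d 1 z ==> pos d z" "alt d (- 1) z ==> ~ pos d z"
  using alt_pos[OF _ _ nz] by auto
 ultimately show ?thesis
  using assms by (auto simp: restr_def alt_chain_def)
qed

text \<open>Cutting with the lexicographic half keeps the leading sign 1, and the boundary of that
  half is the alternating chain one dimension lower. The descent ends in a single vertex.\<close>

lemma ind_alt_chain:
 assumes "odd n" "n >= 1"
 shows "k < d ==> ind d n (%_. {z. pos d z}) k (alt_chain d n k) = 1"
proof (induction k)
 case 0
 define y where "y i = (if i < d then (- 1) ^ (d - Suc i) else 0 :: int)" for i
 have "restr {z. pos d z} (alt_chain d n 0) z = of_bool (z = y)" if z: "z : cells d n" for z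
 proof (cases "dimc d z = 0")
  case True
  have fin: "finite {i. i < d & even (z i)}" by simp
  have odd: "ALL i<d. odd (z i)" using True fin unfolding dimc_def by auto
  have sup: "ALL i>=d. z i = 0" using z by (auto simp: cells_def)
  have "alt d 1 z \<longleftrightarrow> (ALL i<d. z i = (- 1) ^ (d - Suc i))"
   using alt_all_odd[of 1 d z] odd by simp
  also have "... \<longleftrightarrow> z = y"
   using sup unfolding y_def fun_eq_iff by (metis leI)
  finally show ?thesis
   using restr_alt_chain[OF assms(2) 0 sup True] by simp
 next
  case False
  then have "z ~= y" by (auto simp: y_def dimc_def)
  then show ?thesis using False by (auto simp: restr_def alt_chain_def)
 qed
 moreover have "y : cells d n" using assms by (auto simp: cells_def y_def power_abs)
 ultimately show ?case by (simp add: of_bool_def cong: sum.cong)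
next
 case (Suc k)
 have "bdry d (restr {z. pos d z} (alt_chain d n (Suc k))) = alt_chain d n k"
  using assms Suc.prems restr_alt_chain
  by (intro bdry_alt_chain kchain_restr kchain_alt_chain) auto
 then show ?case using Suc by simp
qed

text \<open>Modulo 2 only the fixed cell matters: away from the origin \<open>W\<close> consists of
  antipodal pairs, whose boundary has index zero, and the boundary of the central cell is an
  alternating chain, of index one.\<close>

lemma ind_bdry_symmetric:
 assumes n: "odd n" "n >= 1" and d: "d > 0" and W: "kchain d n d W" "symc W" "W (%_. 0) = 1"
  and Q: "!!k. halves d (Q k)"
 shows "ind d n Q (d - 1) (bdry d W) = 1"
proof -
 define P where "P = (%_::nat. {z. pos d z})"
 have P: "halves d (P k)" for k by (simp add: P_def halves_pos)
 define c0 :: chain where "c0 z = of_bool (z = (%_. 0))" for z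
 have kc0: "kchain d n d c0" using n by (auto simp: kchain_def c0_def cells_def dimc_def)
 \<comment> \<open>Modulo 2 this removes the central cell, the only obstacle to splitting
   \<open>W\<close> into antipodal pairs.\<close>
 define V where "V z = W z + c0 z" for z
 have kV: "kchain d n d V" unfolding V_def using W kc0 kchain_add by blast
 have anti0: "antipode z = (%_. 0) \<longleftrightarrow> z = (%_. 0)" for z by (auto simp: antipode_def fun_eq_iff)
 have sV: "symc V" using W by (simp add: symc_def V_def c0_def anti0)
 have V: "V = symm (restr (P d) V)"
 proof
  fix z
  show "V z = symm (restr (P d) V) z"
  proof (cases "V z = 0")
   case True
   then show ?thesis using sV by (simp add: symm_def restr_def symc_def)
  next
   case False
   then have "z : cells d n" using kV by (auto simp: kchain_def)
   moreover have "z ~= (%_. 0)" using False W by (auto simp: V_def c0_def)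
   ultimately have "EX i<d. z i ~= 0" by (auto simp: cells_def fun_eq_iff) (metis leI)
   then show ?thesis
    using P[of d] sV unfolding halves_def by (auto simp: symm_def restr_def symc_def)
  qed
 qed
 define D where "D = bdry d (restr (P d) V)"
 have d': "Suc (d - 1) = d" using d by simp
 have kL: "kchain d n (Suc (d - 1)) (restr (P d) V)"
  unfolding d' by (rule kchain_restr[OF kV])
 have D: "kchain d n (d - 1) D" "cyc d n (d - 1) D"
  unfolding D_def using kL n kchain_bdry cyc_bdry by blast+
 have "W = (%z. c0 z + V z)" by (simp add: V_def algebra_simps fun_eq_iff)
 then have "bdry d W = (%z. bdry d c0 z + bdry d V z)" by (simp add: bdry_add)
 also have "bdry d V = symm D" unfolding D_def by (metis V bdry_symm)
 also have "bdry d c0 = alt_chain d n (d - 1)"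
 proof (rule bdry_alt_chain)
  fix z assume z: "ALL i>=d. z i = 0" "dimc d z = Suc (d - 1)"
  have "{i. i < d & even (z i)} = {..<d}"
   using z(2) d by (intro card_subset_eq) (auto simp: dimc_def)
  then have ev: "even (z i)" if "i < d" for i using that by auto
  have "alt d 1 z \<longleftrightarrow> z = (%_. 0)"
  proof
   assume a: "alt d 1 z"
   have "z i = 0" for i
   proof (cases "i < d")
    case True
    then have "\<bar>z i\<bar> <= 1" "even (z i)" using alt_abs_le[OF a] ev by auto
    then show ?thesis by presburger
   qed (use z in auto)
   then show "z = (%_. 0)" by auto
  next
   have "alt m 1 (%_. 0)" for m by (induction m) auto
   then show "z = (%_. 0) ==> alt d 1 z" by simp
  qed
  then show "c0 z = of_bool (alt d 1 z)" by (simp add: c0_def)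
 qed (use n d' kc0 in auto)
 finally have bW: "bdry d W = (%z. alt_chain d n (d - 1) z + symm D z)" .
 have "ind d n P (d - 1) (bdry d W) = 1"
  using ind_symm[OF n(1) P _ D] ind_alt_chain[OF n, of "d - 1" d] d
  by (simp add: bW ind_add P_def)
 moreover have "ind d n P (d - 1) (bdry d W) = ind d n Q (d - 1) (bdry d W)"
  using n W d by (intro ind_choice[OF n(1) P Q]) (auto simp: symc_bdry bdry_bdry intro: kchain_bdry)
 ultimately show ?thesis by simp
qed

section \<open>Common zeros of odd functions\<close>

lemma tendsto_fun_iff:
 fixes f :: "'b => 'i => 'c::topological_space"
 shows "(f \<longlongrightarrow> l) F \<longleftrightarrow> (ALL i. ((%c. f c i) \<longlongrightarrow> l i) F)"
 using limitin_componentwise[of "%_. euclidean :: 'c topology" UNIV f l F]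
 by (simp add: euclidean_product_topology)

lemma compact_fun_box:
 fixes S :: "nat => 'c::metric_space set"
 assumes "!!i. compact (S i)"
 shows "compact {x. ALL i. x i : S i}"
 using compactin_PiE[of "%_::nat. euclidean :: 'c topology" UNIV S] assms
 by (simp add: euclidean_product_topology PiE_UNIV_domain Pi_def)

text \<open>Coordinate spaces are realised inside the sequences, so that they are nested as sets and
  a point keeps its meaning when the dimension grows.\<close>

definition fin_sp :: "nat => (nat => real) set" where
 "fin_sp d = {x. ALL i>=d. x i = 0}"

lemma fin_sp_subseq:
 assumes "!!k. x k : fin_sp d" "!!k i. \<bar>x k i\<bar> <= R"
 obtains l r where "l : fin_sp d" "!!i. \<bar>l i\<bar> <= R" "strict_mono (r :: nat => nat)" "(%k. x (r k)) ----> l"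
proof -
 have "compact {x :: nat => real. ALL i. x i : {-R..R}}"
  by (rule compact_fun_box) simp
 moreover have "ALL k. x k : {x :: nat => real. ALL i. x i : {-R..R}}"
  using assms(2) by (auto simp: abs_le_iff minus_le_iff)
 ultimately obtain l r where l: "ALL i. l i : {-R..R}" "strict_mono r" "(x \<circ> r) ----> l"
  unfolding compact_eq_seq_compact_metric seq_compact_def by blast
 have "l i = 0" if "i >= d" for i
 proof -
  have "(%k. x (r k) i) ----> l i" using l(3) by (simp add: tendsto_fun_iff o_def)
  moreover have "(%k. x (r k) i) = (%_. 0)" using assms(1) that by (auto simp: fin_sp_def)
  ultimately show ?thesis by (simp add: LIMSEQ_const_iff)
 qed
 then show ?thesis
  using that[of l r] l by (auto simp: fin_sp_def o_def abs_le_iff minus_le_iff)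
qed

definition attained_near :: "nat => real => (nat => real) => ((nat => real) => bool) => bool" where
 "attained_near d ep x P \<longleftrightarrow> (EX y:fin_sp d. (ALL i. \<bar>y i - x i\<bar> <= ep) & P y)"

text \<open>The grid cells with s < 0 at the centre form a symmetric region around the origin. Its
  boundary separates the signs of s; each further cut along the sign of one g j, followed by passage
  to the boundary, leaves cells near a sign change of that g j. The index is one, so cells remain
  after d - 1 cuts. Each of the d passages to a boundary costs one grid step, whence the radius d *
  h.\<close>

lemma borsuk_approx:
 fixes g :: "nat => (nat => real) => real" and h R :: real
 assumes d: "d > 0" and h: "h > 0" and R: "R > 0"
  and odd_g: "!!j x. x : fin_sp d ==> g j (%i. - x i) = - g j x"
  and even_s: "!!x. x : fin_sp d ==> s (%i. - x i) = s x"
  and s0: "s (%_. 0) < (0::real)"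
  and sR: "!!x i. x : fin_sp d ==> i < d ==> \<bar>x i\<bar> >= R ==> s x > 0"
 shows "EX x:fin_sp d. attained_near d (d * h) x (%y. s y < 0) & attained_near d (d * h) x (%y. s y >= 0) &
  (ALL j:{1..<d}. attained_near d (d * h) x (%y. g j y >= 0) & attained_near d (d * h) x (%y. g j y <= 0))"
proof -
 define pt where "pt z = (%i. if i < d then h * real_of_int (z i) else 0)" for z :: cell
 have pt[simp]: "pt z : fin_sp d" for z by (simp add: pt_def fin_sp_def)
 have pt_anti: "pt (antipode z) = (%i. - pt z i)" for z by (auto simp: pt_def antipode_def)
 \<comment> \<open>Odd, and with h * n >= R, so that s > 0 at every centre beyond the grid.\<close>
 define n :: int where "n = 2 * \<lceil>R / h\<rceil> + 1"
 have "R / h > 0" using R h by simp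
 then have n: "odd n" "n >= 1" "real_of_int n >= R / h" unfolding n_def by (auto, linarith+)
 have nh: "h * real_of_int n >= R" using n(3) h by (simp add: field_simps)
 define W :: chain where "W z = of_bool (z : cells d n & (ALL i<d. even (z i)) & s (pt z) < 0)" for z
 have kW: "kchain d n d W"
 proof -
  have "dimc d z = d" if "ALL i<d. even (z i)" for z
  proof -
   have "{i. i < d & even (z i)} = {..<d}" using that by auto
   then show ?thesis by (simp add: dimc_def)
  qed
  then show ?thesis by (auto simp: kchain_def W_def)
 qed
 have sW: "symc W"
 proof -
  have "(ALL i<d. even (antipode z i)) = (ALL i<d. even (z i))" for z by (simp add: antipode_def)
  then show ?thesis by (simp add: symc_def W_def pt_anti even_s)
 qed
 have "pt (%_. 0) = (%_. 0)" by (auto simp: pt_def)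
 then have W0: "W (%_. 0) = 1" using n s0 by (simp add: W_def cells_def)
 \<comment> \<open>Ties at zero are broken lexicographically, since a half must contain exactly one
   cell of each pair.\<close>
 define Q where "Q k = {z. g k (pt z) > 0 | (g k (pt z) = 0 & pos d z)}" for k
 have Q: "halves d (Q k)" for k
  unfolding halves_def
 proof (intro allI impI)
  fix z :: cell assume "EX i<d. z i ~= 0"
  then have "pos d (antipode z) \<longleftrightarrow> ~ pos d z" by (rule pos_antipode)
  moreover have "g k (pt (antipode z)) = - g k (pt z)" by (simp add: pt_anti odd_g)
  ultimately show "antipode z : Q k \<longleftrightarrow> z \<notin> Q k" by (auto simp: Q_def)
 qed
 \<comment> \<open>The chains that occur while \<open>ind\<close> is evaluated, named so that the
   position of their cells can be followed. They are cut by Q (d - 1) down to Q 1, and Q 0 selects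
   the vertices to be counted; hence the numbering of the functions from 1.\<close>
 define Kc where "Kc = rec_nat (bdry d W) (%m K. bdry d (restr (Q (d - Suc m)) K))"
 have Kc0: "Kc 0 = bdry d W" and KcS: "Kc (Suc m) = bdry d (restr (Q (d - Suc m)) (Kc m))" for m
  by (simp_all add: Kc_def)
 define near where "near m w z \<longleftrightarrow> (ALL i. \<bar>z i - w i\<bar> <= int m)" for m :: nat and w z :: cell
 have near_face: "near (Suc m) w z" if "near m (w(i := w i + e)) z" "e = 1 | e = -1" for m w z i e
  unfolding near_def
 proof
  fix j
  have "\<bar>z j - (w(i := w i + e)) j\<bar> <= int m" using that by (simp add: near_def)
  then show "\<bar>z j - w j\<bar> <= int (Suc m)" using that(2) by (auto split: if_splits)
 qed
 have near_anti: "near m (antipode w) z \<longleftrightarrow> near m w (antipode z)" for m w z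
 proof -
  have "\<bar>z i - - w i\<bar> = \<bar>- z i - w i\<bar>" for i by linarith
  then show ?thesis unfolding near_def antipode_def by simp
 qed
 define G where "G m w \<longleftrightarrow> (EX z. near m w z & s (pt z) < 0) & (EX z. near m w z & s (pt z) >= 0)" for m w
 define Gj where "Gj j m w \<longleftrightarrow> (EX z. near m w z & g j (pt z) >= 0) & (EX z. near m w z & g j (pt z) <= 0)" for j m w
 \<comment> \<open>The last clause is the geometric content: a cell of \<open>Kc m\<close> is within
   m + 1 grid steps of both signs of s and of the functions already used for cutting, those of index
   at least d - m.\<close>
 have inv: "m <= d - 1 ==> kchain d n (d - 1 - m) (Kc m) & symc (Kc m) & bdry d (Kc m) = (%_. 0) &
  ind d n Q (d - 1 - m) (Kc m) = 1 &
  (ALL w. Kc m w ~= 0 --> G (Suc m) w & (ALL j:{d-m..<d}. Gj j (Suc m) w))" for m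
 proof (induction m)
  case 0
  have "G (Suc 0) w" if "Kc 0 w ~= 0" for w
  proof -
   have "bdry d W w ~= 0" using that by (simp add: Kc0)
   then have "EX i:odds d w. W (w(i := w i + 1)) + W (w(i := w i - 1)) ~= 0"
    unfolding bdry_def by (meson sum.neutral)
   then obtain i where i: "i : odds d w" "W (w(i := w i + 1)) ~= W (w(i := w i - 1))"
    by (metis bit_double)
   then obtain e e' where e: "e = 1 | e = -1" "e' = 1 | e' = -1"
    "W (w(i := w i + e)) = 1" "W (w(i := w i + e')) = 0"
   proof -
    have "(a = 1 & b = 0) | (a = 0 & b = 1)" if "a ~= b" for a b :: bit
     using that by (cases a; cases b) auto
    from this[OF i(2)] show thesis
     using that[of 1 "-1"] that[of "-1" 1] by auto
   qed
   let ?z = "w(i := w i + e)" and ?y = "w(i := w i + e')"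
   have z: "?z : cells d n" "ALL j<d. even (?z j)" "s (pt ?z) < 0" using e(3) by (auto simp: W_def)
   \<comment> \<open>Were s negative there, the cell would lie in the grid and hence belong to
     \<open>W\<close>, against the choice of e'.\<close>
   have "s (pt ?y) >= 0"
   proof (rule ccontr)
    assume neg: "~ ?thesis"
    have ev: "ALL j<d. even (?y j)" using z(2) i(1) e by (auto simp: odds_def split: if_splits)
    have "\<bar>?y j\<bar> <= n" if "j < d" for j
    proof (rule ccontr)
     assume "~ \<bar>?y j\<bar> <= n"
     then have "real_of_int n <= \<bar>real_of_int (?y j)\<bar>" by linarith
     then have "h * real_of_int n <= h * \<bar>real_of_int (?y j)\<bar>" using h by simp
     also have "... = \<bar>pt ?y j\<bar>" using that h by (simp add: pt_def abs_mult del: fun_upd_apply)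
     finally have "s (pt ?y) > 0" using sR[of "pt ?y" j] nh that by simp
     with neg show False by simp
    qed
    moreover have "ALL j>=d. ?y j = 0" using z(1) i(1) by (auto simp: cells_def odds_def split: if_splits)
    ultimately have "W ?y = 1" using ev neg unfolding W_def cells_def by simp
    then show False using e(4) by simp
   qed
   moreover have "near (Suc 0) w ?z" "near (Suc 0) w ?y" using e by (auto simp: near_def)
   ultimately show ?thesis using z(3) unfolding G_def by blast
  qed
  moreover have "kchain d n (d - 1) (bdry d W)" using kW n d by (intro kchain_bdry) auto
  ultimately show ?case
   using ind_bdry_symmetric[OF n(1,2) d kW sW W0 Q] sW by (simp add: Kc0 symc_bdry bdry_bdry)
 next
  case (Suc m)
  define k where "k = d - 1 - Suc m"
  have k: "d - 1 - m = Suc k" "d - Suc m = Suc k" "k < d" "Suc k < d" using Suc.prems d by (auto simp: k_def)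
  from Suc have IH: "kchain d n (Suc k) (Kc m)" "symc (Kc m)" "bdry d (Kc m) = (%_. 0)"
   "ind d n Q (Suc k) (Kc m) = 1"
   "!!w. Kc m w ~= 0 ==> G (Suc m) w" "!!w j. Kc m w ~= 0 ==> j\<in>{d-m..<d} ==> Gj j (Suc m) w"
   by (auto simp: k)
  define H where "H = restr (Q (Suc k)) (Kc m)"
  have KS: "Kc (Suc m) = bdry d H" by (simp add: KcS H_def k)
  have "Kc m = symm H" unfolding H_def using IH Q k by (intro symc_decompose) auto
  then have "symm (bdry d H) = (%_. 0)" using IH(3) by (metis bdry_symm)
  then have sy: "symc (bdry d H)"
   unfolding symc_def symm_def fun_eq_iff by (simp add: bit_add_eq_0_iff)
  have kc: "kchain d n k (bdry d H)"
   unfolding H_def using IH(1) n kchain_restr kchain_bdry by blast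
  have ex: "EX i e. (e = 1 | e = -1) & Kc m (w(i := w i + e)) ~= 0 & w(i := w i + e) : Q (Suc k)"
   if "bdry d H w ~= 0" for w
   using bdry_nonzeroE[OF that] unfolding H_def restr_def by metis
  have *: "G (Suc (Suc m)) w & (ALL j:{d - Suc m..<d}. Gj j (Suc (Suc m)) w)" if w: "bdry d H w ~= 0" for w
  proof -
   obtain i e where e: "e = 1 | e = -1" "Kc m (w(i := w i + e)) ~= 0" "w(i := w i + e) : Q (Suc k)"
    using ex[OF w] by blast
   have G: "G (Suc (Suc m)) w" using IH(5)[OF e(2)] near_face[OF _ e(1)] unfolding G_def by blast
   have Gj: "Gj j (Suc (Suc m)) w" if "j : {d-m..<d}" for j
    using IH(6)[OF e(2) that] near_face[OF _ e(1)] unfolding Gj_def by blast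
   \<comment> \<open>By symmetry the antipode of w also has a neighbour in the half; reflecting that
     neighbour gives a point near w at which the odd function is <= 0.\<close>
   have "bdry d H (antipode w) ~= 0" using w sy by (simp add: symc_def)
   then obtain i' e' where e': "e' = 1 | e' = -1"
    "(antipode w)(i' := antipode w i' + e') : Q (Suc k)" (is "?y : _")
    using ex by blast
   have "near (Suc (Suc m)) w (w(i := w i + e))" using e by (auto simp: near_def)
   moreover have "g (Suc k) (pt (w(i := w i + e))) >= 0" using e(3) by (auto simp: Q_def)
   moreover have "near (Suc (Suc m)) w (antipode ?y)"
    using e' unfolding near_anti[symmetric] by (auto simp: near_def)
   moreover have "g (Suc k) (pt (antipode ?y)) <= 0"
    using e'(2) by (auto simp: Q_def pt_anti odd_g)
   ultimately have "Gj (Suc k) (Suc (Suc m)) w" unfolding Gj_def by blast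
   moreover have "j = Suc k | j : {d-m..<d}" if "j : {d - Suc m..<d}" for j using that k by auto
   ultimately show ?thesis using G Gj by blast
  qed
  have "ind d n Q k (bdry d H) = 1" using IH(4) by (simp add: H_def)
  moreover have "d - Suc (Suc m) = k" by (simp add: k_def)
  ultimately show ?case using * sy kc by (simp add: KS bdry_bdry)
 qed
 have "ind d n Q 0 (Kc (d - 1)) = 1" using inv[of "d - 1"] by simp
 moreover have "ind d n Q 0 (%_. 0) = 0" by (simp add: restr_def)
 ultimately have "Kc (d - 1) ~= (%_. 0)" by (metis zero_neq_one)
 then obtain w where "Kc (d - 1) w ~= 0" by (meson ext)
 then have w: "G d w" "!!j. j : {1..<d} ==> Gj j d w" using inv[of "d - 1"] d by auto
 have nearD: "ALL i. \<bar>pt z i - pt w i\<bar> <= d * h" if "near d w z" for z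
 proof
  fix i
  have "\<bar>real_of_int (z i) - real_of_int (w i)\<bar> <= d"
   using that unfolding near_def by (metis of_int_abs of_int_diff of_int_le_iff of_int_of_nat_eq)
  then have "h * \<bar>real_of_int (z i) - real_of_int (w i)\<bar> <= h * d" using h by simp
  moreover have "h * \<bar>real_of_int (z i) - real_of_int (w i)\<bar> = \<bar>h * real_of_int (z i) - h * real_of_int (w i)\<bar>"
   using h by (simp add: abs_mult flip: right_diff_distrib)
  ultimately show "\<bar>pt z i - pt w i\<bar> <= d * h"
   using h by (auto simp: pt_def mult.commute)
 qed
 have at: "attained_near d (d * h) (pt w) P" if "EX z. near d w z & P (pt z)" for P
  using that nearD pt unfolding attained_near_def by blast
 show ?thesis
  by (intro bexI[OF _ pt[of w]] conjI ballI at) (use w in \<open>auto simp: G_def Gj_def\<close>)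
qed

text \<open>The mesh is sent to zero. The approximate points stay bounded, because points with s < 0
  lie in the box of radius R, and at a limit point each function is both >= 0 and <= 0 by
  continuity.\<close>

theorem borsuk_common_zero:
 fixes g :: "nat => (nat => real) => real" and R :: real
 assumes d: "d > 0" and R: "R > 0"
  and cont_g: "!!j. continuous_on (fin_sp d) (g j)" and cont_s: "continuous_on (fin_sp d) s"
  and odd_g: "!!j x. x : fin_sp d ==> g j (%i. - x i) = - g j x"
  and even_s: "!!x. x : fin_sp d ==> s (%i. - x i) = s x"
  and s0: "s (%_. 0) < (0::real)"
  and sR: "!!x i. x : fin_sp d ==> i < d ==> \<bar>x i\<bar> >= R ==> s x > 0"
 obtains x where "x : fin_sp d" "s x = 0" "!!j. j : {1..<d} ==> g j x = 0"
proof -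
 define h where "h k = inverse (real (Suc k))" for k
 have hp: "h k > 0" "h k <= 1" for k by (auto simp: h_def field_simps)
 have "EX x:fin_sp d. attained_near d (d * h k) x (%y. s y < 0) & attained_near d (d * h k) x (%y. s y >= 0) &
  (ALL j:{1..<d}. attained_near d (d * h k) x (%y. g j y >= 0) & attained_near d (d * h k) x (%y. g j y <= 0))" for k
  by (rule borsuk_approx[where g = g and s = s and R = R, OF d hp(1) R _ _ s0]) (use odd_g even_s sR in blast)+
 then obtain x where x: "!!k. x k : fin_sp d" "!!k. attained_near d (d * h k) (x k) (%y. s y < 0)"
  "!!k. attained_near d (d * h k) (x k) (%y. s y >= 0)"
  and g: "!!k j. j : {1..<d} ==> attained_near d (d * h k) (x k) (%y. g j y >= 0)"
   "!!k j. j : {1..<d} ==> attained_near d (d * h k) (x k) (%y. g j y <= 0)"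
  by metis
 have bnd: "\<bar>x k i\<bar> <= R + d" for k i
 proof (cases "i < d")
  case True
  obtain y where y: "y : fin_sp d" "\<bar>y i - x k i\<bar> <= d * h k" "s y < 0"
   using x(2)[of k] unfolding attained_near_def by blast
  have "\<bar>y i\<bar> < R" using sR[OF y(1) True] y(3) by force
  moreover have "d * h k <= d" using hp[of k] by (simp add: mult_left_le)
  ultimately show ?thesis using y(2) by linarith
 next
  case False
  then show ?thesis using x(1)[of k] R by (simp add: fin_sp_def)
 qed
 obtain l r where l: "l : fin_sp d" "strict_mono (r :: nat => nat)" "(%k. x (r k)) ----> l"
  by (rule fin_sp_subseq[OF x(1) bnd])
 have lim: "F l >= 0" if F: "continuous_on (fin_sp d) F" and n: "!!k. attained_near d (d * h k) (x k) (%y. F y >= 0)"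
  for F :: "_ => real"
 proof -
  obtain z where z: "!!k. z k : fin_sp d" "!!k i. \<bar>z k i - x k i\<bar> <= d * h k" "!!k. F (z k) >= 0"
   using n unfolding attained_near_def by metis
  have "(%k. z (r k)) ----> l"
   unfolding tendsto_fun_iff
  proof
   fix i
   have "(%k. inverse (real (Suc (r k)))) ----> 0"
    using LIMSEQ_subseq_LIMSEQ[OF LIMSEQ_inverse_real_of_nat l(2)] by (simp add: o_def)
   from tendsto_mult_left[OF this, of "real d"] have h0: "(%k. d * h (r k)) ----> 0"
    by (simp add: h_def)
   have "\<forall>\<^sub>F k in sequentially. norm (z (r k) i - x (r k) i) <= d * h (r k)" using z(2) by simp
   from Lim_null_comparison[OF this h0] have "(%k. z (r k) i - x (r k) i) ----> 0" .
   moreover have "(%k. x (r k) i) ----> l i" using l(3) by (simp add: tendsto_fun_iff)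
   ultimately show "(%k. z (r k) i) ----> l i"
    using tendsto_add[of "%k. z (r k) i - x (r k) i" 0 sequentially "%k. x (r k) i" "l i"] by simp
  qed
  from continuous_on_tendsto_compose[OF F this l(1)] show ?thesis
   using z by (intro LIMSEQ_le_const) auto
 qed
 have weaken: "attained_near d ep y P ==> (!!z. P z ==> Q z) ==> attained_near d ep y Q" for ep y P Q
  unfolding attained_near_def by blast
 have "s l >= 0" by (rule lim[OF cont_s x(3)])
 moreover have "- s l >= 0" by (rule lim[OF continuous_on_minus[OF cont_s]]) (rule weaken[OF x(2)], simp)
 moreover have "g j l = 0" if j: "j : {1..<d}" for j
 proof -
  have "g j l >= 0" by (rule lim[OF cont_g g(1)[OF j]])
  moreover have "- g j l >= 0" by (rule lim[OF continuous_on_minus[OF cont_g]]) (rule weaken[OF g(2)[OF j]], simp)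
  ultimately show ?thesis by simp
 qed
 ultimately show ?thesis using that l(1) by force
qed

section \<open>Minimax by a single gradient step\<close>

lemma compact_fin_sp_box: "compact {x : fin_sp n. ALL i. \<bar>x i\<bar> <= (R::real)}"
proof -
 have "{x : fin_sp n. ALL i. \<bar>x i\<bar> <= R} = {x. ALL i. x i : (if i < n then {-R..R} else {0} \<inter> {-R..R})}"
 proof (intro set_eqI iffI)
  fix x assume x: "x : {x : fin_sp n. ALL i. \<bar>x i\<bar> <= R}"
  have "x i : (if i < n then {-R..R} else {0} \<inter> {-R..R})" for i
  proof -
   have "\<bar>x i\<bar> <= R" "i >= n ==> x i = 0" using x by (auto simp: fin_sp_def)
   then show ?thesis by (auto simp: abs_le_iff)
  qed
  then show "x : {x. ALL i. x i : (if i < n then {-R..R} else {0} \<inter> {-R..R})}" by blast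
 next
  fix x assume x: "x : {x. ALL i. x i : (if i < n then {-R..R} else {0} \<inter> {-R..R})}"
  have *: "\<bar>x i\<bar> <= R & (i >= n --> x i = 0)" for i
  proof -
   have "x i : (if i < n then {-R..R} else {0} \<inter> {-R..R})" using x by blast
   then show ?thesis by (auto split: if_splits)
  qed
  then show "x : {x : fin_sp n. ALL i. \<bar>x i\<bar> <= R}" by (simp add: fin_sp_def)
 qed
 then show ?thesis by (simp only:) (rule compact_fun_box, auto)
qed

text \<open>If no critical point had the minimax level, one gradient step, instead of a flow, would
  push a nearly optimal set below it. The step is switched off where J <= 0, so that it preserves
  the class, and it is odd because J is even. Boundedness of the set where J >= 0 supplies the
  compactness.\<close>

lemma minimax_critical_point:
 fixes J :: "(nat => real) => real" and D :: "nat => (nat => real) => real"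
 assumes contJ: "continuous_on (fin_sp n) J"
  and contD: "!!i. i < n ==> continuous_on (fin_sp n) (D i)"
  and deriv: "!!x h t. x : fin_sp n ==> h : fin_sp n ==>
   ((%t. J (%i. x i + t * h i)) has_real_derivative (\<Sum>i<n. h i * D i (%i. x i + t * h i))) (at t)"
  and evenJ: "!!x. x : fin_sp n ==> J (%i. - x i) = J x"
  and oddD: "!!x i. x : fin_sp n ==> i < n ==> D i (%i. - x i) = - D i x"
  and bnd: "!!x i. x : fin_sp n ==> J x >= 0 ==> \<bar>x i\<bar> <= R"
  and sub: "!!A. A : \<A> ==> A \<subseteq> fin_sp n"
  and stable: "!!A eta. A : \<A> ==> continuous_on (fin_sp n) eta ==> eta ` fin_sp n \<subseteq> fin_sp n ==>
   (!!x. x : fin_sp n ==> eta (%i. - x i) = (%i. - eta x i)) ==>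
   (!!x. x : fin_sp n ==> J x <= 0 ==> eta x = x) ==> eta ` A : \<A>"
  and low: "!!A. A : \<A> ==> EX x:A. J x >= Lam" and Lam: "Lam > 0"
  and A0: "A0 : \<A>" "!!x. x : A0 ==> J x <= beta"
 shows "EX x:fin_sp n. (ALL i<n. D i x = 0) & Lam <= J x & J x <= beta"
proof -
 \<comment> \<open>Upper bounds are recorded instead of suprema, so that their infimum is the
   minimax level even if J is unbounded above on some member of the class.\<close>
 define S where "S = {b. EX A:\<A>. ALL x:A. J x <= b}"
 define c where "c = Inf S"
 have betaS: "beta : S" using A0 by (auto simp: S_def)
 have Slow: "Lam <= b" if "b : S" for b
  using that low unfolding S_def by force
 have bdd: "bdd_below S" using Slow by (meson bdd_below.I)
 have c: "Lam <= c" "c <= beta"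
  unfolding c_def using betaS Slow bdd by (auto intro: cInf_greatest cInf_lower)
 define G where "G x = (\<Sum>i<n. (D i x)\<^sup>2)" for x
 have contG: "continuous_on (fin_sp n) G" unfolding G_def by (intro continuous_intros contD) auto
 have G0: "G x >= 0" for x by (simp add: G_def sum_nonneg)
 have "EX x:fin_sp n. (ALL i<n. D i x = 0) & J x = c"
 proof (rule ccontr)
  assume nc: "~ ?thesis"
  \<comment> \<open>The step moves only points with J > 0, and these all lie in the compact set
    \<open>B\<close>.\<close>
  define B where "B = {x : fin_sp n. ALL i. \<bar>x i\<bar> <= \<bar>R\<bar>}"
  have B: "compact B" "B \<subseteq> fin_sp n" unfolding B_def by (auto simp: compact_fin_sp_box)
  have "(%_. 0) : B" by (simp add: B_def fin_sp_def)
  moreover have "continuous_on B (%x. \<bar>J x - c\<bar> + G x)"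
   by (intro continuous_intros continuous_on_subset[OF contJ B(2)] continuous_on_subset[OF contG B(2)])
  ultimately obtain x0 where x0: "x0 : B" "!!x. x : B ==> \<bar>J x0 - c\<bar> + G x0 <= \<bar>J x - c\<bar> + G x"
   using continuous_attains_inf[OF B(1)] by blast
  define m where "m = \<bar>J x0 - c\<bar> + G x0"
  have "m > 0"
  proof (rule ccontr)
   assume "~ m > 0"
   then have "J x0 = c" "G x0 = 0" using G0[of x0] unfolding m_def by linarith+
   then have "ALL i<n. D i x0 = 0" by (auto simp: G_def sum_nonneg_eq_0_iff)
   then show False using nc x0(1) B(2) \<open>J x0 = c\<close> by blast
  qed
  \<comment> \<open>Within ep of the level c the squared gradient is at least de; ep <= c / 2 keeps
    this range where the cutoff \<open>psi\<close> equals one.\<close>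
  define ep de where "ep = min (m / 2) (c / 2)" and "de = m / 2"
  have pos: "ep > 0" "de > 0" "ep <= c / 2" "ep <= m / 2" "c > 0"
   using \<open>m > 0\<close> c Lam by (auto simp: ep_def de_def)
  have gap: "G x >= de" if "x : B" "\<bar>J x - c\<bar> <= ep" for x
  proof -
   have "m <= \<bar>J x - c\<bar> + G x" using x0(2)[OF that(1)] by (simp add: m_def)
   then show ?thesis using that(2) pos(4) unfolding de_def by linarith
  qed
  define psi where "psi x = max 0 (min 1 (2 * J x / c))" for x
  have psi: "0 <= psi x" "psi x <= 1" for x by (auto simp: psi_def)
  have contpsi: "continuous_on (fin_sp n) psi"
   unfolding psi_def by (intro continuous_intros contJ) (use pos in auto)
  define eta where "eta t x = (%i. if i < n then x i - t * (psi x * D i x) else 0)" for t and x :: "nat => real"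
  have eta_in: "eta t x : fin_sp n" for t x by (simp add: eta_def fin_sp_def)
  define Q where "Q x t = (\<Sum>i<n. D i x * (D i x - D i (eta t x)))" for x t
  \<comment> \<open>For short steps the derivative hardly changes along the segment, uniformly on
    \<open>B\<close>; a sequence of counterexamples would have a limit point in contradiction to
    continuity.\<close>
  have "EX t0>0. ALL x:B. ALL t:{0..t0}. Q x t <= de / 2"
  proof (rule ccontr)
   assume neg: "~ ?thesis"
   have "EX x t. x : B & 0 <= t & t <= inverse (real (Suc k)) & Q x t > de / 2" for k
   proof -
    have "inverse (real (Suc k)) > 0" by simp
    then have "~ (ALL x:B. ALL t:{0..inverse (real (Suc k))}. Q x t <= de / 2)" using neg by blast
    then show ?thesis by (metis atLeastAtMost_iff not_le)
   qed
   then obtain x t where xt: "!!k. x k : B" "!!k. 0 <= t k" "!!k. t k <= inverse (real (Suc k))"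
    "!!k. Q (x k) (t k) > de / 2"
    by metis
   have "!!k. x k : fin_sp n" "!!k i. \<bar>x k i\<bar> <= \<bar>R\<bar>" using xt(1) by (auto simp: B_def)
   then obtain l r where l: "l : fin_sp n" "!!i. \<bar>l i\<bar> <= \<bar>R\<bar>" "strict_mono (r :: nat => nat)"
     "(%k. x (r k)) ----> l"
    using fin_sp_subseq[of x n "\<bar>R\<bar>"] by blast
   have t0: "(%k. t (r k)) ----> 0"
   proof -
    have "\<forall>\<^sub>F k in sequentially. norm (t k) <= inverse (real (Suc k))" using xt(2,3) by simp
    from Lim_null_comparison[OF this LIMSEQ_inverse_real_of_nat] show ?thesis
     using LIMSEQ_subseq_LIMSEQ[OF _ l(3)] by (simp add: o_def)
   qed
   have xin: "x (r k) : fin_sp n" for k using xt(1) B(2) by blast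
   have lim: "(%k. F (x (r k))) ----> F l" if "continuous_on (fin_sp n) F" for F :: "_ => real"
    using continuous_on_tendsto_compose[OF that l(4) l(1)] xin by simp
   have etal: "(%k. eta (t (r k)) (x (r k))) ----> l"
    unfolding tendsto_fun_iff
   proof
    fix i
    show "(%k. eta (t (r k)) (x (r k)) i) ----> l i"
    proof (cases "i < n")
     case True
     have "(%k. x (r k) i - t (r k) * (psi (x (r k)) * D i (x (r k)))) ----> l i - 0 * (psi l * D i l)"
      using l(4) unfolding tendsto_fun_iff
      by (intro tendsto_diff tendsto_mult t0 lim[OF contpsi] lim[OF contD[OF True]]) blast
     then show ?thesis using True by (simp add: eta_def)
    next
     case False
     then show ?thesis using l(1) by (simp add: eta_def fin_sp_def)
    qed
   qed
   have "(%k. D i (eta (t (r k)) (x (r k)))) ----> D i l" if "i < n" for i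
    using continuous_on_tendsto_compose[OF contD[OF that] etal l(1)] eta_in by simp
   then have "(%k. Q (x (r k)) (t (r k))) ----> (\<Sum>i<n. D i l * (D i l - D i l))"
    unfolding Q_def by (intro tendsto_intros lim contD) auto
   then have "(%k. Q (x (r k)) (t (r k))) ----> 0" by simp
   moreover have "de / 2 <= Q (x (r k)) (t (r k))" for k using xt(4)[of "r k"] by simp
   ultimately have "de / 2 <= 0" by (meson LIMSEQ_le_const)
   then show False using pos by simp
  qed
  then obtain t0 where t0: "t0 > 0" "!!x t. x : B ==> 0 <= t ==> t <= t0 ==> Q x t <= de / 2" by auto
  define t where "t = min t0 (ep / de)"
  have t: "t > 0" "t <= t0" "t * de <= ep" using t0 pos by (auto simp: t_def min_def field_simps)
  \<comment> \<open>The mean value theorem along the step; \<open>Q\<close> measures how far the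
    derivative has turned on the way.\<close>
  have dec: "J (eta t x) <= J x - t * psi x * (G x - de / 2)" if x: "x : B" for x
  proof -
   define h where "h = (%i. if i < n then - t * (psi x * D i x) else 0)"
   have h: "h : fin_sp n" by (simp add: h_def fin_sp_def)
   have xn: "x : fin_sp n" using x B by blast
   have etas: "(%i. x i + s * h i) = eta (s * t) x" for s
    using xn by (auto simp: h_def eta_def fin_sp_def)
   have "EX z. 0 < z & z < 1 & J (%i. x i + 1 * h i) - J (%i. x i + 0 * h i) =
     (1 - 0) * (\<Sum>i<n. h i * D i (%i. x i + z * h i))"
    by (rule MVT2) (use deriv[OF xn h] in auto)
   then obtain z where z: "0 < z" "z < 1" "J (eta t x) - J x = (\<Sum>i<n. h i * D i (eta (z * t) x))"
    by (auto simp: etas[of 1, simplified] etas)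
   have "(\<Sum>i<n. h i * D i (eta (z * t) x)) = - t * psi x * (\<Sum>i<n. D i x * D i (eta (z * t) x))"
    unfolding sum_distrib_left by (intro sum.cong) (auto simp: h_def)
   also have "(\<Sum>i<n. D i x * D i (eta (z * t) x)) = G x - Q x (z * t)"
    by (simp add: G_def Q_def power2_eq_square algebra_simps sum_subtractf)
   finally have e: "J (eta t x) = J x - t * psi x * (G x - Q x (z * t))" using z(3) by simp
   have "z * t <= 1 * t" using z t by (intro mult_right_mono) auto
   then have "z * t <= t0" using t by linarith
   then have "Q x (z * t) <= de / 2" using z t by (intro t0(2) x) auto
   then have "t * psi x * (G x - de / 2) <= t * psi x * (G x - Q x (z * t))"
    using t psi[of x] by (intro mult_left_mono) auto
   then show ?thesis using e by simp
  qed
  define ep' where "ep' = min ep (t * de / 4)"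
  have ep': "ep' > 0" "ep' <= ep" "ep' <= t * de / 4" using pos t by (auto simp: ep'_def)
  have "EX b:S. b < c + ep'"
   unfolding c_def using betaS bdd ep'(1) by (subst cInf_less_iff[symmetric]) auto
  then obtain b A where bA: "A : \<A>" "ALL x:A. J x <= b" "b < c + ep'" by (auto simp: S_def)
  \<comment> \<open>Points below c - ep rise by at most ep / 2; points near c fall by t * de / 2
    from a level of at most c + t * de / 4. Both end at or below this value.\<close>
  define c' where "c' = c - min (ep / 2) (t * de / 4)"
  have c': "c' < c" "c' >= c - ep / 2" "c' >= c - t * de / 4" using pos t by (auto simp: c'_def)
  have etaid: "eta t x = x" if "x : fin_sp n" "J x <= 0" for x
  proof -
   have "2 * J x / c <= 0" using that(2) pos(5) by (simp add: divide_nonpos_pos)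
   then have "psi x = 0" by (simp add: psi_def)
   then show ?thesis using that(1) by (auto simp: eta_def fin_sp_def)
  qed
  have le: "J (eta t x) <= c'" if x: "x : A" for x
  proof (cases "J x <= 0")
   case True
   then have "J (eta t x) <= 0" using etaid sub[OF bA(1)] x by (metis subsetD)
   also have "0 <= c - ep / 2" using pos by simp
   finally show ?thesis using c' by simp
  next
   case False
   have xn: "x : fin_sp n" using sub[OF bA(1)] x by blast
   have "\<bar>x i\<bar> <= \<bar>R\<bar>" for i using bnd[OF xn, of i] False by linarith
   then have xB: "x : B" unfolding B_def using xn by blast
   show ?thesis
   proof (cases "J x < c - ep")
    case True
    have "t * psi x * (de / 2 - G x) <= t * 1 * (de / 2)"
    proof -
     have "t * psi x * (de / 2 - G x) <= t * psi x * (de / 2)"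
      using G0[of x] t psi[of x] by (intro mult_left_mono) auto
     also have "... <= t * 1 * (de / 2)"
      using psi[of x] t pos by (intro mult_mono) auto
     finally show ?thesis .
    qed
    moreover have "t * psi x * (de / 2 - G x) = - (t * psi x * (G x - de / 2))" by (simp add: algebra_simps)
    ultimately have "J (eta t x) <= J x + t * (de / 2)" using dec[OF xB] by linarith
    also have "... <= c - ep + ep / 2" using True t(3) by (simp add: algebra_simps)
    finally show ?thesis using c' by simp
   next
    case False
    have up: "J x <= c + ep'" using bA x by force
    have G: "G x >= de" using False up ep' by (intro gap xB) auto
    have "J x >= c / 2" using False pos by linarith
    then have "2 * J x / c >= 1" using pos(5) by (simp add: field_simps)
    then have "psi x = 1" by (simp add: psi_def)
    then have "J (eta t x) <= J x - t * (G x - de / 2)" using dec[OF xB] by simp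
    also have "... <= J x - t * (de / 2)" using G t by (intro diff_left_mono mult_left_mono) auto
    also have "... <= c - t * de / 4" using up ep'(3) by simp
    finally show ?thesis using c' by simp
   qed
  qed
  have "eta t ` A : \<A>"
  proof (rule stable[OF bA(1)])
   show "continuous_on (fin_sp n) (eta t)"
   proof (rule continuous_on_coordinatewise_then_product)
    fix i
    show "continuous_on (fin_sp n) (%x. eta t x i)"
    proof (cases "i < n")
     case True
     then show ?thesis
      unfolding eta_def by (simp, intro continuous_intros contpsi contD continuous_on_subset[OF continuous_on_product_coordinates]) auto
    qed (simp add: eta_def)
   qed
   show "eta t (%i. - x i) = (%i. - eta t x i)" if "x : fin_sp n" for x
    using that by (auto simp: eta_def psi_def evenJ oddD)
  qed (use eta_in etaid in auto)
  then have "c' : S" using le unfolding S_def by blast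
  then have "c <= c'" unfolding c_def by (intro cInf_lower bdd)
  then show False using c'(1) by simp
 qed
 then show ?thesis using c by blast
qed

section \<open>Test functions and weak gradients\<close>

text \<open>Powers of t are divided out to close the family under differentiation: the derivative of
  \<open>flat_exp j\<close> combines \<open>flat_exp (j + 2)\<close> and
  \<open>flat_exp (Suc j)\<close>.\<close>

definition flat_exp :: "nat => real => real" where
 "flat_exp j t = (if t > 0 then exp (- (1 / t)) / t ^ j else 0)"

text \<open>A single term of the exponential series of 1 / t beats the power t ^ j with a factor t
  to spare; this is what makes the derivative at the origin vanish.\<close>

lemma flat_exp_le: "0 <= t ==> flat_exp j t <= fact (Suc j) * t"
proof (cases "t > 0")
 case True
 have "(1 / t) ^ Suc j / fact (Suc j) <= exp (1 / t)"
 proof -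
  have "(1 / t) ^ Suc j / fact (Suc j) <= (\<Sum>k\<in>{Suc j}. (1 / t) ^ k /\<^sub>R fact k)"
   by (simp add: divide_inverse mult.commute)
  also have "... <= exp (1 / t)"
   unfolding exp_def by (rule sum_le_suminf) (use True summable_exp_generic[of "1/t"] in auto)
  finally show ?thesis .
 qed
 then have "1 / (fact (Suc j) * t ^ Suc j) <= exp (1 / t)"
  by (simp add: power_one_over divide_simps mult.commute)
 then have "1 <= exp (1 / t) * (fact (Suc j) * t ^ Suc j)"
  using True by (subst (asm) pos_divide_le_eq) (auto intro!: mult_pos_pos)
 then have "exp (- (1 / t)) * 1 <= exp (- (1 / t)) * (exp (1 / t) * (fact (Suc j) * t ^ Suc j))"
  by (intro mult_left_mono) auto
 also have "... = fact (Suc j) * t ^ Suc j" by (simp add: exp_minus field_simps)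
 finally have "exp (- (1 / t)) <= (fact (Suc j) * t) * t ^ j" by (simp add: mult.assoc)
 then have "exp (- (1 / t)) / t ^ j <= fact (Suc j) * t" using True by (subst pos_divide_le_eq) auto
 then show ?thesis using True by (simp add: flat_exp_def)
qed (simp add: flat_exp_def)

lemma flat_exp_nonneg: "flat_exp j t >= 0"
 by (simp add: flat_exp_def)

lemma DERIV_flat_exp:
 "(flat_exp j has_real_derivative (flat_exp (j + 2) t - real j * flat_exp (Suc j) t)) (at t)"
proof -
 consider "t > 0" | "t < 0" | "t = 0" by linarith
 then show ?thesis
 proof cases
  case 1
  have "((%t. exp (- (1 / t)) / t ^ j) has_real_derivative
    (exp (- (1 / t)) / t ^ (j + 2) - real j * (exp (- (1 / t)) / t ^ Suc j))) (at t)"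
  proof (cases j)
   case 0
   then show ?thesis using 1
    by (auto intro!: derivative_eq_intros simp: field_simps power2_eq_square)
  next
   case (Suc i)
   show ?thesis unfolding Suc using 1
    by (auto intro!: derivative_eq_intros) (simp add: divide_simps power2_eq_square, simp add: algebra_simps, cases i, auto)
  qed
  then have "(flat_exp j has_real_derivative
    (exp (- (1 / t)) / t ^ (j + 2) - real j * (exp (- (1 / t)) / t ^ Suc j))) (at t)"
   by (rule has_field_derivative_transform_within_open[where S = "{0<..}"])
    (use 1 in \<open>auto simp: flat_exp_def\<close>)
  then show ?thesis using 1 by (simp add: flat_exp_def)
 next
  case 2
  have "((%_. 0) has_real_derivative 0) (at t)" by simp
  then have "(flat_exp j has_real_derivative 0) (at t)"
   by (rule has_field_derivative_transform_within_open[where S = "{..<0}"])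
    (use 2 in \<open>auto simp: flat_exp_def\<close>)
  then show ?thesis using 2 by (simp add: flat_exp_def)
 next
  case 3
  have q: "(flat_exp j h - flat_exp j 0) / h = flat_exp (Suc j) h" for h
   by (simp add: flat_exp_def)
  have "\<forall>\<^sub>F h in at 0. norm (flat_exp (Suc j) h) <= fact (Suc (Suc j)) * \<bar>h\<bar>"
  proof (rule always_eventually, intro allI)
   fix h :: real
   show "norm (flat_exp (Suc j) h) <= fact (Suc (Suc j)) * \<bar>h\<bar>"
   proof (cases "h >= 0")
    case True
    then show ?thesis using flat_exp_le[of h "Suc j"] flat_exp_nonneg[of "Suc j" h] by simp
   qed (simp add: flat_exp_def mult_nonneg_nonpos del: fact_Suc)
  qed
  moreover have "((%h. fact (Suc (Suc j)) * \<bar>h\<bar>) \<longlongrightarrow> 0) (at (0::real))"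
   by (auto intro!: tendsto_eq_intros)
  ultimately have "(flat_exp (Suc j) \<longlongrightarrow> 0) (at 0)" by (rule Lim_null_comparison)
  then show ?thesis
   unfolding 3 DERIV_def using q by (simp add: flat_exp_def cong: LIM_cong)
 qed
qed

text \<open>A syntactic class whose rules are stable under directional derivatives;
  differentiability of all orders then follows by one induction.\<close>

inductive smooth_fn :: "('a::euclidean_space => real) => bool" where
 const: "smooth_fn (%x. c)"
| inner: "smooth_fn (%x. x \<bullet> b)"
| add: "smooth_fn f ==> smooth_fn g ==> smooth_fn (%x. f x + g x)"
| mult: "smooth_fn f ==> smooth_fn g ==> smooth_fn (%x. f x * g x)"
| flat: "smooth_fn f ==> smooth_fn (%x. flat_exp j (f x))"
| inv: "smooth_fn f ==> (!!x. f x ~= 0) ==> smooth_fn (%x. inverse (f x))"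

lemma smooth_fn_derivative:
 "smooth_fn f ==> EX D. (ALL x. (f has_derivative D x) (at x)) & (ALL b. smooth_fn (%x. D x b))"
proof (induction rule: smooth_fn.induct)
 case (const c)
 show ?case by (rule exI[of _ "%_ _. 0"]) (auto intro: smooth_fn.const)
next
 case (inner b)
 show ?case by (rule exI[of _ "%_ h. h \<bullet> b"]) (auto intro!: smooth_fn.const derivative_eq_intros)
next
 case (add f g)
 then obtain D E where "ALL x. (f has_derivative D x) (at x)" "ALL b. smooth_fn (%x. D x b)"
  "ALL x. (g has_derivative E x) (at x)" "ALL b. smooth_fn (%x. E x b)" by blast
 then show ?case
  by (intro exI[of _ "%x h. D x h + E x h"]) (auto intro!: smooth_fn.add has_derivative_add)
next
 case (mult f g)
 then obtain D E where "ALL x. (f has_derivative D x) (at x)" "ALL b. smooth_fn (%x. D x b)"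
  "ALL x. (g has_derivative E x) (at x)" "ALL b. smooth_fn (%x. E x b)" by blast
 then show ?case using mult
  by (intro exI[of _ "%x h. f x * E x h + D x h * g x"])
   (auto intro!: smooth_fn.add smooth_fn.mult has_derivative_mult)
next
 case (flat f j)
 then obtain D where D: "ALL x. (f has_derivative D x) (at x)" "ALL b. smooth_fn (%x. D x b)" by blast
 show ?case
 proof (intro exI[of _ "%x h. (flat_exp (j + 2) (f x) + (- real j) * flat_exp (Suc j) (f x)) * D x h"] conjI allI)
  fix x
  have "((%x. flat_exp j (f x)) has_derivative
    (%h. (flat_exp (j + 2) (f x) - real j * flat_exp (Suc j) (f x)) * D x h)) (at x)"
   using has_derivative_compose[OF D(1)[rule_format] DERIV_flat_exp[THEN has_field_derivative_imp_has_derivative]]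
   by simp
  then show "((%x. flat_exp j (f x)) has_derivative
    (%h. (flat_exp (j + 2) (f x) + (- real j) * flat_exp (Suc j) (f x)) * D x h)) (at x)"
   by simp
 next
  fix b show "smooth_fn (%x. (flat_exp (j + 2) (f x) + (- real j) * flat_exp (Suc j) (f x)) * D x b)"
   using D flat by (intro smooth_fn.add smooth_fn.mult smooth_fn.flat smooth_fn.const) auto
 qed
next
 case (inv f)
 then obtain D where D: "ALL x. (f has_derivative D x) (at x)" "ALL b. smooth_fn (%x. D x b)" by blast
 show ?case
 proof (intro exI[of _ "%x h. (- 1) * (inverse (f x) * D x h * inverse (f x))"] conjI allI)
  fix x show "((%x. inverse (f x)) has_derivative (%h. (- 1) * (inverse (f x) * D x h * inverse (f x)))) (at x)"
   using Deriv.has_derivative_inverse[OF inv(2) D(1)[rule_format, of x]] by simp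
 next
  fix b show "smooth_fn (%x. (- 1) * (inverse (f x) * D x b * inverse (f x)))"
   using D inv by (intro smooth_fn.mult smooth_fn.inv smooth_fn.const) auto
 qed
qed

lemma smooth_fn_Ck: "smooth_fn f ==> Ck k f"
proof (induction k arbitrary: f)
 case 0
 then obtain D where "ALL x. (f has_derivative D x) (at x)" using smooth_fn_derivative by blast
 then show ?case
  by (auto simp: continuous_on_eq_continuous_at intro: has_derivative_continuous)
next
 case (Suc k)
 then obtain D where D: "ALL x. (f has_derivative D x) (at x)" "ALL b. smooth_fn (%x. D x b)"
  using smooth_fn_derivative by blast
 then have "frechet_derivative f (at x) = D x" for x
  by (metis frechet_derivative_at)
 then show ?case using D Suc.IH by (auto simp: differentiable_def)
qed

lemma Ck_lincomb: "Ck k f ==> Ck k g ==> Ck k (%x. c * f x + d * g x)"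
proof (induction k arbitrary: f g)
 case 0
 then show ?case by (auto intro!: continuous_intros)
next
 case (Suc k)
 have f: "(f has_derivative frechet_derivative f (at x)) (at x)"
  and g: "(g has_derivative frechet_derivative g (at x)) (at x)" for x
  using Suc.prems by (auto simp: frechet_derivative_works)
 have h: "((%x. c * f x + d * g x) has_derivative
   (%h. c * frechet_derivative f (at x) h + d * frechet_derivative g (at x) h)) (at x)" for x
  using f[of x] g[of x] by (auto intro!: derivative_eq_intros)
 then have "frechet_derivative (%x. c * f x + d * g x) (at x) =
   (%h. c * frechet_derivative f (at x) h + d * frechet_derivative g (at x) h)" for x
  by (metis frechet_derivative_at)
 then show ?case using h Suc by (auto simp: differentiable_def)
qed

section \<open>Gradients and integrals of test functions\<close>

definition grad :: "('a::euclidean_space => real) => 'a => 'a" where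
 "grad phi x = (\<Sum>b\<in>Basis. frechet_derivative phi (at x) b *\<^sub>R b)"

lemma grad_inner_Basis: "b : Basis ==> grad phi x \<bullet> b = frechet_derivative phi (at x) b"
 by (simp add: grad_def inner_sum_left inner_Basis if_distrib cong: if_cong)

lemma grad_has_derivative:
 assumes "phi differentiable (at x)"
 shows "(phi has_derivative (%h. grad phi x \<bullet> h)) (at x)"
proof -
 have d: "(phi has_derivative frechet_derivative phi (at x)) (at x)"
  using assms by (simp add: frechet_derivative_works)
 then interpret bounded_linear "frechet_derivative phi (at x)" by (rule has_derivative_bounded_linear)
 have "frechet_derivative phi (at x) h = grad phi x \<bullet> h" for h
 proof -
  have "frechet_derivative phi (at x) (\<Sum>b\<in>Basis. (h \<bullet> b) *\<^sub>R b) = (\<Sum>b\<in>Basis. (h \<bullet> b) * frechet_derivative phi (at x) b)"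
   by (simp add: sum scaleR)
  also have "... = grad phi x \<bullet> h"
   by (subst (2) inner_commute) (simp add: grad_def inner_sum_right mult.commute)
  finally show ?thesis by (simp add: euclidean_representation)
 qed
 then show ?thesis using d by presburger
qed

lemma grad_eqI:
 assumes "(phi has_derivative (%h. g \<bullet> h)) (at x)"
 shows "grad phi x = g"
proof -
 have "frechet_derivative phi (at x) = (%h. g \<bullet> h)" using assms by (metis frechet_derivative_at)
 then show ?thesis by (simp add: grad_def euclidean_representation)
qed

lemma test_functionsD:
 assumes "phi : test_functions Om"
 shows "Ck k phi" "continuous_on UNIV phi" "phi differentiable (at x)"
  "(phi has_derivative (%h. grad phi x \<bullet> h)) (at x)" "continuous_on UNIV (grad phi)"
proof -
 show C: "Ck k phi" for k using assms by (simp add: test_functions_def)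
 show "continuous_on UNIV phi" using C[of 0] by simp
 show D: "phi differentiable (at x)" for x using C[of "Suc 0"] by simp
 then show "(phi has_derivative (%h. grad phi x \<bullet> h)) (at x)" by (rule grad_has_derivative)
 show "continuous_on UNIV (grad phi)"
  unfolding grad_def[abs_def] using C[of "Suc 0"] by (auto intro!: continuous_intros)
qed

lemma test_functions_support:
 assumes "phi : test_functions Om"
 obtains K where "compact K" "K \<subseteq> Om" "!!x. x \<notin> K ==> phi x = 0" "!!x. x \<notin> K ==> grad phi x = 0"
proof
 let ?K = "closure {x. phi x ~= 0}"
 show "compact ?K" "?K \<subseteq> Om" using assms by (auto simp: test_functions_def)
 show z: "phi x = 0" if "x \<notin> ?K" for x
  using that closure_subset[of "{x. phi x ~= 0}"] by auto
 show "grad phi x = 0" if "x \<notin> ?K" for x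
 proof (rule grad_eqI)
  have "((%_. 0) has_derivative (%h. 0 \<bullet> h)) (at x)" by simp
  then show "(phi has_derivative (%h. 0 \<bullet> h)) (at x)"
  proof (rule has_derivative_transform_within_open[where s = "- ?K"])
   show "0 = phi y" if "y : - ?K" for y using z[of y] that by simp
  qed (use that in auto)
 qed
qed

lemma test_functions_zero_outside:
 assumes "phi : test_functions Om" "x \<notin> Om"
 shows "phi x = 0" "grad phi x = 0"
 using assms by (meson subsetD test_functions_support)+

lemma test_functions_bounded:
 assumes "phi : test_functions Om"
 obtains B where "B > 0" "!!x. \<bar>phi x\<bar> <= B" "!!x. norm (grad phi x) <= B"
proof -
 obtain K where K: "compact K" "!!x. x \<notin> K ==> phi x = 0" "!!x. x \<notin> K ==> grad phi x = 0"
  using assms test_functions_support by metis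
 have "bounded (phi ` K)" "bounded (grad phi ` K)"
  using K(1) test_functionsD(2,5)[OF assms]
  by (meson compact_continuous_image compact_imp_bounded continuous_on_subset subset_UNIV)+
 then obtain a b where ab: "a > 0" "b > 0" "!!x. x : K ==> norm (phi x) <= a" "!!x. x : K ==> norm (grad phi x) <= b"
  by (auto simp: bounded_pos)
 show ?thesis
 proof (rule that[of "a + b"])
  show "\<bar>phi x\<bar> <= a + b" for x using ab(1,2) ab(3)[of x] K(2)[of x] by (cases "x : K") auto
  show "norm (grad phi x) <= a + b" for x using ab(1,2) ab(4)[of x] K(3)[of x] by (cases "x : K") auto
 qed (use ab in auto)
qed

lemma test_functions_zero: "(%_. 0) : test_functions (Om :: 'a::euclidean_space set)"
proof -
 have "Ck k (%_::'a. 0)" for k by (rule smooth_fn_Ck[OF smooth_fn.const])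
 then show ?thesis by (simp add: test_functions_def)
qed

lemma test_functions_lincomb:
 assumes "phi : test_functions Om" "psi : test_functions Om"
 shows "(%x. c * phi x + d * psi x) : test_functions Om"
  "grad (%x. c * phi x + d * psi x) x = c *\<^sub>R grad phi x + d *\<^sub>R grad psi x"
proof -
 let ?f = "%x. c * phi x + d * psi x"
 have "{x. ?f x ~= 0} \<subseteq> closure {x. phi x ~= 0} \<union> closure {x. psi x ~= 0}"
  using closure_subset[of "{x. phi x ~= 0}"] closure_subset[of "{x. psi x ~= 0}"] by fastforce
 then have *: "closure {x. ?f x ~= 0} \<subseteq> closure {x. phi x ~= 0} \<union> closure {x. psi x ~= 0}"
  by (intro closure_minimal) auto
 have "bounded (closure {x. ?f x ~= 0})"
  using assms by (intro bounded_subset[OF _ *]) (auto simp: test_functions_def compact_imp_bounded)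
 then have "compact (closure {x. ?f x ~= 0})" by (simp add: compact_eq_bounded_closed)
 moreover have "closure {x. ?f x ~= 0} \<subseteq> Om" using * assms by (auto simp: test_functions_def)
 ultimately show "?f : test_functions Om"
  using assms by (simp add: test_functions_def Ck_lincomb)
 show "grad ?f x = c *\<^sub>R grad phi x + d *\<^sub>R grad psi x"
  using test_functionsD(4)[OF assms(1), of x] test_functionsD(4)[OF assms(2), of x]
  by (intro grad_eqI) (auto intro!: derivative_eq_intros simp: inner_add_left)
qed

lemma test_functions_sum:
 fixes Om :: "'a::euclidean_space set"
 assumes "finite I" "!!i. i : I ==> e i : test_functions Om"
 shows "(%x. \<Sum>i\<in>I. c i * e i x) : test_functions Om &
  grad (%x. \<Sum>i\<in>I. c i * e i x) = (%x. \<Sum>i\<in>I. c i *\<^sub>R grad (e i) x)"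
 using assms
proof (induction I rule: finite_induct)
 case empty
 have "grad (%_. 0) x = 0" for x :: 'a by (rule grad_eqI) simp
 then show ?case by (auto simp: test_functions_zero)
next
 case (insert i I)
 then have IH: "(%x. \<Sum>i\<in>I. c i * e i x) : test_functions Om"
  "grad (%x. \<Sum>i\<in>I. c i * e i x) = (%x. \<Sum>i\<in>I. c i *\<^sub>R grad (e i) x)" by auto
 have "e i : test_functions Om" using insert by simp
 from test_functions_lincomb[OF this IH(1), of "c i" 1] insert.hyps
 show ?case by (auto simp: IH(2))
qed

lemma line_derivative:
 fixes F :: "'a::euclidean_space => real"
 assumes "!!x. (F has_derivative (%h. G x \<bullet> h)) (at x)"
 shows "((%t. F (x + t *\<^sub>R h)) has_real_derivative (G (x + t *\<^sub>R h) \<bullet> h)) (at t)"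
proof -
 have "((%t. x + t *\<^sub>R h) has_derivative (%s. s *\<^sub>R h)) (at t)"
  by (auto intro!: derivative_eq_intros)
 from has_derivative_compose[OF this assms]
 moreover have "(*) (G (x + t *\<^sub>R h) \<bullet> h) = (%s. s * (G (x + t *\<^sub>R h) \<bullet> h))"
  by (auto simp: mult.commute)
 ultimately show ?thesis by (simp add: has_field_derivative_def)
qed

lemma line_MVT:
 fixes F :: "'a::euclidean_space => real"
 assumes "!!x. (F has_derivative (%h. G x \<bullet> h)) (at x)"
 shows "EX z. 0 < z & z < 1 & F (x + h) - F x = G (x + z *\<^sub>R h) \<bullet> h"
proof -
 have "EX z. 0 < z & z < 1 & F (x + 1 *\<^sub>R h) - F (x + 0 *\<^sub>R h) = (1 - 0) * (G (x + z *\<^sub>R h) \<bullet> h)"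
  by (rule MVT2) (use line_derivative[OF assms] in auto)
 then show ?thesis by simp
qed

lemma lebesgue_on_borel:
 fixes h :: "'a::euclidean_space => 'b::{banach, second_countable_topology}"
 assumes "open Om" "h : borel_measurable borel" "!!x. x \<notin> Om ==> h x = 0"
 shows "integral\<^sup>L (lebesgue_on Om) h = integral\<^sup>L lborel h"
  "integrable (lebesgue_on Om) h \<longleftrightarrow> integrable lborel h"
proof -
 have e: "(%x. indicator Om x *\<^sub>R h x) = h" using assms(3) by (auto simp: indicator_def)
 have Om: "Om \<inter> space lebesgue : sets lebesgue" using assms(1) by auto
 show "integral\<^sup>L (lebesgue_on Om) h = integral\<^sup>L lborel h"
  using assms(2) by (simp add: integral_restrict_space[OF Om] e integral_completion)
 show "integrable (lebesgue_on Om) h \<longleftrightarrow> integrable lborel h"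
  using assms(2) by (simp add: integrable_restrict_space[OF Om] e integrable_completion)
qed

lemma nn_integral_lebesgue_on_borel:
 assumes "open Om" "h : borel_measurable borel" "!!x. x \<notin> Om ==> h x = 0"
 shows "(\<integral>\<^sup>+x. h x \<partial>lebesgue_on Om) = (\<integral>\<^sup>+x. h (x::'a::euclidean_space) \<partial>lborel)"
proof -
 have Om: "Om \<inter> space lebesgue : sets lebesgue" using assms(1) by auto
 have "(\<integral>\<^sup>+x. h x \<partial>lebesgue_on Om) = (\<integral>\<^sup>+x. h x * indicator Om x \<partial>lebesgue)"
  by (rule nn_integral_restrict_space[OF Om])
 also have "(%x. h x * indicator Om x) = h" using assms(3) by (auto simp: indicator_def)
 finally show ?thesis by (simp add: nn_integral_completion)
qed

lemma integrable_bounded_support: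
 fixes h :: "'a::euclidean_space => 'b::{banach, second_countable_topology}"
 assumes "h : borel_measurable borel" "!!x. norm (h x) <= B" "!!x. norm x > R ==> h x = 0"
 shows "integrable lborel h"
proof (rule Bochner_Integration.integrable_bound[of _ "%x. B * indicator (cball 0 R) x"])
 have "emeasure lborel (cball (0::'a) R) < \<infinity>"
  by (rule emeasure_lborel_cball_finite)
 then show "integrable lborel (%x::'a. B * indicat_real (cball 0 R) x)" by auto
 show "AE x in lborel. norm (h x) <= norm (B * indicat_real (cball 0 R) x)"
  using assms(2,3) order_trans[OF norm_ge_zero assms(2)]
  by (auto simp: indicator_def abs_of_nonneg not_le intro!: always_eventually)
qed (use assms(1) in simp)

lemma lborel_integral_translate:
 fixes f :: "'a::euclidean_space => 'b::{banach, second_countable_topology}"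
 assumes "f : borel_measurable borel"
 shows "integral\<^sup>L lborel (%x. f (x + c)) = integral\<^sup>L lborel f"
proof -
 have "integral\<^sup>L lborel f = integral\<^sup>L (distr lborel borel ((+) c)) f" by (simp add: lborel_distr_plus)
 also have "... = integral\<^sup>L lborel (%x. f (c + x))" using assms by (intro integral_distr) auto
 finally show ?thesis by (simp add: add.commute)
qed

lemma lborel_nn_integral_translate:
 fixes f :: "'a::euclidean_space => ennreal"
 assumes "f : borel_measurable borel"
 shows "(\<integral>\<^sup>+x. f (x + c) \<partial>lborel) = (\<integral>\<^sup>+x. f x \<partial>lborel)"
proof -
 have "(\<integral>\<^sup>+x. f x \<partial>lborel) = (\<integral>\<^sup>+x. f x \<partial>distr lborel borel ((+) c))" by (simp add: lborel_distr_plus)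
 also have "... = (\<integral>\<^sup>+x. f (c + x) \<partial>lborel)" using assms by (intro nn_integral_distr) auto
 finally show ?thesis by (simp add: add.commute)
qed

text \<open>The mean value theorem bounds the difference quotients by the constant B, which is
  integrable for a finite measure. The bound is assumed only within distance one of t0, so the first
  terms of a sequence of increments are dropped.\<close>

lemma leibniz_integral:
 fixes G G' :: "real => 'a => real"
 assumes "finite_measure M" and int: "!!t. integrable M (G t)" and meas: "G' t0 : borel_measurable M"
  and deriv: "AE x in M. ALL t. ((%t. G t x) has_real_derivative G' t x) (at t)"
  and bound: "AE x in M. ALL t. \<bar>t - t0\<bar> <= 1 --> \<bar>G' t x\<bar> <= B"
 shows "((%t. LINT x|M. G t x) has_real_derivative (LINT x|M. G' t0 x)) (at t0)"
 unfolding DERIV_def tendsto_at_iff_sequentially o_def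
proof (intro allI impI)
 interpret finite_measure M by fact
 fix X :: "nat => real" assume X: "ALL i. X i : UNIV - {0}" "X ----> 0"
 have "\<forall>\<^sub>F i in sequentially. dist (X i) 0 < 1" using X(2) by (intro tendstoD) auto
 then obtain m where m: "!!i. i >= m ==> \<bar>X i\<bar> < 1" by (auto simp: eventually_sequentially)
 define Y where "Y i = X (i + m)" for i
 have Y: "Y i ~= 0" "\<bar>Y i\<bar> < 1" for i using X(1) m by (auto simp: Y_def)
 have Y0: "Y ----> 0" unfolding Y_def using X(2) by (rule LIMSEQ_ignore_initial_segment)
 have "(%i. LINT x|M. (G (t0 + Y i) x - G t0 x) / Y i) ----> (LINT x|M. G' t0 x)"
 proof (rule integral_dominated_convergence[where w = "%_. B"])
  show "AE x in M. (%i. (G (t0 + Y i) x - G t0 x) / Y i) ----> G' t0 x"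
   using deriv
  proof eventually_elim
   case (elim x)
   then have "((%h. (G (t0 + h) x - G t0 x) / h) \<longlongrightarrow> G' t0 x) (at 0)" unfolding DERIV_def by blast
   moreover have "filterlim Y (at 0) sequentially" using Y Y0 by (auto simp: filterlim_at)
   ultimately show ?case by (rule filterlim_compose)
  qed
  show "AE x in M. norm ((G (t0 + Y i) x - G t0 x) / Y i) <= B" for i
   using deriv bound
  proof eventually_elim
   case (elim x)
   have "norm (G (t0 + Y i) x - G t0 x) <= B * norm (t0 + Y i - t0)"
    using elim Y(2)[of i] by (intro field_differentiable_bound[of "cball t0 1" _ "%t. G' t x"])
     (auto simp: dist_real_def abs_minus_commute intro: has_field_derivative_at_within)
   then show ?case using Y(1)[of i] by (simp add: field_simps)
  qed
 qed (use int meas in auto)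
 then have "(%i. ((LINT x|M. G (t0 + Y i) x) - (LINT x|M. G t0 x)) / Y i) ----> (LINT x|M. G' t0 x)"
  using int by simp
 then show "(%i. ((LINT x|M. G (t0 + X i) x) - (LINT x|M. G t0 x)) / X i) ----> (LINT x|M. G' t0 x)"
  unfolding Y_def by (rule LIMSEQ_offset)
qed

text \<open>By translation invariance the integral of F (x + t b) does not depend on t, and its
  derivative at zero is the integral in question. The ball of radius R + 2 has finite measure and
  contains the supports of all translates with |t| < 1.\<close>

lemma integral_directional_derivative_zero:
 fixes F :: "'a::euclidean_space => real"
 assumes F: "!!x. (F has_derivative (%h. G x \<bullet> h)) (at x)" and contG: "continuous_on UNIV G"
  and supp: "!!x. norm x > R ==> F x = 0" "!!x. norm x > R ==> G x = 0"
  and B: "!!x. \<bar>F x\<bar> <= B" "!!x. norm (G x) <= B" and b: "norm b <= 1"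
 shows "integral\<^sup>L lborel (%x. G x \<bullet> b) = 0"
proof -
 have contF: "continuous_on UNIV F"
  using F by (auto simp: continuous_on_eq_continuous_at intro: has_derivative_continuous)
 have [measurable]: "F : borel_measurable borel" "G : borel_measurable borel"
  using contF contG by (auto intro: borel_measurable_continuous_onI)
 let ?M = "lebesgue_on (ball (0 :: 'a) (R + 2))"
 have mM: "h : borel_measurable ?M" if "h : borel_measurable borel" for h :: "'a => real"
  using that by (intro measurable_restrict_space1 measurable_completion) simp
 have fin: "finite_measure ?M" by (intro finite_measure_lebesgue_on lmeasurable_ball)
 have const: "(LINT x|?M. F (x + t *\<^sub>R b)) = integral\<^sup>L lborel F" if t: "\<bar>t\<bar> < 1" for t
 proof -
  have "F (x + t *\<^sub>R b) = 0" if "x \<notin> ball 0 (R + 2)" for x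
  proof (rule supp)
   have "norm (t *\<^sub>R b) <= 1" using t b by (simp add: mult_le_one)
   then show "norm (x + t *\<^sub>R b) > R" using that norm_triangle_ineq4[of "x + t *\<^sub>R b" "t *\<^sub>R b"] by simp
  qed
  then show ?thesis using lborel_integral_translate[of F "t *\<^sub>R b"] by (subst lebesgue_on_borel(1)) auto
 qed
 have "((%t. LINT x|?M. F (x + t *\<^sub>R b)) has_real_derivative (LINT x|?M. G (x + 0 *\<^sub>R b) \<bullet> b)) (at 0)"
 proof (rule leibniz_integral[OF fin, where B = B])
  show "integrable ?M (%x. F (x + t *\<^sub>R b))" for t
   by (rule finite_measure.integrable_const_bound[OF fin, of _ B]) (auto simp: B intro!: mM)
  show "AE x in ?M. ALL t. ((%t. F (x + t *\<^sub>R b)) has_real_derivative G (x + t *\<^sub>R b) \<bullet> b) (at t)"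
   using line_derivative[OF F] by auto
  show "AE x in ?M. ALL t. \<bar>t - 0\<bar> <= 1 --> \<bar>G (x + t *\<^sub>R b) \<bullet> b\<bar> <= B"
  proof (intro AE_I2 allI impI)
   fix x t
   have "\<bar>G (x + t *\<^sub>R b) \<bullet> b\<bar> <= norm (G (x + t *\<^sub>R b)) * norm b" by (rule Cauchy_Schwarz_ineq2)
   also have "... <= norm (G (x + t *\<^sub>R b))" using b by (intro mult_left_le) auto
   finally show "\<bar>G (x + t *\<^sub>R b) \<bullet> b\<bar> <= B" using B(2) by (rule order_trans)
  qed
 qed (auto intro!: mM)
 moreover have "((%t. LINT x|?M. F (x + t *\<^sub>R b)) has_real_derivative 0) (at 0)"
  by (rule has_field_derivative_transform_within[of "%_. integral\<^sup>L lborel F" _ _ _ 1]) (auto simp: const)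
 ultimately have "(LINT x|?M. G x \<bullet> b) = 0" by (simp add: DERIV_unique)
 moreover have "(LINT x|?M. G x \<bullet> b) = integral\<^sup>L lborel (%x. G x \<bullet> b)"
  using supp(2) by (intro lebesgue_on_borel(1)) auto
 ultimately show ?thesis by simp
qed

lemma test_functions_support_ball:
 assumes "phi : test_functions Om"
 obtains R where "R > 0" "!!x. norm x > R ==> phi x = 0" "!!x. norm x > R ==> grad phi x = 0"
proof -
 obtain K where K: "compact K" "!!x. x \<notin> K ==> phi x = 0" "!!x. x \<notin> K ==> grad phi x = 0"
  using test_functions_support[OF assms] by metis
 obtain R where "R > 0" "!!x. x : K ==> norm x <= R"
  using compact_imp_bounded[OF K(1)] unfolding bounded_pos by auto
 then show ?thesis using that[of R] K by force
qed

lemma test_functions_borel [measurable_dest]: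
 assumes "phi : test_functions Om"
 shows "phi : borel_measurable borel" "grad phi : borel_measurable borel"
 using test_functionsD(2,5)[OF assms] by (auto intro: borel_measurable_continuous_onI)

text \<open>Integration by parts: the gradient of the product phi psi integrates to zero in every
  direction.\<close>

lemma weak_gradient_test_function:
 assumes Om: "open Om" and phi: "phi : test_functions Om"
 shows "weak_gradient_on Om phi (grad phi)"
 unfolding weak_gradient_on_def
proof (intro conjI allI impI ballI)
 fix K assume K: "compact K & K \<subseteq> Om"
 then have Kb: "K : sets borel" by (simp add: compact_imp_closed)
 obtain B where B: "!!x. \<bar>phi x\<bar> <= B" "!!x. norm (grad phi x) <= B"
  using test_functions_bounded[OF phi] by metis
 obtain R where R: "!!x. norm x > R ==> phi x = 0" "!!x. norm x > R ==> grad phi x = 0"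
  using test_functions_support_ball[OF phi] by metis
 have [measurable]: "phi : borel_measurable borel" "grad phi : borel_measurable borel"
  using test_functions_borel[OF phi] by auto
 have "integrable lborel phi" "integrable lborel (grad phi)"
  by (rule integrable_bounded_support[OF _ _ R(1)] integrable_bounded_support[OF _ _ R(2)]; use B in auto)+
 then have "integrable lebesgue phi" "integrable lebesgue (grad phi)" by (auto simp: integrable_completion)
 then show "integrable (lebesgue_on K) phi" "integrable (lebesgue_on K) (grad phi)"
  using Kb integrable_mult_indicator[of K lebesgue phi] integrable_mult_indicator[of K lebesgue "grad phi"]
  by (auto simp: integrable_restrict_space)
next
 fix psi b assume psi: "psi : test_functions Om" and b: "b : (Basis :: 'a set)"
 obtain B where B: "B > 0" "!!x. \<bar>phi x\<bar> <= B" "!!x. norm (grad phi x) <= B"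
  using test_functions_bounded[OF phi] by metis
 obtain B' where B': "B' > 0" "!!x. \<bar>psi x\<bar> <= B'" "!!x. norm (grad psi x) <= B'"
  using test_functions_bounded[OF psi] by metis
 obtain R where R: "!!x. norm x > R ==> phi x = 0" "!!x. norm x > R ==> grad phi x = 0"
  using test_functions_support_ball[OF phi] by metis
 have [measurable]: "phi : borel_measurable borel" "grad phi : borel_measurable borel"
  "psi : borel_measurable borel" "grad psi : borel_measurable borel"
  using test_functions_borel[OF phi] test_functions_borel[OF psi] by auto
 define G where "G x = phi x *\<^sub>R grad psi x + psi x *\<^sub>R grad phi x" for x
 have fd: "frechet_derivative psi (at x) b = grad psi x \<bullet> b" for x
  using grad_inner_Basis[OF b] by metis
 have bn: "\<bar>v \<bullet> b\<bar> <= norm v" for v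
  using Basis_le_norm[OF b] by auto
 have le: "\<bar>u * v\<bar> <= B * B'" if "\<bar>u\<bar> <= B" "\<bar>v\<bar> <= B'" for u v
  unfolding abs_mult using that by (intro mult_mono) auto
 have i1: "integrable lborel (%x. phi x * (grad psi x \<bullet> b))"
  using R le[OF B(2) order_trans[OF bn B'(3)]]
  by (intro integrable_bounded_support[where B = "B * B'" and R = R]) auto
 have i2: "integrable lborel (%x. (grad phi x \<bullet> b) * psi x)"
  using R le[OF order_trans[OF bn B(3)] B'(2)]
  by (intro integrable_bounded_support[where B = "B * B'" and R = R]) auto
 have "integral\<^sup>L lborel (%x. G x \<bullet> b) = 0"
 proof (rule integral_directional_derivative_zero[where F = "%x. phi x * psi x" and B = "2 * (B * B')" and R = R])
  show "((%x. phi x * psi x) has_derivative (%h. G x \<bullet> h)) (at x)" for x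
   using test_functionsD(4)[OF phi, of x] test_functionsD(4)[OF psi, of x]
   by (auto intro!: derivative_eq_intros simp: G_def inner_add_left algebra_simps)
  show "continuous_on UNIV G"
   unfolding G_def using test_functionsD(2,5)[OF phi] test_functionsD(2,5)[OF psi]
   by (intro continuous_intros)
  show "\<bar>phi x * psi x\<bar> <= 2 * (B * B')" for x
   using le[OF B(2) B'(2), of x x] mult_pos_pos[OF B(1) B'(1)] by linarith
  show "norm (G x) <= 2 * (B * B')" for x
  proof -
   have "norm (G x) <= \<bar>phi x\<bar> * norm (grad psi x) + \<bar>psi x\<bar> * norm (grad phi x)"
    unfolding G_def by (rule order_trans[OF norm_triangle_ineq]) simp
   also have "... <= B * B' + B' * B"
    using B B' by (intro add_mono mult_mono) auto
   finally show ?thesis by (simp add: mult.commute[of B'])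
  qed
  show "norm b <= 1" using b by simp
 qed (use R in \<open>auto simp: G_def\<close>)
 then have z: "integral\<^sup>L lborel (%x. phi x * (grad psi x \<bullet> b)) + integral\<^sup>L lborel (%x. (grad phi x \<bullet> b) * psi x) = 0"
  using i1 i2 by (simp add: G_def inner_add_left mult.commute[of "psi _"])
 have e: "(LINT x|lebesgue_on Om. phi x * (grad psi x \<bullet> b)) = integral\<^sup>L lborel (%x. phi x * (grad psi x \<bullet> b))"
  "(LINT x|lebesgue_on Om. (grad phi x \<bullet> b) * psi x) = integral\<^sup>L lborel (%x. (grad phi x \<bullet> b) * psi x)"
  using test_functions_zero_outside[OF phi] by (auto intro!: lebesgue_on_borel(1)[OF Om])
 show "(LINT x|lebesgue_on Om. phi x * frechet_derivative psi (at x) b) =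
   - (LINT x|lebesgue_on Om. (grad phi x \<bullet> b) * psi x)"
  using z unfolding fd e by simp
qed

section \<open>Bumps and the uniqueness of weak gradients\<close>

lemma smooth_fn_prod: "finite I ==> (!!i. i : I ==> smooth_fn (f i)) ==> smooth_fn (%x. \<Prod>i\<in>I. f i x)"
 by (induction I rule: finite_induct) (auto intro: smooth_fn.const smooth_fn.mult)

text \<open>\<open>Phi\<close> is smooth and positive exactly inside the box; dividing it by
  \<open>Phi\<close> plus 1 / (n + 1) pushes it towards the indicator function without leaving the
  class \<open>smooth_fn\<close>.\<close>

lemma box_bump:
 fixes l u :: "'a::euclidean_space"
 assumes sub: "cbox l u \<subseteq> Om"
 obtains phi where "!!n::nat. phi n : test_functions Om" "!!n x. 0 <= phi n x" "!!n x. phi n x <= 1"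
  "!!n x. x \<notin> box l u ==> phi n x = 0" "!!x. x : box l u ==> (%n. phi n x) ----> 1"
  "!!n x. x : box l u ==> phi n x > 0"
proof -
 define Phi where "Phi x = (\<Prod>b\<in>Basis. flat_exp 0 (x \<bullet> b + - (l \<bullet> b)) * flat_exp 0 (u \<bullet> b + (- 1) * (x \<bullet> b)))" for x
 have sm: "smooth_fn Phi"
  unfolding Phi_def[abs_def]
  by (intro smooth_fn_prod smooth_fn.mult smooth_fn.flat smooth_fn.add smooth_fn.inner smooth_fn.const) auto
 have nn: "Phi x >= 0" for x unfolding Phi_def by (intro prod_nonneg) (auto simp: flat_exp_nonneg)
 have pos: "Phi x > 0" if "x : box l u" for x
  unfolding Phi_def using that by (intro prod_pos) (auto simp: flat_exp_def mem_box)
 have zero: "Phi x = 0" if "x \<notin> box l u" for x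
 proof -
  have "EX b:Basis. x \<bullet> b <= l \<bullet> b | u \<bullet> b <= x \<bullet> b"
   using that by (fastforce simp: mem_box not_less)
  then obtain b where "b : Basis" "x \<bullet> b <= l \<bullet> b | u \<bullet> b <= x \<bullet> b" by blast
  then show ?thesis unfolding Phi_def
   by (intro prod_zero) (auto simp: flat_exp_def intro!: bexI[of _ b])
 qed
 define phi where "phi n x = Phi x * inverse (Phi x + inverse (real (Suc n)))" for n x
 have den: "Phi x + inverse (real (Suc n)) > 0" for n x using nn[of x] by (simp add: add_nonneg_pos)
 show ?thesis
 proof
  fix n
  have "smooth_fn (phi n)"
   unfolding phi_def[abs_def] using den
   by (intro smooth_fn.mult smooth_fn.inv smooth_fn.add smooth_fn.const sm) (metis less_irrefl)
  moreover have "closure {x. phi n x ~= 0} \<subseteq> cbox l u"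
   using zero box_subset_cbox[of l u] by (intro closure_minimal) (auto simp: phi_def)
  moreover from this have "compact (closure {x. phi n x ~= 0})"
   by (meson bounded_cbox bounded_subset closed_closure compact_eq_bounded_closed)
  ultimately show "phi n : test_functions Om"
   using smooth_fn_Ck sub by (auto simp: test_functions_def)
  fix x
  show "0 <= phi n x" using nn[of x] den[of x n] by (simp add: phi_def)
  show "phi n x <= 1" using den[of x n] by (simp add: phi_def field_simps)
  show "x \<notin> box l u ==> phi n x = 0" by (simp add: phi_def zero)
  show "x : box l u ==> phi n x > 0" using pos[of x] den[of x n] by (simp add: phi_def)
 next
  fix x assume x: "x : box l u"
  have "(%n. Phi x * inverse (Phi x + inverse (real (Suc n)))) ----> Phi x * inverse (Phi x + 0)"
   using pos[OF x] by (intro tendsto_intros LIMSEQ_inverse_real_of_nat) auto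
  then show "(%n. phi n x) ----> 1" using pos[OF x] by (simp add: phi_def)
 qed
qed

text \<open>Boxes generate the Borel sets and are closed under intersection; the assumption on the
  total integral takes care of complements.\<close>

lemma AE_zero_if_box_integrals_zero:
 fixes h :: "'a::euclidean_space => real"
 assumes int: "integrable lborel h" and total: "integral\<^sup>L lborel h = 0"
  and box: "!!a b. (LINT x:box a b|lborel. h x) = 0"
 shows "AE x in lborel. h x = 0"
proof (rule sigma_finite_measure.density_zero[OF sigma_finite_lborel int])
 fix A :: "'a set" assume "A : sets lborel"
 then have A: "A : sigma_sets UNIV (range (%(a, b). box a b))" by (simp add: borel_eq_box)
 have "Int_stable (range (%(a, b). box a b :: 'a set))"
  by (auto simp: Int_stable_def box_Int_box)
 moreover have "range (%(a, b). box a b) \<subseteq> Pow (UNIV :: 'a set)" by auto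
 moreover note A
 ultimately show "(LINT x:A|lborel. h x) = 0"
 proof (induction rule: sigma_sets_induct_disjoint)
  case (basic A)
  then show ?case using box by auto
 next
  case empty
  then show ?case by (simp add: set_lebesgue_integral_def)
 next
  case (compl A)
  then have A: "A : sets lborel" by (simp add: borel_eq_box)
  have "(LINT x:UNIV - A|lborel. h x) = (LINT x|lborel. h x - indicator A x *\<^sub>R h x)"
   unfolding set_lebesgue_integral_def by (rule Bochner_Integration.integral_cong) (auto simp: indicator_def)
  also have "... = integral\<^sup>L lborel h - (LINT x:A|lborel. h x)"
   unfolding set_lebesgue_integral_def
   by (rule Bochner_Integration.integral_diff[OF int integrable_mult_indicator[OF A int]])
  finally show ?case using compl total by simp
 next
  case (union A)
  then have A: "!!i. A i : sets lborel" by (auto simp: borel_eq_box)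
  have "(LINT x:(\<Union>i. A i)|lborel. h x) = (\<Sum>i. (LINT x:(A i)|lborel. h x))"
  proof (rule lebesgue_integral_countable_add[OF A])
   show "i ~= j ==> A i \<inter> A j = {}" for i j using union(1) by (auto simp: disjoint_family_on_def)
   show "set_integrable lborel (\<Union>i. A i) h"
    unfolding set_integrable_def using A int by (intro integrable_mult_indicator) auto
  qed
  then show ?case using union by simp
 qed
qed

text \<open>Inside a box in \<open>Om\<close> the bumps converge to indicators of subboxes, so all
  box integrals of g vanish; countably many boxes cover \<open>Om\<close>. As g is only Lebesgue
  measurable, a Borel representative is used for the argument with generators.\<close>

lemma fundamental_lemma:
 fixes g :: "'a::euclidean_space => real"
 assumes Om: "open Om"
  and int: "!!K. compact K ==> K \<subseteq> Om ==> integrable (lebesgue_on K) g"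
  and zero: "!!phi. phi : test_functions Om ==> (LINT x|lebesgue_on Om. g x * phi x) = 0"
 shows "AE x in lebesgue_on Om. g x = 0"
proof -
 have loc: "AE x in lebesgue. x : cbox l u --> g x = 0" if sub: "cbox l u \<subseteq> Om" for l u
 proof -
  define h where "h x = indicator (box l u) x * g x" for x
  have inth: "integrable lebesgue h"
  proof -
   have "integrable lebesgue (%x. indicator (cbox l u) x *\<^sub>R g x)"
    using int[OF compact_cbox sub] by (simp add: integrable_restrict_space)
   from integrable_mult_indicator[OF _ this, of "box l u"]
   have "integrable lebesgue (%x. indicator (box l u) x *\<^sub>R (indicator (cbox l u) x *\<^sub>R g x))"
    by auto
   also have "(%x. indicator (box l u) x *\<^sub>R (indicator (cbox l u) x *\<^sub>R g x)) = h"
    using box_subset_cbox[of l u] by (intro ext) (auto simp: h_def indicator_def)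
   finally show ?thesis .
  qed
  have boxh: "(LINT x|lebesgue. indicator (box a b) x * h x) = 0" for a b
  proof -
   obtain c d where cd: "box a b \<inter> box l u = box c d" by (auto simp: box_Int_box)
   have e: "(%x. indicator (box a b) x * h x) = (%x. indicator (box c d) x * h x)"
    unfolding cd[symmetric] by (auto simp: h_def indicator_def)
   show ?thesis
   proof (cases "box c d = {}")
    case True
    then show ?thesis unfolding e by simp
   next
    case False
    have "cbox c d \<subseteq> cbox l u"
     using closure_mono[of "box c d" "box l u"] cd False closure_box[of c d]
     by (metis Int_lower2 box_eq_empty(1) box_subset_cbox closed_cbox closure_minimal order_trans)
    then have "cbox c d \<subseteq> Om" using sub by blast
    then obtain phi where phi: "!!n::nat. phi n : test_functions Om" "!!n x. 0 <= phi n x" "!!n x. phi n x <= 1"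
     "!!n x. x \<notin> box c d ==> phi n x = 0" "!!x. x : box c d ==> (%n. phi n x) ----> 1"
     by (rule box_bump) blast
    have "(LINT x|lebesgue. h x * phi n x) = 0" for n
    proof -
     have e: "indicator Om x *\<^sub>R (g x * phi n x) = h x * phi n x" for x
     proof (cases "x : box c d")
      case True
      then have "x : box l u" using cd by blast
      then have "x : Om" using sub box_subset_cbox[of l u] by blast
      then show ?thesis using \<open>x : box l u\<close> by (simp add: h_def)
     qed (simp add: phi(4))
     then show ?thesis
      using zero[OF phi(1), of n] Om
       integral_restrict_space[of Om lebesgue "%x. g x * phi n x", unfolded e] by simp
    qed
    moreover have "(%n. LINT x|lebesgue. h x * phi n x) ----> (LINT x|lebesgue. indicator (box c d) x * h x)"
    proof (rule integral_dominated_convergence[where w = "%x. norm (h x)"])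
     have "(%n. h x * phi n x) ----> indicator (box c d) x * h x" for x
     proof (cases "x : box c d")
      case True
      from tendsto_mult_left[OF phi(5)[OF this], of "h x"] show ?thesis using True by simp
     qed (simp add: phi(4))
     then show "AE x in lebesgue. (%n. h x * phi n x) ----> indicator (box c d) x * h x" by simp
     show "AE x in lebesgue. norm (h x * phi n x) <= norm (h x)" for n
      using phi(2,3) by (auto simp: abs_mult mult_left_le)
     show "(%x. h x * phi n x) : borel_measurable lebesgue" for n
      using borel_measurable_integrable[OF inth]
       measurable_completion[of "phi n" lborel borel] test_functions_borel(1)[OF phi(1)]
      by (intro borel_measurable_times) auto
     show "(%x. indicat_real (box c d) x * h x) : borel_measurable lebesgue"
      using borel_measurable_integrable[OF inth]
      by (intro borel_measurable_times borel_measurable_indicator) auto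
    qed (use inth in auto)
    ultimately show ?thesis unfolding e by (simp add: LIMSEQ_const_iff)
   qed
  qed
  obtain h' where h': "h' : borel_measurable lborel" "AE x in lborel. h x = h' x"
   using completion_ex_borel_measurable_real[OF borel_measurable_integrable[OF inth]] by blast
  have ae: "AE x in lebesgue. h x = h' x" using h'(2) by (rule AE_completion)
  have m': "h' : borel_measurable lebesgue" using h'(1) by (rule measurable_completion)
  have inth': "integrable lborel h'"
   using integrable_cong_AE[OF borel_measurable_integrable[OF inth] m' ae] inth h'(1)
   by (simp add: integrable_completion)
  have tr: "(LINT x|lborel. indicator (box a b) x * h' x) = 0" for a b
  proof -
   have "(LINT x|lborel. indicator (box a b) x * h' x) = (LINT x|lebesgue. indicator (box a b) x * h' x)"
    using h'(1) by (subst integral_completion) auto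
   also have "... = (LINT x|lebesgue. indicator (box a b) x * h x)"
    using ae borel_measurable_integrable[OF inth] m'
    by (intro integral_cong_AE borel_measurable_times borel_measurable_indicator) auto
   finally show ?thesis by (simp add: boxh)
  qed
  have "integral\<^sup>L lborel h' = integral\<^sup>L lebesgue h'" using h'(1) by (subst integral_completion) auto
  also have "... = integral\<^sup>L lebesgue h"
   using ae borel_measurable_integrable[OF inth] m' by (intro integral_cong_AE) auto
  also have "... = (LINT x|lebesgue. indicator (box l u) x * h x)"
   by (rule Bochner_Integration.integral_cong) (simp_all add: h_def indicator_def)
  finally have total: "integral\<^sup>L lborel h' = 0" by (simp add: boxh)
  have "AE x in lborel. h' x = 0"
   using AE_zero_if_box_integrals_zero[OF inth' total] tr by (simp add: set_lebesgue_integral_def)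
  then have "AE x in lebesgue. h x = 0" using ae AE_completion by fastforce
  moreover have "AE x in lebesgue. x \<notin> cbox l u - box l u"
   by (rule AE_not_in) (use negligible_frontier_interval[of l u] in \<open>simp only: negligible_iff_null_sets\<close>)
  ultimately show ?thesis by eventually_elim (auto simp: h_def indicator_def split: if_splits)
 qed
 obtain D where D: "countable D" "D \<subseteq> Pow Om" "!!X. X : D ==> EX a b. X = cbox a b" "\<Union>D = Om"
  using open_countable_Union_open_cbox[OF Om] by metis
 have "AE x in lebesgue. ALL X:D. x : X --> g x = 0"
 proof (rule AE_ball_countable[THEN iffD2, OF D(1)], rule ballI)
  fix X assume X: "X : D"
  then obtain a b where "X = cbox a b" using D(3) by blast
  moreover have "X \<subseteq> Om" using D(2) X by blast
  ultimately show "AE x in lebesgue. x : X --> g x = 0" using loc by simp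
 qed
 then have "AE x in lebesgue. x : Om --> g x = 0"
  by eventually_elim (use D(4) in auto)
 then show ?thesis using Om by (simp add: AE_restrict_space_iff)
qed

text \<open>The fundamental lemma is applied to each component of the difference. Equality almost
  everywhere of u and v is all that can be asked, since functions are not identified; and as all
  four functions are only locally integrable, the integrals are first reduced to the support of the
  test function.\<close>

lemma weak_gradient_unique:
 fixes Om :: "'a::euclidean_space set"
 assumes Om: "open Om" and g: "weak_gradient_on Om u g" and g': "weak_gradient_on Om v g'"
  and uv: "AE x in lebesgue_on Om. u x = v x"
 shows "AE x in lebesgue_on Om. g x = g' x"
proof -
 have comp: "AE x in lebesgue_on Om. g x \<bullet> b - g' x \<bullet> b = 0" if b: "b : Basis" for b
 proof (rule fundamental_lemma[OF Om])
  fix K assume K: "compact K" "K \<subseteq> Om"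
  then show "integrable (lebesgue_on K) (%x. g x \<bullet> b - g' x \<bullet> b)"
   using g g' unfolding weak_gradient_on_def by auto
 next
  fix phi assume phi: "phi : test_functions Om"
  obtain K where K: "compact K" "K \<subseteq> Om" "!!x. x \<notin> K ==> phi x = 0" "!!x. x \<notin> K ==> grad phi x = 0"
   using test_functions_support[OF phi] by metis
  obtain B where B: "B > 0" "!!x. \<bar>phi x\<bar> <= B" "!!x. norm (grad phi x) <= B"
   using test_functions_bounded[OF phi] by metis
  have sets: "K \<inter> space lebesgue : sets lebesgue" "Om \<inter> space lebesgue : sets lebesgue"
   using K(1) Om by (auto simp: compact_imp_closed)
  have prod: "integrable (lebesgue_on Om) (%x. w x * psi x)"
   if w: "integrable (lebesgue_on K) w" and psi: "psi : borel_measurable borel" "!!x. \<bar>psi x\<bar> <= B" "!!x. x \<notin> K ==> psi x = 0"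
   for w psi :: "'a => real"
  proof -
   have i: "integrable lebesgue (%x. indicator K x *\<^sub>R w x)" using w by (simp add: integrable_restrict_space[OF sets(1)])
   have "integrable lebesgue (%x. (indicator K x *\<^sub>R w x) * psi x)"
   proof (rule Bochner_Integration.integrable_bound)
    show "integrable lebesgue (%x. B * (indicator K x *\<^sub>R w x))" using i by simp
    show "(%x. (indicator K x *\<^sub>R w x) * psi x) : borel_measurable lebesgue"
     using borel_measurable_integrable[OF i] measurable_completion[of psi lborel borel] psi(1)
     by (intro borel_measurable_times) auto
    show "AE x in lebesgue. norm ((indicator K x *\<^sub>R w x) * psi x) <= norm (B * (indicator K x *\<^sub>R w x))"
     using psi(2) B(1) by (auto simp: abs_mult mult.commute[of B] intro!: mult_left_mono)
   qed
   also have "(%x. (indicator K x *\<^sub>R w x) * psi x) = (%x. indicator Om x *\<^sub>R (w x * psi x))"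
    using psi(3) K(2) by (intro ext) (auto simp: indicator_def)
   finally show ?thesis by (simp add: integrable_restrict_space[OF sets(2)])
  qed
  have fd: "frechet_derivative phi (at x) b = grad phi x \<bullet> b" for x
   using grad_inner_Basis[OF b] by metis
  have "\<bar>grad phi x \<bullet> b\<bar> <= B" for x using Basis_le_norm[OF b, of "grad phi x"] B(3)[of x] by linarith
  moreover have "(%x. grad phi x \<bullet> b) : borel_measurable borel" using test_functions_borel[OF phi] by auto
  moreover have "integrable (lebesgue_on K) u" "integrable (lebesgue_on K) v"
   using g g' K(1,2) by (auto simp: weak_gradient_on_def)
  ultimately have iu: "integrable (lebesgue_on Om) (%x. u x * (grad phi x \<bullet> b))"
    "integrable (lebesgue_on Om) (%x. v x * (grad phi x \<bullet> b))"
   using K(4) by (auto intro!: prod)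
  have "integrable (lebesgue_on K) (%x. g x \<bullet> b)" "integrable (lebesgue_on K) (%x. g' x \<bullet> b)"
   using g g' K(1,2) by (auto simp: weak_gradient_on_def)
  then have ig: "integrable (lebesgue_on Om) (%x. (g x \<bullet> b) * phi x)" "integrable (lebesgue_on Om) (%x. (g' x \<bullet> b) * phi x)"
   using K(3) B(2) test_functions_borel(1)[OF phi] by (auto intro!: prod)
  have "(LINT x|lebesgue_on Om. (g x \<bullet> b - g' x \<bullet> b) * phi x) =
    (LINT x|lebesgue_on Om. (g x \<bullet> b) * phi x) - (LINT x|lebesgue_on Om. (g' x \<bullet> b) * phi x)"
   using ig by (simp add: left_diff_distrib)
  also have "... = (LINT x|lebesgue_on Om. v x * (grad phi x \<bullet> b)) - (LINT x|lebesgue_on Om. u x * (grad phi x \<bullet> b))"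
  proof -
   have "(LINT x|lebesgue_on Om. u x * (grad phi x \<bullet> b)) = - (LINT x|lebesgue_on Om. (g x \<bullet> b) * phi x)"
    "(LINT x|lebesgue_on Om. v x * (grad phi x \<bullet> b)) = - (LINT x|lebesgue_on Om. (g' x \<bullet> b) * phi x)"
    using g g' phi b unfolding weak_gradient_on_def fd[symmetric] by blast+
   then show ?thesis by simp
  qed
  also have "(LINT x|lebesgue_on Om. v x * (grad phi x \<bullet> b)) = (LINT x|lebesgue_on Om. u x * (grad phi x \<bullet> b))"
   using uv iu by (intro integral_cong_AE) auto
  finally show "(LINT x|lebesgue_on Om. (g x \<bullet> b - g' x \<bullet> b) * phi x) = 0" by simp
 qed
 have "AE x in lebesgue_on Om. ALL b:Basis. g x \<bullet> b - g' x \<bullet> b = 0"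
  using comp by (intro AE_finite_allI) auto
 then show ?thesis by eventually_elim (auto intro: euclidean_eqI)
qed

text \<open>The gradient \<open>wgrad\<close> is an arbitrary choice, so a concrete gradient can be
  compared with it only up to a null set.\<close>

lemma wgrad_AE_eq:
 assumes "open Om" "weak_gradient_on Om u g"
 shows "weak_gradient_on Om u (wgrad Om u)" "AE x in lebesgue_on Om. wgrad Om u x = g x"
proof -
 show w: "weak_gradient_on Om u (wgrad Om u)"
  using assms(2) unfolding wgrad_def by (metis someI)
 show "AE x in lebesgue_on Om. wgrad Om u x = g x"
  by (rule weak_gradient_unique[OF assms(1) w assms(2)]) simp
qed

section \<open>Convexity of powers: tangents and Jensen inequalities\<close>

text \<open>Young's inequality for t and s powr (p - 1), multiplied by p, is the tangent
  inequality.\<close>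

lemma powr_tangent:
 fixes s t p :: real
 assumes "p > 1" "s >= 0" "t >= 0"
 shows "s powr p + p * s powr (p - 1) * (t - s) <= t powr p"
proof -
 define q where "q = p / (p - 1)"
 have "q > 1" "1 / p + 1 / q = 1" using assms(1) by (auto simp: q_def field_simps)
 then have "t * s powr (p - 1) <= t powr p / p + (s powr (p - 1)) powr q / q"
  using assms by (intro Youngs_inequality) auto
 also have "(s powr (p - 1)) powr q = s powr p" using assms(1) by (simp add: powr_powr q_def)
 finally have *: "t * s powr (p - 1) <= t powr p / p + s powr p / q" .
 have "p * (t * s powr (p - 1)) <= p * (t powr p / p + s powr p / q)"
  using * assms(1) by (intro mult_left_mono) auto
 also have "... = t powr p + (p - 1) * s powr p" using assms(1) by (simp add: q_def field_simps)
 finally have "p * (t * s powr (p - 1)) <= t powr p + (p - 1) * s powr p" .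
 moreover have "s * s powr (p - 1) = s powr p"
  using assms(2) by (cases "s = 0") (auto simp: powr_diff)
 ultimately show ?thesis by (simp add: algebra_simps)
qed

text \<open>Jensen's inequality for the values y i / w i with weights w i, from the tangent at the
  sum of the y i. It serves to add up arbitrarily many scales with geometric weights, at the price
  of the factors w i powr (1 - s).\<close>

lemma powr_sum_weighted:
 fixes y w :: "'i => real"
 assumes s: "s > 1" and "finite I" and y: "!!i. i : I ==> y i >= 0" and w: "!!i. i : I ==> w i > 0"
  and sum: "(\<Sum>i\<in>I. w i) <= 1"
 shows "(\<Sum>i\<in>I. y i) powr s <= (\<Sum>i\<in>I. w i powr (1 - s) * y i powr s)"
proof -
 define z where "z = (\<Sum>i\<in>I. y i)"
 have z: "z >= 0" unfolding z_def using y by (rule sum_nonneg)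
 have zz: "z powr (s - 1) * z = z powr s"
  using z by (cases "z = 0") (auto simp: powr_diff)
 have "w i * (z powr s + s * z powr (s - 1) * (y i / w i - z)) <= w i powr (1 - s) * y i powr s" if i: "i : I" for i
 proof -
  have "w i * (z powr s + s * z powr (s - 1) * (y i / w i - z)) <= w i * (y i / w i) powr s"
   using powr_tangent[OF s z, of "y i / w i"] y[OF i] w[OF i] by (intro mult_left_mono) auto
  also have "... = w i powr (1 - s) * y i powr s"
   using y[OF i] w[OF i] by (simp add: powr_divide powr_diff)
  finally show ?thesis .
 qed
 then have "(\<Sum>i\<in>I. w i * (z powr s + s * z powr (s - 1) * (y i / w i - z)))
   <= (\<Sum>i\<in>I. w i powr (1 - s) * y i powr s)"
  by (rule sum_mono)
 also have "(\<Sum>i\<in>I. w i * (z powr s + s * z powr (s - 1) * (y i / w i - z))) =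
   (\<Sum>i\<in>I. w i * (z powr s - s * z powr (s - 1) * z) + s * z powr (s - 1) * y i)"
 proof (rule sum.cong)
  fix i assume "i : I"
  then have "w i ~= 0" using w[of i] by auto
  then show "w i * (z powr s + s * z powr (s - 1) * (y i / w i - z)) =
    w i * (z powr s - s * z powr (s - 1) * z) + s * z powr (s - 1) * y i"
   by (simp add: field_simps)
 qed simp
 also have "... = (\<Sum>i\<in>I. w i) * (z powr s - s * z powr (s - 1) * z) + s * z powr (s - 1) * z"
  unfolding z_def by (simp add: sum.distrib flip: sum_distrib_left sum_distrib_right)
 finally have "(\<Sum>i\<in>I. w i) * (z powr s - s * z powr s) + s * z powr s
   <= (\<Sum>i\<in>I. w i powr (1 - s) * y i powr s)"
  using zz by (simp add: mult.assoc)
 moreover have "(1 - (\<Sum>i\<in>I. w i)) * ((s - 1) * z powr s) >= 0"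
  using sum s by (intro mult_nonneg_nonneg) auto
 ultimately show ?thesis unfolding z_def[symmetric] by (simp add: algebra_simps)
qed

lemma powr_add_le: "p >= 0 ==> a >= 0 ==> b >= 0 ==> (a + b) powr p <= 2 powr p * (a powr p + b powr (p::real))"
proof -
 assume p: "p >= 0" and a: "a >= 0" "b >= 0"
 have "(a + b) powr p <= (2 * max a b) powr p" using p a by (intro powr_mono2) auto
 also have "... = 2 powr p * max a b powr p" using a by (simp add: powr_mult)
 also have "max a b powr p <= a powr p + b powr p" by (auto simp: max_def)
 finally show ?thesis by simp
qed

text \<open>The tangent of the power at the mean of |g| over B is integrated over B, where its
  linear part drops out.\<close>

lemma jensen_set:
 fixes g :: "'a::euclidean_space => real"
 assumes p: "p > 1" and B: "B : sets borel" "emeasure lborel B = ennreal m" "m > 0"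
  and g: "g : borel_measurable borel" "!!x. \<bar>g x\<bar> <= K"
 shows "ennreal (\<bar>LINT x|lborel. indicator B x * g x\<bar> powr p) <=
  ennreal (m powr (p - 1)) * (\<integral>\<^sup>+x. ennreal (\<bar>g x\<bar> powr p) * indicator B x \<partial>lborel)"
proof -
 have indB: "integrable lborel (%x. indicator B x :: real)" "(LINT x|lborel. indicator B x) = m"
  using B by (auto simp: measure_def)
 have bd: "integrable lborel (%x. indicator B x * f x)"
  if "f : borel_measurable borel" "!!x. \<bar>f x\<bar> <= L" for f :: "'a => real" and L
 proof (rule Bochner_Integration.integrable_bound[of _ "%x. L * indicator B x"])
  show "AE x in lborel. norm (indicator B x * f x) <= norm (L * indicator B x)"
   using that(2) by (auto simp: indicator_def intro!: order_trans[OF that(2) abs_ge_self])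
 qed (use that B indB in auto)
 have K: "K >= 0" using g(2)[of 0] by linarith
 have i1: "integrable lborel (%x. indicator B x * g x)" "integrable lborel (%x. indicator B x * \<bar>g x\<bar>)"
  using g by (auto intro!: bd[where L = K])
 have i3: "integrable lborel (%x. indicator B x * \<bar>g x\<bar> powr p)"
  using g p K by (auto intro!: bd[where L = "K powr p"] powr_mono2)
 define s where "s = (LINT x|lborel. indicator B x * \<bar>g x\<bar>) / m"
 have s: "s >= 0" unfolding s_def using B(3) by (auto intro!: divide_nonneg_pos integral_nonneg)
 have sm: "(LINT x|lborel. indicator B x * \<bar>g x\<bar>) = s * m" using B(3) by (simp add: s_def)
 have "(LINT x|lborel. indicator B x * (s powr p - p * s powr (p - 1) * s) + p * s powr (p - 1) * (indicator B x * \<bar>g x\<bar>))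
   <= (LINT x|lborel. indicator B x * \<bar>g x\<bar> powr p)"
 proof (rule integral_mono)
  fix x
  show "indicator B x * (s powr p - p * s powr (p - 1) * s) + p * s powr (p - 1) * (indicator B x * \<bar>g x\<bar>)
    <= indicator B x * \<bar>g x\<bar> powr p"
   using powr_tangent[OF p s, of "\<bar>g x\<bar>"] by (simp add: indicator_def algebra_simps)
 qed (use i1 i3 indB in auto)
 also have "(LINT x|lborel. indicator B x * (s powr p - p * s powr (p - 1) * s) + p * s powr (p - 1) * (indicator B x * \<bar>g x\<bar>))
   = m * (s powr p - p * s powr (p - 1) * s) + p * s powr (p - 1) * (s * m)"
  using i1 indB by (simp add: sm)
 also have "... = m * s powr p" by (simp add: algebra_simps)
 finally have 1: "m * s powr p <= (LINT x|lborel. indicator B x * \<bar>g x\<bar> powr p)" .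
 have "\<bar>LINT x|lborel. indicator B x * g x\<bar> <= (LINT x|lborel. \<bar>indicator B x * g x\<bar>)"
  by (rule integral_abs_bound)
 also have "... = s * m" unfolding sm[symmetric] by (simp add: abs_mult)
 finally have "\<bar>LINT x|lborel. indicator B x * g x\<bar> powr p <= (s * m) powr p"
  using p by (intro powr_mono2) auto
 also have "... = m powr (p - 1) * (m * s powr p)" using s B(3) by (simp add: powr_mult powr_diff)
 also have "... <= m powr (p - 1) * (LINT x|lborel. indicator B x * \<bar>g x\<bar> powr p)"
  using 1 by (intro mult_left_mono) auto
 finally have "ennreal (\<bar>LINT x|lborel. indicator B x * g x\<bar> powr p) <=
   ennreal (m powr (p - 1)) * ennreal (LINT x|lborel. indicator B x * \<bar>g x\<bar> powr p)"
  by (simp add: ennreal_leI flip: ennreal_mult'')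
 also have "ennreal (LINT x|lborel. indicator B x * \<bar>g x\<bar> powr p) =
   (\<integral>\<^sup>+x. ennreal (indicator B x * \<bar>g x\<bar> powr p) \<partial>lborel)"
  using i3 by (intro nn_integral_eq_integral[symmetric]) auto
 also have "... = (\<integral>\<^sup>+x. ennreal (\<bar>g x\<bar> powr p) * indicator B x \<partial>lborel)"
  by (intro nn_integral_cong) (auto simp: indicator_def)
 finally show ?thesis .
qed

section \<open>Averages over dyadic cubes\<close>

definition Gp :: "real => ('a::euclidean_space => real) => ennreal" where
 "Gp p phi = (\<integral>\<^sup>+x. ennreal (norm (grad phi x) powr p) \<partial>lborel)"

text \<open>The increment is the integral of a directional derivative over a segment; Jensen on the
  unit interval, Fubini and translation invariance do the rest.\<close>

lemma translation_estimate:
 assumes p: "p > 1" and phi: "phi : test_functions Om"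
 shows "Lpow p (%x. phi (x + h) - phi x) <= ennreal (norm h powr p) * Gp p phi"
proof -
 have [measurable]: "phi : borel_measurable borel" "grad phi : borel_measurable borel"
  using test_functions_borel[OF phi] by auto
 obtain B where B: "B > 0" "!!x. norm (grad phi x) <= B" using test_functions_bounded[OF phi] by metis
 have pw: "ennreal (\<bar>phi (x + h) - phi x\<bar> powr p) <=
   (\<integral>\<^sup>+t. ennreal (norm h powr p) * ennreal (norm (grad phi (x + t *\<^sub>R h)) powr p) * indicator {0..1} t \<partial>lborel)" for x
 proof -
  define g where "g t = grad phi (x + t *\<^sub>R h) \<bullet> h" for t
  have "continuous_on UNIV (%t. x + t *\<^sub>R h)" by (intro continuous_intros)
  from continuous_on_compose2[OF test_functionsD(5)[OF phi] this]
  have contg: "continuous_on UNIV g" unfolding g_def by (intro continuous_on_inner continuous_on_const) simp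
  have "(LINT t|lborel. g t * indicator {0..1} t) = phi (x + 1 *\<^sub>R h) - phi (x + 0 *\<^sub>R h)"
  proof (rule integral_FTC_Icc_real)
   fix t :: real
   show "((%t. phi (x + t *\<^sub>R h)) has_real_derivative g t) (at t)"
    unfolding g_def by (rule line_derivative) (rule test_functionsD(4)[OF phi])
   show "isCont g t" using contg by (simp add: continuous_on_eq_continuous_at)
  qed simp
  then have e: "(LINT t|lborel. indicator {0..1} t * g t) = phi (x + h) - phi x" by (simp add: mult.commute)
  have gle: "\<bar>g t\<bar> <= norm (grad phi (x + t *\<^sub>R h)) * norm h" for t
   unfolding g_def by (rule Cauchy_Schwarz_ineq2)
  have "\<bar>g t\<bar> <= B * norm h" for t
   using gle[of t] B(2) by (meson mult_right_mono norm_ge_zero order_trans)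
  then have "ennreal (\<bar>LINT t|lborel. indicator {0..1} t * g t\<bar> powr p) <=
    ennreal (1 powr (p - 1)) * (\<integral>\<^sup>+t. ennreal (\<bar>g t\<bar> powr p) * indicator {0..1} t \<partial>lborel)"
   using contg p by (intro jensen_set[where K = "B * norm h"]) (auto intro: borel_measurable_continuous_onI)
  also have "... = (\<integral>\<^sup>+t. ennreal (\<bar>g t\<bar> powr p) * indicator {0..1} t \<partial>lborel)" by simp
  also have "... <= (\<integral>\<^sup>+t. ennreal (norm h powr p) * ennreal (norm (grad phi (x + t *\<^sub>R h)) powr p) * indicator {0..1} t \<partial>lborel)"
  proof (intro nn_integral_mono mult_right_mono)
   fix t
   have "\<bar>g t\<bar> powr p <= (norm (grad phi (x + t *\<^sub>R h)) * norm h) powr p"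
    using gle p by (intro powr_mono2) auto
   also have "... = norm h powr p * norm (grad phi (x + t *\<^sub>R h)) powr p" by (simp add: powr_mult)
   finally show "ennreal (\<bar>g t\<bar> powr p) <= ennreal (norm h powr p) * ennreal (norm (grad phi (x + t *\<^sub>R h)) powr p)"
    by (simp add: ennreal_leI flip: ennreal_mult'')
  qed auto
  finally show ?thesis by (simp add: e)
 qed
 have "Lpow p (%x. phi (x + h) - phi x) <=
   (\<integral>\<^sup>+x. (\<integral>\<^sup>+t. ennreal (norm h powr p) * ennreal (norm (grad phi (x + t *\<^sub>R h)) powr p) * indicator {0..1} t \<partial>lborel) \<partial>lborel)"
  by (intro nn_integral_mono pw)
 also have "... = (\<integral>\<^sup>+t. (\<integral>\<^sup>+x. ennreal (norm h powr p) * ennreal (norm (grad phi (x + t *\<^sub>R h)) powr p) * indicator {0..1} t \<partial>lborel) \<partial>lborel)"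
  by (rule lborel_pair.Fubini'[symmetric]) measurable
 also have "... = (\<integral>\<^sup>+t. ennreal (norm h powr p) * Gp p phi * indicator {0..1} (t::real) \<partial>lborel)"
 proof (rule nn_integral_cong)
  fix t :: real
  have "(\<integral>\<^sup>+x. ennreal (norm h powr p) * ennreal (norm (grad phi (x + t *\<^sub>R h)) powr p) * indicator {0..1} t \<partial>lborel)
    = (ennreal (norm h powr p) * indicator {0..1} t) * (\<integral>\<^sup>+x. ennreal (norm (grad phi (x + t *\<^sub>R h)) powr p) \<partial>lborel)"
   by (subst nn_integral_cmult[symmetric]) (auto simp: ac_simps)
  also have "(\<integral>\<^sup>+x. ennreal (norm (grad phi (x + t *\<^sub>R h)) powr p) \<partial>lborel) = Gp p phi"
   unfolding Gp_def by (rule lborel_nn_integral_translate) simp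
  finally show "(\<integral>\<^sup>+x. ennreal (norm h powr p) * ennreal (norm (grad phi (x + t *\<^sub>R h)) powr p) * indicator {0..1} t \<partial>lborel)
    = ennreal (norm h powr p) * Gp p phi * indicator {0..1} t" by (simp add: ac_simps)
 qed
 also have "... = ennreal (norm h powr p) * Gp p phi" by (simp add: nn_integral_cmult)
 finally show ?thesis .
qed

text \<open>The half-open grid cube of side l that contains x. With floors, lying in the same cube
  is an equivalence relation, so averages are constant on cubes.\<close>

definition cube :: "real => 'a::euclidean_space => 'a set" where
 "cube l x = {y. ALL b:Basis. \<lfloor>(y \<bullet> b) / l\<rfloor> = \<lfloor>(x \<bullet> b) / l\<rfloor>}"

definition cube_avg :: "real => ('a::euclidean_space => real) => 'a => real" where
 "cube_avg l phi x = (LINT y|lborel. indicator (cube l x) y * phi y) / l ^ DIM('a)"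

lemma cube_refl [simp]: "x : cube l x" by (simp add: cube_def)

lemma cube_cong: "y : cube l x ==> cube l y = cube l x"
 by (auto simp: cube_def)

lemma cube_dist:
 assumes "l > 0" "y : cube l x" "b : Basis"
 shows "\<bar>(y - x) \<bullet> b\<bar> <= l"
proof -
 have "\<lfloor>(y \<bullet> b) / l\<rfloor> = \<lfloor>(x \<bullet> b) / l\<rfloor>" using assms by (simp add: cube_def)
 then have "\<bar>(y \<bullet> b) / l - (x \<bullet> b) / l\<bar> <= 1" by linarith
 then have "\<bar>y \<bullet> b - x \<bullet> b\<bar> / l <= 1" using assms(1) by (simp add: diff_divide_distrib abs_divide flip: diff_divide_distrib)
 then show ?thesis using assms(1) by (simp add: inner_diff_left field_simps)
qed

lemma cube_norm: "l > 0 ==> y : cube l x ==> norm (y - x) <= DIM('a) * l" for x y :: "'a::euclidean_space" and l :: real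
proof -
 assume a: "l > 0" "y : cube l x"
 have "norm (y - x) <= (\<Sum>b\<in>Basis. \<bar>(y - x) \<bullet> b\<bar>)" by (rule norm_le_l1)
 also have "... <= (\<Sum>b\<in>(Basis :: 'a set). l)" using cube_dist[OF a] by (intro sum_mono) auto
 finally show ?thesis by simp
qed

lemma cube_measurable [measurable]: "cube l x : sets borel"
 unfolding cube_def by measurable

lemma cube_emeasure:
 fixes x :: "'a::euclidean_space"
 assumes l: "l > 0"
 shows "emeasure lborel (cube l x) = ennreal (l ^ DIM('a))"
proof -
 define a where "a = (\<Sum>b\<in>Basis. (l * \<lfloor>(x \<bullet> b) / l\<rfloor>) *\<^sub>R b)"
 have ab: "a \<bullet> b = l * \<lfloor>(x \<bullet> b) / l\<rfloor>" if "b : Basis" for b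
  using that by (simp add: a_def)
 have iff: "\<lfloor>(y \<bullet> b) / l\<rfloor> = \<lfloor>(x \<bullet> b) / l\<rfloor> \<longleftrightarrow> a \<bullet> b <= y \<bullet> b & y \<bullet> b < a \<bullet> b + l" if "b : Basis" for y b
  unfolding floor_eq_iff ab[OF that] using l by (simp add: field_simps)
 have One: "(a + l *\<^sub>R One) \<bullet> b = a \<bullet> b + l" if "b : Basis" for b
  using that by (simp add: inner_add_left)
 have 1: "box a (a + l *\<^sub>R One) \<subseteq> cube l x" "cube l x \<subseteq> cbox a (a + l *\<^sub>R One)"
  by (auto simp: mem_box cube_def iff One less_imp_le)
 have "emeasure lborel (box a (a + l *\<^sub>R One)) = ennreal (l ^ DIM('a))"
  "emeasure lborel (cbox a (a + l *\<^sub>R One)) = ennreal (l ^ DIM('a))"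
  using l One by (auto simp: emeasure_lborel_box_eq emeasure_lborel_cbox_eq)
 then show ?thesis
  using emeasure_mono[OF 1(1), of lborel] emeasure_mono[OF 1(2), of lborel] by (auto intro: antisym)
qed

lemma cube_avg_measurable [measurable]:
 assumes [measurable]: "phi : borel_measurable borel"
 shows "cube_avg l phi : borel_measurable borel"
proof -
 have "(%(x, y). indicator (cube l x) y * phi y) = (%(x, y). indicator {(x, y). ALL b:Basis. \<lfloor>(y \<bullet> b) / l\<rfloor> = \<lfloor>(x \<bullet> b) / l\<rfloor>} (x, y) * phi y)"
  by (auto simp: cube_def indicator_def)
 moreover have "... : borel_measurable (lborel \<Otimes>\<^sub>M lborel)" by measurable
 ultimately have "(%x. LINT y|lborel. indicator (cube l x) y * phi y) : borel_measurable lborel"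
  by (intro lborel.borel_measurable_lebesgue_integral) simp
 then show ?thesis unfolding cube_avg_def[abs_def] by simp
qed

lemma cube_avg_linear:
 assumes "integrable lborel phi" "integrable lborel psi"
 shows "cube_avg l (%x. c * phi x + d * psi x) x = c * cube_avg l phi x + d * cube_avg l psi x"
proof -
 have i: "integrable lborel (%y. indicator (cube l x) y * phi y)" "integrable lborel (%y. indicator (cube l x) y * psi y)"
  using integrable_mult_indicator[OF _ assms(1), of "cube l x"] integrable_mult_indicator[OF _ assms(2), of "cube l x"] by auto
 have "(LINT y|lborel. indicator (cube l x) y * (c * phi y + d * psi y)) =
   (LINT y|lborel. c * (indicator (cube l x) y * phi y) + d * (indicator (cube l x) y * psi y))"
  by (intro Bochner_Integration.integral_cong) (auto simp: algebra_simps)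
 also have "... = c * (LINT y|lborel. indicator (cube l x) y * phi y) + d * (LINT y|lborel. indicator (cube l x) y * psi y)"
  using i by simp
 finally show ?thesis by (simp add: cube_avg_def add_divide_distrib)
qed

lemma test_functions_integrable:
 assumes "phi : test_functions Om"
 shows "integrable lborel phi"
proof -
 obtain B where B: "!!x. \<bar>phi x\<bar> <= B" using test_functions_bounded[OF assms] by metis
 obtain R where R: "!!x. norm x > R ==> phi x = 0" using test_functions_support_ball[OF assms] by metis
 show ?thesis by (rule integrable_bounded_support[OF _ _ R]) (use B test_functions_borel[OF assms] in auto)
qed

lemma cube_avg_diff:
 fixes phi :: "'a::euclidean_space => real"
 assumes "integrable lborel phi" "l > 0"
 shows "phi x - cube_avg l phi x = (LINT y|lborel. indicator (cube l x) y * (phi x - phi y)) / l ^ DIM('a)"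
proof -
 have e: "emeasure lborel (cube l x) = ennreal (l ^ DIM('a))" by (rule cube_emeasure[OF assms(2)])
 have i: "integrable lborel (%y. indicator (cube l x) y * phi y)"
  using integrable_mult_indicator[OF _ assms(1), of "cube l x"] by auto
 have j: "integrable lborel (%y. indicator (cube l x) y * phi x)" using e by auto
 have "(LINT y|lborel. indicator (cube l x) y * (phi x - phi y)) =
   (LINT y|lborel. indicator (cube l x) y * phi x) - (LINT y|lborel. indicator (cube l x) y * phi y)"
  using i j by (simp add: right_diff_distrib)
 also have "(LINT y|lborel. indicator (cube l x) y * phi x) = l ^ DIM('a) * phi x"
  using e assms(2) by (simp add: measure_def)
 finally show ?thesis using assms(2) by (simp add: cube_avg_def diff_divide_distrib)
qed

lemma ennreal_mult_rearrange:
 "0 <= a ==> 0 <= b ==> 0 <= c ==> ennreal a * ((ennreal b * G) * ennreal c) = ennreal (a * b * c) * G"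
 by (simp add: ennreal_mult ac_simps)

text \<open>Within its cube a point only sees shifts from the box of side 2 l around zero, so the
  error is dominated by an average of translation errors. The factor \<open>2 ^ DIM('a)\<close> is
  the ratio of the two volumes, and such shifts have norm at most
  \<open>DIM('a) * l\<close>.\<close>

lemma cube_avg_error:
 fixes phi :: "'a::euclidean_space => real" and l :: real
 assumes p: "p > 1" and phi: "phi : test_functions Om" and l: "l > 0"
 shows "Lpow p (%x. phi x - cube_avg l phi x) <=
  ennreal (2 ^ DIM('a) * (DIM('a) * l) powr p) * Gp p phi"
proof -
 define m where "m = l ^ DIM('a)"
 have m: "m > 0" using l by (simp add: m_def)
 have [measurable]: "phi : borel_measurable borel" using test_functions_borel[OF phi] by auto
 obtain B where B: "B > 0" "!!x. \<bar>phi x\<bar> <= B" using test_functions_bounded[OF phi] by metis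
 define C where "C = cbox (- (l *\<^sub>R One)) (l *\<^sub>R (One :: 'a))"
 have C[measurable]: "C : sets borel" by (simp add: C_def)
 have eC: "emeasure lborel C = ennreal ((2 * l) ^ DIM('a))"
 proof -
  have "(\<Prod>b\<in>Basis. (l *\<^sub>R (One :: 'a) - - (l *\<^sub>R One)) \<bullet> b) = (\<Prod>b\<in>(Basis :: 'a set). 2 * l)"
   by (intro prod.cong) (auto simp: inner_add_left)
  moreover have "- (l *\<^sub>R One) \<bullet> b <= (l *\<^sub>R (One :: 'a)) \<bullet> b" if "b : Basis" for b
   using that l by simp
  ultimately show ?thesis by (simp add: C_def emeasure_lborel_cbox_eq)
 qed
 have "ennreal (\<bar>phi x - cube_avg l phi x\<bar> powr p) <=
   ennreal (1 / m) * (\<integral>\<^sup>+h. ennreal (\<bar>phi (x + h) - phi x\<bar> powr p) * indicator C h \<partial>lborel)" for x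
 proof -
  define g where "g y = phi x - phi y" for y
  have "\<bar>g y\<bar> <= 2 * B" for y using B(2)[of x] B(2)[of y] unfolding g_def by linarith
  moreover have "g : borel_measurable borel" unfolding g_def by measurable
  ultimately have J: "ennreal (\<bar>LINT y|lborel. indicator (cube l x) y * g y\<bar> powr p) <=
    ennreal (m powr (p - 1)) * (\<integral>\<^sup>+y. ennreal (\<bar>g y\<bar> powr p) * indicator (cube l x) y \<partial>lborel)"
   using p m by (intro jensen_set) (auto simp: cube_emeasure[OF l] m_def)
  have "\<bar>phi x - cube_avg l phi x\<bar> powr p = m powr (- p) * \<bar>LINT y|lborel. indicator (cube l x) y * g y\<bar> powr p"
   using m by (simp add: cube_avg_diff[OF test_functions_integrable[OF phi] l] abs_divide powr_divide
     powr_minus_divide g_def m_def[symmetric])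
  then have "ennreal (\<bar>phi x - cube_avg l phi x\<bar> powr p) =
    ennreal (m powr (- p)) * ennreal (\<bar>LINT y|lborel. indicator (cube l x) y * g y\<bar> powr p)"
   by (simp add: ennreal_mult)
  also have "... <= ennreal (m powr (- p)) * (ennreal (m powr (p - 1)) * (\<integral>\<^sup>+y. ennreal (\<bar>g y\<bar> powr p) * indicator (cube l x) y \<partial>lborel))"
   by (rule mult_left_mono[OF J]) simp
  also have "... = ennreal (1 / m) * (\<integral>\<^sup>+y. ennreal (\<bar>g y\<bar> powr p) * indicator (cube l x) y \<partial>lborel)"
   using m by (simp add: mult.assoc[symmetric] ennreal_mult[symmetric] powr_minus_divide powr_diff)
  also have "(\<integral>\<^sup>+y. ennreal (\<bar>g y\<bar> powr p) * indicator (cube l x) y \<partial>lborel) =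
    (\<integral>\<^sup>+h. ennreal (\<bar>g (h + x)\<bar> powr p) * indicator (cube l x) (h + x) \<partial>lborel)"
   unfolding g_def by (rule lborel_nn_integral_translate[symmetric]) measurable
  also have "... <= (\<integral>\<^sup>+h. ennreal (\<bar>phi (x + h) - phi x\<bar> powr p) * indicator C h \<partial>lborel)"
  proof (rule nn_integral_mono)
   fix h
   have "h + x : cube l x ==> h : C"
    using cube_dist[OF l, of "h + x" x] by (auto simp: C_def mem_box abs_le_iff minus_le_iff)
   then show "ennreal (\<bar>g (h + x)\<bar> powr p) * indicator (cube l x) (h + x) <= ennreal (\<bar>phi (x + h) - phi x\<bar> powr p) * indicator C h"
    by (auto simp: g_def add.commute indicator_def abs_minus_commute)
  qed
  finally show ?thesis by (simp add: mult_left_mono)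
 qed
 then have "Lpow p (%x. phi x - cube_avg l phi x) <=
   (\<integral>\<^sup>+x. ennreal (1 / m) * (\<integral>\<^sup>+h. ennreal (\<bar>phi (x + h) - phi x\<bar> powr p) * indicator C h \<partial>lborel) \<partial>lborel)"
  by (intro nn_integral_mono)
 also have "... = ennreal (1 / m) * (\<integral>\<^sup>+x. (\<integral>\<^sup>+h. ennreal (\<bar>phi (x + h) - phi x\<bar> powr p) * indicator C h \<partial>lborel) \<partial>lborel)"
  by (rule nn_integral_cmult) measurable
 also have "(\<integral>\<^sup>+x. (\<integral>\<^sup>+h. ennreal (\<bar>phi (x + h) - phi x\<bar> powr p) * indicator C h \<partial>lborel) \<partial>lborel) =
   (\<integral>\<^sup>+h. (\<integral>\<^sup>+x. ennreal (\<bar>phi (x + h) - phi x\<bar> powr p) * indicator C h \<partial>lborel) \<partial>lborel)"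
  by (rule lborel_pair.Fubini'[symmetric]) measurable
 also have "... = (\<integral>\<^sup>+h. Lpow p (%x. phi (x + h) - phi x) * indicator C h \<partial>lborel)"
  by (intro nn_integral_cong nn_integral_multc) measurable
 also have "... <= (\<integral>\<^sup>+h. (ennreal ((DIM('a) * l) powr p) * Gp p phi) * indicator C h \<partial>lborel)"
 proof (rule nn_integral_mono)
  fix h
  show "Lpow p (%x. phi (x + h) - phi x) * indicator C h <=
    (ennreal ((DIM('a) * l) powr p) * Gp p phi) * indicator C h"
  proof (cases "h : C")
   case True
   have "norm h <= (\<Sum>b\<in>Basis. \<bar>h \<bullet> b\<bar>)" by (rule norm_le_l1)
   also have "... <= (\<Sum>b\<in>(Basis :: 'a set). l)"
    using True by (intro sum_mono) (auto simp: C_def mem_box abs_le_iff minus_le_iff)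
   finally have "norm h powr p <= (DIM('a) * l) powr p" using p by (intro powr_mono2) auto
   then have "ennreal (norm h powr p) * Gp p phi <= ennreal ((DIM('a) * l) powr p) * Gp p phi"
    by (intro mult_right_mono ennreal_leI) auto
   then show ?thesis using translation_estimate[OF p phi, of h] True by (auto intro: order_trans)
  qed simp
 qed
 also have "... = (ennreal ((DIM('a) * l) powr p) * Gp p phi) * ennreal ((2 * l) ^ DIM('a))"
  by (simp add: nn_integral_cmult_indicator eC)
 also have "ennreal (1 / m) * ... = ennreal (1 / m * ((DIM('a) * l) powr p) * (2 * l) ^ DIM('a)) * Gp p phi"
  by (rule ennreal_mult_rearrange) (use m l in auto)
 also have "1 / m * ((DIM('a) * l) powr p) * (2 * l) ^ DIM('a) = 2 ^ DIM('a) * (DIM('a) * l) powr p"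
  using l by (simp add: m_def power_mult_distrib)
 finally show ?thesis by (simp add: mult_left_mono)
qed

section \<open>Dyadic increments and subcritical embeddings\<close>

definition Gr :: "real => ('a::euclidean_space => real) => real" where
 "Gr p phi = (LINT x|lborel. norm (grad phi x) powr p)"

lemma grad_powr_integrable:
 assumes p: "p > 0" and phi: "phi : test_functions Om"
 shows "integrable lborel (%x. norm (grad phi x) powr p)"
proof -
 obtain B where B: "B > 0" "!!x. norm (grad phi x) <= B" using test_functions_bounded[OF phi] by metis
 obtain R where R: "!!x. norm x > R ==> grad phi x = 0" using test_functions_support_ball[OF phi] by metis
 show ?thesis
  using B p R test_functions_borel[OF phi]
  by (intro integrable_bounded_support[where B = "B powr p" and R = R]) (auto intro!: powr_mono2)
qed

lemma Gp_eq:
 assumes "p > 0" "phi : test_functions Om"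
 shows "Gp p phi = ennreal (Gr p phi)"
 unfolding Gp_def Gr_def using grad_powr_integrable[OF assms] by (intro nn_integral_eq_integral) auto

lemma Gr_nonneg: "Gr p phi >= 0"
 unfolding Gr_def by (intro Bochner_Integration.integral_nonneg) auto

abbreviation dyad :: "nat => real" where "dyad k \<equiv> (1 / 2) ^ k"

lemma dyadic_cube_subset: "cube (dyad (Suc k)) x \<subseteq> cube (dyad k) x"
proof -
 have half: "\<lfloor>t / 2\<rfloor> = \<lfloor>t'/ 2\<rfloor>" if "\<lfloor>t\<rfloor> = \<lfloor>t'\<rfloor>" for t t' :: real
 proof -
  have "\<lfloor>u / 2\<rfloor> = \<lfloor>u\<rfloor> div 2" for u :: real
   by (rule floor_unique) (linarith | (simp, linarith))+
  then show ?thesis using that by simp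
 qed
 show ?thesis
 proof
  fix y assume y: "y : cube (dyad (Suc k)) x"
  have "\<lfloor>(y \<bullet> b) / dyad k\<rfloor> = \<lfloor>(x \<bullet> b) / dyad k\<rfloor>" if "b : Basis" for b
   using half[of "(y \<bullet> b) / dyad (Suc k)" "(x \<bullet> b) / dyad (Suc k)"] y that by (simp add: cube_def)
  then show "y : cube (dyad k) x" by (simp add: cube_def)
 qed
qed

definition dyad_diff :: "nat => ('a::euclidean_space => real) => 'a => real" where
 "dyad_diff k phi x = cube_avg (dyad (Suc k)) phi x - cube_avg (dyad k) phi x"

lemma dyad_diff_measurable [measurable]:
 "phi : borel_measurable borel ==> dyad_diff k phi : borel_measurable borel"
 unfolding dyad_diff_def[abs_def] by (intro borel_measurable_diff cube_avg_measurable)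

lemma dyad_diff_Lp:
 fixes phi :: "'a::euclidean_space => real"
 assumes p: "p > 1" and phi: "phi : test_functions Om"
 shows "Lpow p (dyad_diff k phi) <=
  ennreal (2 powr p * 2 * 2 ^ DIM('a) * DIM('a) powr p * dyad k powr p * Gr p phi)"
proof -
 have [measurable]: "phi : borel_measurable borel" using test_functions_borel[OF phi] by auto
 define e where "e l x = ennreal (\<bar>phi x - cube_avg l phi x\<bar> powr p)" for l x
 have e[measurable]: "e l : borel_measurable borel" for l unfolding e_def[abs_def] by measurable
 define c where "c = 2 ^ DIM('a) * DIM('a) powr p * dyad k powr p * Gr p phi"
 have c: "c >= 0" unfolding c_def using Gr_nonneg[of p phi] by simp
 have bound: "(\<integral>\<^sup>+x. e l x \<partial>lborel) <= ennreal c" if l: "0 < l" "l <= dyad k" for l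
 proof -
  have "(\<integral>\<^sup>+x. e l x \<partial>lborel) <= ennreal (2 ^ DIM('a) * (DIM('a) * l) powr p) * Gp p phi"
   unfolding e_def by (rule cube_avg_error[OF p phi l(1)])
  also have "... = ennreal (2 ^ DIM('a) * (DIM('a) * l) powr p * Gr p phi)"
   using Gp_eq[of p, OF _ phi] p Gr_nonneg[of p phi] by (simp add: ennreal_mult)
  also have "... <= ennreal (2 ^ DIM('a) * (DIM('a) * dyad k) powr p * Gr p phi)"
   using l p Gr_nonneg[of p phi]
   by (intro ennreal_leI mult_right_mono mult_left_mono powr_mono2) auto
  finally show ?thesis by (simp add: c_def powr_mult mult.assoc)
 qed
 have "Lpow p (dyad_diff k phi) <=
   (\<integral>\<^sup>+x. ennreal (2 powr p) * (e (dyad (Suc k)) x + e (dyad k) x) \<partial>lborel)"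
 proof (rule nn_integral_mono)
  fix x
  have "\<bar>dyad_diff k phi x\<bar> powr p <= (\<bar>phi x - cube_avg (dyad (Suc k)) phi x\<bar> + \<bar>phi x - cube_avg (dyad k) phi x\<bar>) powr p"
   unfolding dyad_diff_def using p by (intro powr_mono2) auto
  also have "... <= 2 powr p * (\<bar>phi x - cube_avg (dyad (Suc k)) phi x\<bar> powr p + \<bar>phi x - cube_avg (dyad k) phi x\<bar> powr p)"
   using p by (intro powr_add_le) auto
  finally show "ennreal (\<bar>dyad_diff k phi x\<bar> powr p) <= ennreal (2 powr p) * (e (dyad (Suc k)) x + e (dyad k) x)"
   unfolding e_def by (simp add: ennreal_leI flip: ennreal_plus ennreal_mult'')
 qed
 also have "... = ennreal (2 powr p) * ((\<integral>\<^sup>+x. e (dyad (Suc k)) x \<partial>lborel) + (\<integral>\<^sup>+x. e (dyad k) x \<partial>lborel))"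
  by (simp add: nn_integral_cmult nn_integral_add)
 also have "... <= ennreal (2 powr p) * (ennreal c + ennreal c)"
  by (intro mult_left_mono add_mono bound) (auto simp: mult_le_one power_le_one)
 also have "... = ennreal (2 powr p * (c + c))" using c by (simp add: ennreal_mult flip: ennreal_plus)
 finally show ?thesis by (simp add: c_def algebra_simps)
qed

text \<open>An inverse inequality: the increment is constant on the finer cubes, so each of its
  values already contributes its power times the volume of a cube to the integral.\<close>

lemma dyad_diff_sup:
 fixes phi :: "'a::euclidean_space => real"
 assumes "phi : borel_measurable borel"
 shows "ennreal (\<bar>dyad_diff k phi x\<bar> powr p * dyad (Suc k) ^ DIM('a)) <= Lpow p (dyad_diff k phi)"
proof -
 let ?Q = "cube (dyad (Suc k)) x"
 have c: "dyad_diff k phi y = dyad_diff k phi x" if "y : ?Q" for y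
 proof -
  have "cube (dyad k) y = cube (dyad k) x" using dyadic_cube_subset[of k x] that by (intro cube_cong) blast
  then show ?thesis unfolding dyad_diff_def cube_avg_def cube_cong[OF that] by simp
 qed
 have "(\<integral>\<^sup>+y. ennreal (\<bar>dyad_diff k phi x\<bar> powr p) * indicator ?Q y \<partial>lborel) <=
   Lpow p (dyad_diff k phi)"
 proof (rule nn_integral_mono)
  fix y
  show "ennreal (\<bar>dyad_diff k phi x\<bar> powr p) * indicator ?Q y <= ennreal (\<bar>dyad_diff k phi y\<bar> powr p)"
   by (cases "y : ?Q") (simp_all only: c indicator_simps, simp_all)
 qed
 moreover have "(\<integral>\<^sup>+y. ennreal (\<bar>dyad_diff k phi x\<bar> powr p) * indicator ?Q y \<partial>lborel) =
   ennreal (\<bar>dyad_diff k phi x\<bar> powr p) * emeasure lborel ?Q"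
  by (rule nn_integral_cmult_indicator) simp
 ultimately show ?thesis by (simp add: cube_emeasure ennreal_mult del: power_Suc)
qed

text \<open>Interpolation: of the s powers, s - p are estimated pointwise by
  \<open>dyad_diff_sup\<close> and p are integrated. The resulting exponent of the scale is positive
  exactly when s is subcritical.\<close>

lemma dyad_diff_Ls:
 fixes p s :: real
 assumes p: "p > 1" and s: "p < s"
 obtains C where "C >= 0" "!!(phi :: 'a::euclidean_space => real) Om k. phi : test_functions Om ==>
  Lpow s (dyad_diff k phi) <=
  ennreal (C * dyad k powr (s - DIM('a) * (s - p) / p) * Gr p phi powr (s / p))"
proof -
 define C0 where "C0 = 2 powr p * 2 * 2 ^ DIM('a) * DIM('a) powr p"
 have C0: "C0 > 0" by (simp add: C0_def)
 \<comment> \<open>The surplus s - p is written as p * t, because the pointwise estimate is one for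
   the p-th power.\<close>
 define t where "t = (s - p) / p"
 have t: "t > 0" "t + 1 = s / p" "p * t = s - p" using p s by (auto simp: t_def field_simps)
 define C where "C = C0 powr (s / p) * 2 powr (DIM('a) * t)"
 show ?thesis
 proof (rule that[of C])
  show "C >= 0" by (simp add: C_def)
  fix phi :: "'a => real" and Om k assume phi: "phi : test_functions Om"
  have m: "phi : borel_measurable borel" using test_functions_borel[OF phi] by auto
  have [measurable]: "dyad_diff k phi : borel_measurable borel" using m by (rule dyad_diff_measurable)
  define E where "E = C0 * dyad k powr p * Gr p phi"
  have E: "E >= 0" using C0 Gr_nonneg[of p phi] by (simp add: E_def)
  define v where "v = dyad (Suc k) ^ DIM('a)"
  have v: "v > 0" by (simp add: v_def)
  have IE: "Lpow p (dyad_diff k phi) <= ennreal E"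
   using dyad_diff_Lp[OF p phi, of k] by (simp add: E_def C0_def)
  have sup: "\<bar>dyad_diff k phi x\<bar> powr p <= E / v" for x
  proof -
   have "ennreal (\<bar>dyad_diff k phi x\<bar> powr p * v) <= ennreal E"
    using order_trans[OF dyad_diff_sup[OF m, of k x p] IE] by (simp add: v_def)
   then have "\<bar>dyad_diff k phi x\<bar> powr p * v <= E" using E by (simp add: ennreal_le_iff)
   then show ?thesis using v by (simp add: field_simps)
  qed
  have "Lpow s (dyad_diff k phi) <=
    (\<integral>\<^sup>+x. ennreal ((E / v) powr t) * ennreal (\<bar>dyad_diff k phi x\<bar> powr p) \<partial>lborel)"
  proof (rule nn_integral_mono)
   fix x
   let ?d = "\<bar>dyad_diff k phi x\<bar>"
   have "?d powr s = (?d powr p) powr t * ?d powr p"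
    using t(3) by (simp add: powr_powr flip: powr_add)
   also have "... <= (E / v) powr t * ?d powr p"
    using sup[of x] t(1) by (intro mult_right_mono powr_mono2) auto
   finally show "ennreal (?d powr s) <= ennreal ((E / v) powr t) * ennreal (?d powr p)"
    by (simp add: ennreal_leI flip: ennreal_mult'')
  qed
  also have "... = ennreal ((E / v) powr t) * Lpow p (dyad_diff k phi)"
   by (rule nn_integral_cmult) measurable
  also have "... <= ennreal ((E / v) powr t) * ennreal E" by (rule mult_left_mono[OF IE]) simp
  also have "... = ennreal ((E / v) powr t * E)" using E by (simp add: ennreal_mult)
  also have "(E / v) powr t * E = C * dyad k powr (s - DIM('a) * (s - p) / p) * Gr p phi powr (s / p)"
  proof -
   have "(E / v) powr t * E = E powr (s / p) * v powr (- t)"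
   proof (cases "E = 0")
    case False
    then have "E powr t * E = E powr (s / p)" using E t(2) by (simp add: powr_add flip: t(2))
    then show ?thesis using E v by (simp add: powr_divide powr_minus_divide)
   qed (use p s in auto)
   also have "E powr (s / p) = C0 powr (s / p) * dyad k powr s * Gr p phi powr (s / p)"
    using C0 Gr_nonneg[of p phi] p by (simp add: E_def powr_mult powr_powr)
   also have "v powr (- t) = 2 powr (DIM('a) * t) * dyad k powr (- (DIM('a) * t))"
   proof -
    have "v = (dyad k / 2) powr DIM('a)" by (simp add: v_def powr_realpow power_divide)
    then have "v powr (- t) = (dyad k / 2) powr (- (DIM('a) * t))" by (simp add: powr_powr)
    also have "... = dyad k powr (- (DIM('a) * t)) * 2 powr (DIM('a) * t)"
     by (simp add: powr_divide powr_minus_divide)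
    finally show ?thesis by simp
   qed
   finally have "(E / v) powr t * E = C * (dyad k powr s * dyad k powr (- (DIM('a) * t))) * Gr p phi powr (s / p)"
    by (simp add: C_def ac_simps)
   then show ?thesis by (simp add: t_def flip: powr_add)
  qed
  finally show "Lpow s (dyad_diff k phi) <=
    ennreal (C * dyad k powr (s - DIM('a) * (s - p) / p) * Gr p phi powr (s / p))" .
 qed
qed

text \<open>By the mean value theorem a test function varies on a cube of side l by at most a
  constant times l.\<close>

lemma cube_avg_tendsto:
 fixes phi :: "'a::euclidean_space => real"
 assumes phi: "phi : test_functions Om"
 shows "(%k. cube_avg (dyad k) phi x) ----> phi x"
proof -
 obtain B where B: "B > 0" "!!x. norm (grad phi x) <= B" using test_functions_bounded[OF phi] by metis
 have i: "integrable lborel (%y. indicator (cube l x) y * (phi x - phi y))" if "l > 0" for l :: real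
 proof -
  have "integrable lborel (%y. indicator (cube l x) y * phi x)" using cube_emeasure[OF that, of x] by auto
  moreover have "integrable lborel (%y. indicator (cube l x) y * phi y)"
   using integrable_mult_indicator[OF _ test_functions_integrable[OF phi], of "cube l x"] by auto
  ultimately show ?thesis by (simp add: right_diff_distrib)
 qed
 have "\<bar>phi x - cube_avg l phi x\<bar> <= B * (DIM('a) * l)" if l: "l > 0" for l :: real
 proof -
  have i2: "integrable lborel (%y. indicator (cube l x) y * (B * (DIM('a) * l)))"
   using cube_emeasure[OF l, of x] by auto
  have "\<bar>LINT y|lborel. indicator (cube l x) y * (phi x - phi y)\<bar> <= (LINT y|lborel. \<bar>indicator (cube l x) y * (phi x - phi y)\<bar>)"
   by (rule integral_abs_bound)
  also have "... <= (LINT y|lborel. indicator (cube l x) y * (B * (DIM('a) * l)))"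
  proof (rule integral_mono[OF integrable_abs[OF i[OF l]] i2])
   fix y
   show "\<bar>indicator (cube l x) y * (phi x - phi y)\<bar> <= indicator (cube l x) y * (B * (DIM('a) * l))"
   proof (cases "y : cube l x")
    case True
    obtain z where "phi (x + (y - x)) - phi x = grad phi (x + z *\<^sub>R (y - x)) \<bullet> (y - x)"
     using line_MVT[OF test_functionsD(4)[OF phi], of x "y - x"] by blast
    then have "\<bar>phi x - phi y\<bar> <= norm (grad phi (x + z *\<^sub>R (y - x))) * norm (y - x)"
     using Cauchy_Schwarz_ineq2[of "grad phi (x + z *\<^sub>R (y - x))" "y - x"] by (simp add: abs_minus_commute)
    also have "... <= B * (DIM('a) * l)" using B cube_norm[OF l True] by (intro mult_mono) auto
    finally show ?thesis using True by simp
   qed simp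
  qed
  also have "... = l ^ DIM('a) * (B * (DIM('a) * l))" using cube_emeasure[OF l, of x] l by (simp add: measure_def)
  finally show ?thesis
   using l by (simp add: cube_avg_diff[OF test_functions_integrable[OF phi] l] abs_divide pos_divide_le_eq mult.commute)
 qed
 then have "norm (cube_avg (dyad k) phi x - phi x) <= B * DIM('a) * dyad k" for k
  by (simp add: abs_minus_commute mult.assoc)
 moreover have "(%k. B * DIM('a) * dyad k) ----> 0" by (intro tendsto_mult_right_zero LIMSEQ_power_zero) simp
 ultimately have "(%k. cube_avg (dyad k) phi x - phi x) ----> 0"
  by (metis (no_types, lifting) Lim_null_comparison always_eventually)
 then show ?thesis by (simp add: LIM_zero_iff)
qed

lemma powr_below_one: "0 <= (a::real) ==> a < 1 ==> x > 0 ==> a powr x < 1"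
 using powr_less_mono2[of x a 1] by simp

text \<open>The error telescopes over the scales from k on; the increments are added with geometric
  weights, and Fatou's lemma removes the finest scale.\<close>

lemma subcritical_average:
 fixes p s :: real
 assumes p: "p > 1" and s: "p < s" and sub: "s * (DIM('a) - p) < DIM('a) * p"
 obtains ep where "ep ----> 0" "!!k. ep k >= 0" "!!(phi :: 'a::euclidean_space => real) Om k. phi : test_functions Om ==>
  Lpow s (%x. phi x - cube_avg (dyad k) phi x) <= ennreal (ep k * Gr p phi powr (s / p))"
proof -
 obtain C where C: "C >= 0" "!!(phi :: 'a => real) Om k. phi : test_functions Om ==>
  Lpow s (dyad_diff k phi) <=
  ennreal (C * dyad k powr (s - DIM('a) * (s - p) / p) * Gr p phi powr (s / p))"
  using dyad_diff_Ls[OF p s, where 'a = 'a] by blast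
 define e where "e = s - DIM('a) * (s - p) / p"
 have e: "e > 0" using sub p by (simp add: e_def field_simps)
 \<comment> \<open>Chosen so that \<open>dyad j powr e\<close> equals
   \<open>mu powr (s * j)\<close>. With weights proportional to mu ^ (j - k) the cost w j powr (1 -
   s) then leaves just one factor mu ^ (j - k), hence a convergent series, times (mu powr s) ^
   k.\<close>
 define mu where "mu = (1 / 2) powr (e / s)"
 have mu: "0 < mu" "mu < 1" using e s p by (auto simp: mu_def intro!: powr_below_one)
 have mus: "dyad j powr e = mu powr (s * j)" for j
  using s p by (simp add: mu_def powr_powr mult.commute flip: powr_realpow)
 define ep where "ep k = C * (1 - mu) powr (- s) * (mu powr s) ^ k" for k :: nat
 show ?thesis
 proof (rule that[of ep])
  have "\<bar>mu powr s\<bar> < 1" using mu s p by (simp add: powr_below_one)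
  then show "ep ----> 0" unfolding ep_def by (intro tendsto_mult_right_zero LIMSEQ_power_zero) simp
  show "ep k >= 0" for k using C(1) by (simp add: ep_def)
  fix phi :: "'a => real" and Om k assume phi: "phi : test_functions Om"
  have [measurable]: "phi : borel_measurable borel" using test_functions_borel[OF phi] by auto
  define G where "G = Gr p phi powr (s / p)"
  have G: "G >= 0" by (simp add: G_def)
  have fin: "Lpow s (%x. cube_avg (dyad K) phi x - cube_avg (dyad k) phi x) <= ennreal (ep k * G)"
   if K: "k <= K" for K
  proof -
   define w where "w j = (1 - mu) * mu ^ (j - k)" for j
   have w: "w j > 0" for j using mu by (simp add: w_def)
   have geo: "(\<Sum>j\<in>{k..<K}. mu ^ (j - k)) <= 1 / (1 - mu)"
   proof -
    have "(\<Sum>j\<in>{k..<K}. mu ^ (j - k)) = (\<Sum>i<K - k. mu ^ i)"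
     by (rule sum.reindex_bij_witness[of _ "%i. i + k" "%j. j - k"]) auto
    also have "... <= (\<Sum>i. mu ^ i)" using mu by (intro sum_le_suminf) auto
    also have "... = 1 / (1 - mu)" using mu by (simp add: suminf_geometric)
    finally show ?thesis .
   qed
   have w1: "(\<Sum>j\<in>{k..<K}. w j) <= 1"
    using geo mu unfolding w_def sum_distrib_left[symmetric] by (simp add: field_simps)
   have tele: "cube_avg (dyad K) phi x - cube_avg (dyad k) phi x = (\<Sum>j\<in>{k..<K}. dyad_diff j phi x)" for x
    using sum_Suc_diff'[OF K, of "%j. cube_avg (dyad j) phi x"] by (simp add: dyad_diff_def)
   have "Lpow s (%x. cube_avg (dyad K) phi x - cube_avg (dyad k) phi x) <=
     (\<integral>\<^sup>+x. (\<Sum>j\<in>{k..<K}. ennreal (w j powr (1 - s)) * ennreal (\<bar>dyad_diff j phi x\<bar> powr s)) \<partial>lborel)"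
   proof (rule nn_integral_mono)
    fix x
    have "\<bar>cube_avg (dyad K) phi x - cube_avg (dyad k) phi x\<bar> powr s <= (\<Sum>j\<in>{k..<K}. \<bar>dyad_diff j phi x\<bar>) powr s"
     unfolding tele using s p by (intro powr_mono2 sum_abs) auto
    also have "... <= (\<Sum>j\<in>{k..<K}. w j powr (1 - s) * \<bar>dyad_diff j phi x\<bar> powr s)"
     using s p w w1 by (intro powr_sum_weighted) auto
    finally show "ennreal (\<bar>cube_avg (dyad K) phi x - cube_avg (dyad k) phi x\<bar> powr s) <=
      (\<Sum>j\<in>{k..<K}. ennreal (w j powr (1 - s)) * ennreal (\<bar>dyad_diff j phi x\<bar> powr s))"
     by (simp add: ennreal_leI flip: ennreal_mult'')
   qed
   also have "... = (\<Sum>j\<in>{k..<K}. ennreal (w j powr (1 - s)) * Lpow s (dyad_diff j phi))"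
    by (subst nn_integral_sum) (auto simp: nn_integral_cmult)
   also have "... <= (\<Sum>j\<in>{k..<K}. ennreal (w j powr (1 - s)) * ennreal (C * dyad j powr e * G))"
    unfolding e_def G_def by (intro sum_mono mult_left_mono C(2)[OF phi]) auto
   also have "... = ennreal (\<Sum>j\<in>{k..<K}. w j powr (1 - s) * (C * dyad j powr e * G))"
    using C(1) G by (subst sum_ennreal[symmetric]) (auto simp: ennreal_mult)
   also have "(\<Sum>j\<in>{k..<K}. w j powr (1 - s) * (C * dyad j powr e * G)) =
     (\<Sum>j\<in>{k..<K}. (C * (1 - mu) powr (1 - s) * (mu powr s) ^ k * G) * mu ^ (j - k))"
   proof (rule sum.cong)
    fix j assume j: "j : {k..<K}"
    have "w j powr (1 - s) * dyad j powr e = (1 - mu) powr (1 - s) * (mu powr ((j - k) * (1 - s)) * mu powr (s * j))"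
     unfolding mus w_def using mu by (simp add: powr_mult powr_powr flip: powr_realpow)
    also have "mu powr ((j - k) * (1 - s)) * mu powr (s * j) = mu powr ((j - k) + s * k)"
     using j by (simp add: of_nat_diff algebra_simps flip: powr_add)
    also have "... = mu ^ (j - k) * (mu powr s) ^ k"
     using mu by (simp add: powr_add powr_powr flip: powr_realpow)
    finally have e1: "w j powr (1 - s) * dyad j powr e = (1 - mu) powr (1 - s) * (mu ^ (j - k) * (mu powr s) ^ k)" .
    have "w j powr (1 - s) * (C * dyad j powr e * G) = C * G * (w j powr (1 - s) * dyad j powr e)"
     by (simp only: ac_simps)
    also have "... = (C * (1 - mu) powr (1 - s) * (mu powr s) ^ k * G) * mu ^ (j - k)"
     unfolding e1 by (simp only: ac_simps)
    finally show "w j powr (1 - s) * (C * dyad j powr e * G) =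
      (C * (1 - mu) powr (1 - s) * (mu powr s) ^ k * G) * mu ^ (j - k)" .
   qed simp
   also have "... <= (C * (1 - mu) powr (1 - s) * (mu powr s) ^ k * G) * (1 / (1 - mu))"
    unfolding sum_distrib_left[symmetric] using geo C(1) G by (intro mult_left_mono) auto
   also have "... = ep k * G" using mu by (simp add: ep_def powr_diff powr_minus_divide)
   finally show ?thesis by (simp add: ennreal_leI)
  qed
  have lim: "(%K. ennreal (\<bar>cube_avg (dyad K) phi x - cube_avg (dyad k) phi x\<bar> powr s)) ---->
    ennreal (\<bar>phi x - cube_avg (dyad k) phi x\<bar> powr s)" for x
   using s p by (intro tendsto_ennrealI tendsto_powr' tendsto_rabs tendsto_diff cube_avg_tendsto[OF phi] tendsto_const) auto
  have "Lpow s (%x. phi x - cube_avg (dyad k) phi x) =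
    (\<integral>\<^sup>+x. liminf (%K. ennreal (\<bar>cube_avg (dyad K) phi x - cube_avg (dyad k) phi x\<bar> powr s)) \<partial>lborel)"
   by (intro nn_integral_cong lim_imp_Liminf[symmetric] lim) simp
  also have "... <= liminf (%K. \<integral>\<^sup>+x. ennreal (\<bar>cube_avg (dyad K) phi x - cube_avg (dyad k) phi x\<bar> powr s) \<partial>lborel)"
   by (rule nn_integral_liminf) measurable
  also have "... <= ennreal (ep k * G)"
  proof -
   have "\<forall>\<^sub>F K in sequentially. Lpow s (%x. cube_avg (dyad K) phi x - cube_avg (dyad k) phi x) <= ennreal (ep k * G)"
    using eventually_ge_at_top[of k] by eventually_elim (rule fin)
   from Liminf_mono[OF this] show ?thesis by (simp add: Liminf_const)
  qed
  finally show "Lpow s (%x. phi x - cube_avg (dyad k) phi x) <= ennreal (ep k * Gr p phi powr (s / p))"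
   by (simp add: G_def)
 qed
qed

text \<open>A shift longer than the diameter moves every point of \<open>Om\<close> out of
  \<open>Om\<close>, so |phi x| is itself a translation error.\<close>

lemma poincare:
 fixes Om :: "'a::euclidean_space set" and p :: real
 assumes p: "p > 1" and "bounded Om"
 obtains P where "P > 0" "!!phi. phi : test_functions Om ==>
  Lpow p phi <= ennreal (P * Gr p phi)"
proof -
 obtain R where R: "R > 0" "!!x. x : Om ==> norm x <= R" using assms(2) by (auto simp: bounded_pos)
 obtain b :: 'a where b: "b : Basis" using nonempty_Basis by blast
 define h where "h = (2 * R + 1) *\<^sub>R b"
 have h: "norm h = 2 * R + 1" using R b by (simp add: h_def)
 show ?thesis
 proof (rule that[of "norm h powr p"])
  show "norm h powr p > 0" using h R by simp
  fix phi assume phi: "phi : test_functions Om"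
  have "Lpow p phi <= Lpow p (%x. phi (x + h) - phi x)"
  proof (rule nn_integral_mono)
   fix x
   show "ennreal (\<bar>phi x\<bar> powr p) <= ennreal (\<bar>phi (x + h) - phi x\<bar> powr p)"
   proof (cases "x : Om")
    case True
    have "norm (x + h) >= norm h - norm x" by (metis add.commute norm_diff_ineq)
    then have "x + h \<notin> Om" using R(2)[OF True] R(2)[of "x + h"] h R(1) by fastforce
    then show ?thesis using test_functions_zero_outside[OF phi] by simp
   next
    case False
    then show ?thesis using test_functions_zero_outside[OF phi] by simp
   qed
  qed
  also have "... <= ennreal (norm h powr p) * Gp p phi" by (rule translation_estimate[OF p phi])
  also have "... = ennreal (norm h powr p * Gr p phi)"
   using Gp_eq[OF _ phi, of p] p Gr_nonneg[of p phi] by (simp add: ennreal_mult)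
  finally show "Lpow p phi <= ennreal (norm h powr p * Gr p phi)" .
 qed
qed

text \<open>Jensen on a single cube followed by the Poincare inequality; the volume of the cube
  stays in the denominator.\<close>

lemma average_bound:
 fixes Om :: "'a::euclidean_space set" and p :: real
 assumes p: "p > 1" and "bounded Om"
 obtains P where "P > 0" "!!phi k x. phi : test_functions Om ==>
  \<bar>cube_avg (dyad k) phi x\<bar> <= (P * Gr p phi / dyad k ^ DIM('a)) powr (1 / p)"
proof -
 obtain P where P: "P > 0" "!!phi. phi : test_functions Om ==>
  Lpow p phi <= ennreal (P * Gr p phi)"
  using poincare[OF assms] by blast
 show ?thesis
 proof (rule that[OF P(1)])
  fix phi :: "'a => real" and k x assume phi: "phi : test_functions Om"
  define m where "m = dyad k ^ DIM('a)"
  have m: "m > 0" by (simp add: m_def)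
  obtain B where B: "!!x. \<bar>phi x\<bar> <= B" using test_functions_bounded[OF phi] by metis
  define I where "I = \<bar>LINT y|lborel. indicator (cube (dyad k) x) y * phi y\<bar>"
  have G: "Gr p phi >= 0" by (rule Gr_nonneg)
  have "ennreal (I powr p) <= ennreal (m powr (p - 1)) * (\<integral>\<^sup>+y. ennreal (\<bar>phi y\<bar> powr p) * indicator (cube (dyad k) x) y \<partial>lborel)"
   unfolding I_def using p m B test_functions_borel[OF phi]
   by (intro jensen_set) (auto simp: cube_emeasure m_def)
  also have "... <= ennreal (m powr (p - 1)) * Lpow p phi"
   by (intro mult_left_mono nn_integral_mono) (auto simp: indicator_def)
  also have "... <= ennreal (m powr (p - 1)) * ennreal (P * Gr p phi)"
   by (intro mult_left_mono P(2)[OF phi]) simp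
  also have "... = ennreal (m powr (p - 1) * (P * Gr p phi))" using P(1) G by (simp add: ennreal_mult)
  finally have "I powr p <= m powr (p - 1) * (P * Gr p phi)" using P(1) G by (simp add: ennreal_le_iff)
  then have "(I powr p) powr (1 / p) <= (m powr (p - 1) * (P * Gr p phi)) powr (1 / p)"
   using p by (intro powr_mono2) auto
  moreover have "(I powr p) powr (1 / p) = I" using p by (simp add: powr_powr I_def)
  moreover have "m powr (p - 1) * (P * Gr p phi) = m powr p * (P * Gr p phi / m)" using m by (simp add: powr_diff)
  moreover have "(m powr p * (P * Gr p phi / m)) powr (1 / p) = m * (P * Gr p phi / m) powr (1 / p)"
  proof -
   have *: "(m powr p * c) powr (1 / p) = m * c powr (1 / p)" if "c >= 0" for c
    using m p that by (simp add: powr_mult powr_powr)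
   show ?thesis by (rule *) (use P(1) G m in auto)
  qed
  ultimately have "I <= m * (P * Gr p phi / m) powr (1 / p)" by simp
  then have "I / m <= (P * Gr p phi / m) powr (1 / p)" using m by (simp add: pos_divide_le_eq mult.commute)
  then show "\<bar>cube_avg (dyad k) phi x\<bar> <= (P * Gr p phi / dyad k ^ DIM('a)) powr (1 / p)"
   using m by (simp add: cube_avg_def I_def m_def abs_divide)
 qed
qed

text \<open>One estimate for three purposes, according to the size de of the averages on
  \<open>Om\<close>: bounded averages give the Sobolev inequality, small ones give compactness, and
  vanishing ones make the L^s integral small on a fixed sphere of the gradient norm.\<close>

lemma subcritical_on:
 fixes Om :: "'a::euclidean_space set" and p s :: real
 assumes p: "p > 1" and s: "p < s" and sub: "s * (DIM('a) - p) < DIM('a) * p"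
  and Om: "open Om" "bounded Om"
 obtains ep V where "ep ----> 0" "!!k. ep k >= 0" "V >= 0" "!!phi k de. phi : test_functions Om ==> de >= 0 ==>
  (!!x. x : Om ==> \<bar>cube_avg (dyad k) phi x\<bar> <= de) ==>
  Lpow s phi <= ennreal (ep k * Gr p phi powr (s / p) + V * de powr s)"
proof -
 obtain ep where ep: "ep ----> 0" "!!k. ep k >= 0" "!!(phi :: 'a => real) Om k. phi : test_functions Om ==>
  Lpow s (%x. phi x - cube_avg (dyad k) phi x) <= ennreal (ep k * Gr p phi powr (s / p))"
  using subcritical_average[OF p s, where 'a = 'a] sub by blast
 have Omb: "Om : sets borel" using Om(1) by simp
 have fin: "emeasure lborel Om < \<infinity>" using emeasure_bounded_finite[OF Om(2)] .
 define V where "V = measure lborel Om"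
 have V: "emeasure lborel Om = ennreal V" unfolding V_def using fin by (intro emeasure_eq_ennreal_measure) auto
 have V0: "V >= 0" by (simp add: V_def)
 show ?thesis
 proof (rule that[of "%k. 2 powr s * ep k" "2 powr s * V"])
  show "(%k. 2 powr s * ep k) ----> 0" using ep(1) by (rule tendsto_mult_right_zero)
  show "2 powr s * ep k >= 0" for k using ep(2) by simp
  show "2 powr s * V >= 0" using V0 by simp
  fix phi k and de :: real
  assume phi: "phi : test_functions Om" and de: "de >= 0" and av: "!!x. x : Om ==> \<bar>cube_avg (dyad k) phi x\<bar> <= de"
  have [measurable]: "phi : borel_measurable borel" using test_functions_borel[OF phi] by auto
  have [measurable]: "cube_avg (dyad k) phi : borel_measurable borel" by (rule cube_avg_measurable) measurable
  note Omb[measurable]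
  let ?e = "%x. ennreal (\<bar>phi x - cube_avg (dyad k) phi x\<bar> powr s)"
  have "Lpow s phi <=
    (\<integral>\<^sup>+x. ennreal (2 powr s) * (?e x + ennreal (de powr s) * indicator Om x) \<partial>lborel)"
  proof (rule nn_integral_mono)
   fix x
   show "ennreal (\<bar>phi x\<bar> powr s) <= ennreal (2 powr s) * (?e x + ennreal (de powr s) * indicator Om x)"
   proof (cases "x : Om")
    case True
    have "\<bar>phi x\<bar> powr s <= (\<bar>phi x - cube_avg (dyad k) phi x\<bar> + de) powr s"
     using av[OF True] s p by (intro powr_mono2) auto
    also have "... <= 2 powr s * (\<bar>phi x - cube_avg (dyad k) phi x\<bar> powr s + de powr s)"
     using s p de by (intro powr_add_le) auto
    finally show ?thesis using True by (simp add: ennreal_leI flip: ennreal_plus ennreal_mult'')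
   qed (simp add: test_functions_zero_outside[OF phi])
  qed
  also have "... = ennreal (2 powr s) * ((\<integral>\<^sup>+x. ?e x \<partial>lborel) + ennreal (de powr s) * emeasure lborel Om)"
   by (simp add: nn_integral_cmult nn_integral_add nn_integral_cmult_indicator)
  also have "... <= ennreal (2 powr s) * (ennreal (ep k * Gr p phi powr (s / p)) + ennreal (de powr s) * ennreal V)"
   unfolding V by (intro mult_left_mono add_mono ep(3)[OF phi]) auto
  also have "... = ennreal (2 powr s * (ep k * Gr p phi powr (s / p) + de powr s * V))"
   using ep(2)[of k] V0 by (simp flip: ennreal_plus ennreal_mult'' ennreal_mult')
  finally show "Lpow s phi <=
    ennreal (2 powr s * ep k * Gr p phi powr (s / p) + 2 powr s * V * de powr s)"
   by (simp add: algebra_simps)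
 qed
qed

text \<open>The case k = 0 of \<open>subcritical_on\<close>: averages over unit cubes are bounded by
  the gradient through \<open>average_bound\<close>.\<close>

lemma sobolev_subcritical:
 fixes Om :: "'a::euclidean_space set" and p s :: real
 assumes p: "p > 1" and s: "p < s" and sub: "s * (DIM('a) - p) < DIM('a) * p"
  and Om: "open Om" "bounded Om"
 obtains S where "S >= 0" "!!phi. phi : test_functions Om ==>
  Lpow s phi <= ennreal (S * Gr p phi powr (s / p))"
proof -
 obtain ep V where "ep ----> 0" and ep: "!!k. ep k >= 0" "V >= 0" "!!phi k de. phi : test_functions Om ==> de >= 0 ==>
  (!!x. x : Om ==> \<bar>cube_avg (dyad k) phi x\<bar> <= de) ==>
  Lpow s phi <= ennreal (ep k * Gr p phi powr (s / p) + V * de powr s)"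
  using subcritical_on[OF assms] by blast
 obtain P where P: "P > 0" "!!phi k x. phi : test_functions Om ==>
  \<bar>cube_avg (dyad k) phi x\<bar> <= (P * Gr p phi / dyad k ^ DIM('a)) powr (1 / p)"
  using average_bound[OF p Om(2)] by blast
 show ?thesis
 proof (rule that[of "ep 0 + V * P powr (s / p)"])
  show "ep 0 + V * P powr (s / p) >= 0" using ep(1)[of 0] ep(2) by simp
  fix phi assume phi: "phi : test_functions Om"
  have "((P * Gr p phi) powr (1 / p)) powr s = P powr (s / p) * Gr p phi powr (s / p)"
   using P(1) Gr_nonneg[of p phi] by (simp add: powr_powr powr_mult)
  then have e: "ep 0 * Gr p phi powr (s / p) + V * ((P * Gr p phi) powr (1 / p)) powr s =
    (ep 0 + V * P powr (s / p)) * Gr p phi powr (s / p)" by (simp add: distrib_right)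
  have "\<bar>cube_avg (dyad 0) phi x\<bar> <= (P * Gr p phi) powr (1 / p)" for x using P(2)[OF phi, of 0 x] by simp
  then show "Lpow s phi <= ennreal ((ep 0 + V * P powr (s / p)) * Gr p phi powr (s / p))"
   unfolding e[symmetric] by (intro ep(3)[OF phi]) auto
 qed
qed

section \<open>Compactness from countably many averages\<close>

text \<open>A cube is determined by its vector of floors, and on a bounded set only finitely many
  integer vectors occur.\<close>

lemma cube_representatives:
 fixes Om :: "'a::euclidean_space set"
 assumes "bounded Om" "l > 0"
 obtains X where "finite X" "X \<subseteq> Om" "!!x. x : Om ==> EX y:X. cube l x = cube l y"
proof -
 obtain R where R: "R > 0" "!!x. x : Om ==> norm x <= R" using assms(1) by (auto simp: bounded_pos)
 define F where "F x = restrict (%b. \<lfloor>(x \<bullet> b) / l\<rfloor>) Basis" for x :: 'a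
 have "F ` Om \<subseteq> Basis \<rightarrow>\<^sub>E {\<lfloor>- R / l\<rfloor>..\<lfloor>R / l\<rfloor>}"
 proof (intro subsetI, elim imageE)
  fix f x assume x: "f = F x" "x : Om"
  have "\<lfloor>(x \<bullet> b) / l\<rfloor> : {\<lfloor>- R / l\<rfloor>..\<lfloor>R / l\<rfloor>}" if "b : Basis" for b
  proof -
   have "\<bar>x \<bullet> b\<bar> <= R" using Basis_le_norm[OF that, of x] R(2)[OF x(2)] by linarith
   then have "- R / l <= (x \<bullet> b) / l" "(x \<bullet> b) / l <= R / l"
    using assms(2) divide_right_mono[of "- R" "x \<bullet> b" l] divide_right_mono[of "x \<bullet> b" R l] by auto
   then show ?thesis by (simp add: floor_mono)
  qed
  then show "f : Basis \<rightarrow>\<^sub>E {\<lfloor>- R / l\<rfloor>..\<lfloor>R / l\<rfloor>}" by (auto simp: x F_def)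
 qed
 then have "finite (F ` Om)" by (rule finite_subset) (auto intro: finite_PiE)
 then obtain X where X: "X \<subseteq> Om" "finite X" "F ` Om = F ` X"
  using finite_subset_image[of "F ` Om" F Om] by auto
 have "EX y:X. cube l x = cube l y" if "x : Om" for x
 proof -
  have "F x : F ` X" using that X(3) by blast
  then obtain y where y: "y : X" "F x = F y" by auto
  then have "\<lfloor>(x \<bullet> b) / l\<rfloor> = \<lfloor>(y \<bullet> b) / l\<rfloor>" if "b : Basis" for b
   using that unfolding F_def by (metis restrict_apply')
  then have "cube l x = cube l y" by (simp add: cube_def)
  then show ?thesis using y(1) by blast
 qed
 then show ?thesis using that X by blast
qed

lemma cube_avg_cong: "cube l x = cube l y ==> cube_avg l phi x = cube_avg l phi y"
 by (simp add: cube_avg_def)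

lemma Gr_diff_le:
 fixes phi psi :: "'a::euclidean_space => real"
 assumes p: "p > 1" and phi: "phi : test_functions Om" and psi: "psi : test_functions Om"
 shows "Gr p (%x. phi x - psi x) <= 2 powr p * (Gr p phi + Gr p psi)"
proof -
 have d: "(%x. phi x - psi x) : test_functions Om" "grad (%x. phi x - psi x) x = grad phi x - grad psi x" for x
  using test_functions_lincomb[OF phi psi, of 1 "-1"] by auto
 have i: "integrable lborel (%x. norm (grad phi x) powr p)" "integrable lborel (%x. norm (grad psi x) powr p)"
  using grad_powr_integrable[OF _ phi, of p] grad_powr_integrable[OF _ psi, of p] p by auto
 have "Gr p (%x. phi x - psi x) <= (LINT x|lborel. 2 powr p * (norm (grad phi x) powr p + norm (grad psi x) powr p))"
  unfolding Gr_def
 proof (rule integral_mono)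
  show "integrable lborel (%x. norm (grad (%x. phi x - psi x) x) powr p)"
   using grad_powr_integrable[OF _ d(1), of p] p by auto
  fix x
  have "norm (grad (%x. phi x - psi x) x) powr p <= (norm (grad phi x) + norm (grad psi x)) powr p"
   unfolding d(2) using p by (intro powr_mono2 norm_triangle_ineq4) auto
  also have "... <= 2 powr p * (norm (grad phi x) powr p + norm (grad psi x) powr p)"
   using p by (intro powr_add_le) auto
  finally show "norm (grad (%x. phi x - psi x) x) powr p <= 2 powr p * (norm (grad phi x) powr p + norm (grad psi x) powr p)" .
 qed (use i in auto)
 also have "... = 2 powr p * (Gr p phi + Gr p psi)" using i by (simp add: Gr_def)
 finally show ?thesis .
qed

lemma compact_fun_box_nat:
 fixes v :: "nat => nat => real"
 assumes "!!n i. \<bar>v n i\<bar> <= b i"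
 obtains l r where "strict_mono (r :: nat => nat)" "!!i. (%n. v (r n) i) ----> l i"
proof -
 interpret nat_diag: subseqs "%i r. convergent (%n. v (r n) i)"
 proof
  fix i and s :: "nat => nat" assume "strict_mono s"
  have v: "ALL n. v (s n) i : {- b i..b i}" using assms by (auto simp: abs_le_iff minus_le_iff)
  have *: "EX l r. strict_mono r & (f \<circ> r) ----> l" if "ALL n. f n : {- b i..b i}" for f :: "nat => real"
   using compact_Icc[of "- b i" "b i"] that unfolding compact_eq_seq_compact_metric seq_compact_def by blast
  from *[OF v] obtain l r where "strict_mono r" "((%n. v (s n) i) \<circ> r) ----> l" by blast
  then show "EX r. strict_mono r & convergent (%n. v ((s \<circ> r) n) i)"
   by (auto simp: convergent_def o_def)
 qed
 have "convergent (%n. v (nat_diag.diagseq n) i)" for i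
 proof -
  have "convergent (%n. v ((nat_diag.diagseq \<circ> ((+) (Suc i))) n) i)"
  proof (rule nat_diag.diagseq_holds)
   fix m and s r :: "nat => nat" assume "strict_mono s" "convergent (%n. v (r n) m)"
   then show "convergent (%n. v ((r \<circ> s) n) m)"
    using convergent_subseq_convergent[of "%n. v (r n) m" s] by (simp add: o_def)
  qed
  then show ?thesis
   using convergent_ignore_initial_segment[of "%n. v (nat_diag.diagseq n) i" "Suc i"]
   unfolding o_def add.commute[of "Suc i"] by blast
 qed
 then have "(%n. v (nat_diag.diagseq n) i) ----> lim (%n. v (nat_diag.diagseq n) i)" for i
  by (simp add: convergent_LIMSEQ_iff)
 then show ?thesis by (rule that[OF nat_diag.subseq_diagseq])
qed

text \<open>A diagonal subsequence makes the averages at all scales converge. At a fixed scale only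
  finitely many cubes matter, so differences of late members have small averages, and
  \<open>subcritical_on\<close> applies to them.\<close>

lemma rellich_subsequence:
 fixes Om :: "'a::euclidean_space set" and p s :: real and phi :: "nat => 'a => real"
 assumes p: "p > 1" and s: "p < s" and sub: "s * (DIM('a) - p) < DIM('a) * p"
  and Om: "open Om" "bounded Om"
  and phi: "!!n. phi n : test_functions Om" and K: "!!n. Gr p (phi n) <= K"
 obtains r where "strict_mono (r :: nat => nat)"
  "!!e. e > 0 ==> EX n0. ALL i>=n0. ALL j>=n0. Lpow s (%x. phi (r i) x - phi (r j) x) <= ennreal e"
proof -
 obtain ep V where ep: "ep ----> 0" "!!k. ep k >= 0" "V >= 0" "!!phi k de. phi : test_functions Om ==> de >= 0 ==>
  (!!x. x : Om ==> \<bar>cube_avg (dyad k) phi x\<bar> <= de) ==>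
  Lpow s phi <= ennreal (ep k * Gr p phi powr (s / p) + V * de powr s)"
  using subcritical_on[OF p s sub Om] by blast
 obtain P where P: "P > 0" "!!phi k x. phi : test_functions Om ==>
  \<bar>cube_avg (dyad k) phi x\<bar> <= (P * Gr p phi / dyad k ^ DIM('a)) powr (1 / p)"
  using average_bound[OF p Om(2)] by blast
 have "EX X. finite X & X \<subseteq> Om & (ALL x:Om. EX y:X. cube (dyad k) x = cube (dyad k) y)" for k
  using cube_representatives[OF Om(2), of "dyad k"] by (metis zero_less_divide_1_iff zero_less_numeral zero_less_power)
 then obtain X where X: "!!k. finite (X k)" "!!k x. x : Om ==> EX y:X k. cube (dyad k) x = cube (dyad k) y" by metis
 \<comment> \<open>The extra pair (0, 0) keeps the index set nonempty for the enumeration, also when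
   no cube meets \<open>Om\<close>.\<close>
 define I where "I = (SIGMA k:UNIV. X k) \<union> {(0, 0)}"
 have "countable (SIGMA k:UNIV. X k)" using countable_SIGMA[OF countableI_type countable_finite[OF X(1)]] .
 then have I: "countable I" "I ~= {}" unfolding I_def by auto
 define v where "v n i = (case from_nat_into I i of (k, y) => cube_avg (dyad k) (phi n) y)" for n i
 define bd where "bd i = (case from_nat_into I i of (k, y) => (P * K / dyad k ^ DIM('a)) powr (1 / p))" for i
 have vb: "\<bar>v n i\<bar> <= bd i" for n i
 proof -
  obtain k y where ky: "from_nat_into I i = (k, y)" by fastforce
  have "\<bar>cube_avg (dyad k) (phi n) y\<bar> <= (P * Gr p (phi n) / dyad k ^ DIM('a)) powr (1 / p)" by (rule P(2)[OF phi])
  also have "... <= (P * K / dyad k ^ DIM('a)) powr (1 / p)"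
   using P(1) K[of n] Gr_nonneg[of p "phi n"] p by (intro powr_mono2 divide_right_mono mult_left_mono) auto
  finally show ?thesis by (simp add: v_def bd_def ky)
 qed
 obtain l r where r: "strict_mono (r :: nat => nat)" "!!i. (%n. v (r n) i) ----> l i"
  using compact_fun_box_nat[of v bd, OF vb] by blast
 define G where "G = 2 powr p * (K + K)"
 have G: "G >= 0" using K[of 0] Gr_nonneg[of p "phi 0"] by (simp add: G_def)
 show ?thesis
 proof (rule that[OF r(1)])
  fix e :: real assume e: "e > 0"
  have "(%k. ep k * G powr (s / p)) ----> 0" by (rule tendsto_mult_left_zero[OF ep(1)])
  then have "\<forall>\<^sub>F k in sequentially. ep k * G powr (s / p) < e / 2" using e by (intro order_tendstoD(2)) auto
  then obtain k where k: "ep k * G powr (s / p) < e / 2" by (meson eventually_happens sequentially_bot)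
  \<comment> \<open>Small enough that V * de powr s <= e / 2; one is added to V because V may be
    zero.\<close>
  define de where "de = (e / (2 * (V + 1))) powr (1 / s)"
  have de: "de > 0" using e ep(3) by (simp add: de_def)
  have "de powr s = e / (2 * (V + 1))" using e ep(3) s p by (simp add: de_def powr_powr)
  then have "V * de powr s = V * (e / (2 * (V + 1)))" by simp
  also have "... <= e / 2" using e ep(3) by (simp add: field_simps)
  finally have Vde: "V * de powr s <= e / 2" .
  have ev: "\<forall>\<^sub>F n in sequentially. \<bar>cube_avg (dyad k) (phi (r n)) y - l (to_nat_on I (k, y))\<bar> < de / 2" if "y : X k" for y
  proof -
   have "(k, y) : I" using that by (simp add: I_def)
   then have "from_nat_into I (to_nat_on I (k, y)) = (k, y)" using I(1) by simp
   then have "(%n. cube_avg (dyad k) (phi (r n)) y) ----> l (to_nat_on I (k, y))"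
    using r(2)[of "to_nat_on I (k, y)"] by (simp add: v_def)
   then have "\<forall>\<^sub>F n in sequentially. dist (cube_avg (dyad k) (phi (r n)) y) (l (to_nat_on I (k, y))) < de / 2"
    using de by (intro tendstoD) auto
   then show ?thesis by (simp add: dist_real_def)
  qed
  have "\<forall>\<^sub>F n in sequentially. ALL y:X k. \<bar>cube_avg (dyad k) (phi (r n)) y - l (to_nat_on I (k, y))\<bar> < de / 2"
   using ev by (intro eventually_ball_finite[OF X(1)]) auto
  then obtain n0 where n0: "!!n y. n >= n0 ==> y : X k ==> \<bar>cube_avg (dyad k) (phi (r n)) y - l (to_nat_on I (k, y))\<bar> < de / 2"
   unfolding eventually_sequentially by blast
  have "Lpow s (%x. phi (r i) x - phi (r j) x) <= ennreal e" if ij: "i >= n0" "j >= n0" for i j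
  proof -
   let ?d = "%x. phi (r i) x - phi (r j) x"
   have d: "?d : test_functions Om" using test_functions_lincomb(1)[OF phi phi, of 1 "r i" "-1" "r j"] by simp
   have "\<bar>cube_avg (dyad k) ?d x\<bar> <= de" if x: "x : Om" for x
   proof -
    obtain y where y: "y : X k" "cube (dyad k) x = cube (dyad k) y" using X(2)[OF x] by blast
    have "cube_avg (dyad k) ?d y = cube_avg (dyad k) (phi (r i)) y - cube_avg (dyad k) (phi (r j)) y"
     using cube_avg_linear[OF test_functions_integrable[OF phi] test_functions_integrable[OF phi], of "dyad k" 1 "r i" "-1" "r j" y]
     by simp
    then show ?thesis unfolding cube_avg_cong[OF y(2)] using n0[OF ij(1) y(1)] n0[OF ij(2) y(1)] by linarith
   qed
   then have "Lpow s ?d <= ennreal (ep k * Gr p ?d powr (s / p) + V * de powr s)"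
    using de by (intro ep(4)[OF d]) auto
   also have "... <= ennreal e"
   proof (rule ennreal_leI)
    have "Gr p ?d <= G" unfolding G_def
     using Gr_diff_le[OF p phi phi, of "r i" "r j"] K[of "r i"] K[of "r j"]
     by (elim order_trans) (intro mult_left_mono, auto)
    then have "ep k * Gr p ?d powr (s / p) <= ep k * G powr (s / p)"
     using ep(2) Gr_nonneg[of p ?d] s p by (intro mult_left_mono powr_mono2) auto
    then show "ep k * Gr p ?d powr (s / p) + V * de powr s <= e" using k Vde by linarith
   qed
   finally show ?thesis .
  qed
  then show "EX n0. ALL i>=n0. ALL j>=n0. Lpow s (%x. phi (r i) x - phi (r j) x) <= ennreal e" by blast
 qed
qed

section \<open>Uniform convexity of powers of the norm\<close>

text \<open>The derivative p * x powr (p - 1) is strictly increasing, so the mean slopes over the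
  two halves of the interval differ.\<close>

lemma powr_strict_midpoint:
 fixes s t p :: real
 assumes p: "p > 1" and st: "0 <= s" "s < t"
 shows "((s + t) / 2) powr p < (s powr p + t powr p) / 2"
proof -
 define m where "m = (s + t) / 2"
 have m: "s < m" "m < t" "t - m = m - s" "m > 0" using st by (auto simp: m_def field_simps)
 have d: "((%x. x powr p) has_real_derivative p * x powr (p - 1)) (at x)" if "x > 0" for x
  using that by (auto intro!: derivative_eq_intros)
 have diff: "(%x. x powr p) differentiable (at x)" if "x > 0" for x
  using d[OF that] real_differentiable_def by blast
 have c: "continuous_on {a..b} (%x. x powr p)" if "0 <= a" for a b :: real
  using that p by (intro continuous_on_powr' continuous_intros) auto
 obtain l x where x: "m < x" "((%x. x powr p) has_real_derivative l) (at x)" "t powr p - m powr p = (t - m) * l"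
 proof -
  have "EX l z. m < z & z < t & DERIV (%x. x powr p) z :> l & t powr p - m powr p = (t - m) * l"
   by (rule MVT) (use m c[of m t] diff in auto)
  then show ?thesis using that by blast
 qed
 obtain k y where y: "s < y" "y < m" "((%x. x powr p) has_real_derivative k) (at y)" "m powr p - s powr p = (m - s) * k"
 proof -
  have "EX l z. s < z & z < m & DERIV (%x. x powr p) z :> l & m powr p - s powr p = (m - s) * l"
   by (rule MVT) (use st m c[of s m] diff in auto)
  then show ?thesis using that by blast
 qed
 have "l = p * x powr (p - 1)" "k = p * y powr (p - 1)"
  using DERIV_unique[OF x(2) d] DERIV_unique[OF y(3) d] x y m st by auto
 moreover have "y powr (p - 1) < x powr (p - 1)" using p st x y by (intro powr_less_mono2) auto
 ultimately have "k < l" using p by simp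
 then have "(m - s) * k < (t - m) * l" using m by simp
 then show ?thesis using x(3) y(4) unfolding m_def[symmetric] by simp
qed

text \<open>For equal norms strictness comes from the parallelogram law, otherwise from the scalar
  case.\<close>

lemma norm_powr_strict_midpoint:
 fixes xi eta :: "'b::euclidean_space" and p :: real
 assumes p: "p > 1" and ne: "xi ~= eta"
 shows "norm ((1 / 2) *\<^sub>R (xi + eta)) powr p < (norm xi powr p + norm eta powr p) / 2"
proof (cases "norm xi = norm eta")
 case True
 have "(norm (xi + eta))\<^sup>2 + (norm (xi - eta))\<^sup>2 = 2 * (norm xi)\<^sup>2 + 2 * (norm eta)\<^sup>2"
  by (simp add: power2_norm_eq_inner inner_add_left inner_add_right inner_diff_left inner_diff_right)
 moreover have "(norm (xi - eta))\<^sup>2 > 0" using ne by simp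
 moreover have "(2 * norm xi)\<^sup>2 = 2 * (norm xi)\<^sup>2 + 2 * (norm eta)\<^sup>2"
  using True by (simp add: power_mult_distrib)
 ultimately have "(norm (xi + eta))\<^sup>2 < (2 * norm xi)\<^sup>2" by linarith
 then have "norm (xi + eta) < 2 * norm xi" by (rule power2_less_imp_less) simp
 then have "norm ((1 / 2) *\<^sub>R (xi + eta)) powr p < norm xi powr p"
  using p by (intro powr_less_mono2) auto
 then show ?thesis using True by simp
next
 case False
 have "norm ((1 / 2) *\<^sub>R (xi + eta)) powr p <= ((norm xi + norm eta) / 2) powr p"
  using p norm_triangle_ineq[of xi eta] by (intro powr_mono2) auto
 also have "... < (norm xi powr p + norm eta powr p) / 2"
  using False powr_strict_midpoint[OF p, of "norm xi" "norm eta"] powr_strict_midpoint[OF p, of "norm eta" "norm xi"]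
  by (cases "norm xi < norm eta") (auto simp: add.commute)
 finally show ?thesis .
qed

text \<open>All terms are homogeneous of degree p, so it suffices to consider pairs on the unit
  sphere. Those for which the ep term alone does not strictly suffice form a compact set
  \<open>K\<close> on which the convexity gap is positive, hence at least some c.\<close>

lemma norm_powr_midpoint_gap:
 fixes p ep :: real
 assumes p: "p > 1" and ep: "ep > 0"
 obtains C where "C >= 0" "!!xi eta :: 'b::euclidean_space. norm (eta - xi) powr p <= ep * (norm xi powr p + norm eta powr p) +
  C * ((norm xi powr p + norm eta powr p) / 2 - norm ((1 / 2) *\<^sub>R (xi + eta)) powr p)"
proof -
 define K where "K = sphere 0 1 \<inter> {z :: 'b \<times> 'b. ep * (norm (fst z) powr p + norm (snd z) powr p) <= norm (snd z - fst z) powr p}"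
 define g where "g z = (norm (fst z) powr p + norm (snd z) powr p) / 2 - norm ((1 / 2) *\<^sub>R (fst z + snd z)) powr p" for z :: "'b \<times> 'b"
 have contn: "continuous_on A (%z. norm (h z) powr p)" if "continuous_on A h" for h :: "'b \<times> 'b => 'b" and A
  using that p by (intro continuous_on_powr' continuous_intros) auto
 have contg: "continuous_on A g" for A unfolding g_def by (intro continuous_intros contn) auto
 have "compact K" unfolding K_def
  by (intro compact_Int_closed compact_sphere closed_Collect_le continuous_intros contn)
 have gpos: "g z > 0" if "z : K" for z
 proof -
  have "fst z ~= snd z"
  proof
   assume e: "fst z = snd z"
   have "ep * (norm (fst z) powr p + norm (snd z) powr p) <= 0" using that e p by (auto simp: K_def)
   then have "norm (fst z) powr p + norm (snd z) powr p <= 0" using ep by (simp add: mult_le_0_iff)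
   then have "norm (fst z) powr p = 0" by (simp add: add_nonneg_eq_0_iff e)
   then have "z = 0" using e by (simp add: prod_eq_iff)
   then show False using that by (simp add: K_def)
  qed
  then show ?thesis using norm_powr_strict_midpoint[OF p, of "fst z" "snd z"] by (simp add: g_def)
 qed
 have "EX c>0. ALL z:K. c <= g z"
 proof (cases "K = {}")
  case False
  then obtain z0 where "z0 : K" "!!z. z : K ==> g z0 <= g z"
   using continuous_attains_inf[OF \<open>compact K\<close> False contg] by blast
  then show ?thesis using gpos by blast
 qed (auto intro: exI[of _ 1])
 then obtain c where c: "c > 0" "!!z. z : K ==> c <= g z" by blast
 have g0: "g z >= 0" for z
  using norm_powr_strict_midpoint[OF p, of "fst z" "snd z"] by (cases "fst z = snd z") (auto simp: g_def less_imp_le)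
 have scale: "norm (r *\<^sub>R v) powr p = r powr p * norm v powr p" if "r >= 0" for r and v :: 'b
  using that by (simp add: powr_mult)
 show ?thesis
 \<comment> \<open>The difference is at most twice the norm r of the pair, and r powr p is at most
   the gap divided by c.\<close>
 proof (rule that[of "2 powr p / c"])
  show "2 powr p / c >= 0" using c by simp
  fix xi eta :: 'b
  have gz: "(norm xi powr p + norm eta powr p) / 2 - norm ((1 / 2) *\<^sub>R (xi + eta)) powr p = g (xi, eta)"
   by (simp add: g_def)
  show "norm (eta - xi) powr p <= ep * (norm xi powr p + norm eta powr p) +
   2 powr p / c * ((norm xi powr p + norm eta powr p) / 2 - norm ((1 / 2) *\<^sub>R (xi + eta)) powr p)"
  proof (cases "norm (eta - xi) powr p <= ep * (norm xi powr p + norm eta powr p)")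
   case True
   then show ?thesis unfolding gz using g0[of "(xi, eta)"] c by (simp add: add_increasing2)
  next
   case False
   define r where "r = norm (xi, eta)"
   have r: "r > 0"
   proof (rule ccontr)
    assume "~ r > 0"
    then have "(xi, eta) = 0" by (simp add: r_def)
    then show False using False by (simp add: zero_prod_def)
   qed
   define z where "z = (inverse r *\<^sub>R xi, inverse r *\<^sub>R eta)"
   have zr: "z = inverse r *\<^sub>R (xi, eta)" by (simp add: z_def)
   have s1: "norm (inverse r *\<^sub>R v) powr p = inverse r powr p * norm v powr p" for v :: 'b
    using r by (intro scale) simp
   have "norm z = inverse r * r" unfolding zr norm_scaleR using r by (simp flip: r_def)
   then have "norm z = 1" using r by simp
   moreover have "ep * (norm (fst z) powr p + norm (snd z) powr p) <= norm (snd z - fst z) powr p"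
   proof -
    have "ep * (norm (fst z) powr p + norm (snd z) powr p) = inverse r powr p * (ep * (norm xi powr p + norm eta powr p))"
     by (simp only: z_def fst_conv snd_conv s1) (simp add: algebra_simps)
    also have "... <= inverse r powr p * norm (eta - xi) powr p" using False by (intro mult_left_mono) auto
    also have "... = norm (snd z - fst z) powr p"
     by (simp only: z_def fst_conv snd_conv s1[symmetric] scaleR_diff_right)
    finally show ?thesis .
   qed
   ultimately have "z : K" by (simp add: K_def)
   then have "c <= g z" by (rule c(2))
   also have "g z = inverse r powr p * g (xi, eta)"
   proof -
    have "(1 / 2) *\<^sub>R (inverse r *\<^sub>R xi + inverse r *\<^sub>R eta) = inverse r *\<^sub>R ((1 / 2) *\<^sub>R (xi + eta))"
     by (simp add: scaleR_add_right)
    then show ?thesis unfolding g_def z_def fst_conv snd_conv by (simp only: s1) (simp add: algebra_simps)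
   qed
   finally have "r powr p * c <= r powr p * (inverse r powr p * g (xi, eta))" by (intro mult_left_mono) auto
   also have "... = g (xi, eta)" using r by (simp add: mult.assoc[symmetric] flip: powr_mult)
   finally have rc: "r powr p <= g (xi, eta) / c" using c by (simp add: field_simps)
   have "norm xi <= r" "norm eta <= r" unfolding r_def using norm_fst_le[of xi eta] norm_snd_le[of eta xi] by auto
   then have "norm (eta - xi) <= 2 * r" using norm_triangle_ineq4[of eta xi] by linarith
   then have "norm (eta - xi) powr p <= (2 * r) powr p" using p by (intro powr_mono2) auto
   also have "... = 2 powr p * r powr p" using r by (simp add: powr_mult)
   also have "... <= 2 powr p * (g (xi, eta) / c)" using rc by (intro mult_left_mono) auto
   also have "... <= ep * (norm xi powr p + norm eta powr p) + 2 powr p / c * g (xi, eta)" using ep by simp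
   finally show ?thesis unfolding gz .
  qed
 qed
qed

text \<open>Cauchy-Schwarz reduces the claim to the scalar tangent inequality for the two
  norms.\<close>

lemma norm_powr_tangent:
 fixes xi eta :: "'b::euclidean_space" and p :: real
 assumes p: "p > 1"
 shows "norm xi powr p + p * (norm xi powr (p - 2) * (xi \<bullet> (eta - xi))) <= norm eta powr p"
proof (cases "xi = 0")
 case False
 have n2: "norm xi powr (p - 2) * (norm xi)\<^sup>2 = norm xi powr p"
  using False by (simp flip: powr_numeral powr_add)
 have n1: "norm xi powr (p - 2) * norm xi = norm xi powr (p - 1)"
  using False powr_add[of "norm xi" "p - 2" 1] by simp
 have n0: "norm xi powr (p - 1) * norm xi = norm xi powr p"
  using False powr_add[of "norm xi" "p - 1" 1] by simp
 have "norm xi powr (p - 2) * (xi \<bullet> (eta - xi)) = norm xi powr (p - 2) * (xi \<bullet> eta) - norm xi powr p"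
  unfolding n2[symmetric] by (simp add: inner_diff_right power2_norm_eq_inner right_diff_distrib)
 also have "... <= norm xi powr (p - 2) * (norm xi * norm eta) - norm xi powr p"
  by (intro diff_right_mono mult_left_mono norm_cauchy_schwarz) auto
 also have "... = norm xi powr (p - 1) * (norm eta - norm xi)"
  by (simp add: n1[symmetric] n0[symmetric] algebra_simps)
 finally have "p * (norm xi powr (p - 2) * (xi \<bullet> (eta - xi))) <= p * (norm xi powr (p - 1) * (norm eta - norm xi))"
  using p by (intro mult_left_mono) auto
 then show ?thesis using powr_tangent[OF p, of "norm xi" "norm eta"] by (simp add: mult.assoc)
qed (use p in simp)

text \<open>A quantitative form of strict convexity: it turns convergence of the energies into strong
 convergence of the gradients.\<close>

lemma norm_powr_uniform_convexity:
 fixes p ep :: real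
 assumes p: "p > 1" and ep: "ep > 0"
 obtains C where "C >= 0" "!!xi eta :: 'b::euclidean_space. norm (eta - xi) powr p <= ep * (norm xi powr p + norm eta powr p) +
  C * (norm eta powr p / p - norm xi powr p / p - norm xi powr (p - 2) * (xi \<bullet> (eta - xi)))"
proof -
 obtain C where C: "C >= 0" "!!xi eta :: 'b. norm (eta - xi) powr p <= ep * (norm xi powr p + norm eta powr p) +
  C * ((norm xi powr p + norm eta powr p) / 2 - norm ((1 / 2) *\<^sub>R (xi + eta)) powr p)"
  using norm_powr_midpoint_gap[OF assms, where 'b = 'b] by blast
 show ?thesis
 proof (rule that[of "C * (p / 2)"])
  show "C * (p / 2) >= 0" using C p by simp
  fix xi eta :: 'b
  let ?T = "norm xi powr (p - 2) * (xi \<bullet> (eta - xi))"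
  have "(1 / 2) *\<^sub>R (xi + eta) - xi = (1 / 2) *\<^sub>R (eta - xi)"
  proof -
   have "xi = (1 / 2) *\<^sub>R xi + (1 / 2) *\<^sub>R xi" by (simp flip: scaleR_add_left)
   then show ?thesis by (simp add: algebra_simps)
  qed
  then have "xi \<bullet> ((1 / 2) *\<^sub>R (xi + eta) - xi) = (xi \<bullet> (eta - xi)) / 2" by simp
  then have e: "norm xi powr (p - 2) * (xi \<bullet> ((1 / 2) *\<^sub>R (xi + eta) - xi)) = ?T / 2" by simp
  \<comment> \<open>The tangent at xi, evaluated at the midpoint, bounds the midpoint gap by p / 2
    times the Bregman remainder.\<close>
  have "norm xi powr p + p * (?T / 2) <= norm ((1 / 2) *\<^sub>R (xi + eta)) powr p"
   using norm_powr_tangent[OF p, of xi "(1 / 2) *\<^sub>R (xi + eta)"] unfolding e .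
  have "(norm xi powr p + norm eta powr p) / 2 - norm ((1 / 2) *\<^sub>R (xi + eta)) powr p <=
    (p / 2) * (norm eta powr p / p - norm xi powr p / p - ?T)"
  proof -
   have e2: "(p / 2) * (norm eta powr p / p - norm xi powr p / p - ?T) = norm eta powr p / 2 - norm xi powr p / 2 - p * (?T / 2)"
    using p by (simp add: right_diff_distrib)
   have gen: "A + P <= Md ==> (A + B) / 2 - Md <= B / 2 - A / 2 - P" for A B P Md :: real
    by (simp add: field_simps)
   show ?thesis unfolding e2 by (rule gen) fact
  qed
  then have "C * ((norm xi powr p + norm eta powr p) / 2 - norm ((1 / 2) *\<^sub>R (xi + eta)) powr p) <=
    C * (p / 2) * (norm eta powr p / p - norm xi powr p / p - ?T)"
   unfolding mult.assoc using C(1) by (intro mult_left_mono) auto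
  then show "norm (eta - xi) powr p <= ep * (norm xi powr p + norm eta powr p) +
    C * (p / 2) * (norm eta powr p / p - norm xi powr p / p - ?T)"
   using C(2)[of eta xi] by linarith
 qed
qed

section \<open>The double-phase modular\<close>

lemma AE_norm_limit_le:
 fixes u :: "nat => 'a => 'b::real_normed_vector"
 assumes "AE x in M. (%n. u n x) ----> v x" "AE x in M. ALL n. norm (u n x) <= V x"
 shows "AE x in M. norm (v x) <= V x"
 using assms by eventually_elim (rule LIMSEQ_le_const2[OF tendsto_norm], assumption, blast)

lemma flux_bound:
 fixes g k :: "'b::euclidean_space"
 shows "\<bar>norm g powr (p - 2) * (g \<bullet> k)\<bar> <= norm g powr (p - 1) * norm k"
proof (cases "g = 0")
 case False
 have "\<bar>norm g powr (p - 2) * (g \<bullet> k)\<bar> <= norm g powr (p - 2) * (norm g * norm k)"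
  by (simp add: abs_mult Cauchy_Schwarz_ineq2 mult_left_mono)
 also have "norm g powr (p - 2) * (norm g * norm k) = norm g powr (p - 1) * norm k"
  using False powr_add[of "norm g" "p - 2" 1] by simp
 finally show ?thesis .
qed simp

lemma powr_pred_mult:
 fixes W :: real
 shows "W >= 0 ==> W powr (p - 1) * W = W powr p"
 by (cases "W = 0") (auto simp: powr_diff)

lemma flux_bound_majorant:
 fixes g k :: "'b::euclidean_space"
 assumes "p > 1" "norm g <= W" "norm k <= W"
 shows "\<bar>norm g powr (p - 2) * (g \<bullet> k)\<bar> <= W powr p"
proof -
 have W: "W >= 0" using assms(2) norm_ge_zero order_trans by blast
 have "norm g powr (p - 1) * norm k <= W powr (p - 1) * W"
  using assms W by (intro mult_mono powr_mono2) auto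
 then show ?thesis using flux_bound[of g p k] powr_pred_mult[OF W, of p] by linarith
qed

text \<open>For p < 2 the factor norm powr (p - 2) is unbounded near zero; only its product with the
  inner product is continuous there, thanks to the bound by norm powr (p - 1).\<close>

lemma flux_tendsto:
 fixes g k :: "nat => 'b::euclidean_space" and p :: real
 assumes p: "p > 1" and g: "g ----> h" and k: "k ----> l"
 shows "(%n. norm (g n) powr (p - 2) * (g n \<bullet> k n)) ----> norm h powr (p - 2) * (h \<bullet> l)"
proof (cases "h = 0")
 case False
 then show ?thesis by (intro tendsto_intros g k) auto
next
 case True
 have "(%n. norm (g n) powr (p - 1) * norm (k n)) ----> norm h powr (p - 1) * norm l"
  using p by (intro tendsto_mult tendsto_powr' tendsto_norm g k tendsto_const) auto
 then have lim0: "(%n. norm (g n) powr (p - 1) * norm (k n)) ----> 0" using True by simp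
 have "\<forall>\<^sub>F n in sequentially. norm (norm (g n) powr (p - 2) * (g n \<bullet> k n)) <= norm (g n) powr (p - 1) * norm (k n)"
  using flux_bound by (intro always_eventually allI) (simp only: real_norm_def)
 from Lim_null_comparison[OF this lim0] have "(%n. norm (g n) powr (p - 2) * (g n \<bullet> k n)) ----> 0" .
 then show ?thesis using True by simp
qed

text \<open>Away from zero the p-th power of the norm is a power of a positive quadratic polynomial
  in t. At a zero of the line the difference quotient is of order |h| powr (p - 1) and tends to zero
  because p > 1.\<close>

lemma DERIV_norm_powr_line:
 fixes g k :: "'b::euclidean_space" and p :: real
 assumes p: "p > 1"
 shows "((%t. norm (g + t *\<^sub>R k) powr p / p) has_real_derivative
  norm (g + t *\<^sub>R k) powr (p - 2) * ((g + t *\<^sub>R k) \<bullet> k)) (at t)"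
proof (cases "g + t *\<^sub>R k = 0")
 case False
 have e: "norm v powr p = (v \<bullet> v) powr (p / 2)" for v :: 'b
  by (simp add: powr_half_sqrt[symmetric] powr_powr norm_eq_sqrt_inner)
 have "((%t. (g + t *\<^sub>R k) \<bullet> (g + t *\<^sub>R k)) has_real_derivative 2 * ((g + t *\<^sub>R k) \<bullet> k)) (at t)"
 proof -
  have "((%t. g \<bullet> g + 2 * t * (g \<bullet> k) + t^2 * (k \<bullet> k)) has_real_derivative 2 * (g \<bullet> k) + 2 * t * (k \<bullet> k)) (at t)"
   by (auto intro!: derivative_eq_intros)
  moreover have "(g + t *\<^sub>R k) \<bullet> (g + t *\<^sub>R k) = g \<bullet> g + 2 * t * (g \<bullet> k) + t^2 * (k \<bullet> k)" for t
   by (simp add: inner_add_left inner_add_right inner_commute[of k g] power2_eq_square algebra_simps)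
  ultimately show ?thesis by (simp add: inner_add_left algebra_simps)
 qed
 moreover have pos: "(g + t *\<^sub>R k) \<bullet> (g + t *\<^sub>R k) > 0" using False by simp
 ultimately have "((%t. ((g + t *\<^sub>R k) \<bullet> (g + t *\<^sub>R k)) powr (p / 2) / p) has_real_derivative
   (p / 2 * ((g + t *\<^sub>R k) \<bullet> (g + t *\<^sub>R k)) powr (p / 2 - 1) * (2 * ((g + t *\<^sub>R k) \<bullet> k))) / p) (at t)"
  using DERIV_chain2[where g = "%t. (g + t *\<^sub>R k) \<bullet> (g + t *\<^sub>R k)" and x = t,
    OF has_real_derivative_powr[OF pos, of "p / 2"]]
  by (intro DERIV_cdivide) blast
 moreover have "((g + t *\<^sub>R k) \<bullet> (g + t *\<^sub>R k)) powr (p / 2 - 1) = norm (g + t *\<^sub>R k) powr (p - 2)"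
  by (simp add: powr_half_sqrt[symmetric] powr_powr norm_eq_sqrt_inner diff_divide_distrib)
 ultimately show ?thesis unfolding e using p by (simp add: field_simps)
next
 case True
 have e: "g + (t + h) *\<^sub>R k = h *\<^sub>R k" for h
  using True by (simp add: scaleR_add_left add.assoc[symmetric])
 have "\<forall>\<^sub>F h in at 0. norm ((norm (g + (t + h) *\<^sub>R k) powr p / p - norm (g + t *\<^sub>R k) powr p / p) / h)
   <= \<bar>h\<bar> powr (p - 1) * norm k powr p"
 proof (rule always_eventually, rule allI)
  fix h :: real
  show "norm ((norm (g + (t + h) *\<^sub>R k) powr p / p - norm (g + t *\<^sub>R k) powr p / p) / h) <= \<bar>h\<bar> powr (p - 1) * norm k powr p"
  proof (cases "h = 0")
   case False
   have "norm ((norm (g + (t + h) *\<^sub>R k) powr p / p - norm (g + t *\<^sub>R k) powr p / p) / h) =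
     \<bar>h\<bar> powr p / \<bar>h\<bar> * norm k powr p / p"
    using p by (simp add: e True powr_mult abs_divide abs_mult)
   also have "\<bar>h\<bar> powr p / \<bar>h\<bar> = \<bar>h\<bar> powr (p - 1)" using False by (simp add: powr_diff)
   also have "\<bar>h\<bar> powr (p - 1) * norm k powr p / p <= \<bar>h\<bar> powr (p - 1) * norm k powr p / 1"
    using p by (intro divide_left_mono) auto
   finally show ?thesis by simp
  qed simp
 qed
 moreover have "((%h. \<bar>h\<bar> powr (p - 1) * norm k powr p) \<longlongrightarrow> 0) (at 0)"
 proof -
  have "((%h::real. \<bar>h\<bar> powr (p - 1) * norm k powr p) \<longlongrightarrow> \<bar>0\<bar> powr (p - 1) * norm k powr p) (at 0)"
   using p by (intro tendsto_intros tendsto_powr') (auto intro!: always_eventually)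
  then show ?thesis by simp
 qed
 ultimately have "((%h. (norm (g + (t + h) *\<^sub>R k) powr p / p - norm (g + t *\<^sub>R k) powr p / p) / h) \<longlongrightarrow> 0) (at 0)"
  by (rule Lim_null_comparison)
 then show ?thesis unfolding DERIV_def using True by simp
qed

text \<open>Stated for an arbitrary measure and weight, so that the same lemmas serve the
  double-phase modular and, with weight zero and both exponents equal to s, the space L^s.\<close>

definition modM :: "'a measure => ('a => real) => real => real => ('a => 'b::real_normed_vector) => ennreal" where
 "modM M a p q v = (\<integral>\<^sup>+x. ennreal (Hden a p q x (v x)) \<partial>M)"

lemma modM_cong_AE:
 assumes "AE x in M. norm (u x) = norm (v x)"
 shows "modM M a p q u = modM M a p q v"
 unfolding modM_def by (rule nn_integral_cong_AE) (use assms in eventually_elim, simp)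

lemma modM_mono:
 assumes "0 <= p" "0 <= q" "!!x. x : space M ==> a x >= 0" "AE x in M. norm (u x) <= norm (v x)"
 shows "modM M a p q u <= modM M a p q v"
 unfolding modM_def
proof (rule nn_integral_mono_AE)
 show "AE x in M. ennreal (Hden a p q x (u x))
   <= ennreal (Hden a p q x (v x))"
  using assms(4) AE_space
  by eventually_elim (auto intro!: ennreal_leI add_mono mult_left_mono powr_mono2 assms)
qed

locale weighted_modular =
 fixes M :: "'a measure" and a :: "'a => real" and p q :: real
 assumes pq: "1 < p" "p <= q"
  and a_meas [measurable]: "a : borel_measurable M" and a_nonneg: "!!x. x : space M ==> a x >= 0"
begin

lemma modM_integrable:
 assumes "v : borel_measurable M" "modM M a p q v < \<infinity>"
 shows "integrable M (%x. Hden a p q x (v x))"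
proof (rule integrableI_nonneg)
 show "AE x in M. 0 <= Hden a p q x (v x)" using a_nonneg by simp
qed (use assms in \<open>auto simp: modM_def\<close>)

text \<open>The doubling property: for c >= 1 both powers of c are at most c powr q.\<close>

lemma modM_scale:
 assumes "c >= 1" and [measurable]: "v : borel_measurable M"
 shows "modM M a p q (%x. c *\<^sub>R v x) <= ennreal (c powr q) * modM M a p q v"
proof -
 have "modM M a p q (%x. c *\<^sub>R v x) <= (\<integral>\<^sup>+x. ennreal (c powr q) * ennreal (Hden a p q x (v x)) \<partial>M)"
  unfolding modM_def
 proof (rule nn_integral_mono)
  fix x assume x: "x : space M"
  have "c powr p <= c powr q" using assms pq by (intro powr_mono) auto
  then have "Hden a p q x (c *\<^sub>R v x) <= c powr q * norm (v x) powr p + a x * (c powr q * norm (v x) powr q)"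
   using assms a_nonneg[OF x] by (auto simp: powr_mult intro!: add_mono mult_right_mono)
  also have "... = c powr q * (Hden a p q x (v x))" by (simp add: algebra_simps)
  finally have "ennreal (Hden a p q x (c *\<^sub>R v x)) <=
    ennreal (c powr q * (Hden a p q x (v x)))" by (rule ennreal_leI)
  also have "... = ennreal (c powr q) * ennreal (Hden a p q x (v x))"
   using a_nonneg[OF x] by (intro ennreal_mult) auto
  finally show "ennreal (Hden a p q x (c *\<^sub>R v x)) <=
    ennreal (c powr q) * ennreal (Hden a p q x (v x))" .
 qed
 also have "... = ennreal (c powr q) * modM M a p q v"
  unfolding modM_def by (rule nn_integral_cmult) measurable
 finally show ?thesis .
qed

text \<open>A modular is not subadditive; this inequality with the constant 2 powr q takes the place
  of the triangle inequality.\<close>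

lemma modM_triangle:
 fixes v w :: "'a => 'b::euclidean_space"
 assumes [measurable]: "v : borel_measurable M" "w : borel_measurable M"
  and u: "AE x in M. norm (u x) <= norm (v x) + norm (w x)"
 shows "modM M a p q u <= ennreal (2 powr q) * (modM M a p q v + modM M a p q w)"
proof -
 define H where "H t x = t powr p + a x * t powr q" for t x
 have Hm: "(%x. ennreal (H (norm (v x)) x)) : borel_measurable M" "(%x. ennreal (H (norm (w x)) x)) : borel_measurable M"
  unfolding H_def by measurable
 have H0: "x : space M ==> H t x >= 0" for x t unfolding H_def using a_nonneg[of x] by simp
 have "modM M a p q u <= (\<integral>\<^sup>+x. ennreal (2 powr q) * (ennreal (H (norm (v x)) x) + ennreal (H (norm (w x)) x)) \<partial>M)"
  unfolding modM_def H_def[symmetric]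
 proof (rule nn_integral_mono_AE)
  show "AE x in M. ennreal (H (norm (u x)) x) <= ennreal (2 powr q) * (ennreal (H (norm (v x)) x) + ennreal (H (norm (w x)) x))"
   using u AE_space
  proof eventually_elim
   case (elim x)
   have le: "norm (u x) powr m <= 2 powr q * (norm (v x) powr m + norm (w x) powr m)" if m: "0 < m" "m <= q" for m
   proof -
    have "norm (u x) powr m <= (norm (v x) + norm (w x)) powr m" using elim(1) m by (intro powr_mono2) auto
    also have "... <= 2 powr m * (norm (v x) powr m + norm (w x) powr m)" using m by (intro powr_add_le) auto
    also have "... <= 2 powr q * (norm (v x) powr m + norm (w x) powr m)" using m by (intro mult_right_mono powr_mono) auto
    finally show ?thesis .
   qed
   have "H (norm (u x)) x <= 2 powr q * (norm (v x) powr p + norm (w x) powr p) + a x * (2 powr q * (norm (v x) powr q + norm (w x) powr q))"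
    unfolding H_def using pq a_nonneg[OF elim(2)] by (intro add_mono mult_left_mono le) auto
   also have "... = 2 powr q * (H (norm (v x)) x + H (norm (w x)) x)" by (simp add: H_def algebra_simps)
   finally have "ennreal (H (norm (u x)) x) <= ennreal (2 powr q * (H (norm (v x)) x + H (norm (w x)) x))" by (rule ennreal_leI)
   then show ?case using H0[OF elim(2)] by (simp add: ennreal_mult)
  qed
 qed
 also have "... = ennreal (2 powr q) * (modM M a p q v + modM M a p q w)"
 proof -
  have "(\<integral>\<^sup>+x. ennreal (2 powr q) * (h1 x + h2 x) \<partial>M) = ennreal (2 powr q) * (integral\<^sup>N M h1 + integral\<^sup>N M h2)"
   if "h1 : borel_measurable M" "h2 : borel_measurable M" for h1 h2
   using that by (simp add: nn_integral_cmult nn_integral_add)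
  from this[OF Hm] show ?thesis unfolding modM_def by (simp only: H_def)
 qed
 finally show ?thesis .
qed

lemma modM_finite_dom:
 fixes v w :: "'a => 'b::euclidean_space"
 assumes "v : borel_measurable M" "w : borel_measurable M" "AE x in M. norm (u x) <= norm (v x) + norm (w x)"
  "modM M a p q v < \<infinity>" "modM M a p q w < \<infinity>"
 shows "modM M a p q u < \<infinity>"
proof -
 have "ennreal (2 powr q) * (modM M a p q v + modM M a p q w) < \<infinity>"
  using assms(4,5) by (simp add: ennreal_mult_less_top)
 with modM_triangle[OF assms(1-3)] show ?thesis by (rule le_less_trans)
qed

text \<open>Riesz--Fischer with an integrable majorant: after passing to a subsequence every later limit
 is an instance of dominated convergence.\<close>

lemma modM_subsequence:
 fixes v :: "nat => 'a => 'b::euclidean_space"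
 assumes v[measurable]: "!!n. v n : borel_measurable M" and fin: "!!n. modM M a p q (v n) < \<infinity>"
  and cauchy: "!!e. e > 0 ==> EX n0. ALL i>=n0. ALL j>=n0. modM M a p q (%x. v i x - v j x) <= ennreal e"
 obtains r u W where "strict_mono (r :: nat => nat)" "u : borel_measurable M" "W : borel_measurable M"
  "!!x. W x >= (0::real)" "modM M a p q W < \<infinity>" "AE x in M. (%n. v (r n) x) ----> u x"
  "AE x in M. ALL n. norm (v (r n) x) <= W x"
proof -
 define H where "H x t = t powr p + a x * t powr q" for x and t :: real
 have H_mono: "H x s <= H x t" if "x : space M" "0 <= s" "s <= t" for x s t
  unfolding H_def using that pq a_nonneg by (intro add_mono mult_left_mono powr_mono2) auto
 have H_meas[measurable]: "(%x. H x (f x)) : borel_measurable M" if "f : borel_measurable M" for f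
  unfolding H_def using that by measurable
 \<comment> \<open>With this tolerance the n-th increment, rescaled by 2 ^ n at the cost of a factor
   (2 ^ n) powr q, still has modular at most (1 / 2) ^ n.\<close>
 define e :: "nat => real" where "e n = (1 / 2) ^ n / (2 ^ n) powr q" for n
 have e: "e n > 0" for n by (simp add: e_def)
 obtain N where N: "!!n i j. i >= N n ==> j >= N n ==> modM M a p q (%x. v i x - v j x) <= ennreal (e n)"
  using cauchy[OF e] by metis
 define r where "r n = (\<Sum>i\<le>n. Suc (N i))" for n
 have r: "strict_mono r" by (rule strict_monoI_Suc) (simp add: r_def)
 have rN: "r n >= N n" for n by (cases n) (auto simp: r_def)
 define d where "d n x = v (r (Suc n)) x - v (r n) x" for n x
 have d[measurable]: "d n : borel_measurable M" for n unfolding d_def[abs_def] by measurable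
 define S where "S n x = (\<Sum>k<n. norm (d k x))" for n x
 have S[measurable]: "S n : borel_measurable M" for n unfolding S_def[abs_def] by measurable
 have S0: "S n x >= 0" for n x unfolding S_def by (intro sum_nonneg) auto
 have vS: "norm (v (r n) x) <= norm (v (r 0) x) + S n x" for n x
 proof (induction n)
  case (Suc n)
  then show ?case using norm_triangle_ineq[of "v (r n) x" "d n x"] by (simp add: S_def d_def)
 qed (simp add: S_def)
 have Id: "(\<integral>\<^sup>+x. ennreal (H x (norm (2 ^ n *\<^sub>R d n x))) \<partial>M) <= ennreal ((1 / 2) ^ n)" for n
 proof -
  have "r (Suc n) >= N n" using rN[of n] strict_monoD[OF r, of n "Suc n"] by simp
  then have le: "modM M a p q (d n) <= ennreal (e n)" unfolding d_def by (rule N[OF _ rN])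
  have "(\<integral>\<^sup>+x. ennreal (H x (norm (2 ^ n *\<^sub>R d n x))) \<partial>M) <= ennreal ((2 ^ n) powr q) * modM M a p q (d n)"
   unfolding H_def modM_def[symmetric] by (intro modM_scale) auto
  also have "... <= ennreal ((2 ^ n) powr q) * ennreal (e n)" by (intro mult_left_mono le) auto
  also have "... = ennreal ((2 ^ n) powr q * e n)" using e[of n] by (intro ennreal_mult[symmetric]) auto
  finally show ?thesis by (simp add: e_def)
 qed
 define T where "T x = (\<Sum>n. ennreal (H x (norm (2 ^ n *\<^sub>R d n x))))" for x
 have T[measurable]: "T : borel_measurable M" unfolding T_def[abs_def] by measurable
 have IT: "(\<integral>\<^sup>+x. T x \<partial>M) < \<infinity>"
 proof -
  have "(\<integral>\<^sup>+x. T x \<partial>M) = (\<Sum>n. \<integral>\<^sup>+x. ennreal (H x (norm (2 ^ n *\<^sub>R d n x))) \<partial>M)"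
   unfolding T_def by (rule nn_integral_suminf) measurable
  also have "... <= (\<Sum>n. ennreal ((1 / 2) ^ n))" by (intro suminf_le Id) auto
  also have "... = ennreal (\<Sum>n. (1 / 2) ^ n)" by (intro suminf_ennreal2) auto
  also have "... < \<infinity>" by simp
  finally show ?thesis .
 qed
 \<comment> \<open>The sum of the increments is at most twice the largest of the rescaled
   increments, and the density of that one is a single term of \<open>T\<close>. This replaces the
   countable triangle inequality available for norms.\<close>
 have half: "ennreal (H x (S n x / 2)) <= T x" if x: "x : space M" for n x
 proof (cases n)
  case 0
  then show ?thesis using pq by (simp add: S_def H_def)
 next
  case (Suc m)
  define b where "b = Max ((%k. norm (2 ^ k *\<^sub>R d k x)) ` {..<n})"
  have "b : (%k. norm (2 ^ k *\<^sub>R d k x)) ` {..<n}" unfolding b_def using Suc by (intro Max_in) auto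
  then obtain k where k: "b = norm (2 ^ k *\<^sub>R d k x)" by blast
  have "norm (d j x) <= (1 / 2) ^ j * b" if "j < n" for j
  proof -
   have "norm (2 ^ j *\<^sub>R d j x) <= b" unfolding b_def using that by (intro Max_ge) auto
   then show ?thesis by (simp add: field_simps)
  qed
  then have "S n x <= (\<Sum>j<n. (1 / 2) ^ j * b)" unfolding S_def by (intro sum_mono) auto
  also have "... = (\<Sum>j<n. (1 / 2) ^ j) * b" by (simp add: sum_distrib_right)
  also have "... <= 2 * b"
  proof (rule mult_right_mono)
   have "(\<Sum>j<n. (1 / 2) ^ j) <= (\<Sum>j. (1 / 2 :: real) ^ j)" by (intro sum_le_suminf) auto
   then show "(\<Sum>j<n. (1 / 2) ^ j) <= (2 :: real)" by (simp add: suminf_geometric)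
   show "0 <= b" unfolding k by simp
  qed
  finally have "H x (S n x / 2) <= H x (norm (2 ^ k *\<^sub>R d k x))"
   using S0[of n x] unfolding k by (intro H_mono[OF x]) auto
  then have "ennreal (H x (S n x / 2)) <= ennreal (H x (norm (2 ^ k *\<^sub>R d k x)))" by (rule ennreal_leI)
  also have "... <= T x"
   using sum_le_suminf[of "%n. ennreal (H x (norm (2 ^ n *\<^sub>R d n x)))" "{k}"] by (simp add: T_def)
  finally show ?thesis .
 qed
 have "AE x in M. T x ~= \<infinity>" using IT by (intro nn_integral_noteq_infinite) auto
 then have sm: "AE x in M. summable (%k. norm (d k x))"
  using AE_space
 proof eventually_elim
  case (elim x)
  then obtain c where c: "T x = ennreal c" "c >= 0" by (cases "T x") auto
  show ?case
  proof (rule summableI_nonneg_bounded)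
   fix n
   have "H x (S n x / 2) <= c" using half[OF elim(2), of n] c by (simp add: ennreal_le_iff)
   moreover have "a x * (S n x / 2) powr q >= 0" using a_nonneg[OF elim(2)] by simp
   ultimately have "(S n x / 2) powr p <= c" unfolding H_def by linarith
   then have "((S n x / 2) powr p) powr (1 / p) <= c powr (1 / p)" using pq by (intro powr_mono2) auto
   then show "(\<Sum>k<n. norm (d k x)) <= 2 * c powr (1 / p)"
    using pq S0[of n x] by (simp add: powr_powr S_def)
  qed simp
 qed
 \<comment> \<open>The maximum with zero makes Y nonnegative also on the null set where the series
   diverges.\<close>
 define Y where "Y x = max 0 (\<Sum>k. norm (d k x))" for x
 have Y[measurable]: "Y : borel_measurable M" unfolding Y_def[abs_def] by measurable
 have SY: "AE x in M. (%n. S n x) ----> Y x & (ALL n. S n x <= Y x)"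
  using sm
 proof eventually_elim
  case (elim x)
  have "(\<Sum>k. norm (d k x)) >= 0" using elim by (intro suminf_nonneg) auto
  then show ?case using summable_LIMSEQ[OF elim] sum_le_suminf[OF elim, of "{..<n}" for n]
   by (auto simp: Y_def S_def)
 qed
 have hY: "modM M a p q (%x. (1 / 2) *\<^sub>R Y x) <= (\<integral>\<^sup>+x. T x \<partial>M)"
  unfolding modM_def
 proof (rule nn_integral_mono_AE)
  show "AE x in M. ennreal (Hden a p q x ((1 / 2) *\<^sub>R Y x)) <= T x"
   using SY AE_space
  proof eventually_elim
   case (elim x)
   have "(%n. ennreal (H x (S n x / 2))) ----> ennreal (H x (Y x / 2))"
    unfolding H_def using elim(1) pq S0 by (intro tendsto_ennrealI tendsto_intros tendsto_powr') auto
   then have "ennreal (H x (Y x / 2)) <= T x" using half[OF elim(2)] by (intro LIMSEQ_le_const2) auto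
   then show ?case by (simp add: H_def Y_def)
  qed
 qed
 have "modM M a p q (%x. 2 *\<^sub>R ((1 / 2) *\<^sub>R Y x)) <= ennreal (2 powr q) * modM M a p q (%x. (1 / 2) *\<^sub>R Y x)"
  by (rule modM_scale) auto
 also have "... < \<infinity>" using le_less_trans[OF hY IT] by (simp add: ennreal_mult_less_top)
 finally have fY: "modM M a p q Y < \<infinity>" by simp
 define W where "W x = norm (v (r 0) x) + Y x" for x
 have W[measurable]: "W : borel_measurable M" unfolding W_def[abs_def] by measurable
 have W0: "W x >= 0" for x by (simp add: W_def Y_def)
 have mW: "modM M a p q W < \<infinity>"
 proof (rule modM_finite_dom[of "%x. norm (v (r 0) x)" Y])
  show "modM M a p q (%x. norm (v (r 0) x)) < \<infinity>" using fin by (simp add: modM_def)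
 qed (use fY in \<open>auto simp: W_def Y_def\<close>)
 define u where "u x = lim (%n. v (r n) x)" for x
 have u[measurable]: "u : borel_measurable M" unfolding u_def[abs_def] by measurable
 have conv: "AE x in M. (%n. v (r n) x) ----> u x"
  using sm
 proof eventually_elim
  case (elim x)
  from summable_LIMSEQ[OF summable_norm_cancel[OF elim]]
  have "(%n. (\<Sum>i<n. d i x)) ----> (\<Sum>i. d i x)" .
  then have "(%n. v (r n) x - v (r 0) x) ----> (\<Sum>i. d i x)"
   unfolding d_def by (simp add: sum_lessThan_telescope[of "%i. v (r i) x"])
  from tendsto_add[OF this tendsto_const[of "v (r 0) x"]]
  have "convergent (%n. v (r n) x)" by (auto simp: convergent_def)
  then show ?case by (simp add: u_def convergent_LIMSEQ_iff)
 qed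
 show ?thesis
 proof (rule that[OF r u W W0 mW conv])
  show "AE x in M. ALL n. norm (v (r n) x) <= W x"
   using SY by eventually_elim (auto simp: W_def intro: order_trans[OF vS])
 qed
qed

lemma modM_tendsto_zero:
 fixes g :: "nat => 'a => 'b::euclidean_space"
 assumes g[measurable]: "!!n. g n : borel_measurable M" "h : borel_measurable M"
  and W: "W : borel_measurable M" "!!x. W x >= 0" "modM M a p q W < \<infinity>"
  and lim: "AE x in M. (%n. g n x) ----> h x" and dom: "AE x in M. ALL n. norm (g n x) <= W x"
 shows "(%n. modM M a p q (%x. g n x - h x)) ----> 0"
proof -
 note W(1)[measurable]
 have "(%n. modM M a p q (%x. g n x - h x)) ----> (\<integral>\<^sup>+x. 0 \<partial>M)"
  unfolding modM_def
 proof (rule nn_integral_dominated_convergence[where w = "%x. ennreal (Hden a p q x (2 *\<^sub>R W x))"])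
  have "modM M a p q (%x. 2 *\<^sub>R W x) <= ennreal (2 powr q) * modM M a p q W" by (rule modM_scale) (use W in auto)
  also have "... < \<infinity>" using W(3) by (simp add: ennreal_mult_less_top)
  finally show "(\<integral>\<^sup>+x. ennreal (Hden a p q x (2 *\<^sub>R W x)) \<partial>M) < \<infinity>"
   by (simp add: modM_def)
  show "AE x in M. ennreal (Hden a p q x (g n x - h x))
    <= ennreal (Hden a p q x (2 *\<^sub>R W x))" for n
   using lim dom AE_space
  proof eventually_elim
   case (elim x)
   have "norm (h x) <= W x" by (rule LIMSEQ_le_const2[OF tendsto_norm[OF elim(1)]]) (use elim in auto)
   moreover have "norm (g n x) <= W x" using elim by blast
   ultimately have "norm (g n x - h x) <= norm (2 *\<^sub>R W x)"
    using norm_triangle_ineq4[of "g n x" "h x"] W(2)[of x] by simp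
   then show ?case
    using pq a_nonneg[OF elim(3)] by (intro ennreal_leI add_mono mult_left_mono powr_mono2) auto
  qed
  show "AE x in M. (%n. ennreal (Hden a p q x (g n x - h x))) ----> 0"
   using lim
  proof eventually_elim
   case (elim x)
   have "(%n. norm (g n x - h x)) ----> 0" using elim by (simp add: LIM_zero tendsto_norm_zero)
   then have "(%n. Hden a p q x (g n x - h x)) ----> 0 powr p + a x * 0 powr q"
    using pq by (intro tendsto_intros tendsto_powr') auto
   then have "(%n. Hden a p q x (g n x - h x)) ----> 0" by simp
   from tendsto_ennrealI[OF this] show ?case by simp
  qed
 qed measurable
 then show ?thesis by simp
qed

section \<open>Energy and flux integrals under a common majorant\<close>

definition energy_int :: "('a => 'b::euclidean_space) => real" where
 "energy_int g = (LINT x|M. Eden a p q x (g x))"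

text \<open>The derivative of \<open>energy_int\<close> at g in the direction k.\<close>

definition flux_int :: "('a => 'b::euclidean_space) => ('a => 'b) => real" where
 "flux_int g k = (LINT x|M. (Fden a p q x (g x)) * (g x \<bullet> k x))"

lemma flux_density_bound:
 fixes g k :: "'b::euclidean_space"
 assumes "x : space M" "norm g <= W" "norm k <= W"
 shows "norm ((Fden a p q x g) * (g \<bullet> k)) <= W powr p + a x * W powr q"
proof -
 have "norm ((Fden a p q x g) * (g \<bullet> k)) <=
   \<bar>norm g powr (p - 2) * (g \<bullet> k)\<bar> + a x * \<bar>norm g powr (q - 2) * (g \<bullet> k)\<bar>"
  using abs_triangle_ineq[of "norm g powr (p - 2) * (g \<bullet> k)" "a x * (norm g powr (q - 2) * (g \<bullet> k))"] a_nonneg[OF assms(1)]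
  by (simp add: abs_mult distrib_right mult.assoc)
 also have "... <= W powr p + a x * W powr q"
  using assms pq a_nonneg by (intro add_mono mult_left_mono flux_bound_majorant) auto
 finally show ?thesis .
qed

lemma energy_density_bound:
 assumes "x : space M" "norm g <= W"
 shows "norm (Eden a p q x g) <= W powr p + a x * W powr q"
proof -
 have W: "W >= 0" using assms(2) norm_ge_zero order_trans by blast
 have *: "norm g powr s / s <= W powr s" if "s > 1" for s
 proof -
  have "norm g powr s / s <= norm g powr s / 1" using that by (intro divide_left_mono) auto
  also have "... <= W powr s" using that assms by (simp add: powr_mono2)
  finally show ?thesis .
 qed
 have "Eden a p q x g <= W powr p + a x * W powr q"
  using pq a_nonneg[OF assms(1)] by (intro add_mono mult_left_mono *) auto
 moreover have "norm g powr p / p + a x * (norm g powr q / q) >= 0" using pq a_nonneg[OF assms(1)] by simp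
 ultimately show ?thesis by simp
qed

context
 fixes W :: "'a => real"
 assumes W [measurable]: "W : borel_measurable M" and W0: "!!x. W x >= 0" and mW: "modM M a p q W < \<infinity>"
begin

lemma majorant_integrable: "integrable M (%x. W x powr p + a x * W x powr q)"
 using modM_integrable[OF W mW] W0 by simp

lemma energy_integrable:
 fixes g :: "'a => 'b::euclidean_space"
 assumes [measurable]: "g : borel_measurable M" and dom: "AE x in M. norm (g x) <= W x"
 shows "integrable M (%x. Eden a p q x (g x))"
proof (rule Bochner_Integration.integrable_bound[OF majorant_integrable])
 show "AE x in M. norm (Eden a p q x (g x)) <= norm (W x powr p + a x * W x powr q)"
  using dom AE_space by eventually_elim (use energy_density_bound in fastforce)
qed measurable

lemma flux_integrable:
 fixes g k :: "'a => 'b::euclidean_space"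
 assumes [measurable]: "g : borel_measurable M" "k : borel_measurable M"
  and dom: "AE x in M. norm (g x) <= W x" "AE x in M. norm (k x) <= W x"
 shows "integrable M (%x. (Fden a p q x (g x)) * (g x \<bullet> k x))"
proof (rule Bochner_Integration.integrable_bound[OF majorant_integrable])
 show "AE x in M. norm ((Fden a p q x (g x)) * (g x \<bullet> k x)) <= norm (W x powr p + a x * W x powr q)"
  using dom AE_space by eventually_elim (use flux_density_bound in fastforce)
qed measurable

lemma energy_tendsto:
 fixes g :: "nat => 'a => 'b::euclidean_space"
 assumes g[measurable]: "!!n. g n : borel_measurable M" "h : borel_measurable M"
  and lim: "AE x in M. (%n. g n x) ----> h x" and dom: "AE x in M. ALL n. norm (g n x) <= W x"
 shows "(%n. energy_int (g n)) ----> energy_int h"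
 unfolding energy_int_def
proof (rule integral_dominated_convergence[OF _ _ majorant_integrable])
 show "AE x in M. norm (Eden a p q x (g n x)) <= W x powr p + a x * W x powr q" for n
  using dom AE_space by eventually_elim (use energy_density_bound in blast)
 show "AE x in M. (%n. Eden a p q x (g n x)) ----> norm (h x) powr p / p + a x * (norm (h x) powr q / q)"
  using lim by eventually_elim (use pq in \<open>intro tendsto_intros tendsto_powr'; auto\<close>)
qed measurable

lemma flux_int_tendsto:
 fixes g k :: "nat => 'a => 'b::euclidean_space"
 assumes g[measurable]: "!!n. g n : borel_measurable M" "h : borel_measurable M"
  and k[measurable]: "!!n. k n : borel_measurable M" "l : borel_measurable M"
  and lim: "AE x in M. (%n. g n x) ----> h x" "AE x in M. (%n. k n x) ----> l x"
  and dom: "AE x in M. ALL n. norm (g n x) <= W x" "AE x in M. ALL n. norm (k n x) <= W x"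
 shows "(%n. flux_int (g n) (k n)) ----> flux_int h l"
 unfolding flux_int_def
proof (rule integral_dominated_convergence[OF _ _ majorant_integrable])
 show "AE x in M. norm ((Fden a p q x (g n x)) * (g n x \<bullet> k n x)) <= W x powr p + a x * W x powr q" for n
  using dom AE_space by eventually_elim (use flux_density_bound in blast)
 show "AE x in M. (%n. (Fden a p q x (g n x)) * (g n x \<bullet> k n x))
   ----> (Fden a p q x (h x)) * (h x \<bullet> l x)"
  using lim
 proof eventually_elim
  case (elim x)
  from tendsto_add[OF flux_tendsto[OF _ elim, of p] tendsto_mult_left[OF flux_tendsto[OF _ elim, of q], of "a x"]] pq
  show ?case by (simp add: distrib_right mult.assoc)
 qed
qed measurable

end

end

section \<open>A dense and independent sequence of test functions\<close>

text \<open>Gaussian elimination: one unknown is solved from the last equation, which lowers both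
  numbers by one.\<close>

lemma underdetermined_system:
 fixes c :: "'j => nat => real"
 assumes "finite S" "card S > n"
 shows "EX gam. (EX j:S. gam j ~= 0) & (ALL i<n. (\<Sum>j\<in>S. gam j * c j i) = 0)"
 using assms
proof (induction n arbitrary: S c)
 case 0
 then have "S ~= {}" by auto
 then show ?case by (intro exI[of _ "%_. 1"]) auto
next
 case (Suc n)
 show ?case
 proof (cases "ALL j:S. c j n = 0")
  case True
  obtain gam where "EX j:S. gam j ~= 0" "ALL i<n. (\<Sum>j\<in>S. gam j * c j i) = 0"
   using Suc.IH[of S c] Suc.prems by auto
  then show ?thesis using True by (intro exI[of _ gam]) (auto simp: less_Suc_eq)
 next
  case False
  then obtain k where k: "k : S" "c k n ~= 0" by blast
  define S' where "S' = S - {k}"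
  have S': "finite S'" "card S' > n" "k \<notin> S'" "S = insert k S'" using Suc.prems k by (auto simp: S'_def)
  define c' where "c' j i = c j i - c j n / c k n * c k i" for j i
  obtain gam where gam: "EX j:S'. gam j ~= 0" "ALL i<n. (\<Sum>j\<in>S'. gam j * c' j i) = 0"
   using Suc.IH[of S' c'] S' by auto
  define gam' where "gam' = gam(k := - (\<Sum>j\<in>S'. gam j * (c j n / c k n)))"
  have eq: "(\<Sum>j\<in>S. gam' j * c j i) = (\<Sum>j\<in>S'. gam j * c' j i)" for i
  proof -
   have "(\<Sum>j\<in>S'. gam' j * c j i) = (\<Sum>j\<in>S'. gam j * c j i)"
    using S'(3) by (intro sum.cong) (auto simp: gam'_def)
   then have "(\<Sum>j\<in>S. gam' j * c j i) = - (\<Sum>j\<in>S'. gam j * (c j n / c k n)) * c k i + (\<Sum>j\<in>S'. gam j * c j i)"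
    unfolding S'(4) using S' by (simp add: gam'_def)
   also have "... = (\<Sum>j\<in>S'. gam j * c' j i)"
    by (simp add: c'_def sum_distrib_right sum_subtractf right_diff_distrib mult.assoc)
   finally show ?thesis .
  qed
  have "c' j n = 0" for j using k by (simp add: c'_def)
  then have "ALL i<Suc n. (\<Sum>j\<in>S. gam' j * c j i) = 0" using gam(2) unfolding eq by (auto simp: less_Suc_eq)
  moreover have "EX j:S. gam' j ~= 0" using gam(1) S' by (auto simp: gam'_def)
  ultimately show ?thesis by blast
 qed
qed

text \<open>Were all test functions in the span of n functions, bumps at n + 1 points, each
  vanishing at the other points, would be dependent; evaluating the dependence at a point shows that
  its coefficient is zero.\<close>

lemma test_function_outside_span:
 fixes Om :: "'a::euclidean_space set" and f :: "nat => 'a => real"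
 assumes Om: "open Om" "Om ~= {}"
 obtains v where "v : test_functions Om" "!!xi. v ~= (%x. \<Sum>i<n. xi i * f i x)"
proof (rule ccontr)
 assume "~ thesis"
 with that have span: "EX xi. v = (%x. \<Sum>i<n. xi i * f i x)" if "v : test_functions Om" for v
  using that by blast
 obtain z ep where "ep > 0" "ball z ep \<subseteq> Om" using Om open_contains_ball by blast
 then have "infinite Om" using uncountable_ball[of ep z] countable_finite infinite_super by blast
 then obtain X where X: "X \<subseteq> Om" "finite X" "card X = Suc n" by (meson infinite_arbitrarily_large)
 have "EX w:test_functions Om. w x > 0 & (ALL y:X. y ~= x --> w y = 0)" if x: "x : X" for x
 proof -
  have "open (Om - (X - {x}))" using Om(1) X(2) by (intro open_Diff finite_imp_closed) auto
  moreover have "x : Om - (X - {x})" using x X(1) by blast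
  ultimately obtain l u where lu: "cbox l u \<subseteq> Om - (X - {x})" "x : box l u"
   by (rule open_contains_cbox) blast
  then have "cbox l u \<subseteq> Om" by blast
  then obtain phi where phi: "!!k::nat. phi k : test_functions Om" "!!k y. y \<notin> box l u ==> phi k y = 0"
   "!!k y. y : box l u ==> phi k y > 0"
   by (rule box_bump) blast
  have "phi 0 y = 0" if "y : X" "y ~= x" for y
   using that lu box_subset_cbox[of l u] by (intro phi(2)) blast
  then show ?thesis using phi(1)[of 0] phi(3)[OF lu(2), of 0] by blast
 qed
 then obtain w where w: "!!x. x : X ==> w x : test_functions Om" "!!x. x : X ==> w x x > 0"
  "!!x y. x : X ==> y : X ==> y ~= x ==> w x y = (0::real)"
  by metis
 have "ALL x:X. EX xi. w x = (%z. \<Sum>i<n. xi i * f i z)" using span w(1) by blast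
 then obtain c where c: "!!x. x : X ==> w x = (%z. \<Sum>i<n. c x i * f i z)" by metis
 obtain gam where gam: "EX x:X. gam x ~= 0" "ALL i<n. (\<Sum>x\<in>X. gam x * c x i) = 0"
  using underdetermined_system[OF X(2), of n c] X(3) by auto
 have zero: "(\<Sum>x\<in>X. gam x * w x z) = 0" for z
 proof -
  have "(\<Sum>x\<in>X. gam x * w x z) = (\<Sum>x\<in>X. \<Sum>i<n. gam x * c x i * f i z)"
   using c by (intro sum.cong) (auto simp: sum_distrib_left mult.assoc)
  also have "... = (\<Sum>i<n. (\<Sum>x\<in>X. gam x * c x i) * f i z)"
   by (subst sum.swap) (simp add: sum_distrib_right)
  finally show ?thesis using gam(2) by simp
 qed
 obtain y where y: "y : X" "gam y ~= 0" using gam(1) by blast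
 have "(\<Sum>x\<in>X. gam x * w x y) = (\<Sum>x\<in>X. if x = y then gam y * w y y else 0)"
  using w(3) y by (intro sum.cong) auto
 then have "(\<Sum>x\<in>X. gam x * w x y) = gam y * w y y" using X(2) y by simp
 then show False using zero[of y] w(2)[OF y(1)] y(2) by simp
qed

lemma test_function_uniformly_continuous:
 assumes "phi : test_functions Om" "de > 0"
 obtains d where "d > 0" "!!x y. norm (x - y) < d ==> \<bar>phi x - phi y\<bar> < de"
  "!!x y. norm (x - y) < d ==> norm (grad phi x - grad phi y) < de"
proof -
 obtain R where R: "R > 0" "!!x. norm x > R ==> phi x = 0" "!!x. norm x > R ==> grad phi x = 0"
  using test_functions_support_ball[OF assms(1)] by metis
 define F where "F x = (phi x, grad phi x)" for x
 have "continuous_on UNIV F" unfolding F_def using test_functionsD(2,5)[OF assms(1)] by (intro continuous_intros)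
 then have "uniformly_continuous_on (cball 0 (R + 1)) F"
  by (intro compact_uniformly_continuous) (auto intro: continuous_on_subset)
 then obtain d where d: "d > 0" "!!x y. x : cball 0 (R + 1) ==> y : cball 0 (R + 1) ==> dist y x < d ==> dist (F y) (F x) < de"
  using assms(2) unfolding uniformly_continuous_on_def by metis
 have "norm (F x - F y) < de" if n: "norm (x - y) < min d 1" for x y
 proof (cases "x : cball 0 (R + 1) & y : cball 0 (R + 1)")
  case True
  then show ?thesis using d(2)[of y x] n by (simp add: dist_norm)
 next
  case False
  then have "norm x > R" "norm y > R"
   using n norm_triangle_ineq2[of x y] norm_triangle_ineq2[of y x] by (auto simp: norm_minus_commute)
  then show ?thesis using R assms(2) by (simp add: F_def zero_prod_def)
 qed
 then have "\<bar>phi x - phi y\<bar> < de & norm (grad phi x - grad phi y) < de" if "norm (x - y) < min d 1" for x y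
  using that norm_fst_le[of "phi x - phi y" "grad phi x - grad phi y"] norm_snd_le[of "grad phi x - grad phi y" "phi x - phi y"]
  by (fastforce simp: F_def)
 then show ?thesis using that[of "min d 1"] d(1) by auto
qed

text \<open>A test function is coded by the scale of a grid and by its rounded values and gradients
  at finitely many points. There are countably many codes, and one function is kept for each code
  that occurs. Functions of equal code that oscillate little at that scale are close, gradients
  included.\<close>

lemma countable_dense_test_functions:
 fixes Om :: "'a::euclidean_space set"
 assumes Om: "bounded Om"
 obtains D where "countable D" "D ~= {}" "D \<subseteq> test_functions Om"
  "!!phi de. phi : test_functions Om ==> de > 0 ==>
   EX psi:D. (ALL x. \<bar>psi x - phi x\<bar> < de) & (ALL x. norm (grad psi x - grad phi x) < de)"
proof -
 obtain bs :: "'a list" where bs: "set bs = Basis" using finite_list[OF finite_Basis] by blast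
 have "EX xs. set xs \<subseteq> Om & (ALL x:Om. EX y:set xs. cube (dyad k) x = cube (dyad k) y)" for k
 proof -
  have "dyad k > 0" by simp
  with Om obtain X where "finite X" "X \<subseteq> Om" "!!x. x : Om ==> EX y:X. cube (dyad k) x = cube (dyad k) y"
   by (rule cube_representatives) blast
  then show ?thesis by (metis finite_list)
 qed
 then obtain xs where xs: "!!k x. x : Om ==> EX y:set (xs k). cube (dyad k) x = cube (dyad k) y" by metis
 define osc where "osc phi de k \<longleftrightarrow> (ALL x y. norm (x - y) <= DIM('a) * dyad k --> \<bar>phi x - phi y\<bar> < de & norm (grad phi x - grad phi y) < de)"
  for phi :: "'a => real" and de :: real and k
 define code where "code de k phi = (k, map (%y. \<lfloor>phi y / de\<rfloor>) (xs k), map (%y. map (%b. \<lfloor>(grad phi y \<bullet> b) / de\<rfloor>) bs) (xs k))"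
  for de :: real and k and phi :: "'a => real"
 have ex_osc: "EX k. osc phi de k" if phi: "phi : test_functions Om" "de > 0" for phi de
 proof -
  obtain d where d: "d > 0" "!!x y. norm (x - y) < d ==> \<bar>phi x - phi y\<bar> < de"
   "!!x y. norm (x - y) < d ==> norm (grad phi x - grad phi y) < de"
   using phi by (rule test_function_uniformly_continuous) blast
  have "(%k. DIM('a) * dyad k) ----> 0" by (intro tendsto_mult_right_zero LIMSEQ_power_zero) simp
  then have "\<forall>\<^sub>F k in sequentially. DIM('a) * dyad k < d" using d(1) by (intro order_tendstoD(2)) auto
  then obtain k where "DIM('a) * dyad k < d" by (meson eventually_happens sequentially_bot)
  then show ?thesis using d unfolding osc_def by (intro exI[of _ k]) auto
 qed
 \<comment> \<open>At the grid point the values differ by at most de, the gradients by at most de in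
   each coordinate; two oscillations below de are added.\<close>
 have close: "\<bar>psi x - phi x\<bar> < (real DIM('a) + 3) * de & norm (grad psi x - grad phi x) < (real DIM('a) + 3) * de"
  if t: "phi : test_functions Om" "psi : test_functions Om" "de > 0" and o: "osc phi de k" "osc psi de k"
   and c: "code de k phi = code de k psi" for phi psi :: "'a => real" and de :: real and k x
 proof (cases "x : Om")
  case True
  then obtain y where y: "y : set (xs k)" "cube (dyad k) x = cube (dyad k) y" using xs by blast
  have "x : cube (dyad k) y" using y(2) cube_refl[of x "dyad k"] by blast
  then have n: "norm (x - y) <= DIM('a) * dyad k" by (intro cube_norm) auto
  have fl: "\<bar>s - t\<bar> <= de" if "\<lfloor>s / de\<rfloor> = \<lfloor>t / de\<rfloor>" for s t :: real
  proof -
   have "\<bar>s / de - t / de\<bar> <= 1" using that by linarith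
   then show ?thesis using t(3) by (simp add: abs_divide flip: diff_divide_distrib)
  qed
  have "\<lfloor>phi y / de\<rfloor> = \<lfloor>psi y / de\<rfloor>" using c y(1) by (auto simp: code_def)
  then have 1: "\<bar>phi y - psi y\<bar> <= de" by (rule fl)
  have "map (%b. \<lfloor>(grad phi y \<bullet> b) / de\<rfloor>) bs = map (%b. \<lfloor>(grad psi y \<bullet> b) / de\<rfloor>) bs"
   using c y(1) unfolding code_def prod.inject map_eq_conv by blast
  then have "\<bar>(grad phi y - grad psi y) \<bullet> b\<bar> <= de" if "b : Basis" for b
   using that bs fl[of "grad phi y \<bullet> b" "grad psi y \<bullet> b"] by (auto simp: inner_diff_left)
  then have "(\<Sum>b\<in>Basis. \<bar>(grad phi y - grad psi y) \<bullet> b\<bar>) <= (\<Sum>b\<in>(Basis::'a set). de)" by (intro sum_mono) auto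
  then have 2: "norm (grad phi y - grad psi y) <= DIM('a) * de" using norm_le_l1[of "grad phi y - grad psi y"] by simp
  have 3: "\<bar>phi x - phi y\<bar> < de" "\<bar>psi x - psi y\<bar> < de" "norm (grad phi x - grad phi y) < de" "norm (grad psi x - grad psi y) < de"
   using o n unfolding osc_def by auto
  have "\<bar>psi x - phi x\<bar> < 3 * de" using 1 3 by linarith
  moreover have "norm (grad psi x - grad phi x) <= norm (grad psi x - grad psi y) + norm (grad phi y - grad psi y) + norm (grad phi x - grad phi y)"
   using norm_triangle_ineq4[of "grad psi x - grad psi y - (grad phi y - grad psi y)" "grad phi x - grad phi y"]
    norm_triangle_ineq4[of "grad psi x - grad psi y" "grad phi y - grad psi y"] by (simp add: algebra_simps)
  moreover have "DIM('a) * de >= 0" using t(3) by simp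
  moreover have gen: "A < D + 3 * de" "B < D + 3 * de"
   if "A < 3 * de" "B <= b1 + b2 + b3" "b1 < de" "b2 <= D" "b3 < de" "0 <= D" for A B D b1 b2 b3 :: real
   using that t(3) by linarith+
  ultimately show ?thesis using gen[OF _ _ 3(4) 2 3(3)] by (simp add: distrib_right)
 next
  case False
  then show ?thesis using test_functions_zero_outside[OF t(1)] test_functions_zero_outside[OF t(2)] t(3)
   by (auto intro!: mult_pos_pos add_nonneg_pos)
 qed
 define dl where "dl m = inverse (real (Suc m))" for m
 define rp where "rp m c = (SOME psi. psi : test_functions Om & (EX k. osc psi (dl m) k & code (dl m) k psi = c))" for m c
 define good where "good m c \<longleftrightarrow> (EX psi. psi : test_functions Om & (EX k. osc psi (dl m) k & code (dl m) k psi = c))" for m c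
 have rp: "rp m c : test_functions Om & (EX k. osc (rp m c) (dl m) k & code (dl m) k (rp m c) = c)" if "good m c" for m c
  unfolding rp_def using that unfolding good_def by (rule someI_ex)
 define D where "D = (%(m, c). rp m c) ` {(m, c). good m c}"
 have "dl m > 0" for m by (simp add: dl_def)
 have approx: "EX psi:D. (ALL x. \<bar>psi x - phi x\<bar> < de) & (ALL x. norm (grad psi x - grad phi x) < de)"
  if phi: "phi : test_functions Om" "de > 0" for phi de
 proof -
  have "(%m. (real DIM('a) + 3) * dl m) ----> 0"
   unfolding dl_def by (intro tendsto_mult_right_zero LIMSEQ_inverse_real_of_nat)
  then have "\<forall>\<^sub>F m in sequentially. (real DIM('a) + 3) * dl m < de" using phi(2) by (intro order_tendstoD(2)) auto
  then obtain m where m: "(real DIM('a) + 3) * dl m < de" by (meson eventually_happens sequentially_bot)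
  obtain k where k: "osc phi (dl m) k" using ex_osc[OF phi(1) \<open>dl m > 0\<close>] by blast
  define c where "c = code (dl m) k phi"
  have g: "good m c" using phi k unfolding good_def c_def by blast
  obtain k' where k': "osc (rp m c) (dl m) k'" "code (dl m) k' (rp m c) = c" using rp[OF g] by blast
  \<comment> \<open>The scale is part of the code, so both functions oscillate little on the same
    grid.\<close>
  have "k' = k" using k'(2) by (simp add: c_def code_def)
  have "\<bar>rp m c x - phi x\<bar> < (real DIM('a) + 3) * dl m & norm (grad (rp m c) x - grad phi x) < (real DIM('a) + 3) * dl m" for x
  proof (rule close[OF phi(1) _ \<open>dl m > 0\<close> k])
   show "rp m c : test_functions Om" using rp[OF g] by blast
   show "osc (rp m c) (dl m) k" using k'(1) \<open>k' = k\<close> by blast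
   show "code (dl m) k phi = code (dl m) k (rp m c)" using k'(2)[symmetric] \<open>k' = k\<close> by (simp add: c_def)
  qed
  then have "(ALL x. \<bar>rp m c x - phi x\<bar> < de) & (ALL x. norm (grad (rp m c) x - grad phi x) < de)"
   using m by (meson less_trans)
  moreover have "rp m c : D" using g by (force simp: D_def)
  ultimately show ?thesis by blast
 qed
 show ?thesis
 proof (rule that[of D])
  show "countable D" unfolding D_def by (intro countable_image countableI_type)
  show "D \<subseteq> test_functions Om" using rp by (auto simp: D_def)
  show "D ~= {}" using approx[OF test_functions_zero, of 1] by auto
 qed (rule approx)
qed

text \<open>Each member of a dense set is listed infinitely often, with tolerances tending to zero,
  so every entry may be perturbed without losing density. An entry in the span of the earlier
  choices receives a small multiple of a function outside that span.\<close>

lemma independent_dense_test_functions: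
 fixes Om :: "'a::euclidean_space set"
 assumes Om: "open Om" "bounded Om" "Om ~= {}"
 obtains e :: "nat => 'a => real" where "!!n. e n : test_functions Om"
  "!!phi de. phi : test_functions Om ==> de > 0 ==>
   EX n. (ALL x. \<bar>e n x - phi x\<bar> < de) & (ALL x. norm (grad (e n) x - grad phi x) < de)"
  "!!n xi i. (!!x. (\<Sum>i<n. xi i * e i x) = 0) ==> i < n ==> xi i = 0"
proof -
 obtain D where D: "countable D" "D ~= {}" "D \<subseteq> test_functions Om"
  "!!phi de. phi : test_functions Om ==> de > 0 ==>
   EX psi:D. (ALL x. \<bar>psi x - phi x\<bar> < de) & (ALL x. norm (grad psi x - grad phi x) < de)"
  using countable_dense_test_functions[OF Om(2)] by blast
 define dd where "dd n = from_nat_into D (fst (prod_decode n))" for n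
 have dd: "dd n : test_functions Om" for n using from_nat_into[OF D(2)] D(3) by (auto simp: dd_def)
 define h where "h n = inverse (real (Suc n))" for n
 define P where "P f n r \<longleftrightarrow> r : test_functions Om & (ALL x. \<bar>r x - dd n x\<bar> < h n) &
  (ALL x. norm (grad r x - grad (dd n) x) < h n) & (ALL xi. r ~= (%x. \<Sum>i<n. xi i * f i x))"
  for f and n :: nat and r
 have "EX e. ALL n. P e n (e n)"
 proof (rule dependent_wellorder_choice)
  fix r and f g :: "nat => 'a => real" and n assume "!!m. m < n ==> f m = g m"
  then have "(%x. \<Sum>i<n. xi i * f i x) = (%x. \<Sum>i<n. xi i * g i x)" for xi by (intro ext sum.cong) auto
  then show "P f n r = P g n r" by (simp add: P_def)
 next
  fix n f
  have h: "h n > 0" by (simp add: h_def)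
  show "EX r. P f n r"
  proof (cases "ALL xi. dd n ~= (%x. \<Sum>i<n. xi i * f i x)")
   case True
   then show ?thesis using dd h by (intro exI[of _ "dd n"]) (simp add: P_def)
  next
   case False
   then obtain xi where xi: "dd n = (%x. \<Sum>i<n. xi i * f i x)" by blast
   obtain v where v: "v : test_functions Om" "!!xi. v ~= (%x. \<Sum>i<n. xi i * f i x)"
    using test_function_outside_span[OF Om(1,3)] by blast
   obtain B where B: "B > 0" "!!x. \<bar>v x\<bar> <= B" "!!x. norm (grad v x) <= B"
    using test_functions_bounded[OF v(1)] by metis
   define ep where "ep = h n / (2 * B)"
   have ep: "ep > 0" "ep * B < h n" using B(1) h by (auto simp: ep_def)
   define r where "r x = 1 * dd n x + ep * v x" for x
   have r: "r : test_functions Om" "grad r x = grad (dd n) x + ep *\<^sub>R grad v x" for x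
    unfolding r_def using test_functions_lincomb[OF dd v(1), of 1 n ep] by auto
   have "\<bar>r x - dd n x\<bar> < h n" for x
   proof -
    have "\<bar>ep * v x\<bar> <= ep * B" using ep(1) B(2)[of x] by (simp add: abs_mult)
    then show ?thesis using ep(2) by (simp add: r_def)
   qed
   moreover have "norm (grad r x - grad (dd n) x) < h n" for x
   proof -
    have "norm (ep *\<^sub>R grad v x) <= ep * B" using ep(1) B(3)[of x] by simp
    then show ?thesis using ep(2) by (simp add: r(2))
   qed
   moreover have "r ~= (%x. \<Sum>i<n. zeta i * f i x)" for zeta
   proof
    assume a: "r = (%x. \<Sum>i<n. zeta i * f i x)"
    have "v x = (\<Sum>i<n. ((zeta i - xi i) / ep) * f i x)" for x
    proof -
     have "ep * v x = r x - dd n x" by (simp add: r_def)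
     also have "... = (\<Sum>i<n. (zeta i - xi i) * f i x)"
      unfolding fun_cong[OF a, of x] fun_cong[OF xi, of x] by (simp add: left_diff_distrib sum_subtractf)
     finally have "v x = (\<Sum>i<n. (zeta i - xi i) * f i x) / ep" using ep(1) by (simp add: field_simps)
     then show ?thesis by (simp add: sum_divide_distrib)
    qed
    then show False using v(2)[of "%i. (zeta i - xi i) / ep"] by blast
   qed
   ultimately have "P f n r" using r(1) by (simp add: P_def)
   then show ?thesis by blast
  qed
 qed
 then obtain e where e: "!!n. P e n (e n)" by blast
 show ?thesis
 proof (rule that[of e])
  show "e n : test_functions Om" for n using e by (simp add: P_def)
  show "EX n. (ALL x. \<bar>e n x - phi x\<bar> < de) & (ALL x. norm (grad (e n) x - grad phi x) < de)"
   if phi: "phi : test_functions Om" "de > 0" for phi de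
  proof -
   obtain psi where psi: "psi : D" "!!x. \<bar>psi x - phi x\<bar> < de / 2" "!!x. norm (grad psi x - grad phi x) < de / 2"
    using D(4)[OF phi(1), of "de / 2"] phi(2) by auto
   obtain k where k: "from_nat_into D k = psi" using from_nat_into_surj[OF D(1) psi(1)] by blast
   have "\<forall>\<^sub>F m in sequentially. h m < de / 2"
    unfolding h_def using LIMSEQ_inverse_real_of_nat phi(2) by (intro order_tendstoD(2)) auto
   then obtain m where m: "h m < de / 2" by (meson eventually_happens sequentially_bot)
   define n where "n = prod_encode (k, m)"
   have dn: "dd n = psi" by (simp add: dd_def n_def k)
   \<comment> \<open>The pair encoding dominates its second component, so the tolerance at position
     n is as small as demanded.\<close>
   have "m <= n" unfolding n_def by (rule le_prod_encode_2)
   then have "h n <= h m" by (simp add: h_def field_simps)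
   then have hn: "h n < de / 2" using m by simp
   have P: "\<bar>e n x - psi x\<bar> < h n" "norm (grad (e n) x - grad psi x) < h n" for x
    using e[of n] by (auto simp: P_def dn)
   have "\<bar>e n x - phi x\<bar> < de" for x using P(1)[of x] psi(2)[of x] hn by linarith
   moreover have "norm (grad (e n) x - grad phi x) < de" for x
    using norm_triangle_ineq[of "grad (e n) x - grad psi x" "grad psi x - grad phi x"] P(2)[of x] psi(3)[of x] hn by simp
   ultimately show ?thesis by blast
  qed
  show "xi i = 0" if z: "!!x. (\<Sum>i<n. xi i * e i x) = 0" and i: "i < n" for n xi i
  proof (rule ccontr)
   assume "xi i ~= 0"
   define k where "k = Max {i. i < n & xi i ~= 0}"
   have "k : {i. i < n & xi i ~= 0}" unfolding k_def using i \<open>xi i ~= 0\<close> by (intro Max_in) auto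
   then have k: "k < n" "xi k ~= 0" by auto
   have above: "xi j = 0" if j: "k < j" "j < n" for j
   proof (rule ccontr)
    assume "xi j ~= 0"
    then have "j <= k" unfolding k_def using j by (intro Max_ge) auto
    then show False using j by simp
   qed
   have "e k x = (\<Sum>j<k. (- xi j / xi k) * e j x)" for x
   proof -
    have "0 = (\<Sum>j<n. xi j * e j x)" using z by simp
    also have "... = (\<Sum>j<Suc k. xi j * e j x)" using k above by (intro sum.mono_neutral_right) auto
    also have "... = (\<Sum>j<k. xi j * e j x) + xi k * e k x" by simp
    finally have "e k x = - (\<Sum>j<k. xi j * e j x) / xi k" using k(2) by (simp add: field_simps)
    then show ?thesis by (simp add: sum_divide_distrib sum_negf)
   qed
   then have "e k = (%x. \<Sum>j<k. (%j. - xi j / xi k) j * e j x)" by (intro ext)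
   moreover have "ALL zeta. e k ~= (%x. \<Sum>i<k. zeta i * e i x)" using e[of k] unfolding P_def by blast
   then have "e k ~= (%x. \<Sum>j<k. (%j. - xi j / xi k) j * e j x)" by (rule spec)
   ultimately show False by blast
  qed
 qed
qed

section \<open>Primitives and superposition operators\<close>

lemma DERIV_primitive:
 assumes "continuous_on UNIV h"
 shows "(primitive h has_real_derivative h t) (at t)"
proof -
 define b where "b = \<bar>t\<bar> + 1"
 have "continuous_on {-b..b} h" using assms by (rule continuous_on_subset) simp
 then have "((%u. LBINT y=ereal 0..u. h y) has_vector_derivative (h t)) (at t within {-b..b})"
  by (intro interval_integral_FTC2) (auto simp: b_def)
 then have "(primitive h has_vector_derivative h t) (at t within {-b..b})"
  by (simp add: primitive_def[abs_def] zero_ereal_def)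
 then have "(primitive h has_vector_derivative h t) (at t within {-b<..<b})"
  by (rule has_vector_derivative_within_subset) auto
 then have "(primitive h has_vector_derivative h t) (at t)"
  by (subst (asm) has_vector_derivative_within_open) (auto simp: b_def)
 then show ?thesis by (simp add: has_real_derivative_iff_has_vector_derivative)
qed

lemma primitive_zero [simp]: "primitive h 0 = 0"
 by (simp add: primitive_def zero_ereal_def[symmetric])

lemma primitive_cong:
 assumes "t >= 0" "!!tau. 0 <= tau ==> tau <= t ==> h tau = k tau"
 shows "primitive h t = primitive k t"
 unfolding primitive_def zero_ereal_def using assms
 by (intro interval_integral_cong) (auto simp: einterval_eq min_def)

lemma primitive_even:
 assumes "continuous_on UNIV h" "!!t. h (- t) = - h t"
 shows "primitive h (- t) = primitive h t"
proof -
 have "((%t. primitive h (- t) - primitive h t) has_real_derivative 0) (at t)" for t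
  using assms(2) by (auto intro!: derivative_eq_intros DERIV_primitive[OF assms(1)] DERIV_chain'[OF _ DERIV_primitive[OF assms(1)]])
 then have "primitive h (- t) - primitive h t = primitive h (- 0) - primitive h 0"
  by (intro DERIV_isconst_all[rule_format, of "%t. primitive h (- t) - primitive h t"]) auto
 then show ?thesis by simp
qed

text \<open>The variable end point is moved into the integrand, so that measurability in a parameter
  follows from the theorem on parameter integrals.\<close>

lemma primitive_rescale:
 assumes h: "continuous_on UNIV h"
 shows "primitive h t = (LINT tau|lborel. t * h (t * tau) * indicator {0..1} tau)"
proof -
 have "has_bochner_integral lborel (%tau. (t * h (t * tau)) * indicator {0..1} tau) (primitive h (t * 1) - primitive h (t * 0))"
 proof (rule has_bochner_integral_FTC_Icc_real)
  show "((%tau. primitive h (t * tau)) has_real_derivative t * h (t * tau)) (at tau)" for tau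
   using DERIV_chain'[OF DERIV_cmult_Id[of t] DERIV_primitive[OF h]] by (simp add: mult.commute[of t])
  have "continuous_on UNIV (%tau. t * h (t * tau))"
   by (intro continuous_intros continuous_on_compose2[OF h]) auto
  then show "isCont (%tau. t * h (t * tau)) tau" for tau by (simp add: continuous_on_eq_continuous_at)
 qed auto
 then show ?thesis using has_bochner_integral_integral_eq by fastforce
qed

text \<open>The function u is approximated by functions with values in the multiples of 1 / (n + 1),
  for which only countably many sections of f occur; continuity in t gives the limit.\<close>

lemma superposition_measurable:
 fixes f :: "'a => real => real"
 assumes f[measurable]: "!!t. (%x. f x t) : borel_measurable M" and cont: "!!x. x : space M ==> continuous_on UNIV (f x)"
  and u[measurable]: "u : borel_measurable M"
 shows "(%x. f x (u x)) : borel_measurable M"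
proof (rule borel_measurable_LIMSEQ_real)
 define v where "v n x = of_int \<lfloor>real (Suc n) * u x\<rfloor> / real (Suc n)" for n x
 show "(%x. f x (v n x)) : borel_measurable M" for n
  unfolding v_def by (rule measurable_compose_countable[where f = "%i x. f x (of_int i / real (Suc n))"]) measurable
 fix x assume x: "x : space M"
 have "\<bar>v n x - u x\<bar> <= inverse (real (Suc n))" for n
 proof -
  have "\<bar>of_int \<lfloor>real (Suc n) * u x\<rfloor> - real (Suc n) * u x\<bar> <= 1" by linarith
  moreover have "v n x - u x = (of_int \<lfloor>real (Suc n) * u x\<rfloor> - real (Suc n) * u x) / real (Suc n)"
   by (simp add: v_def diff_divide_distrib del: of_nat_Suc)
  ultimately show ?thesis by (simp add: divide_right_mono inverse_eq_divide)
 qed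
 then have "(%n. v n x - u x) ----> 0"
  by (intro Lim_null_comparison[OF _ LIMSEQ_inverse_real_of_nat]) (auto intro: always_eventually)
 then have "(%n. v n x) ----> u x" by (simp add: LIM_zero_iff)
 then show "(%n. f x (v n x)) ----> f x (u x)"
  using cont[OF x] by (intro continuous_on_tendsto_compose[of UNIV "f x"]) auto
qed

lemma primitive_superposition_measurable:
 fixes f :: "'a => real => real"
 assumes f[measurable]: "!!t. (%x. f x t) : borel_measurable M" and cont: "!!x. x : space M ==> continuous_on UNIV (f x)"
  and u[measurable]: "u : borel_measurable M"
 shows "(%x. primitive (f x) (u x)) : borel_measurable M"
proof -
 have "(%z. f (fst z) (u (fst z) * snd z)) : borel_measurable (M \<Otimes>\<^sub>M lborel)"
 proof (rule superposition_measurable[where f = "%z. f (fst z)"])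
  show "(%z. f (fst z) t) : borel_measurable (M \<Otimes>\<^sub>M lborel)" for t
   by (rule measurable_compose[OF measurable_fst f])
  show "continuous_on UNIV (f (fst z))" if "z : space (M \<Otimes>\<^sub>M lborel)" for z
   using cont that by (auto simp: space_pair_measure)
  show "(%z. u (fst z) * snd z) : borel_measurable (M \<Otimes>\<^sub>M lborel)" by measurable
 qed
 then have [measurable]: "(%(x, tau). f x (u x * tau)) : borel_measurable (M \<Otimes>\<^sub>M lborel)" by (simp add: case_prod_beta)
 have "(%x. LINT tau|lborel. u x * f x (u x * tau) * indicator {0..1} tau) : borel_measurable M"
  by measurable
 then show ?thesis by (rule subst[OF measurable_cong, rotated]) (rule primitive_rescale[OF cont, symmetric])
qed

locale superposition = finite_measure M for M :: "'a measure" +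
 fixes f :: "'a => real => real" and C s :: real
 assumes C: "C >= 0" and s: "s > 1"
  and f_meas [measurable]: "!!t. (%x. f x t) : borel_measurable M"
  and f_cont: "!!x. x : space M ==> continuous_on UNIV (f x)"
  and f_growth: "!!x t. x : space M ==> \<bar>f x t\<bar> <= C * (1 + \<bar>t\<bar> powr (s - 1))"
begin

text \<open>One majorant W for the argument and for the test value gives one integrable density; the
  factor 2 absorbs W <= 1 + W powr s.\<close>

lemma f_product_bound:
 assumes x: "x : space M" and "\<bar>t\<bar> <= W" "\<bar>k\<bar> <= W"
 shows "\<bar>f x t * k\<bar> <= 2 * C * (1 + W powr s)"
proof -
 have W: "W >= 0" using assms by linarith
 have "\<bar>f x t\<bar> <= C * (1 + \<bar>t\<bar> powr (s - 1))" by (rule f_growth[OF x])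
 also have "... <= C * (1 + W powr (s - 1))" using assms s C by (intro mult_left_mono add_left_mono powr_mono2) auto
 finally have "\<bar>f x t\<bar> * \<bar>k\<bar> <= C * (1 + W powr (s - 1)) * W"
  using assms W C by (intro mult_mono) auto
 also have "... = C * (W + W powr s)" using powr_pred_mult[where W = W and p = s] s W by (simp add: algebra_simps)
 also have "... <= C * (2 * (1 + W powr s))"
 proof (rule mult_left_mono[OF _ C])
  have "W <= 1 + W powr s"
  proof (cases "W <= 1")
   case True then show ?thesis using powr_ge_zero[of W s] by linarith
  next
   case False
   then have "W powr 1 <= W powr s" using s by (intro powr_mono) auto
   then show ?thesis using False by simp
  qed
  moreover have "W powr s >= 0" by simp
  moreover have "A + B <= 2 * (1 + B)" if "A <= 1 + B" "0 <= B" for A B :: real using that by simp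
  ultimately show "W + W powr s <= 2 * (1 + W powr s)" by blast
 qed
 finally show ?thesis by (simp add: abs_mult algebra_simps)
qed

text \<open>Between - |t| and |t| the product bound with factor |t|, divided by |t|, bounds f
  itself; the mean value theorem then gives the same density as for products.\<close>

lemma primitive_bound:
 assumes x: "x : space M" and "\<bar>t\<bar> <= W"
 shows "\<bar>primitive (f x) t\<bar> <= 2 * C * (1 + W powr s)"
proof (cases "t = 0")
 case False
 define B where "B = 2 * C * (1 + \<bar>t\<bar> powr s) / \<bar>t\<bar>"
 have "norm (primitive (f x) t - primitive (f x) 0) <= B * norm (t - 0)"
 proof (rule field_differentiable_bound[of "{-\<bar>t\<bar>..\<bar>t\<bar>}"])
  show "norm (f x z) <= B" if "z : {-\<bar>t\<bar>..\<bar>t\<bar>}" for z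
   using f_product_bound[OF x, of z "\<bar>t\<bar>" "\<bar>t\<bar>", OF abs_leI] that False by (simp add: B_def field_simps abs_mult)
  show "(primitive (f x) has_real_derivative f x z) (at z within {-\<bar>t\<bar>..\<bar>t\<bar>})" for z
   by (rule has_field_derivative_at_within[OF DERIV_primitive[OF f_cont[OF x]]])
 qed auto
 also have "... = 2 * C * (1 + \<bar>t\<bar> powr s)" using False by (simp add: B_def)
 also have "... <= 2 * C * (1 + W powr s)" using assms C s by (intro mult_left_mono add_left_mono powr_mono2) auto
 finally show ?thesis by simp
qed (use C in simp)

context
 fixes W :: "'a => real"
 assumes W: "integrable M (%x. W x powr s)"
begin

lemma growth_integrable: "integrable M (%x. 2 * C * (1 + W x powr s))"
 using W by (intro Bochner_Integration.integrable_mult_right Bochner_Integration.integrable_add) auto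

lemma superposition_product_integrable:
 assumes [measurable]: "u : borel_measurable M" "w : borel_measurable M"
  and dom: "AE x in M. \<bar>u x\<bar> <= W x" "AE x in M. \<bar>w x\<bar> <= W x"
 shows "integrable M (%x. f x (u x) * w x)"
proof (rule Bochner_Integration.integrable_bound[OF growth_integrable])
 show "AE x in M. norm (f x (u x) * w x) <= norm (2 * C * (1 + W x powr s))"
  using dom AE_space by eventually_elim (use f_product_bound in force)
qed (use superposition_measurable[OF f_meas f_cont] in measurable)

lemma superposition_product_tendsto:
 assumes [measurable]: "!!n. u n : borel_measurable M" "v : borel_measurable M"
  "!!n. w n : borel_measurable M" "y : borel_measurable M"
  and lim: "AE x in M. (%n. u n x) ----> v x" "AE x in M. (%n. w n x) ----> y x"
  and dom: "AE x in M. ALL n. \<bar>u n x\<bar> <= W x" "AE x in M. ALL n. \<bar>w n x\<bar> <= W x"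
 shows "(%n. LINT x|M. f x (u n x) * w n x) ----> (LINT x|M. f x (v x) * y x)"
proof (rule integral_dominated_convergence[OF _ _ growth_integrable])
 have [measurable]: "(%x. f x (v x)) : borel_measurable M" "!!n. (%x. f x (u n x)) : borel_measurable M"
  by (rule superposition_measurable[OF f_meas f_cont]; simp)+
 show "(%x. f x (v x) * y x) : borel_measurable M" "!!n. (%x. f x (u n x) * w n x) : borel_measurable M"
  by measurable
 show "AE x in M. (%n. f x (u n x) * w n x) ----> f x (v x) * y x"
  using lim AE_space
 proof eventually_elim
  case (elim x)
  show ?case using elim(1) f_cont[OF elim(3)] by (intro tendsto_mult elim continuous_on_tendsto_compose[of UNIV "f x"]) auto
 qed
 show "AE x in M. norm (f x (u n x) * w n x) <= 2 * C * (1 + W x powr s)" for n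
  using dom AE_space by eventually_elim (use f_product_bound in force)
qed

lemma primitive_integrable:
 assumes [measurable]: "u : borel_measurable M" and dom: "AE x in M. \<bar>u x\<bar> <= W x"
 shows "integrable M (%x. primitive (f x) (u x))"
proof (rule Bochner_Integration.integrable_bound[OF growth_integrable])
 show "AE x in M. norm (primitive (f x) (u x)) <= norm (2 * C * (1 + W x powr s))"
  using dom AE_space by eventually_elim (use primitive_bound in force)
qed (use primitive_superposition_measurable[OF f_meas f_cont] in measurable)

lemma primitive_tendsto:
 assumes [measurable]: "!!n. u n : borel_measurable M" "v : borel_measurable M"
  and lim: "AE x in M. (%n. u n x) ----> v x" and dom: "AE x in M. ALL n. \<bar>u n x\<bar> <= W x"
 shows "(%n. LINT x|M. primitive (f x) (u n x)) ----> (LINT x|M. primitive (f x) (v x))"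
proof (rule integral_dominated_convergence[OF _ _ growth_integrable])
 show "(%x. primitive (f x) (v x)) : borel_measurable M" "!!n. (%x. primitive (f x) (u n x)) : borel_measurable M"
  by (rule primitive_superposition_measurable[OF f_meas f_cont]; simp)+
 show "AE x in M. (%n. primitive (f x) (u n x)) ----> primitive (f x) (v x)"
  using lim AE_space
 proof eventually_elim
  case (elim x)
  show ?case
   using elim(1) DERIV_isCont[OF DERIV_primitive[OF f_cont[OF elim(2)]]] by (rule isCont_tendsto_compose[rotated])
 qed
 show "AE x in M. norm (primitive (f x) (u n x)) <= 2 * C * (1 + W x powr s)" for n
  using dom AE_space by eventually_elim (use primitive_bound in force)
qed

end

lemma bounded_powr_integrable: "integrable M (%x. (B :: real) powr s)"
 by simp

lemma DERIV_primitive_integral_line: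
 fixes u h :: "'a => real"
 assumes [measurable]: "u : borel_measurable M" "h : borel_measurable M"
  and bnd: "!!x. \<bar>u x\<bar> <= B" "!!x. \<bar>h x\<bar> <= B"
 shows "((%t. LINT x|M. primitive (f x) (u x + t * h x)) has_real_derivative (LINT x|M. f x (u x + t * h x) * h x)) (at t)"
proof (rule leibniz_integral[where G' = "%t x. f x (u x + t * h x) * h x"])
 have tB: "\<bar>u x + t * h x\<bar> <= (1 + \<bar>t\<bar>) * B" for x t
 proof -
  have "\<bar>t * h x\<bar> <= \<bar>t\<bar> * B" using bnd(2)[of x] by (simp add: abs_mult mult_left_mono)
  then show ?thesis using bnd(1)[of x] by (simp add: distrib_right)
 qed
 show "finite_measure M" by (rule finite_measure_axioms)
 show "integrable M (%x. primitive (f x) (u x + t * h x))" for t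
  using tB by (intro primitive_integrable[OF bounded_powr_integrable[of "(1 + \<bar>t\<bar>) * B"]]) auto
 show "(%x. f x (u x + t * h x) * h x) : borel_measurable M"
  by (intro borel_measurable_times superposition_measurable[OF f_meas f_cont]) auto
 show "AE x in M. ALL t. ((%t. primitive (f x) (u x + t * h x)) has_real_derivative f x (u x + t * h x) * h x) (at t)"
  using AE_space
 proof eventually_elim
  case (elim x)
  show ?case
   by (intro allI DERIV_chain'[OF _ DERIV_primitive[OF f_cont[OF elim]], THEN DERIV_cong])
    (auto intro!: derivative_eq_intros)
 qed
 show "AE x in M. ALL t'. \<bar>t' - t\<bar> <= 1 --> \<bar>f x (u x + t' * h x) * h x\<bar> <= 2 * C * (1 + ((2 + \<bar>t\<bar>) * B) powr s)"
  using AE_space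
 proof (eventually_elim, intro allI impI)
  fix x t' assume x: "x : space M" and t': "\<bar>t' - t\<bar> <= (1::real)"
  have B: "B >= 0" using bnd(1)[of x] by linarith
  have "(1 + \<bar>t'\<bar>) * B <= (2 + \<bar>t\<bar>) * B" "1 * B <= (2 + \<bar>t\<bar>) * B" using t' B by (intro mult_right_mono; linarith)+
  then show "\<bar>f x (u x + t' * h x) * h x\<bar> <= 2 * C * (1 + ((2 + \<bar>t\<bar>) * B) powr s)"
   using tB[of x t'] bnd(2)[of x] by (intro f_product_bound[OF x]) linarith+
 qed
qed

end

lemma borel_imp_lebesgue_on: "h : borel_measurable borel ==> h : borel_measurable (lebesgue_on S)"
 by (intro measurable_restrict_space1 borel_measurable_if_I) (auto intro: measurable_completion)

section \<open>The energy functional\<close>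

text \<open>Here K and f are already normalised: K lives on the whole line, so that its primitive is
  differentiable everywhere, and continuity, growth and oddness of f hold at each point of
  \<open>Om\<close>. The exponent s dominates q and the growth of f, and the last inequality of
  \<open>exps\<close> says that s is subcritical.\<close>

locale kirchhoff =
 fixes Om :: "'a::euclidean_space set" and p q s A C :: real and a :: "'a => real"
  and K :: "real => real" and f :: "'a => real => real"
 assumes Om: "open Om" "bounded Om"
  and exps: "1 < p" "p < q" "q <= s" "s * (DIM('a) - p) < DIM('a) * p"
  and a_measurable: "a : borel_measurable (lebesgue_on Om)"
  and a_bounds: "!!x. x : Om ==> 0 <= a x & a x <= A" and A: "A >= 0"
  and K_cont: "continuous_on UNIV K" and K_nonneg: "!!t. K t >= 0"
  and C_nonneg: "C >= 0"
  and f_measurable: "!!t. (%x. f x t) : borel_measurable (lebesgue_on Om)"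
  and f_continuous: "!!x. x : Om ==> continuous_on UNIV (f x)"
  and f_bound: "!!x t. x : Om ==> \<bar>f x t\<bar> <= C * (1 + \<bar>t\<bar> powr (s - 1))"
  and f_odd: "!!x t. x : Om ==> f x (- t) = - f x t"
begin

abbreviation mu where "mu \<equiv> lebesgue_on Om"

sublocale mu: finite_measure mu
 by (rule finite_measure_lebesgue_on[OF lmeasurable_open[OF Om(2,1)]])

sublocale weighted_modular mu a p q
 by standard (use exps a_measurable a_bounds in auto)

sublocale superposition mu f C s
 by standard (use exps C_nonneg f_measurable f_continuous f_bound in auto)

text \<open>With weight zero the modular is the integral of the s-th power, so that L^s inherits the
  lemmas on subsequences, limits and uniqueness.\<close>

sublocale L: weighted_modular mu "%_. 0" s s
 by standard (use exps in auto)

text \<open>The gradient is a separate argument, so that classical gradients of test functions,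
  almost everywhere limits of gradients and the chosen \<open>wgrad\<close> can be inserted without
  being identified first.\<close>

definition J :: "('a => real) => ('a => 'a) => real" where
 "J u g = primitive K (energy_int g) - (LINT x|mu. primitive (f x) (u x))"

definition DJ :: "('a => real) => ('a => 'a) => ('a => real) => ('a => 'a) => real" where
 "DJ u g v k = K (energy_int g) * flux_int g k - (LINT x|mu. f x (u x) * v x)"

lemma modM_const: "modM mu a p q (%_. B :: real) < \<infinity>"
proof -
 have "modM mu a p q (%_. B :: real) <= (\<integral>\<^sup>+x. ennreal (\<bar>B\<bar> powr p + A * \<bar>B\<bar> powr q) \<partial>mu)"
  unfolding modM_def using a_bounds by (intro nn_integral_mono ennreal_leI) (auto intro: mult_right_mono)
 also have "... < \<infinity>"
 proof -
  have "emeasure mu (space mu) < top" using mu.emeasure_finite less_top by blast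
  then show ?thesis by (simp add: ennreal_mult_less_top)
 qed
 finally show ?thesis .
qed

lemma DERIV_energy_line:
 fixes g k :: "'a => 'a"
 assumes [measurable]: "g : borel_measurable mu" "k : borel_measurable mu"
  and bnd: "!!x. norm (g x) <= B" "!!x. norm (k x) <= B"
 shows "((%t. energy_int (%x. g x + t *\<^sub>R k x)) has_real_derivative flux_int (%x. g x + t *\<^sub>R k x) k) (at t)"
 unfolding energy_int_def flux_int_def
proof (rule leibniz_integral[where G' = "%t x. (Fden a p q x (g x + t *\<^sub>R k x)) *
  ((g x + t *\<^sub>R k x) \<bullet> k x)"])
 have B: "B >= 0" using bnd(1)[of undefined] norm_ge_zero[of "g undefined"] by linarith
 have tB: "norm (g x + t *\<^sub>R k x) <= (1 + \<bar>t\<bar>) * B" for x t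
 proof -
  have "norm (t *\<^sub>R k x) <= \<bar>t\<bar> * B" using bnd(2)[of x] by (simp add: mult_left_mono)
  then show ?thesis using norm_triangle_ineq[of "g x" "t *\<^sub>R k x"] bnd(1)[of x] by (simp add: distrib_right)
 qed
 show "finite_measure mu" by (rule mu.finite_measure_axioms)
 show "integrable mu (%x. Eden a p q x (g x + t *\<^sub>R k x))" for t
  using B tB by (intro energy_integrable[OF _ _ modM_const[of "(1 + \<bar>t\<bar>) * B"]]) auto
 show "(%x. (Fden a p q x (g x + t *\<^sub>R k x)) *
  ((g x + t *\<^sub>R k x) \<bullet> k x)) : borel_measurable mu" using a_measurable by measurable
 show "AE x in mu. ALL t. ((%t. Eden a p q x (g x + t *\<^sub>R k x)) has_real_derivative
   (Fden a p q x (g x + t *\<^sub>R k x)) * ((g x + t *\<^sub>R k x) \<bullet> k x)) (at t)"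
 proof (intro AE_I2 allI)
  fix x t
  have "((%t. Eden a p q x (g x + t *\<^sub>R k x)) has_real_derivative
   norm (g x + t *\<^sub>R k x) powr (p - 2) * ((g x + t *\<^sub>R k x) \<bullet> k x) + a x * (norm (g x + t *\<^sub>R k x) powr (q - 2) * ((g x + t *\<^sub>R k x) \<bullet> k x))) (at t)"
   using exps by (intro DERIV_add DERIV_cmult DERIV_norm_powr_line) auto
  then show "((%t. Eden a p q x (g x + t *\<^sub>R k x)) has_real_derivative
   (Fden a p q x (g x + t *\<^sub>R k x)) * ((g x + t *\<^sub>R k x) \<bullet> k x)) (at t)"
   by (simp add: distrib_right mult.assoc)
 qed
 show "AE x in mu. ALL t'. \<bar>t' - t\<bar> <= 1 -->
   \<bar>(Fden a p q x (g x + t' *\<^sub>R k x)) * ((g x + t' *\<^sub>R k x) \<bullet> k x)\<bar>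
   <= ((2 + \<bar>t\<bar>) * B) powr p + A * ((2 + \<bar>t\<bar>) * B) powr q"
 proof (intro AE_I2 allI impI)
  fix x t' assume x: "x : space mu" and t': "\<bar>t' - t\<bar> <= (1::real)"
  have W: "(1 + \<bar>t'\<bar>) * B <= (2 + \<bar>t\<bar>) * B" "1 * B <= (2 + \<bar>t\<bar>) * B" using t' B by (intro mult_right_mono; linarith)+
  have "norm ((Fden a p q x (g x + t' *\<^sub>R k x)) * ((g x + t' *\<^sub>R k x) \<bullet> k x))
   <= ((2 + \<bar>t\<bar>) * B) powr p + a x * ((2 + \<bar>t\<bar>) * B) powr q"
   using order_trans[OF tB W(1)] order_trans[OF bnd(2), of "(2 + \<bar>t\<bar>) * B" x] W(2) by (intro flux_density_bound[OF x]) auto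
  also have "... <= ((2 + \<bar>t\<bar>) * B) powr p + A * ((2 + \<bar>t\<bar>) * B) powr q"
   using a_bounds[of x] x by (intro add_left_mono mult_right_mono) auto
  finally show "\<bar>(Fden a p q x (g x + t' *\<^sub>R k x)) * ((g x + t' *\<^sub>R k x) \<bullet> k x)\<bar>
   <= ((2 + \<bar>t\<bar>) * B) powr p + A * ((2 + \<bar>t\<bar>) * B) powr q" by simp
 qed
qed

lemma DERIV_J_line:
 fixes u h :: "'a => real" and g k :: "'a => 'a"
 assumes "g : borel_measurable mu" "k : borel_measurable mu" "u : borel_measurable mu" "h : borel_measurable mu"
  and bnd: "!!x. norm (g x) <= B" "!!x. norm (k x) <= B" "!!x. \<bar>u x\<bar> <= B" "!!x. \<bar>h x\<bar> <= B"
 shows "((%t. J (%x. u x + t * h x) (%x. g x + t *\<^sub>R k x)) has_real_derivative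
  DJ (%x. u x + t * h x) (%x. g x + t *\<^sub>R k x) h k) (at t)"
 unfolding J_def DJ_def using assms
 by (intro DERIV_diff DERIV_chain'[OF DERIV_energy_line DERIV_primitive[OF K_cont], THEN DERIV_cong]
   DERIV_primitive_integral_line) (auto simp: mult.commute)

lemma J_tendsto:
 assumes "!!n. g n : borel_measurable mu" "h : borel_measurable mu" "!!n. u n : borel_measurable mu" "v : borel_measurable mu"
  and lim: "AE x in mu. (%n. g n x) ----> h x" "AE x in mu. (%n. u n x) ----> v x"
  and W: "W : borel_measurable mu" "!!x. W x >= 0" "modM mu a p q W < \<infinity>"
  and V: "integrable mu (%x. V x powr s)"
  and dom: "AE x in mu. ALL n. norm (g n x) <= W x" "AE x in mu. ALL n. \<bar>u n x\<bar> <= V x"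
 shows "(%n. J (u n) (g n)) ----> J v h"
 unfolding J_def
 by (intro tendsto_diff isCont_tendsto_compose[OF DERIV_isCont[OF DERIV_primitive[OF K_cont]]]
   energy_tendsto[OF W] primitive_tendsto[OF V] assms)

text \<open>Values are dominated in L^s, gradients in the double-phase modular: these are the two
  kinds of majorant that make the integrands of \<open>DJ\<close> dominated.\<close>

lemma DJ_tendsto:
 assumes "!!n. g n : borel_measurable mu" "h : borel_measurable mu" "!!n. u n : borel_measurable mu" "v : borel_measurable mu"
  "!!n. k n : borel_measurable mu" "l : borel_measurable mu" "!!n. w n : borel_measurable mu" "y : borel_measurable mu"
  and lim: "AE x in mu. (%n. g n x) ----> h x" "AE x in mu. (%n. u n x) ----> v x"
   "AE x in mu. (%n. k n x) ----> l x" "AE x in mu. (%n. w n x) ----> y x"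
  and W: "W : borel_measurable mu" "!!x. W x >= 0" "modM mu a p q W < \<infinity>"
  and V: "integrable mu (%x. V x powr s)"
  and dom: "AE x in mu. ALL n. norm (g n x) <= W x" "AE x in mu. ALL n. \<bar>u n x\<bar> <= V x"
   "AE x in mu. ALL n. norm (k n x) <= W x" "AE x in mu. ALL n. \<bar>w n x\<bar> <= V x"
 shows "(%n. DJ (u n) (g n) (w n) (k n)) ----> DJ v h y l"
 unfolding DJ_def
proof (intro tendsto_diff tendsto_mult)
 show "(%n. K (energy_int (g n))) ----> K (energy_int h)"
  by (rule continuous_on_tendsto_compose[OF K_cont]) (auto intro: energy_tendsto[OF W] assms)
 show "(%n. flux_int (g n) (k n)) ----> flux_int h l"
  by (intro flux_int_tendsto[OF W] assms)
 show "(%n. LINT x|mu. f x (u n x) * w n x) ----> (LINT x|mu. f x (v x) * y x)"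
  by (intro superposition_product_tendsto[OF V] assms)
qed

lemma energy_int_uminus: "energy_int (%x. - g x) = energy_int (g :: 'a => 'a)"
 by (simp add: energy_int_def)

lemma flux_int_uminus: "flux_int (%x. - g x) k = - flux_int (g :: 'a => 'a) k"
 by (simp add: flux_int_def)

lemma J_uminus: "J (%x. - u x) (%x. - g x) = J u g"
proof -
 have "(LINT x|mu. primitive (f x) (- u x)) = (LINT x|mu. primitive (f x) (u x))"
  using f_continuous f_odd by (intro Bochner_Integration.integral_cong) (auto intro: primitive_even)
 then show ?thesis by (simp add: J_def energy_int_uminus)
qed

lemma DJ_uminus: "DJ (%x. - u x) (%x. - g x) v k = - DJ u g v k"
proof -
 have "(LINT x|mu. f x (- u x) * v x) = (LINT x|mu. - (f x (u x) * v x))"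
  using f_odd by (intro Bochner_Integration.integral_cong) auto
 then show ?thesis by (simp add: DJ_def energy_int_uminus flux_int_uminus)
qed

lemma DJ_sum:
 fixes g :: "'a => 'a" and n :: nat
 assumes [measurable]: "g : borel_measurable mu" "u : borel_measurable mu"
  "!!i. k i : borel_measurable mu" "!!i. v i : borel_measurable mu"
  and bnd: "!!x. norm (g x) <= B" "!!x. \<bar>u x\<bar> <= B" "!!i x. i < n ==> norm (k i x) <= B" "!!i x. i < n ==> \<bar>v i x\<bar> <= B"
 shows "DJ u g (%x. \<Sum>i<n. h i * v i x) (%x. \<Sum>i<n. h i *\<^sub>R k i x) = (\<Sum>i<n. h i * DJ u g (v i) (k i))"
proof -
 have B: "B >= 0" using bnd(1)[of undefined] norm_ge_zero[of "g undefined"] by linarith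
 let ?m = "%x. Fden a p q x (g x)"
 have "flux_int g (%x. \<Sum>i<n. h i *\<^sub>R k i x) = (LINT x|mu. (\<Sum>i<n. h i * (?m x * (g x \<bullet> k i x))))"
  unfolding flux_int_def by (intro Bochner_Integration.integral_cong) (auto simp: inner_sum_right sum_distrib_left sum.distrib algebra_simps)
 also have "... = (\<Sum>i<n. LINT x|mu. h i * (?m x * (g x \<bullet> k i x)))"
  using bnd B by (intro Bochner_Integration.integral_sum Bochner_Integration.integrable_mult_right
    flux_integrable[OF _ _ modM_const[of B]]) auto
 also have "... = (\<Sum>i<n. h i * flux_int g (k i))"
  by (simp add: flux_int_def)
 finally have 1: "flux_int g (%x. \<Sum>i<n. h i *\<^sub>R k i x) = (\<Sum>i<n. h i * flux_int g (k i))" .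
 have "(LINT x|mu. f x (u x) * (\<Sum>i<n. h i * v i x)) = (LINT x|mu. (\<Sum>i<n. h i * (f x (u x) * v i x)))"
  by (intro Bochner_Integration.integral_cong) (auto simp: sum_distrib_left algebra_simps)
 also have "... = (\<Sum>i<n. LINT x|mu. h i * (f x (u x) * v i x))"
  using bnd B by (intro Bochner_Integration.integral_sum Bochner_Integration.integrable_mult_right
    superposition_product_integrable[OF bounded_powr_integrable[of B]]) auto
 also have "... = (\<Sum>i<n. h i * (LINT x|mu. f x (u x) * v i x))" by simp
 finally show ?thesis unfolding DJ_def 1
  by (simp add: sum_subtractf right_diff_distrib sum_distrib_left algebra_simps)
qed

lemma test_measurable [measurable]:
 assumes "phi : test_functions Om"
 shows "phi : borel_measurable mu" "grad phi : borel_measurable mu"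
 using test_functions_borel[OF assms] by (auto intro: borel_imp_lebesgue_on)

text \<open>Only the p-part is kept, since the weight may vanish; all embeddings rest on it.\<close>

lemma energy_ge_Gr:
 assumes "phi : test_functions Om"
 shows "energy_int (grad phi) >= Gr p phi / p"
proof -
 obtain B where B: "B > 0" "!!x. norm (grad phi x) <= B" using test_functions_bounded[OF assms] by metis
 have m: "grad phi : borel_measurable mu" by (rule borel_imp_lebesgue_on[OF test_functions_borel(2)[OF assms]])
 have "Gr p phi = (LINT x|mu. norm (grad phi x) powr p)"
  unfolding Gr_def using assms exps test_functions_zero_outside[OF assms] test_functions_borel(2)[OF assms]
  by (intro lebesgue_on_borel(1)[OF Om(1), symmetric]) auto
 then have "Gr p phi / p = (LINT x|mu. norm (grad phi x) powr p / p)" by simp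
 also have "... <= energy_int (grad phi)" unfolding energy_int_def
 proof (rule integral_mono)
  have "integrable lborel (%x. norm (grad phi x) powr p)" using exps by (intro grad_powr_integrable[OF _ assms]) auto
  then have "integrable mu (%x. norm (grad phi x) powr p)"
   using assms exps test_functions_zero_outside[OF assms] test_functions_borel(2)[OF assms]
   by (subst lebesgue_on_borel(2)[OF Om(1)]) auto
  then show "integrable mu (%x. norm (grad phi x) powr p / p)" by simp
  show "integrable mu (%x. Eden a p q x (grad phi x))"
   using B m by (intro energy_integrable[OF _ _ modM_const[of B]]) auto
  show "norm (grad phi x) powr p / p <= Eden a p q x (grad phi x)" if "x : space mu" for x
   using a_bounds[of x] exps that by simp
 qed
 finally show ?thesis .
qed

end

section \<open>Restriction to finite-dimensional spans\<close>

locale galerkin = kirchhoff Om p q s A C a K f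
 for Om :: "'a::euclidean_space set" and p q s A C a K f +
 fixes e :: "nat => 'a => real"
 assumes e_test: "!!n. e n : test_functions Om"
  and e_dense: "!!phi de. phi : test_functions Om ==> de > 0 ==>
   EX n. (ALL x. \<bar>e n x - phi x\<bar> < de) & (ALL x. norm (grad (e n) x - grad phi x) < de)"
  and e_independent: "!!n xi i. (!!x. (\<Sum>i<n. xi i * e i x) = 0) ==> i < n ==> xi i = 0"
begin

definition comb :: "nat => (nat => real) => 'a => real" where
 "comb n xi x = (\<Sum>i<n. xi i * e i x)"

lemma comb_test: "comb n xi : test_functions Om"
 and grad_comb: "grad (comb n xi) x = (\<Sum>i<n. xi i *\<^sub>R grad (e i) x)"
 using test_functions_sum[of "{..<n}" e Om xi] e_test unfolding comb_def[abs_def] by auto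

lemma comb_measurable [measurable]: "comb n xi : borel_measurable mu" "grad (comb n xi) : borel_measurable mu"
 using comb_test by (auto intro: test_measurable)

lemma comb_mono: "xi : fin_sp n ==> n <= m ==> comb m xi = comb n xi"
 unfolding comb_def[abs_def] by (intro ext sum.mono_neutral_right) (auto simp: fin_sp_def)

lemma comb_line: "comb n (%i. xi i + t * h i) = (%x. comb n xi x + t * comb n h x)"
 "grad (comb n (%i. xi i + t * h i)) = (%x. grad (comb n xi) x + t *\<^sub>R grad (comb n h) x)"
 unfolding grad_comb fun_eq_iff
 by (auto simp: comb_def sum.distrib distrib_right sum_distrib_left scaleR_sum_right scaleR_left_distrib mult.assoc)

lemma comb_uminus: "comb n (%i. - xi i) = (%x. - comb n xi x)" "grad (comb n (%i. - xi i)) = (%x. - grad (comb n xi) x)"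
 unfolding grad_comb fun_eq_iff by (auto simp: comb_def sum_negf)

lemma e_bounded: "EX B>0. ALL i<n. ALL x. \<bar>e i x\<bar> <= B & norm (grad (e i) x) <= B"
proof -
 have "ALL i. EX B>0. ALL x. \<bar>e i x\<bar> <= B & norm (grad (e i) x) <= B"
  using test_functions_bounded[OF e_test] by metis
 then obtain B where B: "!!i. B i > 0" "!!i x. \<bar>e i x\<bar> <= B i & norm (grad (e i) x) <= B i" by metis
 have "B i <= (\<Sum>i<n. B i)" if "i < n" for i
  using that less_imp_le[OF B(1)] by (intro member_le_sum) auto
 then have "\<bar>e i x\<bar> <= 1 + (\<Sum>i<n. B i) & norm (grad (e i) x) <= 1 + (\<Sum>i<n. B i)" if "i < n" for i x
  using that B(2)[of i x] by force
 moreover have "1 + (\<Sum>i<n. B i) > 0" using less_imp_le[OF B(1)] by (intro add_pos_nonneg sum_nonneg) auto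
 ultimately show ?thesis by blast
qed

lemma comb_bounded:
 fixes R :: real
 shows "EX B>0. ALL xi. (ALL i<n. \<bar>xi i\<bar> <= R) --> (ALL x. \<bar>comb n xi x\<bar> <= B & norm (grad (comb n xi) x) <= B)"
proof -
 obtain B where B: "B > 0" "!!i x. i < n ==> \<bar>e i x\<bar> <= B" "!!i x. i < n ==> norm (grad (e i) x) <= B"
  using e_bounded[of n] by blast
 have "\<bar>comb n xi x\<bar> <= n * (\<bar>R\<bar> * B) + 1 & norm (grad (comb n xi) x) <= n * (\<bar>R\<bar> * B) + 1" if "ALL i<n. \<bar>xi i\<bar> <= R" for xi x
 proof -
  have R: "\<bar>xi i\<bar> <= \<bar>R\<bar>" if "i < n" for i using that \<open>ALL i<n. \<bar>xi i\<bar> <= R\<close> by fastforce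
  have "\<bar>comb n xi x\<bar> <= (\<Sum>i<n. \<bar>R\<bar> * B)" unfolding comb_def
   using B R by (intro order_trans[OF sum_abs] sum_mono) (auto simp: abs_mult intro!: mult_mono)
  moreover have "norm (grad (comb n xi) x) <= (\<Sum>i<n. \<bar>R\<bar> * B)" unfolding grad_comb
   using B R by (intro order_trans[OF norm_sum] sum_mono) (auto intro!: mult_mono)
  ultimately show ?thesis by simp
 qed
 moreover have "n * (\<bar>R\<bar> * B) + 1 > 0" using B(1) by (intro add_nonneg_pos) auto
 ultimately show ?thesis by blast
qed

lemma comb_tendsto:
 assumes "xi ----> zeta"
 shows "(%k. comb n (xi k) x) ----> comb n zeta x" "(%k. grad (comb n (xi k)) x) ----> grad (comb n zeta) x"
  "EX B>0. ALL k x. \<bar>comb n (xi k) x\<bar> <= B & norm (grad (comb n (xi k)) x) <= B"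
proof -
 have c: "(%k. xi k i) ----> zeta i" for i using assms unfolding tendsto_fun_iff by blast
 show "(%k. comb n (xi k) x) ----> comb n zeta x" "(%k. grad (comb n (xi k)) x) ----> grad (comb n zeta) x"
  unfolding grad_comb comb_def by (intro tendsto_intros c)+
 have "ALL i. EX R>0. ALL k. \<bar>xi k i\<bar> <= R"
  using convergent_imp_Bseq[OF convergentI[OF c]] unfolding Bseq_def by simp
 then obtain R where R: "!!i. R i > 0" "!!k i. \<bar>xi k i\<bar> <= R i" by metis
 have "\<bar>xi k i\<bar> <= (\<Sum>i<n. R i)" if "i < n" for k i
  using that R(2)[of k i] less_imp_le[OF R(1)] member_le_sum[of i "{..<n}" R] by force
 then show "EX B>0. ALL k x. \<bar>comb n (xi k) x\<bar> <= B & norm (grad (comb n (xi k)) x) <= B"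
  using comb_bounded[of n "\<Sum>i<n. R i"] by meson
qed

abbreviation Jn :: "nat => (nat => real) => real" where
 "Jn n xi \<equiv> J (comb n xi) (grad (comb n xi))"

abbreviation Dn :: "nat => nat => (nat => real) => real" where
 "Dn n i xi \<equiv> DJ (comb n xi) (grad (comb n xi)) (e i) (grad (e i))"

text \<open>Continuity may be tested along sequences, and a convergent sequence of coefficients
  keeps the combinations and their gradients uniformly bounded; constant majorants then
  suffice.\<close>

lemma continuous_on_comb:
 fixes F :: "(nat => real) => real"
 assumes "!!xi zeta B. xi ----> zeta ==> (0::real) < B ==> (!!k x. \<bar>comb n (xi k) x\<bar> <= B) ==> (!!k x. norm (grad (comb n (xi k)) x) <= B) ==>
  (%k. F (xi k)) ----> F zeta"
 shows "continuous_on S F"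
 unfolding continuous_on_sequentially o_def using assms comb_tendsto(3)[of _ _ n] by meson

lemma continuous_on_Jn: "continuous_on S (Jn n)"
proof (rule continuous_on_comb)
 fix xi zeta B assume c: "xi ----> zeta" and B: "(0::real) < B" "!!k x. \<bar>comb n (xi k) x\<bar> <= B" "!!k x. norm (grad (comb n (xi k)) x) <= B"
 show "(%k. Jn n (xi k)) ----> Jn n zeta"
  using comb_tendsto(1,2)[OF c] B comb_measurable
  by (intro J_tendsto[OF _ _ _ _ _ _ _ _ modM_const[of B] bounded_powr_integrable[of B]]) auto
qed

lemma continuous_on_Dn: "continuous_on S (Dn n i)"
proof (rule continuous_on_comb)
 fix xi zeta B assume c: "xi ----> zeta" and B: "(0::real) < B" "!!k x. \<bar>comb n (xi k) x\<bar> <= B" "!!k x. norm (grad (comb n (xi k)) x) <= B"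
 obtain B' where B': "!!x. \<bar>e i x\<bar> <= B'" "!!x. norm (grad (e i) x) <= B'"
  using test_functions_bounded[OF e_test[of i]] by metis
 have le: "\<bar>comb n (xi k) x\<bar> <= max B B'" "norm (grad (comb n (xi k)) x) <= max B B'" "\<bar>e i x\<bar> <= max B B'" "norm (grad (e i) x) <= max B B'"
  for k x using B(2,3)[of k x] B'[of x] by auto
 show "(%k. Dn n i (xi k)) ----> Dn n i zeta"
  using comb_tendsto(1,2)[OF c] B le comb_measurable test_measurable[OF e_test]
  by (intro DJ_tendsto[OF _ _ _ _ _ _ _ _ _ _ _ _ _ _ modM_const[of "max B B'"] bounded_powr_integrable[of "max B B'"]]) auto
qed

lemma Jn_uminus: "Jn n (%i. - xi i) = Jn n xi"
 unfolding comb_uminus(2) unfolding comb_uminus(1) by (rule J_uminus)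

lemma Dn_uminus: "Dn n i (%i. - xi i) = - Dn n i xi"
 unfolding comb_uminus(2) unfolding comb_uminus(1) by (rule DJ_uminus)

lemma DJ_comb: "DJ (comb n xi) (grad (comb n xi)) (comb m h) (grad (comb m h)) =
  (\<Sum>i<m. h i * DJ (comb n xi) (grad (comb n xi)) (e i) (grad (e i)))"
proof -
 obtain B where B: "!!x. \<bar>comb n xi x\<bar> <= B" "!!x. norm (grad (comb n xi) x) <= B"
  using test_functions_bounded[OF comb_test] by metis
 obtain B' where B': "!!i x. i < m ==> \<bar>e i x\<bar> <= B'" "!!i x. i < m ==> norm (grad (e i) x) <= B'"
  using e_bounded[of m] by blast
 have le: "\<bar>comb n xi x\<bar> <= max B B'" "norm (grad (comb n xi) x) <= max B B'" for x
  using B[of x] by auto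
 have le': "\<bar>e i x\<bar> <= max B B'" "norm (grad (e i) x) <= max B B'" if "i < m" for i x
  using B'[OF that, of x] by auto
 have eq: "comb m h = (%x. \<Sum>i<m. h i * e i x)" "grad (comb m h) = (%x. \<Sum>i<m. h i *\<^sub>R grad (e i) x)"
  by (auto simp: comb_def grad_comb)
 show ?thesis
  unfolding eq(2) unfolding eq(1) by (rule DJ_sum[where B = "max B B'"]) (use le le' comb_measurable test_measurable[OF e_test] in auto)
qed

lemma DERIV_Jn:
 "((%t. Jn n (%i. xi i + t * h i)) has_real_derivative (\<Sum>i<n. h i * Dn n i (%i. xi i + t * h i))) (at t)"
proof -
 obtain B where B: "!!x. \<bar>comb n xi x\<bar> <= B" "!!x. norm (grad (comb n xi) x) <= B"
  using test_functions_bounded[OF comb_test] by metis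
 obtain B' where B': "!!x. \<bar>comb n h x\<bar> <= B'" "!!x. norm (grad (comb n h) x) <= B'"
  using test_functions_bounded[OF comb_test] by metis
 have le: "\<bar>comb n xi x\<bar> <= max B B'" "norm (grad (comb n xi) x) <= max B B'" "\<bar>comb n h x\<bar> <= max B B'" "norm (grad (comb n h) x) <= max B B'"
  for x using B[of x] B'[of x] by auto
 show ?thesis
  unfolding DJ_comb[symmetric] unfolding comb_line(2) unfolding comb_line(1)
  by (rule DERIV_J_line[where B = "max B B'"]) (use le comb_measurable in auto)
qed

end

section \<open>Growth along rays\<close>

text \<open>The assumption says that P t * t powr (- th) has nonpositive derivative. It is used for
  the primitive of K and, with reversed sign, for the primitive of f.\<close>

lemma power_growth:
 fixes P h :: "real => real"
 assumes D: "!!t. (P has_real_derivative h t) (at t)" and T: "T > 0"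
  and le: "!!t. t >= T ==> t * h t <= th * P t" and t: "t >= T"
 shows "P t <= P T * (t / T) powr th"
proof -
 define phi where "phi t = P t * t powr (- th)" for t
 have "phi t <= phi T"
 proof (rule DERIV_nonpos_imp_nonincreasing[OF t])
  fix x assume x: "T <= x" "x <= t"
  then have x0: "x > 0" using T by simp
  have "(phi has_real_derivative h x * x powr (- th) + P x * (- th * x powr (- th - 1))) (at x)"
   unfolding phi_def using x0 D[of x] by (auto intro!: derivative_eq_intros)
  moreover have "h x * x powr (- th) + P x * (- th * x powr (- th - 1)) = x powr (- th - 1) * (x * h x - th * P x)"
   using x0 by (simp add: powr_diff field_simps)
  moreover have "x powr (- th - 1) * (x * h x - th * P x) <= 0" using le[OF x(1)] by (intro mult_nonneg_nonpos) auto
  ultimately show "EX y. (phi has_real_derivative y) (at x) & y <= 0" by metis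
 qed
 then have "P t * t powr (- th) * t powr th <= P T * T powr (- th) * t powr th"
  unfolding phi_def by (intro mult_right_mono) auto
 then show ?thesis using t T by (simp add: powr_divide powr_minus field_simps)
qed

text \<open>The sphere of the maximum norm, which fits the coordinatewise conditions under which
  growth at infinity is stated.\<close>

definition unit_sphere :: "nat => (nat => real) set" where
 "unit_sphere n = {omg : fin_sp n. (ALL i. \<bar>omg i\<bar> <= 1) & (EX i<n. \<bar>omg i\<bar> = 1)}"

lemma compact_unit_sphere: "compact (unit_sphere n)"
proof -
 have "unit_sphere n = {omg : fin_sp n. ALL i. \<bar>omg i\<bar> <= 1} \<inter> (\<Union>i<n. {omg. \<bar>omg i\<bar> = 1})"
  by (auto simp: unit_sphere_def)
 moreover have "closed {omg :: nat => real. \<bar>omg i\<bar> = 1}" for i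
  by (intro closed_Collect_eq continuous_on_rabs continuous_on_product_coordinates continuous_on_const)
 ultimately show ?thesis using compact_fin_sp_box[of n 1] by (auto intro!: compact_Int_closed closed_UN)
qed

lemma radial_decomposition:
 assumes xi: "xi : fin_sp n" and R: "R > 0" "i < n" "\<bar>xi i\<bar> >= R"
 obtains r omg where "r >= R" "omg : unit_sphere n" "xi = (%i. r * omg i)"
proof -
 define r where "r = Max ((%i. \<bar>xi i\<bar>) ` {..<n})"
 have le: "\<bar>xi j\<bar> <= r" if "j < n" for j unfolding r_def using that by (intro Max_ge) auto
 have r: "r >= R" using le[OF R(2)] R(3) by simp
 have "r : (%i. \<bar>xi i\<bar>) ` {..<n}" unfolding r_def using R(2) by (intro Max_in) auto
 then obtain k where k: "k < n" "\<bar>xi k\<bar> = r" by auto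
 define omg where "omg j = xi j / r" for j
 have r0: "r > 0" using r R by simp
 have "\<bar>xi j\<bar> <= r" for j using le[of j] xi r0 by (cases "j < n") (auto simp: fin_sp_def)
 then have "omg : unit_sphere n"
  using xi k r0 by (auto simp: unit_sphere_def omg_def fin_sp_def abs_divide intro!: exI[of _ k])
 then show ?thesis using r r0 by (intro that[of r omg]) (auto simp: omg_def)
qed

lemma positive_on_sphere:
 assumes c: "continuous_on (unit_sphere n) h" and pos: "!!omg. omg : unit_sphere n ==> h omg > (0 :: real)"
 shows "EX de>0. ALL omg:unit_sphere n. h omg >= de"
proof (cases "unit_sphere n = {}")
 case False
 then show ?thesis using continuous_attains_inf[OF compact_unit_sphere False c] pos by blast
qed (auto intro: exI[of _ 1])

text \<open>The set where a continuous function is nonzero is open, and a nonempty open set is not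
  negligible.\<close>

lemma test_function_AE_zero:
 assumes "open Om" "phi : test_functions Om" "AE x in lebesgue_on Om. phi x = 0"
 shows "phi x = 0"
proof (rule ccontr)
 assume "phi x ~= 0"
 have op: "open {x. phi x ~= 0}" using test_functionsD(2)[OF assms(2)] by (intro open_Collect_neq) (auto intro: continuous_on_const)
 have "AE x in lebesgue. x : Om --> phi x = 0"
  using assms(1,3) by (subst (asm) AE_restrict_space_iff) auto
 then have "AE x in lebesgue. phi x = 0" using test_functions_zero_outside(1)[OF assms(2)] by (auto elim: eventually_mono)
 then have "negligible {x. phi x ~= 0}"
  unfolding eventually_ae_filter_negligible by (auto elim: negligible_subset)
 then show False using open_not_negligible[OF op] \<open>phi x ~= 0\<close> by blast
qed

context galerkin
begin

lemma comb_scale: "comb n (%i. r * omg i) = (%x. r * comb n omg x)"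
 "grad (comb n (%i. r * omg i)) = (%x. r *\<^sub>R grad (comb n omg) x)"
 unfolding grad_comb fun_eq_iff by (auto simp: comb_def sum_distrib_left scaleR_sum_right mult.assoc)

text \<open>Independence of the basis functions enters here, after vanishing almost everywhere has
  been improved to vanishing identically.\<close>

lemma comb_sphere_not_AE_zero:
 assumes "omg : unit_sphere n"
 shows "~ (AE x in mu. comb n omg x = 0)"
proof
 assume "AE x in mu. comb n omg x = 0"
 then have "comb n omg x = 0" for x by (rule test_function_AE_zero[OF Om(1) comb_test])
 then have "omg i = 0" if "i < n" for i using that by (intro e_independent[where xi = omg and n = n]) (auto simp: comb_def)
 then show False using assms by (auto simp: unit_sphere_def)
qed

lemma continuous_on_comb_integral:
 fixes h :: "real => 'a => real" and m :: real
 assumes m: "m > 0"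
 shows "continuous_on S (%xi. LINT x|mu. \<bar>comb n xi x\<bar> powr m)" "continuous_on S (%xi. LINT x|mu. norm (grad (comb n xi) x) powr m)"
  "continuous_on S (%xi. energy_int (grad (comb n xi)))"
proof -
 have "(%k. LINT x|mu. \<bar>comb n (xi k) x\<bar> powr m) ----> (LINT x|mu. \<bar>comb n zeta x\<bar> powr m) &
   (%k. LINT x|mu. norm (grad (comb n (xi k)) x) powr m) ----> (LINT x|mu. norm (grad (comb n zeta) x) powr m) &
   (%k. energy_int (grad (comb n (xi k)))) ----> energy_int (grad (comb n zeta))"
  if c: "xi ----> zeta" and B: "(0::real) < B" "!!k x. \<bar>comb n (xi k) x\<bar> <= B" "!!k x. norm (grad (comb n (xi k)) x) <= B" for xi zeta B
 proof (intro conjI integral_dominated_convergence[where w = "%_. B powr m"])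
  show "AE x in mu. (%k. \<bar>comb n (xi k) x\<bar> powr m) ----> \<bar>comb n zeta x\<bar> powr m"
   "AE x in mu. (%k. norm (grad (comb n (xi k)) x) powr m) ----> norm (grad (comb n zeta) x) powr m"
   using m comb_tendsto(1,2)[OF c] by (intro AE_I2 tendsto_powr' tendsto_intros; auto)+
  show "AE x in mu. norm (\<bar>comb n (xi k) x\<bar> powr m) <= B powr m" "AE x in mu. norm (norm (grad (comb n (xi k)) x) powr m) <= B powr m" for k
   using B m by (auto intro!: powr_mono2)
  show "(%k. energy_int (grad (comb n (xi k)))) ----> energy_int (grad (comb n zeta))"
   using comb_tendsto(2)[OF c] B comb_measurable by (intro energy_tendsto[OF _ _ modM_const[of B]]) auto
 qed (use comb_measurable in auto)
 then show "continuous_on S (%xi. LINT x|mu. \<bar>comb n xi x\<bar> powr m)" "continuous_on S (%xi. LINT x|mu. norm (grad (comb n xi) x) powr m)"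
  "continuous_on S (%xi. energy_int (grad (comb n xi)))"
  by (intro continuous_on_comb; blast)+
qed

lemma Gr_integral:
 assumes "phi : test_functions Om" "0 < (m :: real)"
 shows "Gr m phi = (LINT x|mu. norm (grad phi x) powr m)"
 unfolding Gr_def using assms test_functions_zero_outside[OF assms(1)] test_functions_borel(2)[OF assms(1)]
 by (intro lebesgue_on_borel(1)[OF Om(1), symmetric]) auto

lemma comb_integral_positive:
 assumes "omg : unit_sphere n" and m: "(m :: real) > 0"
 shows "(LINT x|mu. \<bar>comb n omg x\<bar> powr m) > 0"
proof (rule ccontr)
 assume "~ (LINT x|mu. \<bar>comb n omg x\<bar> powr m) > 0"
 moreover have "(LINT x|mu. \<bar>comb n omg x\<bar> powr m) >= 0" by (intro Bochner_Integration.integral_nonneg) auto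
 ultimately have z: "(LINT x|mu. \<bar>comb n omg x\<bar> powr m) = 0" by linarith
 obtain B where B: "!!x. \<bar>comb n omg x\<bar> <= B" using test_functions_bounded[OF comb_test] by metis
 have "integrable mu (%x. \<bar>comb n omg x\<bar> powr m)"
 proof (rule mu.integrable_const_bound[of _ "B powr m"])
  show "AE x in mu. norm (\<bar>comb n omg x\<bar> powr m) <= B powr m" using B m by (intro AE_I2) (auto intro!: powr_mono2)
 qed (use comb_measurable in auto)
 then have "AE x in mu. \<bar>comb n omg x\<bar> powr m = 0"
  using z by (subst (asm) integral_nonneg_eq_0_iff_AE) auto
 then show False using comb_sphere_not_AE_zero[OF assms(1)] by simp
qed

text \<open>By the Poincare inequality a zero gradient integral forces the function to vanish almost
  everywhere.\<close>

lemma comb_Gr_positive: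
 assumes "omg : unit_sphere n"
 shows "Gr p (comb n omg) > 0"
proof (rule ccontr)
 assume "~ Gr p (comb n omg) > 0"
 then have z: "Gr p (comb n omg) = 0" using Gr_nonneg[of p "comb n omg"] by linarith
 obtain P where "P > 0" and P: "!!phi. phi : test_functions Om ==> (Lpow p phi) <= ennreal (P * Gr p phi)"
  using poincare[OF exps(1) Om(2)] by blast
 have "(\<integral>\<^sup>+x. ennreal (\<bar>comb n omg x\<bar> powr p) \<partial>mu) = Lpow p (comb n omg)"
  using test_functions_zero_outside[OF comb_test] test_functions_borel(1)[OF comb_test] exps
  by (intro nn_integral_lebesgue_on_borel[OF Om(1)]) auto
 then have "(\<integral>\<^sup>+x. ennreal (\<bar>comb n omg x\<bar> powr p) \<partial>mu) = 0" using P[OF comb_test[of n omg]] z by simp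
 then have "AE x in mu. ennreal (\<bar>comb n omg x\<bar> powr p) = 0"
  using comb_measurable by (subst (asm) nn_integral_0_iff_AE) auto
 then have "AE x in mu. comb n omg x = 0" by eventually_elim (simp add: ennreal_eq_0_iff)
 then show False using comb_sphere_not_AE_zero[OF assms] by simp
qed

text \<open>The gradient integral is homogeneous of degree p and bounded below on the compact unit
  sphere.\<close>

lemma Gr_large:
 "EX R>0. ALL xi:fin_sp n. (EX i<n. \<bar>xi i\<bar> >= R) --> Gr p (comb n xi) > L"
proof -
 have p: "p > 0" using exps by simp
 have "continuous_on (unit_sphere n) (%omg. Gr p (comb n omg))"
  using continuous_on_comb_integral(2)[OF p, of "unit_sphere n" n] Gr_integral[OF comb_test p] by simp
 then obtain de where de: "de > 0" "!!omg. omg : unit_sphere n ==> Gr p (comb n omg) >= de"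
  using positive_on_sphere comb_Gr_positive by metis
 define R where "R = ((\<bar>L\<bar> + 1) / de) powr (1 / p)"
 have R: "R > 0" using de by (simp add: R_def)
 have Rp: "R powr p = (\<bar>L\<bar> + 1) / de" using p de by (simp add: R_def powr_powr)
 have "Gr p (comb n xi) > L" if xi: "xi : fin_sp n" "i < n" "\<bar>xi i\<bar> >= R" for xi i
 proof -
  obtain r omg where r: "r >= R" "omg : unit_sphere n" "xi = (%i. r * omg i)"
   using radial_decomposition[OF xi(1) R xi(2,3)] by blast
  have "Gr p (comb n xi) = r powr p * Gr p (comb n omg)"
   unfolding Gr_def r(3) comb_scale(2) using r(1) R by (simp add: powr_mult)
  moreover have "r powr p * Gr p (comb n omg) >= R powr p * de"
   using r R de p by (intro mult_mono powr_mono2) auto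
  ultimately show ?thesis using Rp de(1) by simp
 qed
 then show ?thesis using R by blast
qed

text \<open>Linearity makes the averages odd and continuous in the coefficients, as the Borsuk
  argument requires.\<close>

lemma cube_avg_comb: "cube_avg l (comb n xi) y = (\<Sum>i<n. xi i * cube_avg l (e i) y)"
proof (induction n)
 case 0
 show ?case by (simp add: cube_avg_def comb_def)
next
 case (Suc n)
 have "comb (Suc n) xi = (%x. 1 * comb n xi x + xi n * e n x)" by (auto simp: comb_def)
 then show ?case
  using cube_avg_linear[OF test_functions_integrable[OF comb_test[of n xi]] test_functions_integrable[OF e_test[of n]], of l 1 "xi n" y] Suc
  by simp
qed

end

section \<open>Galerkin critical points\<close>

locale kirchhoff_AR = galerkin Om p q s A C a K f e
 for Om :: "'a::euclidean_space set" and p q s A C a K f e +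
 fixes th sig c t0 :: real
 assumes theta: "th >= 1" and K_theta: "!!t. t >= 0 ==> t * K t <= th * primitive K t"
  and K_kappa: "!!tau. tau > 0 ==> EX kap>0. ALL t>=tau. K t >= kap"
  and sigma: "q * th < sig" and c: "c > 0" and t0: "t0 >= 0"
  and AR: "AE x in lebesgue_on Om. ALL t. \<bar>t\<bar> >= t0 --> c <= sig * primitive (f x) t & sig * primitive (f x) t <= t * f x t"
begin

lemma sigma_pos: "sig > 0"
 using sigma mult_mono[of 1 q 1 th] theta exps by simp

lemma primitive_K_mono: "t <= t' ==> primitive K t <= primitive K t'"
 using K_nonneg DERIV_primitive[OF K_cont] by (intro DERIV_nonneg_imp_nondecreasing[of t t' "primitive K"]) blast+

lemma primitive_K_nonneg: "t >= 0 ==> primitive K t >= 0"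
 using primitive_K_mono[of 0 t] by simp

lemma primitive_K_upper: "t >= 1 ==> primitive K t <= primitive K 1 * t powr th"
 using power_growth[of "primitive K" K 1 th t] DERIV_primitive[OF K_cont] K_theta by simp

text \<open>The slope kap is available only from 1 on; before that the shifted right-hand side is
  nonpositive.\<close>

lemma primitive_K_lower:
 assumes kap: "kap > 0" "!!t. t >= 1 ==> K t >= kap" and t: "t >= 0"
 shows "primitive K t >= kap * (t - 1)"
proof (cases "t >= 1")
 case True
 have "primitive K 1 - kap * 1 <= primitive K t - kap * t"
 proof (rule DERIV_nonneg_imp_nondecreasing[OF True])
  fix x :: real assume "1 <= x"
  then show "EX y. ((%t. primitive K t - kap * t) has_real_derivative y) (at x) & 0 <= y"
   using kap(2) by (intro exI[of _ "K x - kap"]) (auto intro!: derivative_eq_intros DERIV_primitive[OF K_cont])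
 qed
 then show ?thesis using primitive_K_nonneg[of 1] by (simp add: algebra_simps)
next
 case False
 then have "kap * (t - 1) <= 0" using kap(1) by (intro mult_nonneg_nonpos) auto
 then show ?thesis using primitive_K_nonneg[OF t] by linarith
qed

text \<open>Coercivity in the gradient integral, up to the L^s integral. The latter enters through a
  free bound V, so that a small value can be inserted on the linking sphere.\<close>

lemma J_lower:
 obtains kap where "kap > 0" "!!phi V. phi : test_functions Om ==> V >= 0 ==> (Lpow s phi) <= ennreal V ==>
  J phi (grad phi) >= kap * (Gr p phi / p - 1) - 2 * C * (measure mu Om + V)"
proof -
 obtain kap where kap: "kap > 0" "!!t. t >= 1 ==> K t >= kap" using K_kappa[of 1] by auto
 show ?thesis
 proof (rule that[OF kap(1)])
  fix phi and V :: real assume phi: "phi : test_functions Om" and V: "V >= 0" "Lpow s phi <= ennreal V"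
  obtain B where B: "!!x. \<bar>phi x\<bar> <= B" using test_functions_bounded[OF phi] by metis
  have s0: "s > 0" using exps by simp
  have m: "phi : borel_measurable mu" by (rule test_measurable[OF phi])
  have E: "Gr p phi / p <= energy_int (grad phi)" by (rule energy_ge_Gr[OF phi])
  have E0: "0 <= Gr p phi / p" using Gr_nonneg[of p phi] exps by simp
  have "kap * (Gr p phi / p - 1) <= kap * (energy_int (grad phi) - 1)" using E kap(1) by simp
  also have "... <= primitive K (energy_int (grad phi))" using E E0 by (intro primitive_K_lower kap) auto
  finally have 1: "kap * (Gr p phi / p - 1) <= primitive K (energy_int (grad phi))" .
  have int: "integrable mu (%x. \<bar>phi x\<bar> powr s)"
   by (rule mu.integrable_const_bound[of _ "B powr s"]) (use m B s0 in \<open>auto intro!: powr_mono2\<close>)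
  have "(\<integral>\<^sup>+x. ennreal (\<bar>phi x\<bar> powr s) \<partial>mu) = Lpow s phi"
   using test_functions_zero_outside[OF phi] test_functions_borel(1)[OF phi] s0
   by (intro nn_integral_lebesgue_on_borel[OF Om(1)]) auto
  then have "ennreal (LINT x|mu. \<bar>phi x\<bar> powr s) <= ennreal V"
   using V(2) nn_integral_eq_integral[OF int] by simp
  then have iV: "(LINT x|mu. \<bar>phi x\<bar> powr s) <= V" using V(1) by simp
  have "(LINT x|mu. primitive (f x) (phi x)) <= (LINT x|mu. 2 * C * (1 + \<bar>phi x\<bar> powr s))"
  proof (rule integral_mono)
   show "integrable mu (%x. primitive (f x) (phi x))"
    using B m by (intro primitive_integrable[OF bounded_powr_integrable[of B]]) auto
   show "integrable mu (%x. 2 * C * (1 + \<bar>phi x\<bar> powr s))" using int by (rule growth_integrable)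
   show "primitive (f x) (phi x) <= 2 * C * (1 + \<bar>phi x\<bar> powr s)" if "x : space mu" for x
    using primitive_bound[OF that order_refl, of "phi x"] by linarith
  qed
  also have "... = 2 * C * (measure mu Om + (LINT x|mu. \<bar>phi x\<bar> powr s))"
   using int by (simp add: measure_restrict_space)
  also have "... <= 2 * C * (measure mu Om + V)" using iV C_nonneg by (intro mult_left_mono add_left_mono) auto
  finally show "J phi (grad phi) >= kap * (Gr p phi / p - 1) - 2 * C * (measure mu Om + V)"
   using 1 unfolding J_def by linarith
 qed
qed

text \<open>Integrating the Ambrosetti-Rabinowitz inequality from T on gives growth of order sig;
  evenness of the primitive covers negative t, and c2 pays for the bounded range.\<close>

lemma primitive_f_lower:
 obtains c1 c2 where "c1 > 0" "c2 >= 0" "AE x in mu. ALL t. primitive (f x) t >= c1 * \<bar>t\<bar> powr sig - c2"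
proof -
 \<comment> \<open>At least one, so that the quotient t / T makes sense also when t0 = 0.\<close>
 define T where "T = max t0 1"
 have T: "T >= t0" "T >= 1" by (auto simp: T_def)
 define c1 where "c1 = c / sig / T powr sig"
 define c2 where "c2 = 2 * C * (1 + T powr s) + c1 * T powr sig"
 have c1: "c1 > 0" using c sigma_pos T by (simp add: c1_def)
 have c2: "c2 >= 0" unfolding c2_def using C_nonneg c1 by (intro add_nonneg_nonneg mult_nonneg_nonneg) auto
 have "AE x in mu. ALL t. primitive (f x) t >= c1 * \<bar>t\<bar> powr sig - c2"
  using AR AE_space
 proof (eventually_elim, intro allI)
  fix x t assume ar: "ALL t. \<bar>t\<bar> >= t0 --> c <= sig * primitive (f x) t & sig * primitive (f x) t <= t * f x t" and x: "x : space mu"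
  have x': "x : Om" using x by simp
  have pos: "primitive (f x) t >= c1 * t powr sig" if t: "t >= T" for t
  proof -
   have "- primitive (f x) t <= - primitive (f x) T * (t / T) powr sig"
   proof (rule power_growth[of "%t. - primitive (f x) t" "%t. - f x t"])
    show "((%t. - primitive (f x) t) has_real_derivative - f x z) (at z)" for z
     by (intro DERIV_minus DERIV_primitive f_continuous x')
    show "z * - f x z <= sig * - primitive (f x) z" if "z >= T" for z
     using ar[rule_format, of z] that T by simp
   qed (use T t in auto)
   moreover have "c / sig <= primitive (f x) T" using ar[rule_format, of T] T sigma_pos by (simp add: field_simps)
   then have "c / sig * (t / T) powr sig <= primitive (f x) T * (t / T) powr sig" by (intro mult_right_mono) auto
   moreover have "c / sig * (t / T) powr sig = c1 * t powr sig" using t T by (simp add: c1_def powr_divide)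
   ultimately show ?thesis by linarith
  qed
  have ev: "primitive (f x) t = primitive (f x) \<bar>t\<bar>"
   using primitive_even[OF f_continuous[OF x'] f_odd[OF x'], of t] by (cases "t >= 0") auto
  show "primitive (f x) t >= c1 * \<bar>t\<bar> powr sig - c2"
  proof (cases "\<bar>t\<bar> >= T")
   case True
   then show ?thesis using pos[OF True] ev c2 by linarith
  next
   case False
   then have "c1 * \<bar>t\<bar> powr sig <= c1 * T powr sig" using c1 sigma_pos by (intro mult_left_mono powr_mono2) auto
   moreover have "\<bar>primitive (f x) t\<bar> <= 2 * C * (1 + T powr s)" using False by (intro primitive_bound[OF x]) auto
   ultimately show ?thesis unfolding c2_def by linarith
  qed
 qed
 then show ?thesis using c1 c2 that by blast
qed

lemma energy_int_scale:
 assumes r: "r >= 1" and phi: "phi : test_functions Om"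
 shows "energy_int (%x. r *\<^sub>R grad phi x) <= r powr q * energy_int (grad phi)"
proof -
 obtain B where B: "B > 0" "!!x. norm (grad phi x) <= B" using test_functions_bounded[OF phi] by metis
 have "integrable mu (%x. Eden a p q x (grad phi x))"
  using B test_measurable[OF phi] by (intro energy_integrable[OF _ _ modM_const[of B]]) auto
 moreover have "integrable mu (%x. Eden a p q x (r *\<^sub>R grad phi x))"
  using B r test_measurable[OF phi] by (intro energy_integrable[OF _ _ modM_const[of "r * B"]]) auto
 moreover have "Eden a p q x (r *\<^sub>R grad phi x) <=
   r powr q * (Eden a p q x (grad phi x))" if x: "x : space mu" for x
 proof -
  have "r powr p <= r powr q" using r exps by (intro powr_mono) auto
  then have "r powr p * (norm (grad phi x) powr p / p) <= r powr q * (norm (grad phi x) powr p / p)"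
   using exps by (intro mult_right_mono) auto
  then show ?thesis using r by (simp add: powr_mult algebra_simps)
 qed
 ultimately have "energy_int (%x. r *\<^sub>R grad phi x) <= (LINT x|mu. r powr q * (Eden a p q x (grad phi x)))"
  unfolding energy_int_def by (intro integral_mono Bochner_Integration.integrable_mult_right) auto
 then show ?thesis by (simp add: energy_int_def)
qed

text \<open>Along a ray the Kirchhoff part grows at most like r powr (q * th) and the integral of
  the primitive at least like r powr sig, with sig > q * th. Compactness of the unit sphere makes
  the radius uniform.\<close>

lemma Jn_negative:
 "EX R>0. ALL xi:fin_sp n. (EX i<n. \<bar>xi i\<bar> >= R) --> Jn n xi < 0"
proof -
 obtain c1 c2 where c12: "c1 > 0" "c2 >= 0" "AE x in mu. ALL t. primitive (f x) t >= c1 * \<bar>t\<bar> powr sig - c2"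
  by (rule primitive_f_lower)
 obtain de where de: "de > 0" "!!omg. omg : unit_sphere n ==> (LINT x|mu. \<bar>comb n omg x\<bar> powr sig) >= de"
  using positive_on_sphere[OF continuous_on_comb_integral(1)[OF sigma_pos] comb_integral_positive[OF _ sigma_pos], of n n] by blast
 have "bounded ((%omg. energy_int (grad (comb n omg))) ` unit_sphere n)"
  by (intro compact_imp_bounded compact_continuous_image compact_unit_sphere continuous_on_comb_integral(3)[of 1]) simp
 then obtain E where E: "E > 0" "!!omg. omg : unit_sphere n ==> \<bar>energy_int (grad (comb n omg))\<bar> <= E"
  unfolding bounded_pos by auto
 define E' where "E' = max 1 E"
 define B where "B = primitive K 1 * E' powr th + c2 * measure mu Om"
 have B: "B >= 0" unfolding B_def using primitive_K_nonneg[of 1] c12(2) by (intro add_nonneg_nonneg mult_nonneg_nonneg) auto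
 \<comment> \<open>Ensures c1 * de * r powr (sig - q * th) >= B + 1 for r >= R; the additional one
   makes the energy strictly negative.\<close>
 define R where "R = max 1 (((B + 1) / (c1 * de)) powr (1 / (sig - q * th)))"
 have R: "R >= 1" by (simp add: R_def)
 have "Jn n xi < 0" if xi: "xi : fin_sp n" "i < n" "\<bar>xi i\<bar> >= R" for xi i
 proof -
  obtain r omg where r: "r >= R" "omg : unit_sphere n" "xi = (%i. r * omg i)"
   using radial_decomposition[OF xi(1) _ xi(2,3)] R by auto
  have r1: "r >= 1" using r R by simp
  obtain Bd where Bd: "Bd > 0" "!!x. \<bar>comb n omg x\<bar> <= Bd" using test_functions_bounded[OF comb_test] by metis
  have "energy_int (grad (comb n xi)) <= r powr q * energy_int (grad (comb n omg))"
   unfolding r(3) comb_scale(2) by (rule energy_int_scale[OF r1 comb_test])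
  also have "... <= r powr q * E'" using E(2)[OF r(2)] by (intro mult_left_mono) (auto simp: E'_def)
  finally have "primitive K (energy_int (grad (comb n xi))) <= primitive K (r powr q * E')" by (rule primitive_K_mono)
  also have "... <= primitive K 1 * (r powr q * E') powr th"
   using r1 exps ge_one_powr_ge_zero[of r q] mult_mono[of 1 "r powr q" 1 E'] by (intro primitive_K_upper) (auto simp: E'_def)
  also have "... = primitive K 1 * E' powr th * r powr (q * th)"
   by (simp add: powr_mult powr_powr E'_def)
  finally have 1: "primitive K (energy_int (grad (comb n xi))) <= primitive K 1 * E' powr th * r powr (q * th)" .
  have "c1 * (r powr sig * de) - c2 * measure mu Om <= c1 * (r powr sig * (LINT x|mu. \<bar>comb n omg x\<bar> powr sig)) - c2 * measure mu Om"
   using de(2)[OF r(2)] c12(1) by (intro diff_right_mono mult_left_mono) auto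
  also have "... = (LINT x|mu. c1 * \<bar>comb n xi x\<bar> powr sig - c2)"
  proof -
   have "integrable mu (%x. \<bar>comb n omg x\<bar> powr sig)"
    by (rule mu.integrable_const_bound[of _ "Bd powr sig"])
     (use comb_measurable Bd sigma_pos in \<open>auto intro!: powr_mono2\<close>)
   then have "(LINT x|mu. c1 * (r powr sig * \<bar>comb n omg x\<bar> powr sig) - c2) = c1 * (r powr sig * (LINT x|mu. \<bar>comb n omg x\<bar> powr sig)) - c2 * measure mu Om"
    by (simp add: measure_restrict_space)
   then show ?thesis unfolding r(3) comb_scale(1) using r1 by (simp add: abs_mult powr_mult)
  qed
  also have "... <= (LINT x|mu. primitive (f x) (comb n xi x))"
  proof (rule integral_mono_AE)
   obtain Bx where Bx: "Bx > 0" "!!x. \<bar>comb n xi x\<bar> <= Bx" using test_functions_bounded[OF comb_test] by metis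
   have "integrable mu (%x. \<bar>comb n xi x\<bar> powr sig)"
    by (rule mu.integrable_const_bound[of _ "Bx powr sig"])
     (use comb_measurable Bx sigma_pos in \<open>auto intro!: powr_mono2\<close>)
   then show "integrable mu (%x. c1 * \<bar>comb n xi x\<bar> powr sig - c2)" by simp
   show "integrable mu (%x. primitive (f x) (comb n xi x))"
    using Bx comb_measurable by (intro primitive_integrable[OF bounded_powr_integrable[of Bx]]) auto
  qed (use c12(3) in auto)
  finally have 2: "c1 * (r powr sig * de) - c2 * measure mu Om <= (LINT x|mu. primitive (f x) (comb n xi x))" .
  have rq: "r powr (q * th) >= 1" using r1 exps theta by (intro ge_one_powr_ge_zero) auto
  have "(B + 1) / (c1 * de) <= r powr (sig - q * th)"
  proof -
   have "(B + 1) / (c1 * de) = (((B + 1) / (c1 * de)) powr (1 / (sig - q * th))) powr (sig - q * th)"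
    using sigma B c12(1) de(1) by (simp add: powr_powr)
   also have "... <= r powr (sig - q * th)" using r(1) sigma unfolding R_def by (intro powr_mono2) auto
   finally show ?thesis .
  qed
  then have "(B + 1) * r powr (q * th) <= (c1 * de * r powr (sig - q * th)) * r powr (q * th)"
   using c12(1) de(1) by (intro mult_right_mono) (auto simp: field_simps)
  also have "... = c1 * (r powr sig * de)" using r1 by (simp add: mult.assoc powr_add[symmetric])
  finally have "(B + 1) * r powr (q * th) <= c1 * (r powr sig * de)" .
  moreover have "primitive K 1 * E' powr th * r powr (q * th) + c2 * measure mu Om <= B * r powr (q * th)"
   unfolding B_def distrib_right using mult_left_mono[OF rq, of "c2 * measure mu Om"] c12(2) by simp
  ultimately show ?thesis using 1 2 rq unfolding J_def by (simp add: distrib_right)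
 qed
 then show ?thesis using R by (intro exI[of _ R]) auto
qed

text \<open>The level determines the size G0 of the gradient integral through coercivity; then the
  scale is taken so fine that vanishing averages force the L^s integral below 1. Neither G0 nor the
  cubes refer to a finite span, so the lower bound is uniform in n.\<close>

lemma linking_sphere:
 obtains G0 l m y where "G0 > (0::real)" "!!phi. phi : test_functions Om ==> Gr p phi = G0 ==>
  (!!j. j < (m::nat) ==> cube_avg l phi (y j) = 0) ==> J phi (grad phi) >= Lam"
proof -
 obtain kap where kap: "kap > 0" "!!phi V. phi : test_functions Om ==> V >= 0 ==> (Lpow s phi) <= ennreal V ==>
  J phi (grad phi) >= kap * (Gr p phi / p - 1) - 2 * C * (measure mu Om + V)" by (rule J_lower) blast
 \<comment> \<open>Solves \<open>kap * (G0 / p - 1) = \<bar>Lam\<bar> + 2 * C * (measure mu Om +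
   1)\<close>; the last 1 is the bound for the L^s integral obtained below.\<close>
 define G0 where "G0 = p * (1 + (\<bar>Lam\<bar> + 2 * C * (measure mu Om + 1)) / kap)"
 have G0: "G0 > 0" unfolding G0_def using kap(1) exps C_nonneg by (intro mult_pos_pos add_pos_nonneg divide_nonneg_pos) auto
 have ps: "p < s" using exps by simp
 obtain ep V where eps: "ep ----> (0::real)" "!!k. ep k >= 0" "V >= (0::real)" "!!phi k de. phi : test_functions Om ==> de >= 0 ==>
  (!!x. x : Om ==> \<bar>cube_avg (dyad k) phi x\<bar> <= de) ==>
  Lpow s phi <= ennreal (ep k * Gr p phi powr (s / p) + V * de powr s)"
  by (rule subcritical_on[OF exps(1) ps exps(4) Om]) blast
 have "(%k. ep k * G0 powr (s / p)) ----> 0" using eps(1) by (rule tendsto_mult_left_zero)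
 then have "\<forall>\<^sub>F k in sequentially. ep k * G0 powr (s / p) < 1" by (intro order_tendstoD(2)) auto
 then obtain k where k: "ep k * G0 powr (s / p) < 1" by (meson eventually_happens sequentially_bot)
 have "dyad k > 0" by simp
 with Om(2) obtain X where X: "finite X" "X \<subseteq> Om" "!!x. x : Om ==> EX y:X. cube (dyad k) x = cube (dyad k) y"
  by (rule cube_representatives) blast
 obtain ys where ys: "set ys = X" using finite_list[OF X(1)] by blast
 show ?thesis
 proof (rule that[OF G0, of "length ys" "dyad k" "%j. ys ! j"])
  fix phi assume phi: "phi : test_functions Om" "Gr p phi = G0" and z: "!!j. j < length ys ==> cube_avg (dyad k) phi (ys ! j) = 0"
  have "\<bar>cube_avg (dyad k) phi x\<bar> <= 0" if x: "x : Om" for x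
  proof -
   obtain y where y: "y : X" "cube (dyad k) x = cube (dyad k) y" using X(3)[OF x] by blast
   obtain j where "j < length ys" "ys ! j = y" using y(1) ys by (metis in_set_conv_nth)
   then show ?thesis using z[of j] cube_avg_cong[OF y(2), of phi] by simp
  qed
  then have "Lpow s phi <= ennreal (ep k * G0 powr (s / p))"
   using eps(4)[OF phi(1), of 0 k] phi(2) exps by simp
  also have "... <= ennreal 1" using k by (intro ennreal_leI) simp
  finally have "J phi (grad phi) >= kap * (G0 / p - 1) - 2 * C * (measure mu Om + 1)"
   using kap(2)[OF phi(1), of 1] phi(2) by simp
  moreover have "kap * (G0 / p - 1) = \<bar>Lam\<bar> + 2 * C * (measure mu Om + 1)" using kap(1) exps by (simp add: G0_def)
  ultimately show "J phi (grad phi) >= Lam" by linarith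
 qed
qed

text \<open>The minimax class consists of the images of the fixed space \<open>fin_sp d\<close>
  under odd maps into the larger span that are the identity far out. The dimension d and the upper
  bound beta stem from \<open>fin_sp d\<close> alone and therefore serve all n.\<close>

lemma critical_points:
 assumes Lam: "Lam > 0"
 obtains d beta where "!!n. n >= d ==> EX xi:fin_sp n. (ALL i<n. Dn n i xi = 0) & Lam <= Jn n xi & Jn n xi <= beta"
proof -
 obtain G0 l m y where link: "G0 > (0::real)" "!!phi. phi : test_functions Om ==> Gr p phi = G0 ==>
  (!!j. j < (m::nat) ==> cube_avg l phi (y j) = 0) ==> J phi (grad phi) >= Lam"
  by (rule linking_sphere) blast
 \<comment> \<open>One dimension more than there are averages, which leaves room to prescribe the
   value of \<open>Gr p\<close> as well.\<close>
 define d where "d = Suc m"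
 obtain R1 where R1: "R1 > 0" "!!xi i. xi : fin_sp d ==> i < d ==> \<bar>xi i\<bar> >= R1 ==> Jn d xi < 0" using Jn_negative[of d] by blast
 obtain R2 where R2: "R2 > 0" "!!xi i. xi : fin_sp d ==> i < d ==> \<bar>xi i\<bar> >= R2 ==> Gr p (comb d xi) > G0" using Gr_large[of d G0] by blast
 \<comment> \<open>Beyond R the energy is negative, so that deformations leave these points alone,
   and \<open>Gr p\<close> exceeds G0, as the Borsuk argument demands.\<close>
 define R where "R = max R1 R2"
 have R: "R > 0" "R >= R1" "R >= R2" using R1(1) by (auto simp: R_def)
 have "compact {x : fin_sp d. ALL i. \<bar>x i\<bar> <= R}" by (rule compact_fin_sp_box)
 then have "bounded (Jn d ` {x : fin_sp d. ALL i. \<bar>x i\<bar> <= R})"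
  by (intro compact_imp_bounded compact_continuous_image continuous_on_Jn)
 then obtain beta where beta: "beta > 0" "!!x. x : fin_sp d ==> (!!i. \<bar>x i\<bar> <= R) ==> \<bar>Jn d x\<bar> <= beta"
  unfolding bounded_pos by auto
 have p: "p > 0" using exps by simp
 have "EX xi:fin_sp n. (ALL i<n. Dn n i xi = 0) & Lam <= Jn n xi & Jn n xi <= beta" if n: "n >= d" for n
 proof -
  have sub: "fin_sp d \<subseteq> fin_sp n" using n by (auto simp: fin_sp_def)
  have Jd: "Jn n xi = Jn d xi" "comb n xi = comb d xi" if "xi : fin_sp d" for xi using comb_mono[OF that n] by simp_all
  define odd_map where "odd_map gam \<longleftrightarrow> continuous_on (fin_sp d) gam & gam ` fin_sp d \<subseteq> fin_sp n &
   (ALL x:fin_sp d. gam (%i. - x i) = (%i. - gam x i)) & (ALL x:fin_sp d. (EX i<d. \<bar>x i\<bar> >= R) --> gam x = x)"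
   for gam :: "(nat => real) => nat => real"
  obtain R0 where R0: "R0 > 0" "!!xi i. xi : fin_sp n ==> i < n ==> \<bar>xi i\<bar> >= R0 ==> Jn n xi < 0" using Jn_negative[of n] by blast
  show ?thesis
  proof (rule minimax_critical_point[where R = R0 and \<A> = "{gam ` fin_sp d |gam. odd_map gam}" and ?A0.0 = "fin_sp d"])
   show "continuous_on (fin_sp n) (Jn n)" "!!i. continuous_on (fin_sp n) (Dn n i)"
    by (rule continuous_on_Jn continuous_on_Dn)+
   show "((%t. Jn n (%i. x i + t * h i)) has_real_derivative (\<Sum>i<n. h i * Dn n i (%i. x i + t * h i))) (at t)" for x h t
    by (rule DERIV_Jn)
   show "Jn n (%i. - x i) = Jn n x" for x by (rule Jn_uminus)
   show "Dn n i (%i. - x i) = - Dn n i x" for x i by (rule Dn_uminus)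
   show "\<bar>x i\<bar> <= R0" if x: "x : fin_sp n" "Jn n x >= 0" for x i
   proof (cases "i < n")
    case True
    then show ?thesis using R0(2)[OF x(1) True] x(2) by linarith
   next
    case False
    then show ?thesis using x R0(1) by (simp add: fin_sp_def)
   qed
   show "A \<subseteq> fin_sp n" if "A : {gam ` fin_sp d |gam. odd_map gam}" for A using that by (auto simp: odd_map_def)
   show "eta ` A : {gam ` fin_sp d |gam. odd_map gam}"
    if A: "A : {gam ` fin_sp d |gam. odd_map gam}" and eta: "continuous_on (fin_sp n) eta" "eta ` fin_sp n \<subseteq> fin_sp n"
     "!!x. x : fin_sp n ==> eta (%i. - x i) = (%i. - eta x i)" "!!x. x : fin_sp n ==> Jn n x <= 0 ==> eta x = x" for A eta
   proof -
    obtain gam where gam: "A = gam ` fin_sp d" "odd_map gam" using A by blast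
    have "odd_map (eta \<circ> gam)" unfolding odd_map_def
    proof (intro conjI ballI impI)
     show "continuous_on (fin_sp d) (eta \<circ> gam)"
      using gam(2) eta(1) unfolding odd_map_def by (intro continuous_on_compose continuous_on_subset[OF eta(1)]) auto
     show "(eta \<circ> gam) ` fin_sp d \<subseteq> fin_sp n" using gam(2) eta(2) unfolding odd_map_def by fastforce
     fix x assume x: "x : fin_sp d"
     then have "gam x : fin_sp n" using gam(2) unfolding odd_map_def by blast
     then show "(eta \<circ> gam) (%i. - x i) = (%i. - (eta \<circ> gam) x i)"
      using eta(3)[of "gam x"] gam(2) x unfolding odd_map_def by simp
     assume ex: "EX i<d. \<bar>x i\<bar> >= R"
     then have "gam x = x" using gam(2) x unfolding odd_map_def by blast
     moreover have "Jn n x < 0" using ex R1(2)[OF x] R(2) Jd(1)[OF x] by fastforce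
     ultimately show "(eta \<circ> gam) x = x" using eta(4)[of x] x sub by auto
    qed
    then show ?thesis unfolding gam(1) image_comp by blast
   qed
   show "EX x:A. Jn n x >= Lam" if inA: "A : {gam ` fin_sp d |gam. odd_map gam}" for A
   proof -
    obtain gam where A: "A = gam ` fin_sp d" and om: "odd_map gam" using inA by blast
    have gam: "continuous_on (fin_sp d) gam" "gam ` fin_sp d \<subseteq> fin_sp n" "!!x. x : fin_sp d ==> gam (%i. - x i) = (%i. - gam x i)"
     "!!x i. x : fin_sp d ==> i < d ==> \<bar>x i\<bar> >= R ==> gam x = x" using om unfolding odd_map_def by blast+
    have d0: "d > 0" by (simp add: d_def)
    obtain x where x: "x : fin_sp d" "Gr p (comb n (gam x)) - G0 = 0"
     "!!j. j : {1..<d} ==> cube_avg l (comb n (gam x)) (y (j - 1)) = 0"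
    \<comment> \<open>The even function is \<open>Gr p\<close> minus G0 along the map, negative at
      the origin and positive far out; the odd functions are the averages. The shift j - 1 reflects
      their numbering from 1.\<close>
    proof (rule borsuk_common_zero[OF d0 R(1), where s = "%x. Gr p (comb n (gam x)) - G0"
       and g = "%j x. cube_avg l (comb n (gam x)) (y (j - 1))"])
     have cg: "continuous_on (fin_sp d) (%x. gam x i)" for i
      by (rule continuous_on_compose2[OF continuous_on_product_coordinates gam(1)]) auto
     show "continuous_on (fin_sp d) (%x. cube_avg l (comb n (gam x)) (y (j - 1)))" for j
      unfolding cube_avg_comb by (intro continuous_intros cg)
     have "continuous_on UNIV (%xi. Gr p (comb n xi))"
      using continuous_on_comb_integral(2)[OF p, of UNIV n] Gr_integral[OF comb_test p] by simp
     then show "continuous_on (fin_sp d) (%x. Gr p (comb n (gam x)) - G0)"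
      by (intro continuous_intros continuous_on_compose2[OF _ gam(1)]) auto
     show "cube_avg l (comb n (gam (%i. - x i))) (y (j - 1)) = - cube_avg l (comb n (gam x)) (y (j - 1))" if "x : fin_sp d" for x j
      unfolding cube_avg_comb gam(3)[OF that] by (simp add: sum_negf)
     have Grneg: "Gr p (comb n (%i. - xi i)) = Gr p (comb n xi)" for xi by (simp add: Gr_def comb_uminus(2))
     show "Gr p (comb n (gam (%i. - x i))) - G0 = Gr p (comb n (gam x)) - G0" if "x : fin_sp d" for x
      unfolding gam(3)[OF that] Grneg ..
     have "gam (%_. 0) = (%_. 0)"
     proof -
      have "gam (%_. 0) = (%i. - gam (%_. 0) i)" using gam(3)[of "%_. 0"] by (simp add: fin_sp_def)
      then have "gam (%_. 0) i = - gam (%_. 0) i" for i by metis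
      then have "gam (%_. 0) i = 0" for i by (metis equal_neg_zero)
      then show ?thesis by auto
     qed
     then show "Gr p (comb n (gam (%_. 0))) - G0 < 0" using link(1) by (simp add: Gr_def grad_comb)
     show "Gr p (comb n (gam x)) - G0 > 0" if x: "x : fin_sp d" "i < d" "\<bar>x i\<bar> >= R" for x i
      using R2(2)[OF x(1,2)] x(3) R(3) gam(4)[OF x] Jd(2)[OF x(1)] by simp
    qed blast
    have "Jn n (gam x) >= Lam"
    proof (rule link(2)[OF comb_test])
     show "Gr p (comb n (gam x)) = G0" using x(2) by simp
     show "cube_avg l (comb n (gam x)) (y j) = 0" if "j < m" for j using x(3)[of "Suc j"] that by (simp add: d_def)
    qed
    then show ?thesis using A x(1) by blast
   qed
   have "odd_map (%x. x)" using sub by (auto simp: odd_map_def)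
   then show "fin_sp d : {gam ` fin_sp d |gam. odd_map gam}" by (intro CollectI exI[of _ "%x. x"]) auto
   show "Jn n x <= beta" if x: "x : fin_sp d" for x
   proof (cases "EX i<d. \<bar>x i\<bar> >= R")
    case True
    then have "Jn d x < 0" using R1(2)[OF x] R(2) by fastforce
    then show ?thesis using Jd(1)[OF x] beta(1) by simp
   next
    case False
    then have "\<bar>x i\<bar> <= R" for i using x R(1) by (cases "i < d") (auto simp: fin_sp_def not_le less_imp_le)
    then show ?thesis using beta(2)[OF x] Jd(1)[OF x] by force
   qed
  qed (use Lam in auto)
 qed
 then show ?thesis by (rule that)
qed

end

section \<open>Luxemburg norm, modular and the Sobolev space\<close>

lemma integrable_lebesgue_on_subset:
 fixes g :: "'a::euclidean_space => 'b::{banach, second_countable_topology}"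
 assumes "integrable (lebesgue_on S) g" "S : sets lebesgue" "T : sets lebesgue" "T \<subseteq> S"
 shows "integrable (lebesgue_on T) g"
proof -
 have "integrable lebesgue (%x. indicator T x *\<^sub>R (indicator S x *\<^sub>R g x))"
  using assms(1-3) by - (rule integrable_mult_indicator; simp add: integrable_restrict_space)
 also have "(%x. indicator T x *\<^sub>R (indicator S x *\<^sub>R g x)) = (%x. indicator T x *\<^sub>R g x)"
  using assms(4) by (auto simp: indicator_def fun_eq_iff)
 finally show ?thesis using assms(3) integrable_restrict_space[of T lebesgue g] by simp
qed

lemma borel_measurable_lebesgue_on_AE:
 fixes g h :: "'a::euclidean_space => 'b::euclidean_space"
 assumes Om: "Om : sets lebesgue" and g: "g : borel_measurable (lebesgue_on Om)" and eq: "AE x in lebesgue_on Om. g x = h x"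
 shows "h : borel_measurable (lebesgue_on Om)"
proof -
 have Om': "Om \<inter> space lebesgue : sets lebesgue" using Om by simp
 have "AE x in lebesgue. x : Om --> g x = h x" using eq Om by (subst (asm) AE_restrict_space_iff) auto
 then have "AE x in lebesgue. indicator Om x *\<^sub>R g x = (indicator Om x *\<^sub>R h x :: 'b)"
  by eventually_elim (auto simp: indicator_def)
 with g show ?thesis unfolding borel_measurable_restrict_space_iff[OF Om'] by (rule borel_measurable_AE)
qed

context weighted_modular
begin

text \<open>For 0 <= c <= 1 and exponents at least one, both powers of c are at most c.\<close>

lemma modM_shrink:
 fixes v :: "'a => 'b::euclidean_space"
 assumes c: "0 <= c" "c <= 1" and [measurable]: "v : borel_measurable M"
 shows "modM M a p q (%x. c *\<^sub>R v x) <= ennreal c * modM M a p q v"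
proof -
 have "modM M a p q (%x. c *\<^sub>R v x) <= (\<integral>\<^sup>+x. ennreal c * ennreal (Hden a p q x (v x)) \<partial>M)"
  unfolding modM_def
 proof (rule nn_integral_mono)
  fix x assume x: "x : space M"
  have le: "c powr m <= c" if "m >= 1" for m using powr_mono'[OF that c] c by simp
  have "Hden a p q x (c *\<^sub>R v x) <= c * norm (v x) powr p + a x * (c * norm (v x) powr q)"
   using c pq a_nonneg[OF x] le by (auto simp: powr_mult intro!: add_mono mult_left_mono mult_right_mono)
  also have "... = c * (Hden a p q x (v x))" by (simp add: algebra_simps)
  finally have "ennreal (Hden a p q x (c *\<^sub>R v x)) <= ennreal (c * (Hden a p q x (v x)))"
   by (rule ennreal_leI)
  then show "ennreal (Hden a p q x (c *\<^sub>R v x)) <= ennreal c * ennreal (Hden a p q x (v x))"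
   using a_nonneg[OF x] c by (simp add: ennreal_mult)
 qed
 also have "... = ennreal c * modM M a p q v" unfolding modM_def by (rule nn_integral_cmult) measurable
 finally show ?thesis .
qed

lemma modM_eq_0:
 fixes v :: "'a => 'b::euclidean_space"
 assumes [measurable]: "v : borel_measurable M" and z: "modM M a p q v = 0"
 shows "AE x in M. v x = 0"
proof -
 have "AE x in M. ennreal (Hden a p q x (v x)) = 0"
  using z unfolding modM_def by (subst (asm) nn_integral_0_iff_AE) auto
 then show ?thesis using AE_space
 proof eventually_elim
  case (elim x)
  then have "Hden a p q x (v x) <= 0" by (simp add: ennreal_eq_0_iff)
  moreover have "a x * norm (v x) powr q >= 0" using a_nonneg[OF elim(2)] by simp
  moreover have "norm (v x) powr p >= 0" by simp
  ultimately have "norm (v x) powr p = 0" by linarith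
  then show ?case by simp
 qed
qed

lemma modM_tendsto_zero_unique:
 fixes g :: "nat => 'a => 'b::euclidean_space"
 assumes [measurable]: "!!n. g n : borel_measurable M" "u : borel_measurable M" "v : borel_measurable M"
  and "(%n. modM M a p q (%x. g n x - u x)) ----> 0" "(%n. modM M a p q (%x. g n x - v x)) ----> 0"
 shows "AE x in M. u x = v x"
proof -
 have "modM M a p q (%x. u x - v x) <= ennreal (2 powr q) * (modM M a p q (%x. g n x - u x) + modM M a p q (%x. g n x - v x))" for n
 proof (rule modM_triangle)
  have "norm (u x - v x) <= norm (g n x - u x) + norm (g n x - v x)" for x
   using norm_triangle_ineq4[of "g n x - v x" "g n x - u x"] by simp
  then show "AE x in M. norm (u x - v x) <= norm (g n x - u x) + norm (g n x - v x)" by simp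
 qed measurable
 moreover have "(%n. ennreal (2 powr q) * (modM M a p q (%x. g n x - u x) + modM M a p q (%x. g n x - v x))) ----> ennreal (2 powr q) * (0 + 0)"
  using assms(4,5) by (intro ennreal_tendsto_cmult tendsto_add) auto
 ultimately have "modM M a p q (%x. u x - v x) <= ennreal (2 powr q) * (0 + 0)"
  by (intro LIMSEQ_le_const) auto
 then have "modM M a p q (%x. u x - v x) = 0" by simp
 then have "AE x in M. u x - v x = 0" by (intro modM_eq_0) auto
 then show ?thesis by simp
qed

lemma modM_Cauchy_of_tendsto:
 fixes g :: "nat => 'a => 'b::euclidean_space"
 assumes [measurable]: "!!n. g n : borel_measurable M" "h : borel_measurable M"
  and lim: "(%n. modM M a p q (%x. g n x - h x)) ----> 0" and e: "e > 0"
 shows "EX n0. ALL i>=n0. ALL j>=n0. modM M a p q (%x. g i x - g j x) <= ennreal e"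
proof -
 have "ennreal (e / (2 * 2 powr q)) > 0" using e by simp
 then have "\<forall>\<^sub>F n in sequentially. modM M a p q (%x. g n x - h x) < ennreal (e / (2 * 2 powr q))"
  using lim by (intro order_tendstoD(2)) auto
 then obtain n0 where n0: "!!n. n >= n0 ==> modM M a p q (%x. g n x - h x) < ennreal (e / (2 * 2 powr q))"
  unfolding eventually_sequentially by blast
 have "modM M a p q (%x. g i x - g j x) <= ennreal e" if ij: "i >= n0" "j >= n0" for i j
 proof -
  have "modM M a p q (%x. g i x - g j x) <= ennreal (2 powr q) * (modM M a p q (%x. g i x - h x) + modM M a p q (%x. g j x - h x))"
  proof (rule modM_triangle)
   have "norm (g i x - g j x) <= norm (g i x - h x) + norm (g j x - h x)" for x
    using norm_triangle_ineq4[of "g i x - h x" "g j x - h x"] by simp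
   then show "AE x in M. norm (g i x - g j x) <= norm (g i x - h x) + norm (g j x - h x)" by simp
  qed measurable
  also have "... <= ennreal (2 powr q) * (ennreal (e / (2 * 2 powr q)) + ennreal (e / (2 * 2 powr q)))"
   using n0[OF ij(1)] n0[OF ij(2)] by (intro mult_left_mono add_mono) auto
  also have "ennreal (e / (2 * 2 powr q)) + ennreal (e / (2 * 2 powr q)) = ennreal (e / (2 * 2 powr q) + e / (2 * 2 powr q))"
   using e by (intro ennreal_plus[symmetric]) auto
  also have "ennreal (2 powr q) * ennreal (e / (2 * 2 powr q) + e / (2 * 2 powr q)) = ennreal (2 powr q * (e / (2 * 2 powr q) + e / (2 * 2 powr q)))"
   using e by (intro ennreal_mult[symmetric]) auto
  also have "2 powr q * (e / (2 * 2 powr q) + e / (2 * 2 powr q)) = e" by (simp add: field_simps)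
  finally show ?thesis .
 qed
 then show ?thesis by blast
qed

text \<open>The subsequence lemma produces some limit; uniqueness of modular limits identifies it
  with h almost everywhere.\<close>

lemma modM_AE_subsequence:
 fixes g :: "nat => 'a => 'b::euclidean_space"
 assumes g[measurable]: "!!n. g n : borel_measurable M" "h : borel_measurable M" and fin: "!!n. modM M a p q (g n) < \<infinity>"
  and lim: "(%n. modM M a p q (%x. g n x - h x)) ----> 0"
 obtains r W where "strict_mono (r :: nat => nat)" "W : borel_measurable M"
  "!!x. W x >= (0::real)" "modM M a p q W < \<infinity>" "AE x in M. (%n. g (r n) x) ----> h x"
  "AE x in M. ALL n. norm (g (r n) x) <= W x"
proof -
 obtain r u W where r: "strict_mono (r :: nat => nat)" "u : borel_measurable M" "W : borel_measurable M"
  "!!x. W x >= (0::real)" "modM M a p q W < \<infinity>" "AE x in M. (%n. g (r n) x) ----> u x"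
  "AE x in M. ALL n. norm (g (r n) x) <= W x"
  using modM_subsequence[OF g(1) fin modM_Cauchy_of_tendsto[OF g lim]] by blast
 have "(%n. modM M a p q (%x. g (r n) x - u x)) ----> 0"
  using r by (intro modM_tendsto_zero[where W = W]) auto
 moreover have "(%n. modM M a p q (%x. g (r n) x - h x)) ----> 0"
  using LIMSEQ_subseq_LIMSEQ[OF lim r(1)] by (simp add: o_def)
 ultimately have "AE x in M. u x = h x"
  by (intro modM_tendsto_zero_unique[where g = "%n. g (r n)"]) (use r in auto)
 then have "AE x in M. (%n. g (r n) x) ----> h x" using r(6) by eventually_elim simp
 then show ?thesis using r that by blast
qed

end

context kirchhoff
begin

lemma Om_sets: "Om : sets lebesgue"
 using Om(1) by simp

lemma modM_bounded:
 assumes "!!x. norm (v x) <= B"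
 shows "modM mu a p q v < \<infinity>"
proof -
 have "modM mu a p q v <= modM mu a p q (%_. B)"
  using assms exps a_bounds order_trans[OF assms] by (intro modM_mono) auto
 then show ?thesis using modM_const[of B] by (rule le_less_trans)
qed

lemma modM_test:
 assumes "phi : test_functions Om"
 shows "modM mu a p q phi < \<infinity>" "modM mu a p q (grad phi) < \<infinity>"
proof -
 obtain B where "!!x. \<bar>phi x\<bar> <= B" "!!x. norm (grad phi x) <= B" using test_functions_bounded[OF assms] by metis
 then show "modM mu a p q phi < \<infinity>" "modM mu a p q (grad phi) < \<infinity>"
  using modM_bounded[of phi B] modM_bounded[of "grad phi" B] by simp_all
qed

lemma modM_imp_integrable:
 fixes v :: "'a => 'b::euclidean_space"
 assumes [measurable]: "v : borel_measurable mu" and fin: "modM mu a p q v < \<infinity>"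
 shows "integrable mu v"
proof (rule Bochner_Integration.integrable_bound)
 show "integrable mu (%x. 1 + (Hden a p q x (v x)))"
  using modM_integrable[OF assms] by simp
 show "AE x in mu. norm (v x) <= norm (1 + (Hden a p q x (v x)))"
 proof (rule AE_I2)
  fix x assume "x : space mu"
  then have "a x * norm (v x) powr q >= 0" using a_bounds[of x] by simp
  moreover have "norm (v x) <= 1 + norm (v x) powr p"
  proof (cases "norm (v x) <= 1")
   case True then show ?thesis using powr_ge_zero[of "norm (v x)" p] by linarith
  next
   case False
   then have "norm (v x) powr 1 <= norm (v x) powr p" using exps by (intro powr_mono) auto
   then show ?thesis by simp
  qed
  ultimately show "norm (v x) <= norm (1 + (Hden a p q x (v x)))" by simp
 qed
qed simp

text \<open>Both sides of the integral identity pass to the limit by dominated convergence, with the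
  given majorants times a bound for the test function and its gradient.\<close>

lemma weak_gradient_limit:
 assumes phi: "!!n. phi n : test_functions Om" and m[measurable]: "u : borel_measurable mu" "g : borel_measurable mu"
  and lim: "AE x in mu. (%n. phi n x) ----> u x" "AE x in mu. (%n. grad (phi n) x) ----> g x"
  and V: "integrable mu V" "AE x in mu. ALL n. \<bar>phi n x\<bar> <= V x" and W: "integrable mu W" "AE x in mu. ALL n. norm (grad (phi n) x) <= W x"
 shows "weak_gradient_on Om u g"
 unfolding weak_gradient_on_def
proof (intro conjI allI impI ballI)
 have ug: "integrable mu u" "integrable mu g"
  using lim V W by (auto intro: integrable_dominated_convergence[where s = "%n. phi n" and w = V]
    integrable_dominated_convergence[where s = "%n. grad (phi n)" and w = W] test_measurable[OF phi])
 fix L assume L: "compact L & L \<subseteq> Om"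
 then have "L : sets lebesgue" by (simp add: compact_imp_closed)
 with L show "integrable (lebesgue_on L) u" "integrable (lebesgue_on L) g"
  using integrable_lebesgue_on_subset ug Om_sets by blast+
next
 fix psi and b :: 'a assume psi: "psi : test_functions Om" and b: "b : Basis"
 obtain B where B: "B > 0" "!!x. \<bar>psi x\<bar> <= B" "!!x. norm (grad psi x) <= B" using test_functions_bounded[OF psi] by metis
 have fd: "frechet_derivative psi (at x) b = grad psi x \<bullet> b" for x
  using test_functionsD(4)[OF psi, of x] by (simp add: frechet_derivative_at[symmetric])
 have Bb: "\<bar>grad psi x \<bullet> b\<bar> <= B" for x using Basis_le_norm[OF b, of "grad psi x"] B(3)[of x] by linarith
 note [measurable] = test_measurable[OF phi] test_measurable[OF psi]
 have 1: "(%n. LINT x|mu. phi n x * (grad psi x \<bullet> b)) ----> (LINT x|mu. u x * (grad psi x \<bullet> b))"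
 proof (rule integral_dominated_convergence[where w = "%x. V x * B"])
  show "AE x in mu. (%n. phi n x * (grad psi x \<bullet> b)) ----> u x * (grad psi x \<bullet> b)"
   using lim(1) by eventually_elim (intro tendsto_intros)
  show "AE x in mu. norm (phi n x * (grad psi x \<bullet> b)) <= V x * B" for n
   using V(2)
  proof eventually_elim
   case (elim x)
   then have "\<bar>phi n x\<bar> * \<bar>grad psi x \<bullet> b\<bar> <= V x * B" using Bb[of x] B(1) by (intro mult_mono) (auto intro: order_trans[OF abs_ge_zero])
   then show ?case by (simp add: abs_mult)
  qed
 qed (use V in auto)
 have 2: "(%n. LINT x|mu. (grad (phi n) x \<bullet> b) * psi x) ----> (LINT x|mu. (g x \<bullet> b) * psi x)"
 proof (rule integral_dominated_convergence[where w = "%x. W x * B"])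
  show "AE x in mu. (%n. (grad (phi n) x \<bullet> b) * psi x) ----> (g x \<bullet> b) * psi x"
   using lim(2) by eventually_elim (intro tendsto_intros)
  show "AE x in mu. norm ((grad (phi n) x \<bullet> b) * psi x) <= W x * B" for n
   using W(2)
  proof eventually_elim
   case (elim x)
   have "\<bar>grad (phi n) x \<bullet> b\<bar> <= W x" using Basis_le_norm[OF b, of "grad (phi n) x"] elim by (meson order_trans)
   then have "\<bar>grad (phi n) x \<bullet> b\<bar> * \<bar>psi x\<bar> <= W x * B" using B by (intro mult_mono) (auto intro: order_trans[OF abs_ge_zero])
   then show ?case by (simp add: abs_mult)
  qed
 qed (use W in auto)
 have eq: "(LINT x|mu. phi n x * (grad psi x \<bullet> b)) = - (LINT x|mu. (grad (phi n) x \<bullet> b) * psi x)" for n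
  using weak_gradient_test_function[OF Om(1) phi[of n]] psi b unfolding weak_gradient_on_def fd[symmetric] by blast
 have "(LINT x|mu. u x * (grad psi x \<bullet> b)) = - (LINT x|mu. (g x \<bullet> b) * psi x)"
  using LIMSEQ_unique[OF 1[unfolded eq] tendsto_minus[OF 2]] .
 then show "(LINT x|mu. u x * frechet_derivative psi (at x) b) = - (LINT x|mu. (g x \<bullet> b) * psi x)"
  by (simp add: fd)
qed

lemma modular_H_modM:
 "modular_H Om p q a u = modM mu a p q u"
 "modular_H Om p q a (%x. norm (g x)) = modM mu a p q g"
 by (simp_all add: modular_H_def modM_def)

text \<open>With \<open>norm_H_modM\<close> this translates between norm and modular near zero:
  rescaling by 1 / ep costs at most (1 / ep) powr q, whereas shrinking by a factor s <= 1 gains at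
  least s.\<close>

lemma norm_H_le:
 assumes [measurable]: "v : borel_measurable mu" and ep: "0 < ep" "ep <= 1" and le: "modM mu a p q v <= ennreal (ep powr q)"
 shows "norm_H Om p q a v <= ep"
 unfolding norm_H_def
proof (rule cInf_lower)
 have "modM mu a p q (%x. (1 / ep) *\<^sub>R v x) <= ennreal ((1 / ep) powr q) * modM mu a p q v"
  using ep by (intro modM_scale) auto
 also have "... <= ennreal ((1 / ep) powr q) * ennreal (ep powr q)" using le by (intro mult_left_mono) auto
 also have "... = ennreal ((1 / ep) powr q * ep powr q)" by (simp add: ennreal_mult)
 also have "(1 / ep) powr q * ep powr q = 1" using ep by (simp add: powr_divide)
 finally show "ep : {s. 0 < s & modular_H Om p q a (%x. v x / s) <= 1}"
  using ep by (simp add: modular_H_modM)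
 show "bdd_below {s. 0 < s & modular_H Om p q a (%x. v x / s) <= 1}" by (rule bdd_belowI[of _ 0]) auto
qed

text \<open>The infimum of the empty set carries no information, so admissible scalings must exist
  before the norm can be used.\<close>

lemma norm_H_set_nonempty:
 fixes v :: "'a => real"
 assumes [measurable]: "v : borel_measurable mu" and fin: "modM mu a p q v < \<infinity>"
 shows "EX s>0. modular_H Om p q a (%x. v x / s) <= 1"
proof -
 obtain m where m: "modM mu a p q v = ennreal m" "m >= 0" using fin by (cases "modM mu a p q v") auto
 have "modM mu a p q (%x. (1 / (1 + m)) *\<^sub>R v x) <= ennreal (1 / (1 + m)) * modM mu a p q v"
  using m by (intro modM_shrink) auto
 also have "... = ennreal (1 / (1 + m) * m)" unfolding m(1) using m(2) by (intro ennreal_mult[symmetric]) auto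
 also have "... <= ennreal 1" using m by (intro ennreal_leI) (simp add: field_simps)
 finally show ?thesis using m by (intro exI[of _ "1 + m"]) (simp add: modular_H_modM)
qed

lemma norm_H_modM:
 assumes [measurable]: "v : borel_measurable mu" and fin: "modM mu a p q v < \<infinity>"
  and ep: "ep <= 1" and le: "norm_H Om p q a v < ep"
 shows "modM mu a p q v <= ennreal ep"
proof -
 let ?S = "{s. 0 < s & modular_H Om p q a (%x. v x / s) <= 1}"
 have "?S ~= {}" using norm_H_set_nonempty[OF assms(1) fin] by blast
 then obtain s where s: "s < ep" "0 < s" "modM mu a p q (%x. v x / s) <= 1"
  using cInf_lessD[of ?S ep] le unfolding norm_H_def by (auto simp: modular_H_modM)
 have "modM mu a p q v = modM mu a p q (%x. s *\<^sub>R (v x / s))" using s by (intro modM_cong_AE) auto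
 also have "... <= ennreal s * modM mu a p q (%x. v x / s)" using s ep by (intro modM_shrink) auto
 also have "... <= ennreal s * 1" using s by (intro mult_left_mono) auto
 also have "... <= ennreal ep" using s by (simp add: ennreal_leI)
 finally show ?thesis .
qed

lemma norm_H_nonneg:
 assumes [measurable]: "v : borel_measurable mu" and fin: "modM mu a p q v < \<infinity>"
 shows "norm_H Om p q a v >= 0"
proof (rule ccontr)
 let ?S = "{s. 0 < s & modular_H Om p q a (%x. v x / s) <= 1}"
 assume "~ norm_H Om p q a v >= 0"
 then have neg: "norm_H Om p q a v < 0" by simp
 have "?S ~= {}" using norm_H_set_nonempty[OF assms(1) fin] by blast
 then show False using cInf_lessD[of ?S 0] neg unfolding norm_H_def by auto
qed

end

context kirchhoff
begin

lemma Ls_integrable: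
 fixes V :: "'a => real"
 assumes "V : borel_measurable mu" "modM mu (%_. 0) s s V < \<infinity>"
 shows "integrable mu (%x. \<bar>V x\<bar> powr s)"
 using L.modM_integrable[OF assms] by simp

text \<open>Both p and q are at most s, while \<open>Om\<close> has finite measure and the weight is
  bounded.\<close>

lemma modM_of_Ls:
 fixes V :: "'a => real"
 assumes [measurable]: "V : borel_measurable mu" and fin: "modM mu (%_. 0) s s V < \<infinity>"
 shows "modM mu a p q V < \<infinity>"
proof -
 have int: "integrable mu (%x. (1 + A) * (1 + \<bar>V x\<bar> powr s))"
  using Ls_integrable[OF assms] by simp
 have "modM mu a p q V <= (\<integral>\<^sup>+x. ennreal ((1 + A) * (1 + \<bar>V x\<bar> powr s)) \<partial>mu)"
  unfolding modM_def
 proof (intro nn_integral_mono ennreal_leI)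
  fix x assume x: "x : space mu"
  have le: "\<bar>V x\<bar> powr m <= 1 + \<bar>V x\<bar> powr s" if "0 < m" "m <= s" for m
  proof (cases "\<bar>V x\<bar> <= 1")
   case True
   then have "\<bar>V x\<bar> powr m <= 1 powr m" using that by (intro powr_mono2) auto
   moreover have "\<bar>V x\<bar> powr s >= 0" by simp
   ultimately show ?thesis by (simp only: powr_one_eq_one)
  next
   case False
   then have "\<bar>V x\<bar> powr m <= \<bar>V x\<bar> powr s" using that by (intro powr_mono) auto
   then show ?thesis by simp
  qed
  have "Hden a p q x (V x) <= (1 + \<bar>V x\<bar> powr s) + A * (1 + \<bar>V x\<bar> powr s)"
   using exps a_bounds[of x] x A le[of p] le[of q] by (intro add_mono mult_mono) auto
  then show "Hden a p q x (V x) <= (1 + A) * (1 + \<bar>V x\<bar> powr s)" by (simp add: distrib_right)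
 qed
 also have "... = ennreal (LINT x|mu. (1 + A) * (1 + \<bar>V x\<bar> powr s))"
  using int A by (intro nn_integral_eq_integral AE_I2 mult_nonneg_nonneg add_nonneg_nonneg) auto
 also have "... < \<infinity>" by simp
 finally show ?thesis .
qed

text \<open>Quantified over all v of the right absolute value almost everywhere, because
  \<open>wgrad\<close> of a difference is known only up to a null set.\<close>

lemma norm_H_difference_tendsto:
 fixes g :: "nat => 'a => 'b::euclidean_space"
 assumes [measurable]: "!!n. g n : borel_measurable mu" "h : borel_measurable mu"
  and lim: "(%n. modM mu a p q (%x. g n x - h x)) ----> 0" and ep: "ep > 0"
 shows "\<forall>\<^sub>F n in sequentially. ALL v. v : borel_measurable mu --> (AE x in mu. \<bar>v x\<bar> = norm (h x - g n x)) --> norm_H Om p q a v <= ep"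
proof -
 define de where "de = min ep 1"
 have de: "0 < de" "de <= 1" "de <= ep" using ep by (auto simp: de_def)
 have "ennreal (de powr q) > 0" using de by simp
 then have "\<forall>\<^sub>F n in sequentially. modM mu a p q (%x. g n x - h x) < ennreal (de powr q)"
  using lim by (intro order_tendstoD(2)) auto
 then show ?thesis
 proof (eventually_elim, intro allI impI)
  fix n v assume lt: "modM mu a p q (%x. g n x - h x) < ennreal (de powr q)" and v: "v : borel_measurable mu"
   and eq: "AE x in mu. \<bar>v x\<bar> = norm (h x - g n x)"
  have "modM mu a p q v = modM mu a p q (%x. g n x - h x)"
   using eq by (intro modM_cong_AE) (auto simp: norm_minus_commute)
  then have "norm_H Om p q a v <= de" using v de lt by (intro norm_H_le) auto
  then show "norm_H Om p q a v <= ep" using de by simp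
 qed
qed

text \<open>The sequence itself approximates its limit in norm. To see this the weak gradient of u -
  phi n is needed; it is obtained as the limit of the gradients of phi j - phi n.\<close>

lemma W1H0_limit:
 assumes phi: "!!n. phi n : test_functions Om" and m[measurable]: "u : borel_measurable mu" "g : borel_measurable mu"
  and lim: "AE x in mu. (%n. phi n x) ----> u x" "AE x in mu. (%n. grad (phi n) x) ----> g x"
  and V[measurable]: "V : borel_measurable mu" and V0: "!!x. V x >= 0" "modM mu a p q V < \<infinity>" "AE x in mu. ALL n. \<bar>phi n x\<bar> <= V x"
  and W[measurable]: "W : borel_measurable mu" and W0: "!!x. W x >= 0" "modM mu a p q W < \<infinity>" "AE x in mu. ALL n. norm (grad (phi n) x) <= W x"
 shows "u : W1H0 Om p q a" "AE x in mu. wgrad Om u x = g x"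
proof -
 note [measurable] = test_measurable[OF phi]
 have iV: "integrable mu V" and iW: "integrable mu W" using V0 W0 by (auto intro: modM_imp_integrable)
 have wg: "weak_gradient_on Om u g" by (rule weak_gradient_limit[OF phi m lim iV V0(3) iW W0(3)])
 show ae: "AE x in mu. wgrad Om u x = g x" by (rule wgrad_AE_eq(2)[OF Om(1) wg])
 then have [measurable]: "wgrad Om u : borel_measurable mu"
  by (intro borel_measurable_lebesgue_on_AE[OF Om_sets m(2)]) (simp add: eq_commute)
 have uV: "AE x in mu. \<bar>u x\<bar> <= V x" using AE_norm_limit_le[OF lim(1)] V0(3) by simp
 have gW: "AE x in mu. norm (g x) <= W x" by (rule AE_norm_limit_le[OF lim(2) W0(3)])
 have "modM mu a p q u <= modM mu a p q V" using exps a_bounds uV V0(1) by (intro modM_mono) auto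
 then have fu: "modM mu a p q u < \<infinity>" using V0(2) by (rule le_less_trans)
 have "modM mu a p q g <= modM mu a p q W" using exps a_bounds gW W0(1) by (intro modM_mono) auto
 then have "modM mu a p q g < \<infinity>" using W0(2) by (rule le_less_trans)
 moreover have "modM mu a p q (wgrad Om u) = modM mu a p q g" using ae by (intro modM_cong_AE) auto
 ultimately have W1H: "u : W1H Om p q a"
  unfolding W1H_def LH_def modular_H_def using fu wg m(1) by (auto simp: modM_def)
 have "EX psi:test_functions Om. norm_W1H Om p q a (%x. u x - psi x) < ep" if ep: "ep > 0" for ep
 proof -
  have e4: "ep / 4 > 0" using ep by simp
  have 1: "(%n. modM mu a p q (%x. phi n x - u x)) ----> 0"
   using lim(1) V0 by (intro modM_tendsto_zero[where W = V]) auto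
  have 2: "(%n. modM mu a p q (%x. grad (phi n) x - g x)) ----> 0"
   using lim(2) W0 by (intro modM_tendsto_zero[where W = W]) auto
  have ev: "\<forall>\<^sub>F n in sequentially. (ALL v. v : borel_measurable mu --> (AE x in mu. \<bar>v x\<bar> = norm (u x - phi n x)) --> norm_H Om p q a v <= ep / 4) &
    (ALL v. v : borel_measurable mu --> (AE x in mu. \<bar>v x\<bar> = norm (g x - grad (phi n) x)) --> norm_H Om p q a v <= ep / 4)"
   by (intro eventually_conj norm_H_difference_tendsto 1 2 e4) measurable
  obtain n where n: "!!v. v : borel_measurable mu ==> (AE x in mu. \<bar>v x\<bar> = norm (u x - phi n x)) ==> norm_H Om p q a v <= ep / 4"
    "!!v. v : borel_measurable mu ==> (AE x in mu. \<bar>v x\<bar> = norm (g x - grad (phi n) x)) ==> norm_H Om p q a v <= ep / 4"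
   using eventually_happens'[OF sequentially_bot ev] by blast
  obtain B where B: "B > 0" "!!x. \<bar>phi n x\<bar> <= B" "!!x. norm (grad (phi n) x) <= B" using test_functions_bounded[OF phi[of n]] by metis
  have diff: "(%x. phi j x - phi n x) : test_functions Om" "grad (%x. phi j x - phi n x) x = grad (phi j) x - grad (phi n) x" for j x
   using test_functions_lincomb[OF phi[of j] phi[of n], of 1 "-1"] by auto
  have "weak_gradient_on Om (%x. u x - phi n x) (%x. g x - grad (phi n) x)"
  proof (rule weak_gradient_limit[where phi = "%j x. phi j x - phi n x" and V = "%x. V x + B" and W = "%x. W x + B"])
   show "AE x in mu. (%j. phi j x - phi n x) ----> u x - phi n x" using lim(1) by eventually_elim (intro tendsto_intros)
   show "AE x in mu. (%j. grad (%x. phi j x - phi n x) x) ----> g x - grad (phi n) x"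
    using lim(2) unfolding diff(2) by eventually_elim (intro tendsto_intros)
   show "AE x in mu. ALL j. \<bar>phi j x - phi n x\<bar> <= V x + B"
    using V0(3)
   proof (eventually_elim, intro allI)
    fix x j assume "ALL n. \<bar>phi n x\<bar> <= V x"
    then show "\<bar>phi j x - phi n x\<bar> <= V x + B" using abs_triangle_ineq4[of "phi j x" "phi n x"] B(2)[of x] by (meson add_mono order_trans)
   qed
   show "AE x in mu. ALL j. norm (grad (%x. phi j x - phi n x) x) <= W x + B"
    using W0(3) unfolding diff(2)
   proof (eventually_elim, intro allI)
    fix x j assume "ALL n. norm (grad (phi n) x) <= W x"
    then show "norm (grad (phi j) x - grad (phi n) x) <= W x + B"
     using norm_triangle_ineq4[of "grad (phi j) x" "grad (phi n) x"] B(3)[of x] by (meson add_mono order_trans)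
   qed
  qed (use diff(1) iV iW in auto)
  then have ae': "AE x in mu. wgrad Om (%x. u x - phi n x) x = g x - grad (phi n) x" by (rule wgrad_AE_eq(2)[OF Om(1)])
  then have [measurable]: "wgrad Om (%x. u x - phi n x) : borel_measurable mu"
   by (intro borel_measurable_lebesgue_on_AE[OF Om_sets borel_measurable_diff[OF m(2) test_measurable(2)[OF phi[of n]]]]) (simp add: eq_commute)
  have "norm_H Om p q a (%x. u x - phi n x) <= ep / 4" by (rule n(1)) auto
  moreover have "norm_H Om p q a (%x. norm (wgrad Om (%x. u x - phi n x) x)) <= ep / 4"
   using ae' by (intro n(2)) auto
  ultimately show ?thesis using phi[of n] ep by (intro bexI[of _ "phi n"]) (auto simp: norm_W1H_def)
 qed
 then show "u : W1H0 Om p q a" using W1H by (auto simp: W1H0_def)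
qed

lemma weak_gradient_diff_test:
 assumes wg: "weak_gradient_on Om u g" and int: "integrable mu u" "integrable mu g" and psi: "psi : test_functions Om"
 shows "weak_gradient_on Om (%x. u x - psi x) (%x. g x - grad psi x)"
 unfolding weak_gradient_on_def
proof (intro conjI allI impI ballI)
 fix L assume L: "compact L & L \<subseteq> Om"
 have wp: "weak_gradient_on Om psi (grad psi)" by (rule weak_gradient_test_function[OF Om(1) psi])
 show "integrable (lebesgue_on L) (%x. u x - psi x)" "integrable (lebesgue_on L) (%x. g x - grad psi x)"
  using wg wp L unfolding weak_gradient_on_def by (auto intro!: Bochner_Integration.integrable_diff)
next
 fix phi and b :: 'a assume phi: "phi : test_functions Om" and b: "b : Basis"
 obtain B where B: "B > 0" "!!x. \<bar>phi x\<bar> <= B" "!!x. norm (grad phi x) <= B" using test_functions_bounded[OF phi] by metis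
 have fd: "frechet_derivative phi (at x) b = grad phi x \<bullet> b" for x
  using test_functionsD(4)[OF phi, of x] by (simp add: frechet_derivative_at[symmetric])
 have Bb: "\<bar>grad phi x \<bullet> b\<bar> <= B" for x using Basis_le_norm[OF b, of "grad phi x"] B(3)[of x] by linarith
 note [measurable] = test_measurable[OF phi] test_measurable[OF psi]
 have prod: "integrable mu (%x. w x * z x)" if w: "integrable mu w" and z: "z : borel_measurable mu" "!!x. \<bar>z x\<bar> <= B" for w z :: "'a => real"
 proof (rule Bochner_Integration.integrable_bound[OF integrable_mult_left[OF integrable_abs[OF w], of B]])
  show "AE x in mu. norm (w x * z x) <= norm (\<bar>w x\<bar> * B)"
   using z(2) B(1) by (intro AE_I2) (auto simp: abs_mult intro!: mult_left_mono)
 qed (use w z in measurable)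
 have mb: "(%x. grad phi x \<bullet> b) : borel_measurable mu" "phi : borel_measurable mu" by measurable
 have it: "integrable mu psi" "integrable mu (grad psi)"
  using modM_test[OF psi] by (auto intro: modM_imp_integrable)
 have i1: "integrable mu (%x. u x * (grad phi x \<bullet> b))" "integrable mu (%x. psi x * (grad phi x \<bullet> b))"
  using prod int(1) it(1) mb(1) Bb by blast+
 have i2: "integrable mu (%x. (g x \<bullet> b) * phi x)" "integrable mu (%x. (grad psi x \<bullet> b) * phi x)"
  using prod[OF integrable_inner_left[OF int(2)] mb(2) B(2)] prod[OF integrable_inner_left[OF it(2)] mb(2) B(2)] by blast+
 have e1: "(LINT x|mu. u x * (grad phi x \<bullet> b)) = - (LINT x|mu. (g x \<bullet> b) * phi x)"
  using wg phi b unfolding weak_gradient_on_def fd[symmetric] by blast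
 have e2: "(LINT x|mu. psi x * (grad phi x \<bullet> b)) = - (LINT x|mu. (grad psi x \<bullet> b) * phi x)"
  using weak_gradient_test_function[OF Om(1) psi] phi b unfolding weak_gradient_on_def fd[symmetric] by blast
 show "(LINT x|mu. (u x - psi x) * frechet_derivative phi (at x) b) = - (LINT x|mu. ((g x - grad psi x) \<bullet> b) * phi x)"
  unfolding fd left_diff_distrib inner_diff_left using i1 i2 e1 e2 by simp
qed

text \<open>Local integrability yields measurability on compact sets only; an increasing compact
  exhaustion yields it on \<open>Om\<close>.\<close>

lemma weak_gradient_measurable:
 assumes wg: "weak_gradient_on Om u g"
 shows "g : borel_measurable mu"
proof -
 obtain F where F: "!!n::nat. compact (F n)" "!!n. F n \<subseteq> Om" "!!n. F n \<subseteq> interior (F (Suc n))" "(\<Union>n. F n) = Om"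
  using open_Union_compact_subsets[OF Om(1)] by metis
 have Om': "Om \<inter> space lebesgue : sets lebesgue" using Om_sets by simp
 show ?thesis
 proof (rule borel_measurable_LIMSEQ_metric)
  fix n
  have Fs: "F n \<inter> space lebesgue : sets lebesgue" using F(1)[of n] by (simp add: compact_imp_closed)
  have "g : borel_measurable (lebesgue_on (F n))"
   using wg F(1,2)[of n] unfolding weak_gradient_on_def by (auto intro: borel_measurable_integrable)
  then have "(%x. indicator (F n) x *\<^sub>R g x) : borel_measurable lebesgue"
   unfolding borel_measurable_restrict_space_iff[OF Fs] .
  then show "(%x. indicator (F n) x *\<^sub>R g x) : borel_measurable mu" by (rule measurable_restrict_space1)
 next
  fix x assume "x : space mu"
  then obtain n where n: "x : F n" using F(4) by auto
  have "x : F m" if "n <= m" for m using that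
  proof (induction rule: dec_induct)
   case (step m)
   then show ?case using F(3)[of m] interior_subset by blast
  qed (rule n)
  then have "\<forall>\<^sub>F m in sequentially. indicator (F m) x *\<^sub>R g x = g x"
   unfolding eventually_sequentially by (intro exI[of _ n]) auto
  then show "(%m. indicator (F m) x *\<^sub>R g x) ----> g x" by (rule tendsto_eventually)
 qed
qed

text \<open>The modular of a gradient difference controls its \<open>Gr p\<close>, and the
  subcritical Sobolev inequality then controls the L^s integral.\<close>

lemma Ls_Cauchy_of_grad_Cauchy:
 assumes phi: "!!n. phi n : test_functions Om"
  and cauchy: "!!e. e > 0 ==> EX n0. ALL i>=n0. ALL j>=n0. modM mu a p q (%x. grad (phi i) x - grad (phi j) x) <= ennreal e"
  and e: "e > 0"
 shows "EX n0. ALL i>=n0. ALL j>=n0. modM mu (%_. 0) s s (%x. phi i x - phi j x) <= ennreal e"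
proof -
 have ps: "p < s" and p0: "p > 0" using exps by simp_all
 obtain S where S: "S >= 0" "!!phi. phi : test_functions Om ==> (Lpow s phi) <= ennreal (S * Gr p phi powr (s / p))"
  by (rule sobolev_subcritical[OF exps(1) ps exps(4) Om]) blast
 \<comment> \<open>Makes S * de powr (s / p) at most e; one is added to S because S may be
   zero.\<close>
 define de where "de = (e / (S + 1)) powr (p / s)"
 have de: "de > 0" using e S(1) by (simp add: de_def)
 have des: "de powr (s / p) = e / (S + 1)" using e S(1) ps p0 by (simp add: de_def powr_powr)
 obtain n0 where n0: "!!i j. i >= n0 ==> j >= n0 ==> modM mu a p q (%x. grad (phi i) x - grad (phi j) x) <= ennreal de"
  using cauchy[OF de] by blast
 have "modM mu (%_. 0) s s (%x. phi i x - phi j x) <= ennreal e" if ij: "i >= n0" "j >= n0" for i j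
 proof -
  define psi where "psi = (%x. phi i x - phi j x)"
  have psi: "psi : test_functions Om" "grad psi x = grad (phi i) x - grad (phi j) x" for x
   unfolding psi_def using test_functions_lincomb[OF phi[of i] phi[of j], of 1 "-1"] by auto
  have "ennreal (Gr p psi) = (\<integral>\<^sup>+x. ennreal (norm (grad psi x) powr p) \<partial>lborel)"
   using Gp_eq[OF p0 psi(1)] by (simp add: Gp_def)
  also have "... = (\<integral>\<^sup>+x. ennreal (norm (grad psi x) powr p) \<partial>mu)"
   using test_functions_zero_outside[OF psi(1)] test_functions_borel(2)[OF psi(1)] p0
   by (intro nn_integral_lebesgue_on_borel[OF Om(1), symmetric]) auto
  also have "... <= modM mu a p q (grad psi)"
   unfolding modM_def using a_bounds by (intro nn_integral_mono ennreal_leI) auto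
  also have "... <= ennreal de" using n0[OF ij] by (simp add: psi(2)[abs_def])
  finally have G: "Gr p psi <= de" using de by simp
  have "modM mu (%_. 0) s s psi = Lpow s psi"
   unfolding modM_def using test_functions_zero_outside[OF psi(1)] test_functions_borel(1)[OF psi(1)] ps p0
   by (subst nn_integral_lebesgue_on_borel[OF Om(1)]) auto
  also have "... <= ennreal (S * Gr p psi powr (s / p))" by (rule S(2)[OF psi(1)])
  also have "... <= ennreal e"
  proof (rule ennreal_leI)
   have "S * Gr p psi powr (s / p) <= S * (e / (S + 1))"
    using G S(1) ps p0 Gr_nonneg[of p psi] unfolding des[symmetric] by (intro mult_left_mono powr_mono2) auto
   also have "... <= e" using e S(1) by (simp add: field_simps)
   finally show "S * Gr p psi powr (s / p) <= e" .
  qed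
  finally show ?thesis unfolding psi_def .
 qed
 then show ?thesis by blast
qed

lemma Ls_modM_test:
 assumes "phi : test_functions Om"
 shows "modM mu (%_. 0) s s phi < \<infinity>"
proof -
 have ps: "p < s" and p0: "p > 0" using exps by simp_all
 obtain B where B: "!!x. \<bar>phi x\<bar> <= B" using test_functions_bounded[OF assms] by metis
 have "modM mu (%_. 0) s s phi <= (\<integral>\<^sup>+x. ennreal (B powr s) \<partial>mu)"
  unfolding modM_def using B ps p0 by (intro nn_integral_mono ennreal_leI) (auto intro!: powr_mono2)
 also have "... < \<infinity>"
 proof -
  have "emeasure mu (space mu) < top" using mu.emeasure_finite less_top by blast
  then show ?thesis by (simp add: ennreal_mult_less_top)
 qed
 finally show ?thesis .
qed

end

text \<open>Approximation by members of the countable family itself, with majorants, lets equations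
  known for each e i pass to arbitrary test functions. The majorant for the values must lie in L^s,
  as the nonlinearity demands.\<close>

lemma (in galerkin) W1H0_approx:
 assumes phi: "phi : W1H0 Om p q a"
 obtains j V W where "V : borel_measurable mu" "!!x. V x >= (0::real)" "modM mu (%_. 0) s s V < \<infinity>"
  "W : borel_measurable mu" "!!x. W x >= (0::real)" "modM mu a p q W < \<infinity>"
  "AE x in mu. (%n. e (j n) x) ----> phi x" "AE x in mu. (%n. grad (e (j n)) x) ----> wgrad Om phi x"
  "AE x in mu. ALL n. \<bar>e (j n) x\<bar> <= V x" "AE x in mu. ALL n. norm (grad (e (j n)) x) <= W x"
  "phi : borel_measurable mu" "wgrad Om phi : borel_measurable mu"
proof -
 define g where "g = wgrad Om phi"
 have W1H: "phi : W1H Om p q a" using phi by (simp add: W1H0_def)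
 then have m[measurable]: "phi : borel_measurable mu" and fphi: "modM mu a p q phi < \<infinity>" and fg: "modM mu a p q g < \<infinity>"
  by (simp_all add: W1H_def LH_def modular_H_def modM_def g_def)
 obtain g0 where "weak_gradient_on Om phi g0" using W1H by (auto simp: W1H_def)
 then have wg: "weak_gradient_on Om phi g" unfolding g_def by (rule wgrad_AE_eq(1)[OF Om(1)])
 then have gm[measurable]: "g : borel_measurable mu" by (rule weak_gradient_measurable)
 have int: "integrable mu phi" "integrable mu g" using fphi fg by (auto intro: modM_imp_integrable)
 define h where "h n = inverse (real (Suc n))" for n
 have h: "h n > 0" "h n <= 1" for n by (auto simp: h_def field_simps)
 have h0: "h ----> 0" unfolding h_def[abs_def] by (rule LIMSEQ_inverse_real_of_nat)
 define m1 where "m1 = modM mu a p q (%_. 1 :: real)"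
 have m1: "m1 < \<infinity>" unfolding m1_def by (rule modM_const)
 \<comment> \<open>The quasi-triangle bound for two errors: a uniform one of size h n, from density
   of the family, and a modular one of size h n, from approximation by a test function.\<close>
 define b where "b n = ennreal (2 powr q) * (ennreal (h n) * m1 + ennreal (h n))" for n
 have b0: "b ----> 0"
 proof -
  have "(%n. ennreal (h n)) ----> 0" using tendsto_ennrealI[OF h0] by simp
  then have "(%n. m1 * ennreal (h n)) ----> m1 * 0" using m1 by (intro ennreal_tendsto_cmult) auto
  then have "b ----> ennreal (2 powr q) * (m1 * 0 + 0)"
   unfolding mult.commute[of m1] b_def[abs_def] using \<open>(%n. ennreal (h n)) ----> 0\<close> by (intro ennreal_tendsto_cmult tendsto_add) auto
  then show ?thesis by simp
 qed
 have "EX j. modM mu a p q (%x. e j x - phi x) <= b n & modM mu a p q (%x. grad (e j) x - g x) <= b n" for n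
 proof -
  obtain psi where psi: "psi : test_functions Om" "norm_W1H Om p q a (%x. phi x - psi x) < h n"
   using phi h(1)[of n] by (auto simp: W1H0_def)
  have md: "(%x. phi x - psi x) : borel_measurable mu" "(%x. g x - grad psi x) : borel_measurable mu"
   by (rule borel_measurable_diff[OF m test_measurable(1)[OF psi(1)]], rule borel_measurable_diff[OF gm test_measurable(2)[OF psi(1)]])
  have ae: "AE x in mu. wgrad Om (%x. phi x - psi x) x = g x - grad psi x"
   by (rule wgrad_AE_eq(2)[OF Om(1) weak_gradient_diff_test[OF wg int psi(1)]])
  then have "wgrad Om (%x. phi x - psi x) : borel_measurable mu"
   by (intro borel_measurable_lebesgue_on_AE[OF Om_sets md(2)]) (simp add: eq_commute)
  then have wm: "(%x. norm (wgrad Om (%x. phi x - psi x) x)) : borel_measurable mu"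
   by (rule measurable_compose[OF _ borel_measurable_norm])
  have f1: "modM mu a p q (%x. phi x - psi x) < \<infinity>"
   by (rule modM_finite_dom[OF m test_measurable(1)[OF psi(1)] _ fphi modM_test(1)[OF psi(1)]]) (intro AE_I2 norm_triangle_ineq4)
  have f2: "modM mu a p q (%x. g x - grad psi x) < \<infinity>"
   by (rule modM_finite_dom[OF gm test_measurable(2)[OF psi(1)] _ fg modM_test(2)[OF psi(1)]]) (intro AE_I2 norm_triangle_ineq4)
  have eqm: "modM mu a p q (%x. norm (wgrad Om (%x. phi x - psi x) x)) = modM mu a p q (%x. g x - grad psi x)"
   using ae by (intro modM_cong_AE) (auto elim: eventually_mono)
  have n0: "norm_H Om p q a (%x. phi x - psi x) >= 0" "norm_H Om p q a (%x. norm (wgrad Om (%x. phi x - psi x) x)) >= 0"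
   using norm_H_nonneg[OF md(1) f1] norm_H_nonneg[OF wm] f2 unfolding eqm by blast+
  have l1: "modM mu a p q (%x. phi x - psi x) <= ennreal (h n)"
   using n0 psi(2) unfolding norm_W1H_def by (intro norm_H_modM[OF md(1) f1 h(2)]) linarith
  have "modM mu a p q (%x. norm (wgrad Om (%x. phi x - psi x) x)) <= ennreal (h n)"
   using n0 psi(2) f2 unfolding norm_W1H_def eqm[symmetric] by (intro norm_H_modM[OF wm _ h(2)]) linarith+
  then have l2: "modM mu a p q (%x. g x - grad psi x) <= ennreal (h n)" unfolding eqm .
  obtain j where j: "!!x. \<bar>e j x - psi x\<bar> < h n" "!!x. norm (grad (e j) x - grad psi x) < h n"
   using e_dense[OF psi(1) h(1)[of n]] by blast
  have hc: "modM mu a p q (%_. h n) <= ennreal (h n) * m1"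
   unfolding m1_def using modM_shrink[of "h n" "%_. 1 :: real"] h[of n] by simp
  have "modM mu a p q (%x. e j x - phi x) <= ennreal (2 powr q) * (modM mu a p q (%_. h n) + modM mu a p q (%x. phi x - psi x))"
  proof (rule modM_triangle)
   have "norm (e j x - phi x) <= norm (h n) + norm (phi x - psi x)" for x
    using j(1)[of x] h(1)[of n] abs_triangle_ineq4[of "e j x - psi x" "phi x - psi x"] by simp
   then show "AE x in mu. norm (e j x - phi x) <= norm (h n) + norm (phi x - psi x)" by (intro AE_I2)
  qed (use md in auto)
  also have "... <= b n" unfolding b_def by (intro mult_left_mono add_mono hc l1) auto
  finally have 1: "modM mu a p q (%x. e j x - phi x) <= b n" .
  have "modM mu a p q (%x. norm (grad (e j) x - g x)) <= ennreal (2 powr q) * (modM mu a p q (%_. h n) + modM mu a p q (%x. norm (g x - grad psi x)))"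
  proof (rule modM_triangle)
   have "norm (grad (e j) x - g x) <= h n + norm (g x - grad psi x)" for x
    using j(2)[of x] norm_triangle_ineq4[of "grad (e j) x - grad psi x" "g x - grad psi x"] by simp
   then show "AE x in mu. norm (norm (grad (e j) x - g x)) <= norm (h n) + norm (norm (g x - grad psi x))"
    using h(1)[of n] by (intro AE_I2) simp
  qed (use measurable_compose[OF md(2) borel_measurable_norm] in auto)
  also have "... <= b n" unfolding b_def using l2 by (intro mult_left_mono add_mono hc) (auto simp: modM_def)
  finally have 2: "modM mu a p q (%x. grad (e j) x - g x) <= b n" by (simp add: modM_def)
  show ?thesis using 1 2 by blast
 qed
 then obtain j0 where j0: "!!n. modM mu a p q (%x. e (j0 n) x - phi x) <= b n" "!!n. modM mu a p q (%x. grad (e (j0 n)) x - g x) <= b n"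
  by metis
 have lim: "(%n. modM mu a p q (%x. e (j0 n) x - phi x)) ----> 0" "(%n. modM mu a p q (%x. grad (e (j0 n)) x - g x)) ----> 0"
  by (rule tendsto_sandwich[OF _ _ tendsto_const b0]; simp add: j0)+
 \<comment> \<open>Three successive subsequences: for the gradients, for the values, and for a
   majorant of the values in L^s, which the double-phase modular does not provide.\<close>
 obtain r1 W where r1: "strict_mono (r1 :: nat => nat)" "W : borel_measurable mu" "!!x. W x >= (0::real)" "modM mu a p q W < \<infinity>"
  "AE x in mu. (%n. grad (e (j0 (r1 n))) x) ----> g x" "AE x in mu. ALL n. norm (grad (e (j0 (r1 n))) x) <= W x"
  by (rule modM_AE_subsequence[of "%n. grad (e (j0 n))" g, OF test_measurable(2)[OF e_test] gm modM_test(2)[OF e_test] lim(2)]) auto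
 have "(%n. modM mu a p q (%x. e (j0 (r1 n)) x - phi x)) ----> 0"
  using LIMSEQ_subseq_LIMSEQ[OF lim(1) r1(1)] by (simp add: o_def)
 then obtain r2 V0 where r2: "strict_mono (r2 :: nat => nat)" "AE x in mu. (%n. e (j0 (r1 (r2 n))) x) ----> phi x"
  by (rule modM_AE_subsequence[of "%n. e (j0 (r1 n))" phi, OF test_measurable(1)[OF e_test] m modM_test(1)[OF e_test]]) auto
 define k where "k n = j0 (r1 (r2 n))" for n
 have lim2: "(%n. modM mu a p q (%x. grad (e (k n)) x - g x)) ----> 0"
  using LIMSEQ_subseq_LIMSEQ[OF LIMSEQ_subseq_LIMSEQ[OF lim(2) r1(1)] r2(1)] by (simp add: o_def k_def)
 have gc: "EX n0. ALL i>=n0. ALL j>=n0. modM mu a p q (%x. grad (e (k i)) x - grad (e (k j)) x) <= ennreal d" if "d > 0" for d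
  by (rule modM_Cauchy_of_tendsto[OF test_measurable(2)[OF e_test] gm lim2 that])
 have Lc: "EX n0. ALL i>=n0. ALL j>=n0. modM mu (%_. 0) s s (%x. e (k i) x - e (k j) x) <= ennreal d" if "d > 0" for d
  by (rule Ls_Cauchy_of_grad_Cauchy[OF e_test gc that])
 obtain r3 u V where r3: "strict_mono (r3 :: nat => nat)" "u : borel_measurable mu" "V : borel_measurable mu"
  "!!x. V x >= (0::real)" "modM mu (%_. 0) s s V < \<infinity>" "AE x in mu. (%n. e (k (r3 n)) x) ----> u x"
  "AE x in mu. ALL n. norm (e (k (r3 n)) x) <= V x"
  by (rule L.modM_subsequence[of "%n. e (k n)", OF test_measurable(1)[OF e_test] Ls_modM_test[OF e_test] Lc]) auto
 show ?thesis
 proof (rule that[of V W "%n. k (r3 n)"])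
  show "AE x in mu. (%n. e (k (r3 n)) x) ----> phi x"
   using r2(2)
  proof eventually_elim
   case (elim x)
   show ?case using LIMSEQ_subseq_LIMSEQ[OF elim r3(1)] by (simp add: o_def k_def)
  qed
  show "AE x in mu. (%n. grad (e (k (r3 n))) x) ----> wgrad Om phi x"
   using r1(5)
  proof eventually_elim
   case (elim x)
   show ?case using LIMSEQ_subseq_LIMSEQ[OF LIMSEQ_subseq_LIMSEQ[OF elim r2(1)] r3(1)] by (simp add: o_def k_def g_def)
  qed
  show "AE x in mu. ALL n. norm (grad (e (k (r3 n))) x) <= W x" using r1(6) by eventually_elim (simp add: k_def)
  show "AE x in mu. ALL n. \<bar>e (k (r3 n)) x\<bar> <= V x" using r3(7) by simp
 qed (use r1 r3 m gm in \<open>auto simp: g_def\<close>)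
qed

section \<open>Strong convergence of gradients\<close>

context kirchhoff
begin

lemma test_integrable:
 assumes phi: "phi : test_functions Om" and psi: "psi : test_functions Om"
 shows "integrable mu (%x. Eden a p q x (grad phi x))"
  "integrable mu (%x. Hden a p q x (grad phi x))"
  "integrable mu (%x. (Fden a p q x (grad phi x)) * (grad phi x \<bullet> (grad psi x - grad phi x)))"
proof -
 obtain B where B: "B > 0" "!!x. norm (grad phi x) <= B" using test_functions_bounded[OF phi] by metis
 obtain B' where B': "B' > 0" "!!x. norm (grad psi x) <= B'" using test_functions_bounded[OF psi] by metis
 note m = test_measurable(2)[OF phi] test_measurable(2)[OF psi]
 have le: "norm (grad phi x) <= B + B'" "norm (grad psi x - grad phi x) <= B + B'" for x
  using B(2)[of x] B'(2)[of x] B'(1) norm_triangle_ineq4[of "grad psi x" "grad phi x"] by linarith+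
 show "integrable mu (%x. Eden a p q x (grad phi x))"
  using B m by (intro energy_integrable[OF _ _ modM_const[of B]]) auto
 show "integrable mu (%x. Hden a p q x (grad phi x))"
  by (rule modM_integrable[OF m(1) modM_test(2)[OF phi]])
 show "integrable mu (%x. (Fden a p q x (grad phi x)) * (grad phi x \<bullet> (grad psi x - grad phi x)))"
  using le m B(1) B'(1) by (intro flux_integrable[OF _ _ modM_const[of "B + B'"]] borel_measurable_diff) auto
qed

text \<open>The coefficients 1 / p and 1 / q of the energy are both at least 1 / q.\<close>

lemma modular_le_energy:
 assumes phi: "phi : test_functions Om"
 shows "(LINT x|mu. Hden a p q x (grad phi x)) <= q * energy_int (grad phi)"
proof -
 have "(LINT x|mu. Hden a p q x (grad phi x)) <=
   (LINT x|mu. q * (Eden a p q x (grad phi x)))"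
 proof (rule integral_mono)
  show "integrable mu (%x. Hden a p q x (grad phi x))" by (rule test_integrable(2)[OF phi phi])
  show "integrable mu (%x. q * (Eden a p q x (grad phi x)))"
   using test_integrable(1)[OF phi phi] by simp
  show "Hden a p q x (grad phi x) <= q * (Eden a p q x (grad phi x))" for x
  proof -
   have "1 * norm (grad phi x) powr p <= q / p * norm (grad phi x) powr p" using exps by (intro mult_right_mono) auto
   then show ?thesis using exps by (simp add: algebra_simps)
  qed
 qed
 then show ?thesis by (simp add: energy_int_def)
qed

lemma flux_self_le:
 assumes phi: "phi : test_functions Om"
 shows "flux_int (grad phi) (grad phi) <= q * energy_int (grad phi)"
proof -
 have eq: "norm v powr (m - 2) * (v \<bullet> v) = norm v powr m" for v :: 'a and m
 proof (cases "v = 0")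
  case False
  then show ?thesis using powr_add[of "norm v" "m - 2" 2] by (simp add: power2_norm_eq_inner[symmetric])
 qed simp
 have "flux_int (grad phi) (grad phi) = (LINT x|mu. Hden a p q x (grad phi x))"
  unfolding flux_int_def by (intro Bochner_Integration.integral_cong) (auto simp: distrib_right mult.assoc eq)
 then show ?thesis using modular_le_energy[OF phi] by simp
qed

text \<open>Uniform convexity for the powers p and q, weighted by 1 and a x and integrated. The
  Bregman remainders add up to the energy difference minus the flux in the direction of the
  difference.\<close>

lemma gradient_difference_bound:
 assumes ep: "ep > 0"
 shows "EX C'>=0. ALL phi:test_functions Om. ALL psi:test_functions Om. modM mu a p q (%x. grad psi x - grad phi x) <=
  ennreal (ep * q * (energy_int (grad phi) + energy_int (grad psi)) +
   C' * (energy_int (grad psi) - energy_int (grad phi) - flux_int (grad phi) (%x. grad psi x - grad phi x)))"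
proof -
 have q1: "q > 1" using exps by simp
 define Br where "Br m xi eta = norm eta powr m / m - norm xi powr m / m - norm xi powr (m - 2) * (xi \<bullet> (eta - xi))" for m and xi eta :: 'a
 have Br0: "Br m xi eta >= 0" if "m > 1" for m xi eta
  using norm_powr_tangent[OF that, of xi eta] that by (simp add: Br_def field_simps)
 obtain Cp where Cp: "Cp >= 0" "!!xi eta :: 'a. norm (eta - xi) powr p <= ep * (norm xi powr p + norm eta powr p) + Cp * Br p xi eta"
  unfolding Br_def by (rule norm_powr_uniform_convexity[OF exps(1) ep]) blast
 obtain Cq where Cq: "Cq >= 0" "!!xi eta :: 'a. norm (eta - xi) powr q <= ep * (norm xi powr q + norm eta powr q) + Cq * Br q xi eta"
  unfolding Br_def by (rule norm_powr_uniform_convexity[OF q1 ep]) blast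
 \<comment> \<open>One constant for both powers is possible because the Bregman remainders are
   nonnegative.\<close>
 define C' where "C' = max Cp Cq"
 have C': "C' >= 0" using Cp(1) by (simp add: C'_def)
 have pw: "Hden a p q x (eta - xi) <=
   ep * ((Hden a p q x xi) + (Hden a p q x eta)) + C' * (Br p xi eta + a x * Br q xi eta)"
  if x: "x : Om" for x xi eta
 proof -
  have "Cp * Br p xi eta <= C' * Br p xi eta" "Cq * Br q xi eta <= C' * Br q xi eta"
   using Br0 exps q1 by (auto simp: C'_def intro!: mult_right_mono)
  then have "norm (eta - xi) powr p <= ep * (norm xi powr p + norm eta powr p) + C' * Br p xi eta"
   "norm (eta - xi) powr q <= ep * (norm xi powr q + norm eta powr q) + C' * Br q xi eta"
   using Cp(2)[of eta xi] Cq(2)[of eta xi] by linarith+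
  then have "Hden a p q x (eta - xi) <=
    (ep * (norm xi powr p + norm eta powr p) + C' * Br p xi eta) + a x * (ep * (norm xi powr q + norm eta powr q) + C' * Br q xi eta)"
   using a_bounds[OF x] by (intro add_mono mult_left_mono) auto
  then show ?thesis by (simp add: algebra_simps)
 qed
 show ?thesis
 proof (intro exI[of _ C'] conjI C' ballI)
  fix phi psi assume phi: "phi : test_functions Om" and psi: "psi : test_functions Om"
  define \<chi>' where "\<chi>' = (%x. psi x - phi x)"
  have \<chi>': "\<chi>' : test_functions Om" "grad \<chi>' = (%x. grad psi x - grad phi x)"
   unfolding \<chi>'_def using test_functions_lincomb[OF psi phi, of 1 "-1"] by auto
  let ?D = "%phi x. Hden a p q x (grad phi x)"
  let ?E = "%phi x. Eden a p q x (grad phi x)"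
  let ?F = "%x. (Fden a p q x (grad phi x)) * (grad phi x \<bullet> (grad psi x - grad phi x))"
  note iD = test_integrable(2)[OF phi phi] test_integrable(2)[OF psi psi] test_integrable(2)[OF \<chi>'(1) \<chi>'(1)]
  note iE = test_integrable(1)[OF phi phi] test_integrable(1)[OF psi psi]
  note iF = test_integrable(3)[OF phi psi]
  have gen: "integrable mu (%x. ep * (d1 x + d2 x) + C' * (e1 x - e2 x - h x))"
   "(LINT x|mu. ep * (d1 x + d2 x) + C' * (e1 x - e2 x - h x)) =
    ep * (integral\<^sup>L mu d1 + integral\<^sup>L mu d2) + C' * (integral\<^sup>L mu e1 - integral\<^sup>L mu e2 - integral\<^sup>L mu h)"
   if "integrable mu d1" "integrable mu d2" "integrable mu e1" "integrable mu e2" "integrable mu h" for d1 d2 e1 e2 h :: "'a => real"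
   using that by simp_all
  have "(LINT x|mu. ?D \<chi>' x) <= (LINT x|mu. ep * (?D phi x + ?D psi x) + C' * (?E psi x - ?E phi x - ?F x))"
  proof (rule integral_mono)
   show "integrable mu (?D \<chi>')" by (rule iD(3))
   show "integrable mu (%x. ep * (?D phi x + ?D psi x) + C' * (?E psi x - ?E phi x - ?F x))"
    by (rule gen(1)[OF iD(1,2) iE(2,1) iF])
   fix x assume "x : space mu"
   then have x: "x : Om" by simp
   have "Br p (grad phi x) (grad psi x) + a x * Br q (grad phi x) (grad psi x) = ?E psi x - ?E phi x - ?F x"
    by (simp add: Br_def algebra_simps)
   then show "?D \<chi>' x <= ep * (?D phi x + ?D psi x) + C' * (?E psi x - ?E phi x - ?F x)"
    using pw[OF x, of "grad psi x" "grad phi x"] unfolding \<chi>'(2) by simp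
  qed
  also have "... = ep * ((LINT x|mu. ?D phi x) + (LINT x|mu. ?D psi x)) +
    C' * (energy_int (grad psi) - energy_int (grad phi) - flux_int (grad phi) (%x. grad psi x - grad phi x))"
   unfolding energy_int_def flux_int_def by (rule gen(2)[OF iD(1,2) iE(2,1) iF])
  also have "ep * ((LINT x|mu. ?D phi x) + (LINT x|mu. ?D psi x)) <= ep * (q * energy_int (grad phi) + q * energy_int (grad psi))"
   using ep modular_le_energy[OF phi] modular_le_energy[OF psi] by (intro mult_left_mono add_mono) auto
  finally have le: "(LINT x|mu. ?D \<chi>' x) <= ep * q * (energy_int (grad phi) + energy_int (grad psi)) +
    C' * (energy_int (grad psi) - energy_int (grad phi) - flux_int (grad phi) (%x. grad psi x - grad phi x))"
   by (simp add: algebra_simps)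
  have "modM mu a p q (%x. grad psi x - grad phi x) = ennreal (LINT x|mu. ?D \<chi>' x)"
   unfolding modM_def \<chi>'(2)[symmetric] using iD(3) a_bounds by (intro nn_integral_eq_integral) auto
  then show "modM mu a p q (%x. grad psi x - grad phi x) <= ennreal (ep * q * (energy_int (grad phi) + energy_int (grad psi)) +
    C' * (energy_int (grad psi) - energy_int (grad phi) - flux_int (grad phi) (%x. grad psi x - grad phi x)))"
   using le by (simp add: ennreal_leI)
 qed
qed

text \<open>The factor f x (u m x) need not be small, but it is bounded by b x, and b times the
  majorant V is integrable. Dominated convergence for b times |u n - v| therefore suffices.\<close>

lemma superposition_difference_small:
 fixes u :: "nat => 'a => real"
 assumes u: "!!n. u n : borel_measurable mu" "v : borel_measurable mu"
  and lim: "AE x in mu. (%n. u n x) ----> v x" and V: "V : borel_measurable mu" "!!x. V x >= 0" "modM mu (%_. 0) s s V < \<infinity>"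
  and dom: "AE x in mu. ALL n. \<bar>u n x\<bar> <= V x" and e: "e > 0"
 shows "EX n0. ALL m>=n0. ALL k>=n0. \<bar>LINT x|mu. f x (u m x) * (u m x - u k x)\<bar> <= e"
proof -
 note [measurable] = u V(1)
 define b where "b x = C * (1 + V x powr (s - 1))" for x
 have b[measurable]: "b : borel_measurable mu" unfolding b_def by measurable
 have b0: "b x >= 0" for x using C_nonneg by (simp add: b_def)
 have s1: "s > 1" using exps by simp
 have iVs: "integrable mu (%x. V x powr s)" using Ls_integrable[OF V(1,3)] V(2) by simp
 have iV: "integrable mu V" by (rule modM_imp_integrable[OF V(1) modM_of_Ls[OF V(1,3)]])
 have bV: "b x * V x = C * (V x + V x powr s)" for x
  using powr_pred_mult[of "V x" s] V(2)[of x] by (simp add: b_def distrib_right distrib_left mult.assoc)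
 have ibV: "integrable mu (%x. b x * V x)" unfolding bV using iVs iV by simp
 have vV: "AE x in mu. \<bar>v x\<bar> <= V x" using AE_norm_limit_le[OF lim] dom by simp
 have dV: "AE x in mu. ALL n. b x * \<bar>u n x - v x\<bar> <= 2 * (b x * V x)"
  using dom vV
 proof (eventually_elim, intro allI)
  fix x n assume "ALL n. \<bar>u n x\<bar> <= V x" "\<bar>v x\<bar> <= V x"
  then have "\<bar>u n x\<bar> <= V x" "\<bar>v x\<bar> <= V x" by blast+
  then have "\<bar>u n x - v x\<bar> <= 2 * V x" by linarith
  then have "b x * \<bar>u n x - v x\<bar> <= b x * (2 * V x)" using b0 by (intro mult_left_mono)
  then show "b x * \<bar>u n x - v x\<bar> <= 2 * (b x * V x)" by simp
 qed
 have i2: "integrable mu (%x. 2 * (b x * V x))" using ibV by simp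
 have iu: "integrable mu (%x. b x * \<bar>u n x - v x\<bar>)" for n
 proof (rule Bochner_Integration.integrable_bound[OF i2])
  show "AE x in mu. norm (b x * \<bar>u n x - v x\<bar>) <= norm (2 * (b x * V x))"
   using dV
  proof eventually_elim
   case (elim x)
   then have "b x * \<bar>u n x - v x\<bar> <= 2 * (b x * V x)" by blast
   moreover have "b x * \<bar>u n x - v x\<bar> >= 0" using b0 by simp
   ultimately show ?case by simp
  qed
 qed simp
 have "(%n. LINT x|mu. b x * \<bar>u n x - v x\<bar>) ----> (LINT x|mu. 0)"
 proof (rule integral_dominated_convergence[OF _ _ i2])
  show "AE x in mu. (%n. b x * \<bar>u n x - v x\<bar>) ----> 0"
   using lim
  proof eventually_elim
   case (elim x)
   then have "(%n. \<bar>u n x - v x\<bar>) ----> 0" by (simp add: LIM_zero tendsto_rabs_zero)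
   then show ?case by (rule tendsto_mult_right_zero)
  qed
  show "AE x in mu. norm (b x * \<bar>u n x - v x\<bar>) <= 2 * (b x * V x)" for n
   using dV
  proof eventually_elim
   case (elim x)
   then have "b x * \<bar>u n x - v x\<bar> <= 2 * (b x * V x)" by blast
   moreover have "b x * \<bar>u n x - v x\<bar> >= 0" using b0 by simp
   ultimately show ?case by simp
  qed
 qed simp_all
 then have "(%n. LINT x|mu. b x * \<bar>u n x - v x\<bar>) ----> 0" by simp
 then have "\<forall>\<^sub>F n in sequentially. (LINT x|mu. b x * \<bar>u n x - v x\<bar>) < e / 2" using e by (intro order_tendstoD(2)) auto
 then obtain n0 where n0: "!!n. n >= n0 ==> (LINT x|mu. b x * \<bar>u n x - v x\<bar>) < e / 2"
  unfolding eventually_sequentially by blast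
 have "\<bar>LINT x|mu. f x (u m x) * (u m x - u k x)\<bar> <= e" if mk: "m >= n0" "k >= n0" for m k
 proof -
  have "\<bar>LINT x|mu. f x (u m x) * (u m x - u k x)\<bar> <= (LINT x|mu. b x * \<bar>u m x - v x\<bar> + b x * \<bar>u k x - v x\<bar>)"
  proof (rule order_trans[OF integral_abs_bound], rule integral_mono_AE')
   show "integrable mu (%x. b x * \<bar>u m x - v x\<bar> + b x * \<bar>u k x - v x\<bar>)" using iu by simp
   show "AE x in mu. \<bar>f x (u m x) * (u m x - u k x)\<bar> <= b x * \<bar>u m x - v x\<bar> + b x * \<bar>u k x - v x\<bar>"
    using dom AE_space
   proof eventually_elim
    case (elim x)
    have "\<bar>f x (u m x)\<bar> <= C * (1 + \<bar>u m x\<bar> powr (s - 1))" using elim(2) by (intro f_bound) simp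
    also have "... <= b x" unfolding b_def using elim(1) C_nonneg s1 by (intro mult_left_mono add_left_mono powr_mono2) auto
    finally have "\<bar>f x (u m x)\<bar> * \<bar>u m x - u k x\<bar> <= b x * (\<bar>u m x - v x\<bar> + \<bar>u k x - v x\<bar>)"
     using b0[of x] by (intro mult_mono) auto
    then show ?case by (simp add: abs_mult distrib_left)
   qed
  qed (use b0 in auto)
  also have "... = (LINT x|mu. b x * \<bar>u m x - v x\<bar>) + (LINT x|mu. b x * \<bar>u k x - v x\<bar>)"
   using iu by simp
  also have "... <= e" using n0[OF mk(1)] n0[OF mk(2)] by linarith
  finally show ?thesis .
 qed
 then show ?thesis by blast
qed

end

context kirchhoff_AR
begin

text \<open>The hypothesis \<open>crit\<close> reflects nested spans: for k <= m the difference is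
  an admissible direction at u m. It bounds K times the flux by a small superposition term, and K
  stays above kap because the energies stay above E / 2. Small flux and convergent energies then
  feed \<open>gradient_difference_bound\<close>.\<close>

lemma gradient_Cauchy:
 fixes u :: "nat => 'a => real"
 assumes u: "!!n. u n : test_functions Om" "v : borel_measurable mu"
  and lim: "AE x in mu. (%n. u n x) ----> v x" and V: "V : borel_measurable mu" "!!x. V x >= 0" "modM mu (%_. 0) s s V < \<infinity>"
  and dom: "AE x in mu. ALL n. \<bar>u n x\<bar> <= V x"
  and E: "(%n. energy_int (grad (u n))) ----> E" "E > 0"
  and crit: "!!k m. k <= m ==> DJ (u m) (grad (u m)) (%x. u m x - u k x) (%x. grad (u m) x - grad (u k) x) = 0"
  and eta: "eta > 0"
 shows "EX n0. ALL i>=n0. ALL j>=n0. modM mu a p q (%x. grad (u i) x - grad (u j) x) <= ennreal eta"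
proof -
 \<comment> \<open>The sum of two energies is at most 2 * (E + 1), so the first term of the bound is
   at most eta / 2.\<close>
 define ep where "ep = eta / (4 * q * (E + 1))"
 have q0: "q > 0" using exps by simp
 have ep: "ep > 0" using eta E(2) q0 by (simp add: ep_def)
 obtain C' where C': "C' >= 0" "!!phi psi. phi : test_functions Om ==> psi : test_functions Om ==> modM mu a p q (%x. grad psi x - grad phi x) <=
  ennreal (ep * q * (energy_int (grad phi) + energy_int (grad psi)) +
   C' * (energy_int (grad psi) - energy_int (grad phi) - flux_int (grad phi) (%x. grad psi x - grad phi x)))"
  using gradient_difference_bound[OF ep] by blast
 \<comment> \<open>Energy difference and flux are each at most de, so the second term is at most C'
   * (2 * de) <= eta / 2.\<close>
 define de where "de = eta / (4 * (C' + 1))"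
 have de: "de > 0" using eta C'(1) by (simp add: de_def)
 obtain kap where kap: "kap > 0" "!!t. t >= E / 2 ==> K t >= kap" using K_kappa[of "E / 2"] E(2) by auto
 have dekap: "de * kap > 0" using de kap(1) by simp
 obtain n1 where n1: "!!m k. m >= n1 ==> k >= n1 ==> \<bar>LINT x|mu. f x (u m x) * (u m x - u k x)\<bar> <= de * kap"
  using superposition_difference_small[OF test_measurable(1)[OF u(1)] u(2) lim V dom dekap] by blast
 have "\<forall>\<^sub>F n in sequentially. dist (energy_int (grad (u n))) E < min (de / 2) (min (E / 2) 1)"
  using E de by (intro tendstoD) auto
 then obtain n2 where n2: "!!n. n >= n2 ==> \<bar>energy_int (grad (u n)) - E\<bar> < min (de / 2) (min (E / 2) 1)"
  unfolding eventually_sequentially dist_real_def by blast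
 define n0 where "n0 = max n1 n2"
 have main: "modM mu a p q (%x. grad (u k) x - grad (u m) x) <= ennreal eta" if k: "k >= n0" "k <= m" for k m
 proof -
  have km: "k >= n1" "k >= n2" "m >= n1" "m >= n2" using k by (auto simp: n0_def)
  let ?Ek = "energy_int (grad (u k))" and ?Em = "energy_int (grad (u m))"
  have Ek: "\<bar>?Ek - E\<bar> < de / 2" "?Ek <= E + 1" and Em: "\<bar>?Em - E\<bar> < de / 2" "?Em <= E + 1" "?Em >= E / 2"
   using n2[OF km(2)] n2[OF km(4)] by (auto simp: abs_if split: if_splits)
  let ?F = "flux_int (grad (u m)) (%x. grad (u m) x - grad (u k) x)"
  have "K ?Em * ?F = (LINT x|mu. f x (u m x) * (u m x - u k x))" using crit[OF k(2)] by (simp add: DJ_def)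
  then have "K ?Em * \<bar>?F\<bar> <= de * kap" using n1[OF km(3,1)] K_nonneg[of ?Em] by (metis abs_mult abs_of_nonneg)
  moreover have "kap * \<bar>?F\<bar> <= K ?Em * \<bar>?F\<bar>" using kap(2)[OF Em(3)] by (intro mult_right_mono) auto
  ultimately have "kap * \<bar>?F\<bar> <= kap * de" by (simp add: mult.commute)
  then have F: "\<bar>?F\<bar> <= de" using kap(1) by simp
  have neg: "flux_int (grad (u m)) (%x. grad (u k) x - grad (u m) x) = - ?F"
   unfolding flux_int_def integral_minus[symmetric]
   by (intro Bochner_Integration.integral_cong) (auto simp: inner_diff_right algebra_simps)
  have "modM mu a p q (%x. grad (u k) x - grad (u m) x) <= ennreal (ep * q * (?Em + ?Ek) + C' * (?Ek - ?Em + ?F))"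
   using C'(2)[OF u(1)[of m] u(1)[of k]] unfolding neg by simp
  also have "... <= ennreal eta"
  proof (rule ennreal_leI)
   have "ep * q * (?Em + ?Ek) <= ep * q * (2 * (E + 1))" using Ek(2) Em(2) ep q0 by (intro mult_left_mono) auto
   also have "... = ep * (4 * q * (E + 1)) / 2" by simp
   also have "ep * (4 * q * (E + 1)) = eta" using q0 E(2) by (simp add: ep_def)
   finally have 1: "ep * q * (?Em + ?Ek) <= eta / 2" .
   have "?Ek - ?Em + ?F <= 2 * de" using Ek(1) Em(1) F by linarith
   then have "C' * (?Ek - ?Em + ?F) <= C' * (2 * de)" using C'(1) by (intro mult_left_mono)
   also have "... <= (C' + 1) * (2 * de)" using de by (intro mult_right_mono) auto
   also have "... = eta / 2" using C'(1) by (simp add: de_def field_simps)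
   finally show "ep * q * (?Em + ?Ek) + C' * (?Ek - ?Em + ?F) <= eta" using 1 by linarith
  qed
  finally show ?thesis .
 qed
 have "modM mu a p q (%x. grad (u i) x - grad (u j) x) <= ennreal eta" if ij: "i >= n0" "j >= n0" for i j
 proof (cases "i <= j")
  case False
  then have "modM mu a p q (%x. grad (u j) x - grad (u i) x) <= ennreal eta" using main[of j i] ij by simp
  moreover have "modM mu a p q (%x. grad (u j) x - grad (u i) x) = modM mu a p q (%x. grad (u i) x - grad (u j) x)"
   by (intro modM_cong_AE) (auto simp: norm_minus_commute)
  ultimately show ?thesis by simp
 qed (use main ij in simp)
 then show ?thesis by blast
qed

text \<open>Subtracting the derivative in the direction u from sig times the energy removes the
  nonlinearity up to a constant. What remains is at least (sig - q * th) times the primitive of K,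
  which grows linearly; the resulting bound does not depend on n.\<close>

lemma critical_energy_bound:
 "EX E0. ALL n xi. (ALL i<n. Dn n i xi = 0) --> Jn n xi <= beta --> energy_int (grad (comb n xi)) <= E0"
proof -
 obtain kap where kap: "kap > 0" "!!t. t >= 1 ==> K t >= kap" using K_kappa[of 1] by auto
 \<comment> \<open>Pays for the points with |u x| < t0, where sig times the primitive and the
   product of f and u are bounded separately, with weights sig and 1.\<close>
 define c3 where "c3 = (sig + 1) * (2 * C * (1 + t0 powr s))"
 have c3: "c3 >= 0" using C_nonneg sigma_pos by (simp add: c3_def)
 have gap: "sig - q * th > 0" using sigma by simp
 define E0 where "E0 = (sig * beta + c3 * measure mu Om) / (sig - q * th) / kap + 1"
 have "energy_int (grad (comb n xi)) <= E0" if crit: "ALL i<n. Dn n i xi = 0" and J: "Jn n xi <= beta" for n xi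
 proof -
  define u where "u = comb n xi"
  define E where "E = energy_int (grad u)"
  have u: "u : test_functions Om" unfolding u_def by (rule comb_test)
  have E0: "E >= 0" using energy_ge_Gr[OF u] Gr_nonneg[of p u] exps unfolding E_def by (meson divide_nonneg_nonneg less_eq_real_def order_trans zero_less_one)
  obtain B where B: "B > 0" "!!x. \<bar>u x\<bar> <= B" using test_functions_bounded[OF u] by metis
  have mu: "u : borel_measurable mu" by (rule test_measurable[OF u])
  have "DJ u (grad u) u (grad u) = 0" using DJ_comb[of n xi n xi] crit by (simp add: u_def)
  then have eq: "K E * flux_int (grad u) (grad u) = (LINT x|mu. f x (u x) * u x)" by (simp add: DJ_def E_def)
  have iF: "integrable mu (%x. primitive (f x) (u x))" and iff: "integrable mu (%x. f x (u x) * u x)"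
   using B mu by (auto intro!: primitive_integrable[OF bounded_powr_integrable[of B]] superposition_product_integrable[OF bounded_powr_integrable[of B]])
  have "sig * (LINT x|mu. primitive (f x) (u x)) = (LINT x|mu. sig * primitive (f x) (u x))" by simp
  also have "... <= (LINT x|mu. f x (u x) * u x + c3)"
  proof (rule integral_mono_AE)
   show "AE x in mu. sig * primitive (f x) (u x) <= f x (u x) * u x + c3"
    using AR AE_space
   proof eventually_elim
    case (elim x)
    show ?case
    proof (cases "\<bar>u x\<bar> >= t0")
     case True
     then have "sig * primitive (f x) (u x) <= u x * f x (u x)" using elim(1) by blast
     then show ?thesis using c3 by (simp add: mult.commute)
    next
     case False
     then have ut: "\<bar>u x\<bar> <= t0" by simp
     have "sig * primitive (f x) (u x) <= sig * (2 * C * (1 + t0 powr s))"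
      using primitive_bound[OF elim(2) ut] sigma_pos by (intro mult_left_mono) auto
     moreover have "- (2 * C * (1 + t0 powr s)) <= f x (u x) * u x"
      using f_product_bound[OF elim(2) ut ut] by linarith
     ultimately show ?thesis by (simp add: c3_def algebra_simps)
    qed
   qed
  qed (use iF iff in auto)
  also have "... = K E * flux_int (grad u) (grad u) + c3 * measure mu Om" using iff eq by (simp add: measure_restrict_space)
  also have "... <= K E * (q * E) + c3 * measure mu Om"
   using flux_self_le[OF u] K_nonneg[of E] by (intro add_right_mono mult_left_mono) (auto simp: E_def)
  also have "... <= q * (th * primitive K E) + c3 * measure mu Om"
  proof -
   have "q * (E * K E) <= q * (th * primitive K E)" using K_theta[OF E0] exps by (intro mult_left_mono) auto
   then show ?thesis by (simp add: algebra_simps)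
  qed
  finally have "sig * (LINT x|mu. primitive (f x) (u x)) <= q * (th * primitive K E) + c3 * measure mu Om" .
  moreover have "sig * primitive K E - sig * (LINT x|mu. primitive (f x) (u x)) <= sig * beta"
   using J mult_left_mono[of "Jn n xi" beta sig] sigma_pos by (simp add: J_def u_def E_def right_diff_distrib)
  ultimately have "(sig - q * th) * primitive K E <= sig * beta + c3 * measure mu Om" by (simp add: algebra_simps)
  then have "primitive K E <= (sig * beta + c3 * measure mu Om) / (sig - q * th)" using gap by (simp add: field_simps)
  then have "kap * (E - 1) <= (sig * beta + c3 * measure mu Om) / (sig - q * th)"
   using primitive_K_lower[OF kap E0] by linarith
  moreover have "x <= b / kap" if "kap * x <= b" for x b using that kap(1) by (simp add: field_simps)
  ultimately have "E - 1 <= (sig * beta + c3 * measure mu Om) / (sig - q * th) / kap" by blast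
  then show ?thesis by (simp add: E0_def E_def u_def)
 qed
 then show ?thesis by blast
qed

end

section \<open>Passage to the limit\<close>

context kirchhoff
begin

text \<open>Solution and test function come with different majorants; the sums dominate
  both.\<close>

lemma DJ_tendsto_two_majorants:
 assumes m: "!!n. g n : borel_measurable mu" "h : borel_measurable mu" "!!n. u n : borel_measurable mu" "v : borel_measurable mu"
  "!!n. k n : borel_measurable mu" "l : borel_measurable mu" "!!n. w n : borel_measurable mu" "y : borel_measurable mu"
  and lim: "AE x in mu. (%n. g n x) ----> h x" "AE x in mu. (%n. u n x) ----> v x"
   "AE x in mu. (%n. k n x) ----> l x" "AE x in mu. (%n. w n x) ----> y x"
  and V: "V : borel_measurable mu" "!!x. V x >= (0::real)" "modM mu (%_. 0) s s V < \<infinity>"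
  and V': "V' : borel_measurable mu" "!!x. V' x >= (0::real)" "modM mu (%_. 0) s s V' < \<infinity>"
  and W: "W : borel_measurable mu" "!!x. W x >= (0::real)" "modM mu a p q W < \<infinity>"
  and W': "W' : borel_measurable mu" "!!x. W' x >= (0::real)" "modM mu a p q W' < \<infinity>"
  and dom: "AE x in mu. ALL n. norm (g n x) <= W x" "AE x in mu. ALL n. \<bar>u n x\<bar> <= V x"
   "AE x in mu. ALL n. norm (k n x) <= W' x" "AE x in mu. ALL n. \<bar>w n x\<bar> <= V' x"
 shows "(%n. DJ (u n) (g n) (w n) (k n)) ----> DJ v h y l"
proof (rule DJ_tendsto[where W = "%x. W x + W' x" and V = "%x. V x + V' x"])
 show "(%x. W x + W' x) : borel_measurable mu" using W(1) W'(1) by (rule borel_measurable_add)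
 show "modM mu a p q (%x. W x + W' x) < \<infinity>"
  by (rule modM_finite_dom[OF W(1) W'(1) _ W(3) W'(3)]) (intro AE_I2 norm_triangle_ineq)
 have "modM mu (%_. 0) s s (%x. V x + V' x) < \<infinity>"
  by (rule L.modM_finite_dom[OF V(1) V'(1) _ V(3) V'(3)]) (intro AE_I2 norm_triangle_ineq)
 then show "integrable mu (%x. (V x + V' x) powr s)"
  using Ls_integrable[OF borel_measurable_add[OF V(1) V'(1)]] V(2) V'(2) by simp
 show "AE x in mu. ALL n. norm (g n x) <= W x + W' x" using dom(1) by eventually_elim (metis W'(2) add_increasing2)
 show "AE x in mu. ALL n. \<bar>u n x\<bar> <= V x + V' x" using dom(2) by eventually_elim (metis V'(2) add_increasing2)
 show "AE x in mu. ALL n. norm (k n x) <= W x + W' x" using dom(3) by eventually_elim (metis W(2) add_increasing)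
 show "AE x in mu. ALL n. \<bar>w n x\<bar> <= V x + V' x" using dom(4) by eventually_elim (metis V(2) add_increasing)
 show "W x + W' x >= 0" for x using W(2) W'(2) by simp
qed (use m lim in auto)

lemma energy_int_cong_AE:
 assumes "g : borel_measurable mu" "h : borel_measurable mu" "AE x in mu. g x = (h x :: 'a)"
 shows "energy_int g = energy_int h"
 unfolding energy_int_def
proof (rule integral_cong_AE)
 show "AE x in mu. Eden a p q x (g x) = Eden a p q x (h x)"
  using assms(3) by eventually_elim simp
qed (use assms(1,2) a_measurable in measurable)

lemma flux_int_cong_AE:
 assumes "g : borel_measurable mu" "h : borel_measurable mu" "k : borel_measurable mu" "AE x in mu. g x = (h x :: 'a)"
 shows "flux_int g k = flux_int h k"
 unfolding flux_int_def
proof (rule integral_cong_AE)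
 show "AE x in mu. (Fden a p q x (g x)) * (g x \<bullet> k x) =
   (Fden a p q x (h x)) * (h x \<bullet> k x)"
  using assms(4) by eventually_elim simp
qed (use assms(1-3) a_measurable in measurable)

lemma Ls_modM_lborel:
 assumes "phi : test_functions Om"
 shows "modM mu (%_. 0) s s phi = Lpow s phi"
 unfolding modM_def using test_functions_zero_outside[OF assms] test_functions_borel(1)[OF assms] exps
 by (subst nn_integral_lebesgue_on_borel[OF Om(1)]) auto

lemma primitive_f_integral_zero:
 assumes "AE x in mu. v x = 0" "v : borel_measurable mu"
 shows "(LINT x|mu. primitive (f x) (v x)) = 0"
proof -
 have "(LINT x|mu. primitive (f x) (v x)) = (LINT x|mu. 0)"
 proof (rule integral_cong_AE)
  show "AE x in mu. primitive (f x) (v x) = 0" using assms(1) by eventually_elim simp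
  show "(%x. primitive (f x) (v x)) : borel_measurable mu"
   using assms(2) f_continuous by (intro primitive_superposition_measurable[OF f_measurable]) auto
 qed simp
 then show ?thesis by simp
qed

end

text \<open>The order of the extractions matters: first the values and the energies converge, then
  the limit energy is shown to be positive, and only this makes the gradients converge and the
  equation pass to the limit.\<close>

lemma (in kirchhoff_AR) high_energy_solution:
 assumes Lam: "Lam > 0"
 shows "EX u:W1H0 Om p q a. (ALL phi:W1H0 Om p q a. DJ u (wgrad Om u) phi (wgrad Om phi) = 0) & Lam <= J u (wgrad Om u)"
proof -
 have ps: "p < s" and p0: "p > 0" and s0: "s > 0" using exps by simp_all
 obtain d beta where crit: "!!n. n >= d ==> EX xi:fin_sp n. (ALL i<n. Dn n i xi = 0) & Lam <= Jn n xi & Jn n xi <= beta"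
  using critical_points[OF Lam] by blast
 then have "ALL k. EX xi. xi : fin_sp (d + k) & (ALL i<d + k. Dn (d + k) i xi = 0) & Lam <= Jn (d + k) xi & Jn (d + k) xi <= beta"
  by (meson le_add1)
 then obtain xi where xi: "!!k. xi k : fin_sp (d + k)" "!!k i. i < d + k ==> Dn (d + k) i (xi k) = 0"
   "!!k. Lam <= Jn (d + k) (xi k)" "!!k. Jn (d + k) (xi k) <= beta"
  by metis
 define U where "U k = comb (d + k) (xi k)" for k
 have Ut: "U k : test_functions Om" for k unfolding U_def by (rule comb_test)
 have Ud: "(%x. U m x - U k x) : test_functions Om" "grad (%x. U m x - U k x) = (%x. grad (U m) x - grad (U k) x)" for m k
  using test_functions_lincomb[OF Ut[of m] Ut[of k], of 1 "-1"] by auto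
 have UJ: "Lam <= J (U k) (grad (U k))" for k using xi(3) by (simp add: U_def)
 obtain E0 where "ALL n xi. (ALL i<n. Dn n i xi = 0) --> Jn n xi <= beta --> energy_int (grad (comb n xi)) <= E0"
  using critical_energy_bound by blast
 then have E0: "energy_int (grad (U k)) <= E0" for k using xi by (simp add: U_def)
 have GrE: "Gr p (U k) <= p * energy_int (grad (U k))" for k
  using energy_ge_Gr[OF Ut[of k]] p0 by (simp add: field_simps)
 have Ege: "energy_int (grad (U k)) >= 0" for k
 proof -
  have "p * energy_int (grad (U k)) >= 0" using GrE[of k] Gr_nonneg[of p "U k"] by linarith
  then show ?thesis using p0 by (simp add: zero_le_mult_iff)
 qed
 have GrK: "Gr p (U k) <= p * E0" for k using GrE[of k] E0[of k] p0 mult_left_mono[of _ E0 p] by (meson less_imp_le order_trans)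
 obtain r1 where r1: "strict_mono (r1 :: nat => nat)"
  "!!e. e > 0 ==> EX n0. ALL i>=n0. ALL j>=n0. Lpow s (%x. U (r1 i) x - U (r1 j) x) <= ennreal e"
  by (rule rellich_subsequence[where phi = U, OF exps(1) ps exps(4) Om Ut GrK]) blast
 have "seq_compact {0..E0}" by (simp add: compact_imp_seq_compact)
 moreover have "ALL n. energy_int (grad (U (r1 n))) : {0..E0}" using Ege E0 by simp
 ultimately obtain E r2 where r2: "strict_mono (r2 :: nat => nat)" "((%n. energy_int (grad (U (r1 n)))) \<circ> r2) ----> E" and "E : {0..E0}"
  unfolding seq_compact_def by metis
 have Lc: "EX n0. ALL i>=n0. ALL j>=n0. modM mu (%_. 0) s s (%x. U (r1 (r2 i)) x - U (r1 (r2 j)) x) <= ennreal eta" if eta: "eta > 0" for eta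
 proof -
  obtain n0 where "!!i j. i >= n0 ==> j >= n0 ==> (Lpow s (%x. U (r1 i) x - U (r1 j) x)) <= ennreal eta"
   using r1(2)[OF eta] by blast
  then have "modM mu (%_. 0) s s (%x. U (r1 (r2 i)) x - U (r1 (r2 j)) x) <= ennreal eta" if "i >= n0" "j >= n0" for i j
   using that seq_suble[OF r2(1), of i] seq_suble[OF r2(1), of j] unfolding Ls_modM_lborel[OF Ud(1)] by (meson order_trans)
  then show ?thesis by blast
 qed
 obtain r3 v V where r3: "strict_mono (r3 :: nat => nat)" "v : borel_measurable mu" "V : borel_measurable mu"
  "!!x. V x >= (0::real)" "modM mu (%_. 0) s s V < \<infinity>" "AE x in mu. (%n. U (r1 (r2 (r3 n))) x) ----> v x"
  "AE x in mu. ALL n. norm (U (r1 (r2 (r3 n))) x) <= V x"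
  by (rule L.modM_subsequence[of "%n. U (r1 (r2 n))", OF test_measurable(1)[OF Ut] Ls_modM_test[OF Ut] Lc]) auto
 define R where "R n = r1 (r2 (r3 n))" for n
 have R: "strict_mono R" unfolding R_def[abs_def] using r1(1) r2(1) r3(1) by (simp add: strict_mono_def)
 have RE: "(%n. energy_int (grad (U (R n)))) ----> E"
  using LIMSEQ_subseq_LIMSEQ[OF r2(2) r3(1)] by (simp add: o_def R_def)
 have lim: "AE x in mu. (%n. U (R n) x) ----> v x" and dom: "AE x in mu. ALL n. \<bar>U (R n) x\<bar> <= V x"
  using r3(6,7) by (simp_all add: R_def)
 have iV: "integrable mu (%x. V x powr s)" using Ls_integrable[OF r3(3,5)] r3(4) by simp
 \<comment> \<open>A vanishing limit energy would send \<open>Gr p\<close> and, by the Sobolev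
   inequality, the values to zero; then J would tend to zero, against the lower bound
   \<open>Lam\<close> > 0.\<close>
 have E_pos: "E > 0"
 proof (rule ccontr)
  assume "~ E > 0"
  then have "E = 0" using \<open>E : {0..E0}\<close> by simp
  then have "(%n. energy_int (grad (U (R n)))) ----> 0" using RE by simp
  then have pE: "(%n. p * energy_int (grad (U (R n)))) ----> 0" by (rule tendsto_mult_right_zero)
  have G0: "(%n. Gr p (U (R n))) ----> 0"
   by (rule tendsto_sandwich[OF _ _ tendsto_const pE]) (intro always_eventually allI Gr_nonneg GrE)+
  obtain S where S: "S >= 0" "!!phi. phi : test_functions Om ==> (Lpow s phi) <= ennreal (S * Gr p phi powr (s / p))"
   by (rule sobolev_subcritical[OF exps(1) ps exps(4) Om]) blast
  have "(%n. Gr p (U (R n)) powr (s / p)) ----> 0 powr (s / p)"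
   using G0 s0 p0 by (intro tendsto_powr') (auto intro!: always_eventually Gr_nonneg)
  then have SG: "(%n. S * Gr p (U (R n)) powr (s / p)) ----> 0" using tendsto_mult_right_zero by fastforce
  have eG: "(%n. ennreal (S * Gr p (U (R n)) powr (s / p))) ----> 0" using tendsto_ennrealI[OF SG] by simp
  have "modM mu (%_. 0) s s (%x. U (R n) x - 0) <= ennreal (S * Gr p (U (R n)) powr (s / p))" for n
   using S(2)[OF Ut[of "R n"]] unfolding Ls_modM_lborel[OF Ut, symmetric] by simp
  then have M0: "(%n. modM mu (%_. 0) s s (%x. U (R n) x - 0)) ----> 0"
   by (intro tendsto_sandwich[OF _ _ tendsto_const eG] always_eventually allI) auto
  have "(%n. modM mu (%_. 0) s s (%x. U (R n) x - v x)) ----> 0"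
   by (rule L.modM_tendsto_zero[OF test_measurable(1)[OF Ut] r3(2,3,4,5) lim]) (use dom in auto)
  then have "AE x in mu. v x = 0"
   by (rule L.modM_tendsto_zero_unique[OF test_measurable(1)[OF Ut] r3(2) borel_measurable_const _ M0])
  then have z: "(LINT x|mu. primitive (f x) (v x)) = 0" using r3(2) by (rule primitive_f_integral_zero)
  have "(%n. J (U (R n)) (grad (U (R n)))) ----> primitive K E - (LINT x|mu. primitive (f x) (v x))"
   unfolding J_def
   by (intro tendsto_diff isCont_tendsto_compose[OF DERIV_isCont[OF DERIV_primitive[OF K_cont]] RE]
     primitive_tendsto[OF iV test_measurable(1)[OF Ut] r3(2) lim dom])
  then have "Lam <= primitive K E - (LINT x|mu. primitive (f x) (v x))" using UJ by (intro LIMSEQ_le_const) auto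
  then show False using z \<open>E = 0\<close> Lam by simp
 qed
 \<comment> \<open>For k <= m both functions are combinations of the first d + m basis functions,
   and U m is critical on their span.\<close>
 have critU: "DJ (U m) (grad (U m)) (%x. U m x - U k x) (%x. grad (U m) x - grad (U k) x) = 0" if km: "k <= m" for k m
 proof -
  have k: "U k = comb (d + m) (xi k)" unfolding U_def using comb_mono[OF xi(1)[of k], of "d + m"] km by simp
  have "(%x. U m x - U k x) = comb (d + m) (%i. xi m i - xi k i)"
   unfolding k unfolding U_def by (simp add: fun_eq_iff comb_def left_diff_distrib sum_subtractf)
  then have "DJ (U m) (grad (U m)) (%x. U m x - U k x) (grad (%x. U m x - U k x)) =
    (\<Sum>i<d + m. (xi m i - xi k i) * DJ (U m) (grad (U m)) (e i) (grad (e i)))"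
   using DJ_comb[of "d + m" "xi m" "d + m" "%i. xi m i - xi k i"] by (simp add: U_def)
  also have "... = 0" using xi(2)[of _ m] by (intro sum.neutral) (simp add: U_def)
  finally show ?thesis by (simp add: Ud(2))
 qed
 have gc: "EX n0. ALL i>=n0. ALL j>=n0. modM mu a p q (%x. grad (U (R i)) x - grad (U (R j)) x) <= ennreal eta" if "eta > 0" for eta
  by (rule gradient_Cauchy[OF Ut r3(2) lim r3(3,4,5) dom RE E_pos critU that])
   (use R in \<open>auto simp: strict_mono_less_eq\<close>)
 obtain r4 g W where r4: "strict_mono (r4 :: nat => nat)" "g : borel_measurable mu" "W : borel_measurable mu"
  "!!x. W x >= (0::real)" "modM mu a p q W < \<infinity>" "AE x in mu. (%n. grad (U (R (r4 n))) x) ----> g x"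
  "AE x in mu. ALL n. norm (grad (U (R (r4 n))) x) <= W x"
  by (rule modM_subsequence[of "%n. grad (U (R n))", OF test_measurable(2)[OF Ut] modM_test(2)[OF Ut] gc]) auto
 define z where "z n = U (R (r4 n))" for n
 have zt: "z n : test_functions Om" for n unfolding z_def by (rule Ut)
 have zl: "AE x in mu. (%n. z n x) ----> v x"
  using lim
 proof eventually_elim
  case (elim x)
  show ?case using LIMSEQ_subseq_LIMSEQ[OF elim r4(1)] by (simp add: o_def z_def)
 qed
 have zd: "AE x in mu. ALL n. \<bar>z n x\<bar> <= V x" using dom by eventually_elim (simp add: z_def)
 have gl: "AE x in mu. (%n. grad (z n) x) ----> g x" and gd: "AE x in mu. ALL n. norm (grad (z n) x) <= W x"
  using r4(6,7) by (simp_all add: z_def)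
 note mz = test_measurable[OF zt] and me = test_measurable[OF e_test]
 have vW: "v : W1H0 Om p q a" and ae: "AE x in mu. wgrad Om v x = g x"
  using W1H0_limit[OF zt r3(2) r4(2) zl gl r3(3,4) modM_of_Ls[OF r3(3,5)] zd r4(3,4,5) gd] by blast+
 \<comment> \<open>The convergence lemma for \<open>DJ\<close> is later applied to constant
   sequences, hence the vacuous quantifier over n.\<close>
 have vV: "AE x in mu. ALL n::nat. \<bar>v x\<bar> <= V x" using AE_norm_limit_le[OF zl] zd by simp
 have gW: "AE x in mu. ALL n::nat. norm (g x) <= W x" using AE_norm_limit_le[OF gl gd] by simp
 \<comment> \<open>Each e i belongs to the span as soon as n > i, so the derivatives along the
   sequence are eventually zero.\<close>
 have De: "DJ v g (e i) (grad (e i)) = 0" for i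
 proof -
  have mV: "(%x. \<bar>e i x\<bar>) : borel_measurable mu" "(%x. norm (grad (e i) x)) : borel_measurable mu"
   using measurable_compose[OF me(1) borel_measurable_norm] measurable_compose[OF me(2) borel_measurable_norm] by simp_all
  have fV: "modM mu (%_. 0) s s (%x. \<bar>e i x\<bar>) < \<infinity>" "modM mu a p q (%x. norm (grad (e i) x)) < \<infinity>"
   using Ls_modM_test[OF e_test[of i]] modM_test(2)[OF e_test[of i]] by (simp_all add: modM_def)
  have "(%n. DJ (z n) (grad (z n)) (e i) (grad (e i))) ----> DJ v g (e i) (grad (e i))"
   by (rule DJ_tendsto_two_majorants[OF mz(2) r4(2) mz(1) r3(2) me(2) me(2) me(1) me(1) gl zl _ _ r3(3,4,5) mV(1) _ fV(1) r4(3,4,5) mV(2) _ fV(2) gd zd]) auto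
  moreover have "DJ (z n) (grad (z n)) (e i) (grad (e i)) = 0" if "n >= Suc i" for n
  proof -
   have "n <= R (r4 n)" using seq_suble[OF R, of "r4 n"] seq_suble[OF r4(1), of n] by linarith
   then show ?thesis using xi(2)[of i "R (r4 n)"] that unfolding z_def U_def by simp
  qed
  then have "(%n. DJ (z n) (grad (z n)) (e i) (grad (e i))) ----> 0"
   by (intro tendsto_eventually) (auto simp only: eventually_sequentially)
  ultimately show ?thesis by (rule LIMSEQ_unique)
 qed
 have Dphi: "DJ v g phi (wgrad Om phi) = 0" and mphi: "wgrad Om phi : borel_measurable mu" if phi: "phi : W1H0 Om p q a" for phi
 proof -
  obtain j V' W' where j: "V' : borel_measurable mu" "!!x. V' x >= (0::real)" "modM mu (%_. 0) s s V' < \<infinity>"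
   "W' : borel_measurable mu" "!!x. W' x >= (0::real)" "modM mu a p q W' < \<infinity>"
   "AE x in mu. (%n. e (j n) x) ----> phi x" "AE x in mu. (%n. grad (e (j n)) x) ----> wgrad Om phi x"
   "AE x in mu. ALL n. \<bar>e (j n) x\<bar> <= V' x" "AE x in mu. ALL n. norm (grad (e (j n)) x) <= W' x"
   "phi : borel_measurable mu" "wgrad Om phi : borel_measurable mu"
   by (rule W1H0_approx[OF phi]) blast
  have "(%n. DJ v g (e (j n)) (grad (e (j n)))) ----> DJ v g phi (wgrad Om phi)"
   by (rule DJ_tendsto_two_majorants[OF r4(2) r4(2) r3(2) r3(2) me(2) j(12) me(1) j(11) _ _ j(8,7) r3(3,4,5) j(1,2,3) r4(3,4,5) j(4,5,6) gW vV j(10,9)]) auto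
  then show "DJ v g phi (wgrad Om phi) = 0" using De by (simp add: LIMSEQ_const_iff)
  show "wgrad Om phi : borel_measurable mu" by (rule j(12))
 qed
 have mv: "wgrad Om v : borel_measurable mu" by (rule mphi[OF vW])
 have Eeq: "energy_int (wgrad Om v) = energy_int g" by (rule energy_int_cong_AE[OF mv r4(2) ae])
 have "DJ v (wgrad Om v) phi (wgrad Om phi) = 0" if phi: "phi : W1H0 Om p q a" for phi
  using Dphi[OF phi] flux_int_cong_AE[OF mv r4(2) mphi[OF phi] ae] by (simp add: DJ_def Eeq)
 moreover have "Lam <= J v (wgrad Om v)"
 proof -
  have "(%n. J (z n) (grad (z n))) ----> J v g"
   by (rule J_tendsto[OF mz(2) r4(2) mz(1) r3(2) gl zl r4(3,4,5) iV gd zd])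
  then have "Lam <= J v g" using UJ by (intro LIMSEQ_le_const) (auto simp: z_def)
  then show ?thesis by (simp add: J_def Eeq)
 qed
 ultimately show ?thesis using vW by blast
qed

section \<open>Return to the original data\<close>

lemma (in kirchhoff) W1H0_measurable:
 assumes "u : W1H0 Om p q a"
 shows "u : borel_measurable mu" "weak_gradient_on Om u (wgrad Om u)" "wgrad Om u : borel_measurable mu"
proof -
 have u: "u : W1H Om p q a" using assms by (simp add: W1H0_def)
 then show "u : borel_measurable mu" by (simp add: W1H_def LH_def)
 show wg: "weak_gradient_on Om u (wgrad Om u)" using u wgrad_AE_eq(1)[OF Om(1)] by (auto simp: W1H_def)
 then show "wgrad Om u : borel_measurable mu" by (rule weak_gradient_measurable)
qed

text \<open>Used contrapositively: solutions of different energy cannot agree almost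
  everywhere.\<close>

lemma (in kirchhoff) J_cong_AE:
 assumes u: "u : W1H0 Om p q a" and v: "v : W1H0 Om p q a" and ae: "AE x in mu. u x = v x"
 shows "J u (wgrad Om u) = J v (wgrad Om v)"
proof -
 have "AE x in mu. wgrad Om u x = wgrad Om v x"
  by (rule weak_gradient_unique[OF Om(1) W1H0_measurable(2)[OF u] W1H0_measurable(2)[OF v] ae])
 then have "energy_int (wgrad Om u) = energy_int (wgrad Om v)"
  by (rule energy_int_cong_AE[OF W1H0_measurable(3)[OF u] W1H0_measurable(3)[OF v]])
 moreover have "(LINT x|mu. primitive (f x) (u x)) = (LINT x|mu. primitive (f x) (v x))"
 proof (rule integral_cong_AE)
  show "(%x. primitive (f x) (u x)) : borel_measurable mu" "(%x. primitive (f x) (v x)) : borel_measurable mu"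
   using W1H0_measurable(1)[OF u] W1H0_measurable(1)[OF v] f_continuous
   by (auto intro!: primitive_superposition_measurable[OF f_measurable])
  show "AE x in mu. primitive (f x) (u x) = primitive (f x) (v x)" using ae by eventually_elim simp
 qed
 ultimately show ?thesis by (simp add: J_def)
qed

context kirchhoff
begin

context
 fixes M :: "real => real" and f0 :: "'a => real => real"
 assumes M: "!!t. t >= 0 ==> K t = M t" and f0: "AE x in mu. f x = f0 x"
begin

lemma phi_H_energy_int: "phi_H Om p q a u = energy_int (wgrad Om u)" "phi_H Om p q a u >= 0"
proof -
 show eq: "phi_H Om p q a u = energy_int (wgrad Om u)" by (simp add: phi_H_def energy_int_def)
 show "phi_H Om p q a u >= 0"
  unfolding phi_H_def using a_bounds exps by (intro Bochner_Integration.integral_nonneg) auto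
qed

text \<open>K and M agree for nonnegative arguments, where \<open>phi_H\<close> takes its values,
  and f and f0 differ only on a null set.\<close>

lemma energy_eq_J:
 assumes u: "u : W1H0 Om p q a"
 shows "energy Om p q a M f0 u = J u (wgrad Om u)"
proof -
 have m: "(%x. primitive (f x) (u x)) : borel_measurable mu"
  using W1H0_measurable(1)[OF u] f_continuous by (auto intro!: primitive_superposition_measurable[OF f_measurable])
 have ae: "AE x in mu. primitive (f x) (u x) = primitive (f0 x) (u x)" using f0 by eventually_elim simp
 have "(LINT x|mu. primitive (f x) (u x)) = (LINT x|mu. primitive (f0 x) (u x))"
  by (rule integral_cong_AE[OF m borel_measurable_lebesgue_on_AE[OF Om_sets m ae] ae])
 moreover have "primitive M (phi_H Om p q a u) = primitive K (phi_H Om p q a u)"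
  by (rule primitive_cong[OF phi_H_energy_int(2)]) (simp add: M)
 ultimately show ?thesis by (simp add: energy_def J_def phi_H_energy_int(1))
qed

lemma weak_solution_if_DJ_zero:
 assumes u: "u : W1H0 Om p q a" and z: "!!phi. phi : W1H0 Om p q a ==> DJ u (wgrad Om u) phi (wgrad Om phi) = 0"
 shows "weak_solution Om p q a M f0 u"
 unfolding weak_solution_def
proof (intro conjI ballI u)
 fix phi assume phi: "phi : W1H0 Om p q a"
 have "(%x. f x (u x)) : borel_measurable mu"
  using W1H0_measurable(1)[OF u] f_continuous by (auto intro!: superposition_measurable[OF f_measurable])
 then have m: "(%x. f x (u x) * phi x) : borel_measurable mu" using W1H0_measurable(1)[OF phi] by (rule borel_measurable_times)
 have ae: "AE x in mu. f x (u x) * phi x = f0 x (u x) * phi x" using f0 by eventually_elim simp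
 have "(LINT x|mu. f x (u x) * phi x) = (LINT x|mu. f0 x (u x) * phi x)"
  by (rule integral_cong_AE[OF m borel_measurable_lebesgue_on_AE[OF Om_sets m ae] ae])
 then show "M (phi_H Om p q a u) *
   (LINT x|lebesgue_on Om. (Fden a p q x (wgrad Om u x)) * (wgrad Om u x \<bullet> wgrad Om phi x))
   = (LINT x|lebesgue_on Om. f0 x (u x) * phi x)"
  using z[OF phi] M[OF phi_H_energy_int(2)[of u]] by (simp add: DJ_def flux_int_def phi_H_energy_int(1))
qed

end

end

text \<open>Each element is chosen at least one above the value of its predecessor, which gives
  distinctness and unboundedness together.\<close>

lemma unbounded_values_sequence:
 fixes E :: "'b => real"
 assumes "!!L. EX x. P x & E x >= L"
 shows "EX x :: nat => 'b. (ALL n. P (x n)) & (ALL i j. i ~= j --> E (x i) ~= E (x j)) & ~ bounded (range (%n. E (x n)))"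
proof -
 obtain w where w: "!!L. P (w L)" "!!L. E (w L) >= L" using assms by metis
 define x where "x = rec_nat (w 0) (%_ y. w (E y + 1))"
 have P: "P (x n)" for n by (cases n) (auto simp: x_def w(1))
 have step: "E (x (Suc n)) >= E (x n) + 1" for n using w(2) by (simp add: x_def)
 then have "strict_mono (%n. E (x n))" by (intro strict_monoI_Suc) (metis add_le_imp_le_diff add_le_same_cancel1 less_le_not_le not_le not_one_le_zero order_trans zero_less_one)
 then have inj: "E (x i) ~= E (x j)" if "i ~= j" for i j using that by (auto dest: strict_mono_eq)
 have lower: "E (x n) >= E (x 0) + real n" for n
 proof (induction n)
  case (Suc n)
  then show ?case using step[of n] by simp
 qed simp
 have "~ bounded (range (%n. E (x n)))"
 proof
  assume "bounded (range (%n. E (x n)))"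
  then obtain B where B: "!!n. \<bar>E (x n)\<bar> <= B" by (auto simp: bounded_iff)
  obtain n :: nat where "real n > B - E (x 0)" using reals_Archimedean2 by blast
  then show False using lower[of n] B[of n] by linarith
 qed
 then show ?thesis using P inj by blast
qed

theorem theorem1p2:
  fixes \<Omega> :: "'a::euclidean_space set"
    and p q \<theta> r C \<sigma> c t0 :: real
    and a :: "'a \<Rightarrow> real"
    and M :: "real \<Rightarrow> real"
    and f :: "'a \<Rightarrow> real \<Rightarrow> real"
  assumes dim: "DIM('a) \<ge> 2"
    and Omega: "open \<Omega>" "bounded \<Omega>" "\<Omega> \<noteq> {}" "lipschitz_boundary \<Omega>"
    and exponents: "1 < p" "p < q" "q < real DIM('a)" "q / p < 1 + 1 / real DIM('a)"
    and a_lipschitz: "\<exists>L. L-lipschitz_on (closure \<Omega>) a"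
    and a_nonneg: "\<And>x. x \<in> closure \<Omega> \<Longrightarrow> a x \<ge> 0"
    and M_cont: "continuous_on {0..} M"
    and M_nonneg: "\<And>t. t \<ge> 0 \<Longrightarrow> M t \<ge> 0"
    and theta: "1 \<le> \<theta>" "\<theta> < sobolev_conjugate (real DIM('a)) p / q"
    and M_theta: "\<And>t. t \<ge> 0 \<Longrightarrow> t * M t \<le> \<theta> * primitive M t"
    and M_kappa: "\<And>\<tau>. \<tau> > 0 \<Longrightarrow> \<exists>\<kappa>>0. \<forall>t\<ge>\<tau>. M t \<ge> \<kappa>"
    and f_caratheodory: "caratheodory \<Omega> f"
    and r: "p < r" "r < sobolev_conjugate (real DIM('a)) p"
    and C: "C > 0"
    and f_growth: "AE x in lebesgue_on \<Omega>. \<forall>t. \<bar>f x t\<bar> \<le> C * (1 + \<bar>t\<bar> powr (r - 1))"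
    and sigma: "q * \<theta> < \<sigma>" "\<sigma> < sobolev_conjugate (real DIM('a)) p"
    and c: "c > 0"
    and t0: "t0 \<ge> 0"
    and f_AR: "AE x in lebesgue_on \<Omega>. \<forall>t. \<bar>t\<bar> \<ge> t0 \<longrightarrow>
        c \<le> \<sigma> * primitive (f x) t \<and> \<sigma> * primitive (f x) t \<le> t * f x t"
    and f_odd: "AE x in lebesgue_on \<Omega>. \<forall>t. f x (- t) = - f x t"
  shows "\<exists>u :: nat \<Rightarrow> 'a \<Rightarrow> real.
      (\<forall>j. weak_solution \<Omega> p q a M f (u j)) \<and>
      (\<forall>i j. i \<noteq> j \<longrightarrow> \<not> (AE x in lebesgue_on \<Omega>. u i x = u j x)) \<and>
      \<not> bounded (range (\<lambda>j. energy \<Omega> p q a M f (u j)))"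
proof -
 have N: "real DIM('a) > p" and p0: "p > 0" and q1: "q > 1" using exponents by linarith+
 have a_cont: "continuous_on (closure \<Omega>) a" using a_lipschitz lipschitz_on_continuous_on by blast
 have "compact (closure \<Omega>)" using Omega(2) by simp
 then have "bounded (a ` closure \<Omega>)" by (intro compact_imp_bounded compact_continuous_image a_cont)
 then obtain A where A: "A > 0" "!!x. x : closure \<Omega> ==> \<bar>a x\<bar> <= A" unfolding bounded_pos by auto
 have a_bounds: "0 <= a x & a x <= A" if "x : \<Omega>" for x
  using that a_nonneg[of x] A(2)[of x] closure_subset[of \<Omega>] by auto
 have a_meas: "a : borel_measurable (lebesgue_on \<Omega>)"
  using continuous_on_subset[OF a_cont closure_subset] Omega(1) by (intro continuous_imp_measurable_on_sets_lebesgue) auto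
 \<comment> \<open>One exponent above q and r. It is subcritical because r is and because q <= q *
   \<theta> < \<sigma>.\<close>
 define s where "s = max q r"
 have "q * 1 <= q * \<theta>" using theta(1) q1 by (intro mult_left_mono) auto
 then have "q < sobolev_conjugate (real DIM('a)) p" using sigma by linarith
 then have "s < sobolev_conjugate (real DIM('a)) p" using r(2) by (simp add: s_def)
 then have s_sub: "s * (DIM('a) - p) < DIM('a) * p" using N by (simp add: sobolev_conjugate_def field_simps)
 \<comment> \<open>Passing from r to the possibly larger s costs a factor 2, needed where |t| <=
   1.\<close>
 have growth: "C * (1 + \<bar>t\<bar> powr (r - 1)) <= 2 * C * (1 + \<bar>t\<bar> powr (s - 1))" for t :: real
 proof -
  have "\<bar>t\<bar> powr (r - 1) <= 1 + \<bar>t\<bar> powr (s - 1)"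
  proof (cases "\<bar>t\<bar> <= 1")
   case True
   then have "\<bar>t\<bar> powr (r - 1) <= 1" using r(1) exponents(1) by (intro powr_le1) auto
   then show ?thesis using powr_ge_zero[of "\<bar>t\<bar>" "s - 1"] by linarith
  next
   case False
   then have "\<bar>t\<bar> powr (r - 1) <= \<bar>t\<bar> powr (s - 1)" by (intro powr_mono) (auto simp: s_def)
   then show ?thesis by simp
  qed
  then have "1 + \<bar>t\<bar> powr (r - 1) <= 2 * (1 + \<bar>t\<bar> powr (s - 1))"
   using powr_ge_zero[of "\<bar>t\<bar>" "s - 1"] by argo
  from mult_left_mono[OF this, of C] C show ?thesis by simp
 qed
 \<comment> \<open>The even extension is continuous and nonnegative on the whole line, so that its
   primitive is differentiable everywhere, zero included.\<close>
 define K where "K t = M \<bar>t\<bar>" for t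
 have K_cont: "continuous_on UNIV K"
  unfolding K_def by (rule continuous_on_compose2[OF M_cont]) (auto intro!: continuous_intros)
 have KM: "K t = M t" if "t >= 0" for t using that by (simp add: K_def)
 have pKM: "primitive K t = primitive M t" if "t >= 0" for t by (rule primitive_cong[OF that]) (simp add: KM)
 have car: "!!t. (%x. f x t) : borel_measurable (lebesgue_on \<Omega>)" "AE x in lebesgue_on \<Omega>. continuous_on UNIV (f x)"
  using f_caratheodory by (simp_all add: caratheodory_def)
 have "AE x in lebesgue_on \<Omega>. continuous_on UNIV (f x) & (ALL t. \<bar>f x t\<bar> <= C * (1 + \<bar>t\<bar> powr (r - 1))) & (ALL t. f x (- t) = - f x t)"
  using car(2) f_growth f_odd by eventually_elim blast
 then obtain Z where Z: "{x : space (lebesgue_on \<Omega>). ~ (continuous_on UNIV (f x) &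
   (ALL t. \<bar>f x t\<bar> <= C * (1 + \<bar>t\<bar> powr (r - 1))) & (ALL t. f x (- t) = - f x t))} \<subseteq> Z"
   "emeasure (lebesgue_on \<Omega>) Z = 0" "Z : sets (lebesgue_on \<Omega>)" by (rule AE_E)
 \<comment> \<open>Zero is continuous, odd and within the growth bound, so the modified function
   satisfies these conditions at every point. The Ambrosetti-Rabinowitz condition fails for zero on
   \<open>Z\<close>, but it is only assumed almost everywhere in the locale.\<close>
 define f' where "f' x t = (if x : Z then 0 else f x t)" for x t
 have good: "continuous_on UNIV (f x)" "\<bar>f x t\<bar> <= C * (1 + \<bar>t\<bar> powr (r - 1))" "f x (- t) = - f x t"
  if "x : \<Omega>" "x \<notin> Z" for x t using Z(1) that by auto
 have "AE x in lebesgue_on \<Omega>. x \<notin> Z" using Z(2,3) by (intro AE_not_in) auto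
 then have ff': "AE x in lebesgue_on \<Omega>. f' x = f x" by eventually_elim (auto simp: f'_def)
 obtain e :: "nat => 'a => real" where e: "!!n. e n : test_functions \<Omega>"
  "!!\<phi> \<delta>. \<phi> : test_functions \<Omega> ==> \<delta> > 0 ==>
   EX n. (ALL x. \<bar>e n x - \<phi> x\<bar> < \<delta>) & (ALL x. norm (grad (e n) x - grad \<phi> x) < \<delta>)"
  "!!n \<xi> i. (!!x. (\<Sum>i<n. \<xi> i * e i x) = 0) ==> i < n ==> \<xi> i = 0"
  using Omega(1-3) by (rule independent_dense_test_functions) blast
 interpret kirchhoff_AR \<Omega> p q s A "2 * C" a K f' e \<theta> \<sigma> c t0
 proof unfold_locales
  show "(%x. f' x t) : borel_measurable (lebesgue_on \<Omega>)" for t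
   unfolding f'_def using car(1) Z(3) by (intro measurable_If_set borel_measurable_const) auto
  show "continuous_on UNIV (f' x)" if "x : \<Omega>" for x
   using good(1)[OF that] by (cases "x : Z") (auto simp: f'_def[abs_def])
  show "\<bar>f' x t\<bar> <= 2 * C * (1 + \<bar>t\<bar> powr (s - 1))" if "x : \<Omega>" for x t
  proof (cases "x : Z")
   case True
   then show ?thesis using C by (simp add: f'_def)
  next
   case False
   then show ?thesis using good(2)[OF that False, of t] growth[of t] by (simp add: f'_def)
  qed
  show "f' x (- t) = - f' x t" if "x : \<Omega>" for x t using good(3)[OF that] by (simp add: f'_def)
  show "t * K t <= \<theta> * primitive K t" if "t >= 0" for t using M_theta[OF that] KM[OF that] pKM[OF that] by simp
  show "EX \<kappa>>0. ALL t>=\<tau>. \<kappa> <= K t" if "\<tau> > 0" for \<tau> using M_kappa[OF that] that KM by (metis less_le_trans less_imp_le)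
  show "AE x in lebesgue_on \<Omega>. ALL t. t0 <= \<bar>t\<bar> --> c <= \<sigma> * primitive (f' x) t & \<sigma> * primitive (f' x) t <= t * f' x t"
   using f_AR ff' by eventually_elim simp
  show "\<xi> i = 0" if "!!x. (\<Sum>i<n. \<xi> i * e i x) = 0" "i < n" for n \<xi> i using e(3)[OF that] .
 qed (use exponents Omega a_meas a_bounds A(1) K_cont M_nonneg C theta(1) sigma(1) c t0 e(1,2) s_sub in \<open>auto simp: s_def K_def\<close>)
 have "EX u. (weak_solution \<Omega> p q a M f u & u : W1H0 \<Omega> p q a) & energy \<Omega> p q a M f u >= L" for L
 proof -
  \<comment> \<open>The existence result asks for a positive level, which excludes the limit energy
    zero.\<close>
  have "max L 1 > 0" by simp
  then obtain u where u: "u : W1H0 \<Omega> p q a" "!!\<phi>. \<phi> : W1H0 \<Omega> p q a ==> DJ u (wgrad \<Omega> u) \<phi> (wgrad \<Omega> \<phi>) = 0"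
   "max L 1 <= J u (wgrad \<Omega> u)" using high_energy_solution by blast
  have "weak_solution \<Omega> p q a M f u" by (rule weak_solution_if_DJ_zero[OF KM ff' u(1,2)])
  moreover have "energy \<Omega> p q a M f u >= L" using energy_eq_J[OF KM ff' u(1)] u(3) by simp
  ultimately show ?thesis using u(1) by blast
 qed
 then obtain u :: "nat => 'a => real" where u: "!!n. weak_solution \<Omega> p q a M f (u n)" "!!n. u n : W1H0 \<Omega> p q a"
  "!!i j. i ~= j ==> energy \<Omega> p q a M f (u i) ~= energy \<Omega> p q a M f (u j)"
  "~ bounded (range (%n. energy \<Omega> p q a M f (u n)))"
  using unbounded_values_sequence[of "%u. weak_solution \<Omega> p q a M f u & u : W1H0 \<Omega> p q a" "energy \<Omega> p q a M f"] by blast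
 have "~ (AE x in lebesgue_on \<Omega>. u i x = u j x)" if "i ~= j" for i j
  using u(3)[OF that] J_cong_AE[OF u(2) u(2), of i j] energy_eq_J[OF KM ff' u(2)] by auto
 then show ?thesis using u(1,4) by blast
qed

end
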